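(* Let $\mathbb{G}$ be a Carnot group of dimension $n$ and homogeneous dimension $Q$, let $d$ be a left-invariant distance on $\mathbb{G}$ associated with a homogeneous norm, let $1\le p<Q$ and $\lambda>1$, and set $B:=B_d(e,1)$, $B':=B_d(e,\lambda)$. Let $q$ satisfy (i) $1\le q\le \frac{pQ}{Q-p}$ if $p>1$, or (ii) $1\le q<\frac{Q}{Q-1}$ if $p=1$. Then there exists a constant $C=C(p,q,\lambda,B)$ such that for every $\omega\in L^p(B,E_0^n)$ compactly supported in $B$ with $\int_B\omega=0$ there exists a differential form $\phi\in L^q(B',E_0^{n-1})$, compactly supported in $B'$, such that $$d_c\phi=\omega\quad\text{in }B\qquad\text{and}\qquad \|\phi\|_{L^q(B',E_0^{n-1})}\le C\,\|\omega\|_{L^p(B,E_0^n)} .$$ Moreover, if $p>1$ and $q=\frac{pQ}{Q-p}$, the constant $C$ does not depend on the ball: one and the same $C$ (depending on $p$, $\lambda$, $\mathbb{G}$, $d$) works when $B,B'$ are replaced by $B_d(x,r),B_d(x,\lambda r)$ for any $x\in\mathbb{G}$, $r>0$.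
   Context: A Carnot group $\mathbb{G}$ of step $\kappa$ is a connected, simply connected Lie group whose Lie algebra $\mathfrak{g}$, of dimension $n$, has a stratification $\mathfrak{g}=V_1\oplus\dots\oplus V_\kappa$ with $[V_1,V_i]=V_{i+1}$, $V_\kappa\ne\{0\}$, $V_i=\{0\}$ for $i>\kappa$. Its homogeneous dimension is $Q=\sum_i i\dim V_i$. Fix a basis of $\mathfrak{g}$ adapted to the stratification, with left-invariant vector fields $X_1,\dots,X_n$ (the first $m_1=\dim V_1$ span $V_1$), made orthonormal, and dual left-invariant 1-forms $\theta_1,\dots,\theta_n$; $dV=\theta_1\wedge\dots\wedge\theta_n$. $\mathbb{G}$ is identified with $\mathfrak{g}\cong\mathbb{R}^n$ via exponential coordinates; $e=0$ is the identity. The dilations $\delta_\lambda$ act on $V_i$ as multiplication by $\lambda^i$. A homogeneous norm is a continuous $\|\cdot\|:\mathbb{G}\to[0,\infty)$ with $\|p\|=0\iff p=e$, $\|p^{-1}\|=\|p\|$, $\|\delta_\lambda p\|=\lambda\|p\|$, $\|p\cdot q\|\le\|p\|+\|q\|$; the associated distance is $d(p,q)=\|p^{-1}q\|$, and $B_d(p,r)$ is the open $d$-ball. Rumin complex. $\Omega^h$ is the space of smooth $h$-forms on $\mathbb{G}$, with the pointwise inner product making the forms $\theta_{i_1}\wedge\dots\wedge\theta_{i_h}$, $i_1<\dots<i_h$, orthonormal. The weight of $\theta_j$ is $k$ if $X_j\in V_k$, and the weight of $\theta_{i_1}\wedge\dots\wedge\theta_{i_h}$ is the sum of the weights of its factors.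 Let $d$ (on forms) be the exterior differential. The algebraic operator $d_0:\Omega^h\to\Omega^{h+1}$ is its weight-preserving part: $d_0(\sum_I\alpha_I\theta_I)=\sum_I\alpha_I\,d\theta_I$, where $\theta_I$ are the left-invariant basis forms. $d_0^*$ is its pointwise (algebraic) adjoint, and $d_0^{-1}:\Omega^{h+1}\to\Omega^h$ is defined by letting $d_0^{-1}\beta$ be the unique $\alpha\in\Omega^h\cap(\ker d_0)^\perp$ with $d_0^*d_0\alpha=d_0^*\beta$. Set $E_0^h=\ker d_0\cap\ker d_0^*=\ker d_0\cap(\mathrm{Im}\,d_0)^\perp\subset\Omega^h$, regarded also as (smooth sections of) a left-invariant bundle. Set $E=\ker d_0^{-1}\cap\ker(d_0^{-1}d)$ and $F=\mathrm{Range}(d_0^{-1})+\mathrm{Range}(d\,d_0^{-1})$. It is known (Rumin) that $\Omega^*=E\oplus F$; let $\Pi_E$ be the projection on $E$ along $F$ (a differential operator), and $\Pi_{E_0}$ the pointwise orthogonal projection on $E_0^*$. The Rumin differential is $d_c=\Pi_{E_0}\,d\,\Pi_E:E_0^h\to E_0^{h+1}$. It is a left-invariant differential operator and is applied to forms with $L^q$ coefficients in the sense of distributions. One has $E_0^n=\{f\,dV\}$. $L^p(U,E_0^h)$ is the space of sections of the bundle $E_0^h$ over $U$ with $L^p$ coefficients, normed using the pointwise norm. *)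

theory Defs
  imports "HOL-Analysis.Analysis"
begin

section \<open>Smooth maps\<close>

primrec Ck :: "nat \<Rightarrow> ('a::euclidean_space \<Rightarrow> 'b::real_normed_vector) \<Rightarrow> bool" where
  "Ck 0 f \<longleftrightarrow> continuous_on UNIV f"
| "Ck (Suc k) f \<longleftrightarrow> (\<forall>x. f differentiable (at x)) \<and>
     (\<forall>v. Ck k (\<lambda>x. frechet_derivative f (at x) v))"

definition smooth :: "('a::euclidean_space \<Rightarrow> 'b::real_normed_vector) \<Rightarrow> bool" where
  "smooth f \<longleftrightarrow> (\<forall>k. Ck k f)"


section \<open>Carnot groups in exponential coordinates\<close>

type_synonym 'n point = "(real, 'n) vec"
type_synonym 'n group_law = "'n point \<Rightarrow> 'n point \<Rightarrow> 'n point"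

text \<open>
  The group is the space \<open>real^'n\<close> with a group law \<open>gmul\<close>, which is its own Lie algebra (the
  tangent space at the identity 0). The standard basis is the orthonormal basis adapted to the
  stratification, and \<open>w j\<close> is the index of the layer containing the \<open>j\<close>-th basis vector.
\<close>

definition left_inv_field ::
    "('n::finite) group_law \<Rightarrow> 'n point \<Rightarrow> 'n point \<Rightarrow> 'n point" where
  "left_inv_field gmul v = (\<lambda>p. frechet_derivative (gmul p) (at 0) v)"

definition field_bracket ::
    "(('n::finite) point \<Rightarrow> 'n point) \<Rightarrow> ('n point \<Rightarrow> 'n point) \<Rightarrow> 'n point \<Rightarrow> 'n point" where
  "field_bracket X Y = (\<lambda>p. frechet_derivative Y (at p) (X p) - frechet_derivative X (at p) (Y p))"

definition lie_bracket ::
    "('n::finite) group_law \<Rightarrow> 'n point \<Rightarrow> 'n point \<Rightarrow> 'n point" where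
  "lie_bracket gmul u v = field_bracket (left_inv_field gmul u) (left_inv_field gmul v) 0"

definition layer ::
    "(('n::finite) \<Rightarrow> nat) \<Rightarrow> nat \<Rightarrow> 'n point set" where
  "layer w i = span {axis j 1 | j. w j = i}"

text \<open>
  The condition \<open>gmul (s *\<^sub>R v) (t *\<^sub>R v) = (s + t) *\<^sub>R v\<close> says that \<open>t \<mapsto> t v\<close> is the one-parameter
  subgroup with velocity \<open>v\<close>, i.e. that the exponential map is the identity. Since all layer
  indices lie between 1 and \<open>step\<close>, the space is the direct sum of the layers \<open>1, \<dots>, step\<close>, and
  layer \<open>step + 1\<close> is the zero space.
\<close>

definition carnot_group ::
    "('n::{finite,linorder}) group_law \<Rightarrow> ('n \<Rightarrow> nat) \<Rightarrow> nat \<Rightarrow> bool" where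
  "carnot_group gmul w step \<longleftrightarrow>
     (\<forall>p q r. gmul (gmul p q) r = gmul p (gmul q r)) \<and>
     (\<forall>p. gmul 0 p = p) \<and> (\<forall>p. gmul p 0 = p) \<and>
     smooth (\<lambda>(p, q). gmul p q) \<and>
     (\<forall>s t v. gmul (s *\<^sub>R v) (t *\<^sub>R v) = (s + t) *\<^sub>R v) \<and>
     mono w \<and> (\<forall>j. w j \<in> {1..step}) \<and> layer w step \<noteq> {0} \<and>
     (\<forall>i\<ge>1. span {lie_bracket gmul u v | u v. u \<in> layer w 1 \<and> v \<in> layer w i} = layer w (Suc i))"

lemma carnot_group_inverse:
  assumes "carnot_group gmul w step"
  shows "gmul p (- p) = 0" "gmul (- p) p = 0"
proof -
  have *: "gmul (s *\<^sub>R p) (t *\<^sub>R p) = (s + t) *\<^sub>R p" for s t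
    using assms unfolding carnot_group_def by blast
  show "gmul p (- p) = 0" using *[of 1 "-1"] by simp
  show "gmul (- p) p = 0" using *[of "-1" 1] by simp
qed

definition homogeneous_dim ::
    "(('n::finite) \<Rightarrow> nat) \<Rightarrow> nat \<Rightarrow> nat" where
  "homogeneous_dim w step = (\<Sum>i=1..step. i * dim (layer w i))"

definition dilation ::
    "(('n::finite) \<Rightarrow> nat) \<Rightarrow> real \<Rightarrow> 'n point \<Rightarrow> 'n point" where
  "dilation w l p = (\<chi> j. l ^ w j * p $ j)"

text \<open>The group inverse of \<open>p\<close> is \<open>- p\<close>, see \<open>carnot_group_inverse\<close>.\<close>

definition homogeneous_norm ::
    "('n::finite) group_law \<Rightarrow> ('n \<Rightarrow> nat) \<Rightarrow> ('n point \<Rightarrow> real) \<Rightarrow> bool" where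
  "homogeneous_norm gmul w N \<longleftrightarrow>
     continuous_on UNIV N \<and> (\<forall>p. 0 \<le> N p) \<and> (\<forall>p. N p = 0 \<longleftrightarrow> p = 0) \<and>
     (\<forall>p. N (- p) = N p) \<and> (\<forall>l>0. \<forall>p. N (dilation w l p) = l * N p) \<and>
     (\<forall>p q. N (gmul p q) \<le> N p + N q)"

definition gball ::
    "('n::finite) group_law \<Rightarrow> ('n point \<Rightarrow> real) \<Rightarrow> 'n point \<Rightarrow> real \<Rightarrow> 'n point set" where
  "gball gmul N x r = {y. N (gmul (- x) y) < r}"


section \<open>Differential forms\<close>

type_synonym 'n covector = "(real, 'n set) vec"
type_synonym 'n form = "'n point \<Rightarrow> 'n covector"

text \<open>
  The exterior algebra over a basis indexed by \<open>'n\<close> is the space \<open>'n covector\<close>: the \<open>I\<close>-th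
  coordinate is the coefficient of the wedge product, in increasing order, of the basis covectors
  with index in \<open>I\<close>. These products are orthonormal for the inner product of \<open>'n covector\<close>.
  Reordering the product of \<open>I\<close> followed by \<open>J\<close> gives the sign \<open>wedge_sign I J\<close>.
\<close>

definition wedge_sign :: "('n::linorder) set \<Rightarrow> 'n set \<Rightarrow> real" where
  "wedge_sign I J = (if I \<inter> J = {} then (-1) ^ card {(i, j). i \<in> I \<and> j \<in> J \<and> j < i} else 0)"

definition wedge ::
    "('n::{finite,linorder}) covector \<Rightarrow> 'n covector \<Rightarrow> 'n covector" where
  "wedge \<alpha> \<beta> = (\<Sum>I\<in>UNIV. \<Sum>J\<in>UNIV. (\<alpha> $ I * \<beta> $ J * wedge_sign I J) *\<^sub>R axis (I \<union> J) 1)"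

text \<open>Exterior differential of a form given by its coefficients in the coordinate coframe \<open>dx\<^sub>I\<close>.\<close>

definition ext_d :: "('n::{finite,linorder}) form \<Rightarrow> 'n form" where
  "ext_d \<omega> = (\<lambda>p. \<Sum>j\<in>UNIV. wedge (axis {j} 1) (frechet_derivative \<omega> (at p) (axis j 1)))"

text \<open>
  The left-invariant form \<open>\<theta>\<^sub>j\<close> in the coordinate coframe: the pullback of the \<open>j\<close>-th coordinate
  covector at 0 under left translation by the inverse of \<open>p\<close>.
\<close>

definition theta :: "('n::finite) group_law \<Rightarrow> 'n \<Rightarrow> 'n form" where
  "theta gmul j p =
     (\<Sum>k\<in>UNIV. (frechet_derivative (gmul (- p)) (at p) (axis k 1) $ j) *\<^sub>R axis {k} 1)"

definition theta_set ::
    "('n::{finite,linorder}) group_law \<Rightarrow> 'n set \<Rightarrow> 'n form" where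
  "theta_set gmul I p =
     foldr (\<lambda>j \<alpha>. wedge (theta gmul j p) \<alpha>) (sorted_list_of_set I) (axis {} 1)"

text \<open>
  \<open>frame gmul p\<close> turns coefficients with respect to the left-invariant coframe \<open>\<theta>\<^sub>I\<close> at \<open>p\<close> into
  coefficients with respect to \<open>dx\<^sub>I\<close>. From here on every form is given by its coefficients with
  respect to \<open>\<theta>\<^sub>I\<close>, and \<open>form_d\<close> is the exterior differential in this description.
\<close>

definition frame ::
    "('n::{finite,linorder}) group_law \<Rightarrow> 'n point \<Rightarrow> 'n covector \<Rightarrow> 'n covector" where
  "frame gmul p \<alpha> = (\<Sum>I\<in>UNIV. (\<alpha> $ I) *\<^sub>R theta_set gmul I p)"

definition form_d ::
    "('n::{finite,linorder}) group_law \<Rightarrow> 'n form \<Rightarrow> 'n form" where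
  "form_d gmul \<omega> = (\<lambda>p. inv (frame gmul p) (ext_d (\<lambda>x. frame gmul x (\<omega> x)) p))"


section \<open>The Rumin complex\<close>

text \<open>
  The forms \<open>d\<theta>\<^sub>I\<close> are left-invariant, so their coefficients with respect to the \<open>\<theta>\<^sub>J\<close> are
  constants; they are read off at the identity. The algebraic operators \<open>d0\<close> and \<open>d0_inv\<close> act on
  the fibres, simultaneously in all degrees.
\<close>

definition d0 ::
    "('n::{finite,linorder}) group_law \<Rightarrow> 'n covector \<Rightarrow> 'n covector" where
  "d0 gmul \<alpha> = (\<Sum>I\<in>UNIV. (\<alpha> $ I) *\<^sub>R form_d gmul (\<lambda>_. axis I 1) 0)"

definition d0_inv ::
    "('n::{finite,linorder}) group_law \<Rightarrow> 'n covector \<Rightarrow> 'n covector" where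
  "d0_inv gmul \<beta> =
     (THE \<alpha>. \<alpha> \<in> {\<gamma>. d0 gmul \<gamma> = 0}\<^sup>\<bottom> \<and> adjoint (d0 gmul) (d0 gmul \<alpha>) = adjoint (d0 gmul) \<beta>)"

definition E0_all :: "('n::{finite,linorder}) group_law \<Rightarrow> 'n covector set" where
  "E0_all gmul = {\<alpha>. d0 gmul \<alpha> = 0 \<and> adjoint (d0 gmul) \<alpha> = 0}"

definition E0 ::
    "('n::{finite,linorder}) group_law \<Rightarrow> nat \<Rightarrow> 'n covector set" where
  "E0 gmul h = {\<alpha> \<in> E0_all gmul. \<forall>I. card I \<noteq> h \<longrightarrow> \<alpha> $ I = 0}"

definition proj_E0 ::
    "('n::{finite,linorder}) group_law \<Rightarrow> 'n covector \<Rightarrow> 'n covector" where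
  "proj_E0 gmul \<alpha> = (THE \<beta>. \<beta> \<in> E0_all gmul \<and> \<alpha> - \<beta> \<in> (E0_all gmul)\<^sup>\<bottom>)"

definition rumin_E :: "('n::{finite,linorder}) group_law \<Rightarrow> 'n form set" where
  "rumin_E gmul = {\<omega>. smooth \<omega> \<and> (\<forall>x. d0_inv gmul (\<omega> x) = 0) \<and>
     (\<forall>x. d0_inv gmul (form_d gmul \<omega> x) = 0)}"

definition rumin_F :: "('n::{finite,linorder}) group_law \<Rightarrow> 'n form set" where
  "rumin_F gmul = {(\<lambda>x. d0_inv gmul (\<alpha> x) + form_d gmul (\<lambda>y. d0_inv gmul (\<beta> y)) x) | \<alpha> \<beta>.
     smooth \<alpha> \<and> smooth \<beta>}"

definition proj_E ::
    "('n::{finite,linorder}) group_law \<Rightarrow> 'n form \<Rightarrow> 'n form" where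
  "proj_E gmul \<omega> = (THE \<epsilon>. \<epsilon> \<in> rumin_E gmul \<and> (\<lambda>x. \<omega> x - \<epsilon> x) \<in> rumin_F gmul)"

definition rumin_d ::
    "('n::{finite,linorder}) group_law \<Rightarrow> 'n form \<Rightarrow> 'n form" where
  "rumin_d gmul \<omega> = (\<lambda>x. proj_E0 gmul (form_d gmul (proj_E gmul \<omega>) x))"


section \<open>Weak Rumin differential\<close>

text \<open>
  Left translations have unit Jacobian in exponential coordinates, so the volume form
  \<open>dV = \<theta>\<^sub>1 \<and> \<dots> \<and> \<theta>\<^sub>n\<close> is Lebesgue measure.
\<close>

definition test_forms ::
    "('n::{finite,linorder}) group_law \<Rightarrow> nat \<Rightarrow> 'n point set \<Rightarrow> 'n form set" where
  "test_forms gmul h U = {\<psi>. smooth \<psi> \<and> (\<forall>x. \<psi> x \<in> E0 gmul h) \<and>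
     (\<exists>K. compact K \<and> K \<subseteq> U \<and> (\<forall>x. x \<notin> K \<longrightarrow> \<psi> x = 0))}"

text \<open>
  The formal adjoint of \<open>d\<^sub>c\<close> from \<open>h\<close>-forms to \<open>(h+1)\<close>-forms, applied to a smooth compactly
  supported section \<open>\<psi>\<close> of \<open>E\<^sub>0\<close> in degree \<open>h+1\<close>. It exists, and is unique, because \<open>d\<^sub>c\<close> is a
  differential operator with smooth coefficients; it is the transpose through which \<open>d\<^sub>c\<close> acts on
  distributions.
\<close>

definition rumin_d_adj ::
    "('n::{finite,linorder}) group_law \<Rightarrow> nat \<Rightarrow> 'n form \<Rightarrow> 'n form" where
  "rumin_d_adj gmul h \<psi> = (THE \<eta>. smooth \<eta> \<and> (\<forall>x. \<eta> x \<in> E0 gmul h) \<and>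
     (\<forall>\<alpha> \<in> test_forms gmul h UNIV.
        (LINT x|lebesgue. rumin_d gmul \<alpha> x \<bullet> \<psi> x) = (LINT x|lebesgue. \<alpha> x \<bullet> \<eta> x)))"

text \<open>\<open>d\<^sub>c \<phi> = \<omega>\<close> in \<open>U\<close> in the sense of distributions, for an \<open>h\<close>-form \<open>\<phi>\<close>.\<close>

definition weak_rumin_d ::
    "('n::{finite,linorder}) group_law \<Rightarrow> nat \<Rightarrow> 'n point set \<Rightarrow> 'n form \<Rightarrow> 'n form \<Rightarrow> bool" where
  "weak_rumin_d gmul h U \<phi> \<omega> \<longleftrightarrow> (\<forall>\<psi> \<in> test_forms gmul (Suc h) U.
     (LINT x:U|lebesgue. \<phi> x \<bullet> rumin_d_adj gmul h \<psi> x) = (LINT x:U|lebesgue. \<omega> x \<bullet> \<psi> x))"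


section \<open>Lebesgue spaces of sections\<close>

text \<open>Only the values on \<open>U\<close>, up to null sets, are relevant in the following definitions.\<close>

definition Lp_forms ::
    "('n::{finite,linorder}) group_law \<Rightarrow> real \<Rightarrow> nat \<Rightarrow> 'n point set \<Rightarrow> 'n form set" where
  "Lp_forms gmul p h U = {\<omega>. set_borel_measurable lebesgue U \<omega> \<and>
     (AE x in lebesgue. x \<in> U \<longrightarrow> \<omega> x \<in> E0 gmul h) \<and>
     set_integrable lebesgue U (\<lambda>x. norm (\<omega> x) powr p)}"

definition Lp_norm ::
    "real \<Rightarrow> ('n::finite) point set \<Rightarrow> 'n form \<Rightarrow> real" where
  "Lp_norm p U \<omega> = (LINT x:U|lebesgue. norm (\<omega> x) powr p) powr (1 / p)"

definition compactly_supported_in ::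
    "('n::finite) form \<Rightarrow> 'n point set \<Rightarrow> bool" where
  "compactly_supported_in \<omega> U \<longleftrightarrow>
     (\<exists>K. compact K \<and> K \<subseteq> U \<and> (AE x in lebesgue. x \<in> U - K \<longrightarrow> \<omega> x = 0))"

text \<open>The integral of an \<open>n\<close>-form: the coefficient of \<open>dV\<close> is the one with index \<open>UNIV\<close>.\<close>

definition top_integral :: "('n::finite) point set \<Rightarrow> 'n form \<Rightarrow> real" where
  "top_integral U \<omega> = (LINT x:U|lebesgue. \<omega> x $ UNIV)"

end

theory Submission
  imports Defs
begin

text \<open>
  A weight argument shows that \<open>E\<^sub>0\<close> in degree \<open>n - 1\<close> corresponds to horizontal vector fields and that the
  Rumin differential there is, up to sign, the horizontal divergence. So one has to solve a
  divergence equation with horizontal fields.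

  Contract a bump function \<open>e\<close> of integral one to a point by dilations. The derivative in the dilation
  parameter \<open>t\<close> is a derivative along the Euler field, and since horizontal fields generate the Lie
  algebra, each non-horizontal derivative is an iterated commutator, so integration by parts rewrites it
  as a sum of horizontal derivatives with test function coefficients. Integrating over \<open>t\<close> expresses
  \<open>\<integral> e g - g\<close> as an integral of the horizontal derivatives of \<open>g\<close> against a compactly supported
  kernel, and homogeneity bounds the kernel by \<open>N\<^sup>1\<^sup>-\<^sup>Q\<close>. Integrating \<open>\<omega>\<close> against the translated kernels
  gives the solution, because the averages drop out when \<open>\<integral> \<omega> = 0\<close>; the Lebesgue estimate is that of the
  Riesz potential with kernel \<open>N\<^sup>1\<^sup>-\<^sup>Q\<close>, and translations and dilations of the kernel carry it to every ball.
\<close>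

subsection \<open>Smooth maps\<close>

text \<open>Neither the compatibility of dilations with the group law nor the left invariance of
  Lebesgue measure is part of the definitions. Both rest on the grading of the bracket: along rays
  the Maurer-Cartan equation is linear with the bracket as its only coefficient, and invariant
  fields are divergence free by homogeneity. A second obstacle is the support of the kernel.
  Contracting a fixed bump around 0 to \<open>y\<close> moves points along
  \<open>gmul y (dil t z)\<close> with \<open>N z\<close> up to about \<open>N y\<close>; this gives
  only a norm bound near 2, too large for \<open>l\<close> close to 1. Therefore a bump of radius
  \<epsilon> around \<open>y\<close> is contracted twice, to \<open>y\<close> and to points
  \<open>v\<close> near 0. Both families of paths keep norm at most
  \<open>1 + 3 * \<epsilon>\<close>, and the average around \<open>y\<close> cancels. This is why
  the bump carries a parameter \<open>p\<close> and why all coefficients are kept jointly smooth in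
  it: the kernel bounds must be uniform in \<open>p\<close>. At the critical exponent a strong
  estimate is needed; cutting \<open>f\<close> at the very height that indexes the level lets the
  weak estimates be integrated over all levels.\<close>

lemma frechet_derivative_eqI:
  "(f has_derivative f') (at x) \<Longrightarrow> frechet_derivative f (at x) v = f' v"
  using frechet_derivative_at[of f f' x] by simp

lemma Ck_imp_continuous: "Ck k f \<Longrightarrow> continuous_on UNIV f"
proof (cases k)
  case (Suc m)
  moreover assume "Ck k f"
  ultimately have "f differentiable (at x)" for x by simp
  then show ?thesis
    by (intro continuous_at_imp_continuous_on ballI differentiable_imp_continuous_within)
qed simp

lemma Ck_Suc_imp: "Ck (Suc k) f \<Longrightarrow> Ck k f"
proof (induction k arbitrary: f)
  case 0 then show ?case using Ck_imp_continuous[OF 0] by (simp only: Ck.simps(1))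
next
  case (Suc k) then show ?case by (metis Ck.simps(2))
qed

lemma Ck_const: "Ck k (\<lambda>x. c)"
  by (induction k arbitrary: c) auto

lemma Ck_linear_comp:
  assumes "bounded_linear L" shows "Ck k g \<Longrightarrow> Ck k (\<lambda>x. L (g x))"
proof (induction k arbitrary: g)
  case 0 then show ?case using assms by (auto intro: bounded_linear.continuous_on)
next
  case (Suc k)
  have d: "((\<lambda>x. L (g x)) has_derivative (\<lambda>v. L (frechet_derivative g (at x) v))) (at x)" for x
    using Suc.prems by (auto intro!: bounded_linear.has_derivative[OF assms] simp: frechet_derivative_works)
  have "frechet_derivative (\<lambda>x. L (g x)) (at x) v = L (frechet_derivative g (at x) v)" for x v
    by (rule frechet_derivative_eqI[OF d])
  with d Suc show ?case by (auto simp: differentiable_def)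
qed

lemma Ck_add: "Ck k f \<Longrightarrow> Ck k g \<Longrightarrow> Ck k (\<lambda>x. f x + g x)"
proof (induction k arbitrary: f g)
  case 0 then show ?case by (auto intro: continuous_on_add)
next
  case (Suc k)
  have d: "((\<lambda>x. f x + g x) has_derivative (\<lambda>v. frechet_derivative f (at x) v + frechet_derivative g (at x) v)) (at x)" for x
    using Suc.prems by (auto intro!: has_derivative_add simp: frechet_derivative_works)
  have "frechet_derivative (\<lambda>x. f x + g x) (at x) v = frechet_derivative f (at x) v + frechet_derivative g (at x) v" for x v
    by (rule frechet_derivative_eqI[OF d])
  with d Suc show ?case by (auto simp: differentiable_def)
qed

lemma Ck_sum: "(\<And>i. i \<in> I \<Longrightarrow> Ck k (f i)) \<Longrightarrow> Ck k (\<lambda>x. \<Sum>i\<in>I. f i x)"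
  by (induction I rule: infinite_finite_induct) (auto intro: Ck_const Ck_add)

lemma Ck_bilinear:
  assumes "bounded_bilinear B" shows "Ck k f \<Longrightarrow> Ck k g \<Longrightarrow> Ck k (\<lambda>x. B (f x) (g x))"
proof (induction k arbitrary: f g)
  case 0 then show ?case using bounded_bilinear.continuous_on[OF assms] by auto
next
  case (Suc k)
  have d: "((\<lambda>x. B (f x) (g x)) has_derivative (\<lambda>v. B (f x) (frechet_derivative g (at x) v) + B (frechet_derivative f (at x) v) (g x))) (at x)" for x
    using Suc.prems by (auto intro!: bounded_bilinear.FDERIV[OF assms] simp: frechet_derivative_works)
  have "frechet_derivative (\<lambda>x. B (f x) (g x)) (at x) v = B (f x) (frechet_derivative g (at x) v) + B (frechet_derivative f (at x) v) (g x)" for x v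
    by (rule frechet_derivative_eqI[OF d])
  with d Suc.prems show ?case
    by (auto simp: differentiable_def intro!: Ck_add Suc.IH Ck_Suc_imp[of k f] Ck_Suc_imp[of k g])
qed

text \<open>The chain rule produces the direction \<open>frechet_derivative g (at x) v\<close>,
  which moves with \<open>x\<close>, while \<open>Ck\<close> only speaks about fixed directions.
  Expanding it in the basis turns the derivative into a sum of products to which the induction
  hypothesis applies.\<close>

lemma Ck_compose:
  fixes g :: "'a::euclidean_space \<Rightarrow> 'b::euclidean_space" and f :: "'b \<Rightarrow> 'c::real_normed_vector"
  shows "Ck k f \<Longrightarrow> Ck k g \<Longrightarrow> Ck k (\<lambda>x. f (g x))"
proof (induction k arbitrary: f g)
  case 0 then show ?case using continuous_on_compose2[of UNIV f UNIV g] by auto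
next
  case (Suc k)
  have d: "((\<lambda>x. f (g x)) has_derivative (\<lambda>v. frechet_derivative f (at (g x)) (frechet_derivative g (at x) v))) (at x)" for x
    by (rule has_derivative_compose[of g _ x UNIV f]) (use Suc.prems in \<open>simp_all add: frechet_derivative_works[symmetric]\<close>)
  have e: "frechet_derivative (\<lambda>x. f (g x)) (at x) v =
     (\<Sum>b\<in>Basis. (frechet_derivative g (at x) v \<bullet> b) *\<^sub>R frechet_derivative f (at (g x)) b)" for x v
  proof -
    interpret l: linear "frechet_derivative f (at (g x))"
      using Suc.prems by (auto intro: linear_frechet_derivative)
    have "frechet_derivative (\<lambda>x. f (g x)) (at x) v =
      frechet_derivative f (at (g x)) (\<Sum>b\<in>Basis. (frechet_derivative g (at x) v \<bullet> b) *\<^sub>R b)"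
      unfolding euclidean_representation by (rule frechet_derivative_eqI[OF d])
    then show ?thesis by (simp add: l.sum l.scale)
  qed
  have "Ck k (\<lambda>x. (frechet_derivative g (at x) v \<bullet> b) *\<^sub>R frechet_derivative f (at (g x)) b)" for v b
    using Suc.prems Ck_Suc_imp[OF Suc.prems(2)]
    by (intro Ck_bilinear[OF bounded_bilinear_scaleR] Ck_linear_comp[OF bounded_linear_inner_left]
        Suc.IH[of "\<lambda>x. frechet_derivative f (at x) b"]) auto
  with d show ?case by (auto simp: differentiable_def e intro!: Ck_sum)
qed

text \<open>With the direction fixed, the derivative is again a function of the point, so it can be
  iterated and smoothness becomes closure under \<open>dird\<close> (see
  \<open>smooth_iff\<close>).\<close>

definition dird :: "'a::euclidean_space \<Rightarrow> ('a \<Rightarrow> 'b::real_normed_vector) \<Rightarrow> 'a \<Rightarrow> 'b" where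
  "dird v f = (\<lambda>x. frechet_derivative f (at x) v)"

lemma smooth_iff: "smooth f \<longleftrightarrow> (\<forall>x. f differentiable (at x)) \<and> (\<forall>v. smooth (dird v f))"
proof
  assume *: "smooth f"
  then show "(\<forall>x. f differentiable (at x)) \<and> (\<forall>v. smooth (dird v f))"
    unfolding smooth_def dird_def by (metis Ck.simps(2))
next
  assume "(\<forall>x. f differentiable (at x)) \<and> (\<forall>v. smooth (dird v f))"
  then have "Ck (Suc k) f" for k by (auto simp: smooth_def dird_def)
  then show "smooth f" unfolding smooth_def using Ck_Suc_imp by blast
qed

lemma smooth_differentiable: "smooth f \<Longrightarrow> f differentiable (at x)"
  using smooth_iff by blast

lemma smooth_dird: "smooth f \<Longrightarrow> smooth (dird v f)"
  using smooth_iff by blast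

lemma smooth_has_derivative: "smooth f \<Longrightarrow> (f has_derivative (\<lambda>v. dird v f x)) (at x)"
  using smooth_differentiable[of f x] unfolding dird_def by (simp add: frechet_derivative_works)

lemma dird_eqI: "(f has_derivative f') (at x) \<Longrightarrow> dird v f x = f' v"
  unfolding dird_def by (rule frechet_derivative_eqI)

lemma linear_dird: "smooth f \<Longrightarrow> linear (\<lambda>v. dird v f x)"
  using smooth_has_derivative has_derivative_linear by blast

lemma smooth_continuous_on: "smooth f \<Longrightarrow> continuous_on S f"
  unfolding smooth_def by (metis Ck.simps(1) continuous_on_subset subset_UNIV)

lemma smooth_const [simp, intro]: "smooth (\<lambda>x. c)"
  by (simp add: smooth_def Ck_const)

lemma smooth_linear_comp: "bounded_linear L \<Longrightarrow> smooth g \<Longrightarrow> smooth (\<lambda>x. L (g x))"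
  by (simp add: smooth_def Ck_linear_comp)

lemma smooth_add [intro]: "smooth f \<Longrightarrow> smooth h \<Longrightarrow> smooth (\<lambda>x. f x + h x)"
  by (simp add: smooth_def Ck_add)

lemma smooth_sum: "(\<And>i. i \<in> I \<Longrightarrow> smooth (F i)) \<Longrightarrow> smooth (\<lambda>x. \<Sum>i\<in>I. F i x)"
  by (simp add: smooth_def Ck_sum)

lemma smooth_bilinear: "bounded_bilinear B \<Longrightarrow> smooth f \<Longrightarrow> smooth g \<Longrightarrow> smooth (\<lambda>x. B (f x) (g x))"
  by (simp add: smooth_def Ck_bilinear)

lemma smooth_compose:
  fixes g :: "'a::euclidean_space \<Rightarrow> 'b::euclidean_space" and f :: "'b \<Rightarrow> 'c::real_normed_vector"
  shows "smooth f \<Longrightarrow> smooth g \<Longrightarrow> smooth (\<lambda>x. f (g x))"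
  by (simp add: smooth_def Ck_compose)

lemma smooth_id [simp, intro]: "smooth (\<lambda>x. x)"
proof -
  have "dird v (\<lambda>x. x) = (\<lambda>x::'a. v)" for v
    by (auto intro!: ext dird_eqI derivative_eq_intros)
  then show ?thesis by (subst smooth_iff) auto
qed

lemma smooth_linear: "linear L \<Longrightarrow> smooth L" for L :: "'a::euclidean_space \<Rightarrow> 'b::real_normed_vector"
  using smooth_linear_comp[of L "\<lambda>x. x"] by (simp add: linear_conv_bounded_linear)

lemmas smooth_scaleR [intro] = smooth_bilinear[OF bounded_bilinear_scaleR]
lemmas smooth_mult [intro] = smooth_bilinear[OF bounded_bilinear_mult]
lemmas smooth_inner [intro] = smooth_bilinear[OF bounded_bilinear_inner]
lemmas smooth_minus [intro] = smooth_linear_comp[OF bounded_linear_minus[OF bounded_linear_ident]]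
lemmas smooth_component = smooth_linear_comp[OF bounded_linear_vec_nth]

lemma smooth_uminus [intro]: "smooth uminus"
  using smooth_minus[OF smooth_id] by simp

lemma smooth_diff [intro]: "smooth f \<Longrightarrow> smooth h \<Longrightarrow> smooth (\<lambda>x. f x - h x)"
  using smooth_add[of f "\<lambda>x. - h x"] smooth_minus[of h] by simp

lemma smooth_power [intro]: "smooth f \<Longrightarrow> smooth (\<lambda>x. (f x :: real) ^ n)"
  by (induction n) (auto intro: smooth_mult)

lemma smooth_Pair [intro]:
  fixes f :: "'a::euclidean_space \<Rightarrow> 'b::euclidean_space" and g :: "'a \<Rightarrow> 'c::euclidean_space"
  assumes "smooth f" "smooth g" shows "smooth (\<lambda>x. (f x, g x))"
proof -
  have "smooth (\<lambda>x. (f x, 0) + (0, g x))"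
    using assms
    by (intro smooth_add smooth_linear_comp[of "\<lambda>y. (y, 0)" f] smooth_linear_comp[of "\<lambda>y. (0, y)" g]
         bounded_linear_Pair bounded_linear_ident bounded_linear_zero)
  then show ?thesis by simp
qed

lemma smooth_fst: "smooth f \<Longrightarrow> smooth (\<lambda>x. fst (f x))"
  and smooth_snd: "smooth f \<Longrightarrow> smooth (\<lambda>x. snd (f x))"
  by (auto intro: smooth_linear_comp[OF bounded_linear_fst] smooth_linear_comp[OF bounded_linear_snd])

lemma smooth_vec:
  assumes "\<And>i. smooth (\<lambda>x. f x $ i)" shows "smooth (f :: 'a::euclidean_space \<Rightarrow> real^'n)"
proof -
  have "smooth (\<lambda>x. \<Sum>i\<in>UNIV. (f x $ i) *\<^sub>R axis i 1)"
    by (intro smooth_sum smooth_scaleR assms smooth_const)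
  also have "(\<lambda>x. \<Sum>i\<in>UNIV. (f x $ i) *\<^sub>R axis i 1) = f"
    by (auto simp: fun_eq_iff vec_eq_iff axis_def if_distrib cong: if_cong)
  finally show ?thesis .
qed

section \<open>Symmetry of second derivatives\<close>

lemma second_difference_mvt:
  fixes f :: "'a::euclidean_space \<Rightarrow> real"
  assumes f: "smooth f" and s: "s > 0"
  shows "\<exists>a b. 0 < a \<and> a < s \<and> 0 < b \<and> b < s \<and>
    f (x + s *\<^sub>R u + s *\<^sub>R v) - f (x + s *\<^sub>R u) - f (x + s *\<^sub>R v) + f x
      = s * s * dird v (dird u f) (x + a *\<^sub>R u + b *\<^sub>R v)"
proof -
  define g where "g a = f (x + a *\<^sub>R u + s *\<^sub>R v) - f (x + a *\<^sub>R u)" for a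
  have D: "((\<lambda>a. h (y + a *\<^sub>R w)) has_real_derivative dird w h (y + a *\<^sub>R w)) (at a)"
    if "smooth h" for h :: "'a \<Rightarrow> real" and y w a
  proof -
    have "((\<lambda>a. h (y + a *\<^sub>R w)) has_derivative (\<lambda>t. dird (t *\<^sub>R w) h (y + a *\<^sub>R w))) (at a)"
      by (rule has_derivative_compose[of "\<lambda>a. y + a *\<^sub>R w", OF _ smooth_has_derivative[OF that]])
         (auto intro!: derivative_eq_intros)
    also have "(\<lambda>t. dird (t *\<^sub>R w) h (y + a *\<^sub>R w)) = (\<lambda>t. t * dird w h (y + a *\<^sub>R w))"
      using linear_cmul[OF linear_dird[OF that]] by auto
    also have "\<dots> = (*) (dird w h (y + a *\<^sub>R w))" by (simp add: fun_eq_iff)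
    finally show ?thesis by (simp add: has_field_derivative_def)
  qed
  have 1: "(g has_real_derivative (dird u f (x + a *\<^sub>R u + s *\<^sub>R v) - dird u f (x + a *\<^sub>R u))) (at a)" for a
    unfolding g_def using D[OF f, of "x + s *\<^sub>R v" u a] D[OF f, of x u a]
    by (auto intro!: DERIV_diff simp: algebra_simps)
  obtain a where a: "0 < a" "a < s" "g s - g 0 = s * (dird u f (x + a *\<^sub>R u + s *\<^sub>R v) - dird u f (x + a *\<^sub>R u))"
    using MVT2[OF s 1] by auto
  obtain b where b: "0 < b" "b < s" "dird u f (x + a *\<^sub>R u + s *\<^sub>R v) - dird u f (x + a *\<^sub>R u + 0 *\<^sub>R v)
      = s * dird v (dird u f) (x + a *\<^sub>R u + b *\<^sub>R v)"
    using MVT2[OF s D[OF smooth_dird[OF f, of u], of "x + a *\<^sub>R u" v]] by auto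
  from a b show ?thesis unfolding g_def by (intro exI[of _ a] exI[of _ b]) (auto simp: algebra_simps)
qed

text \<open>The second difference of \<open>f\<close> is symmetric in \<open>u\<close> and
  \<open>v\<close>, and \<open>second_difference_mvt\<close> writes it as \<open>s * s\<close> times
  either mixed derivative at a point near \<open>x\<close>. By continuity, different mixed
  derivatives at \<open>x\<close> could not share that value for small \<open>s\<close>.\<close>

lemma dird_commute_real:
  fixes f :: "'a::euclidean_space \<Rightarrow> real"
  assumes f: "smooth f" shows "dird v (dird u f) x = dird u (dird v f) x"
proof (rule ccontr)
  assume ne: "\<not> ?thesis"
  define e where "e = \<bar>dird v (dird u f) x - dird u (dird v f) x\<bar> / 2"
  have e: "e > 0" using ne by (simp add: e_def)
  have "continuous_on UNIV (dird v (dird u f))" "continuous_on UNIV (dird u (dird v f))"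
    using f by (auto intro!: smooth_continuous_on smooth_dird)
  then obtain d1 d2 where d: "d1 > 0" "\<And>y. dist y x < d1 \<Longrightarrow> dist (dird v (dird u f) y) (dird v (dird u f) x) < e"
    "d2 > 0" "\<And>y. dist y x < d2 \<Longrightarrow> dist (dird u (dird v f) y) (dird u (dird v f) x) < e"
    using e unfolding continuous_on_iff by (metis UNIV_I)
  \<comment> \<open>All points produced by the mean value theorem lie within
    \<open>s * (norm u + norm v)\<close> of \<open>x\<close>, hence within half of both radii; the
    summand 1 keeps the denominator positive.\<close>
  define s where "s = min d1 d2 / (2 * (norm u + norm v + 1))"
  have s: "s > 0" using d by (auto simp: s_def intro!: divide_pos_pos add_nonneg_pos)
  have n1: "norm u + norm v + 1 > 0" by (auto intro: add_nonneg_pos)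
  have half: "s * (norm u + norm v + 1) = min d1 d2 / 2"
  proof -
    have "m / (2 * c) * c = m / 2" if "c > 0" for m c :: real using that by simp
    from this[OF n1] show ?thesis unfolding s_def .
  qed
  have close: "dist (x + a *\<^sub>R p + b *\<^sub>R q) x < min d1 d2" if "0 < a" "a < s" "0 < b" "b < s" "{p,q} = {u,v}" for a b p q
  proof -
    have "norm (a *\<^sub>R p + b *\<^sub>R q) \<le> a * norm p + b * norm q" using that norm_triangle_ineq[of "a *\<^sub>R p" "b *\<^sub>R q"] by simp
    also have "\<dots> \<le> s * norm p + s * norm q" using that by (intro add_mono mult_right_mono) auto
    also have "\<dots> = s * (norm u + norm v)" using that by (auto simp: doubleton_eq_iff algebra_simps)
    also have "\<dots> \<le> s * (norm u + norm v + 1)" using s by simp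
    also have "\<dots> = min d1 d2 / 2" by (rule half)
    also have "\<dots> < min d1 d2" using d by auto
    finally show ?thesis by (simp add: dist_norm add.assoc)
  qed
  obtain a b where ab: "0 < a" "a < s" "0 < b" "b < s"
    "f (x + s *\<^sub>R u + s *\<^sub>R v) - f (x + s *\<^sub>R u) - f (x + s *\<^sub>R v) + f x = s * s * dird v (dird u f) (x + a *\<^sub>R u + b *\<^sub>R v)"
    using second_difference_mvt[OF f s, of x u v] by blast
  obtain a' b' where ab': "0 < a'" "a' < s" "0 < b'" "b' < s"
    "f (x + s *\<^sub>R v + s *\<^sub>R u) - f (x + s *\<^sub>R v) - f (x + s *\<^sub>R u) + f x = s * s * dird u (dird v f) (x + a' *\<^sub>R v + b' *\<^sub>R u)"
    using second_difference_mvt[OF f s, of x v u] by blast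
  have "s * s * dird v (dird u f) (x + a *\<^sub>R u + b *\<^sub>R v) = s * s * dird u (dird v f) (x + a' *\<^sub>R v + b' *\<^sub>R u)"
    using ab(5) ab'(5) by (simp add: algebra_simps)
  then have "dird v (dird u f) (x + a *\<^sub>R u + b *\<^sub>R v) = dird u (dird v f) (x + a' *\<^sub>R v + b' *\<^sub>R u)" using s by simp
  moreover have "dist (dird v (dird u f) (x + a *\<^sub>R u + b *\<^sub>R v)) (dird v (dird u f) x) < e"
    using close[OF ab(1-4)] d by auto
  moreover have "dist (dird u (dird v f) (x + a' *\<^sub>R v + b' *\<^sub>R u)) (dird u (dird v f) x) < e"
    using close[OF ab'(1-4), of v u] d by (auto simp: insert_commute)
  ultimately show False unfolding e_def dist_real_def by (simp add: abs_if split: if_splits)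
qed

lemma dird_linear_comp:
  assumes "bounded_linear L" "smooth f" shows "dird v (\<lambda>x. L (f x)) x = L (dird v f x)"
  by (intro dird_eqI bounded_linear.has_derivative[OF assms(1)] smooth_has_derivative assms(2))

lemma dird_commute:
  fixes f :: "'a::euclidean_space \<Rightarrow> 'b::euclidean_space"
  assumes f: "smooth f" shows "dird v (dird u f) x = dird u (dird v f) x"
proof (rule euclidean_eqI)
  fix b :: 'b
  have *: "dird v (dird u f) x \<bullet> b = dird v (dird u (\<lambda>x. f x \<bullet> b)) x" for u v
  proof -
    have "dird u (\<lambda>x. f x \<bullet> b) = (\<lambda>x. dird u f x \<bullet> b)"
      using dird_linear_comp[OF bounded_linear_inner_left f] by blast
    then show ?thesis using dird_linear_comp[OF bounded_linear_inner_left smooth_dird[OF f]] by simp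
  qed
  show "dird v (dird u f) x \<bullet> b = dird u (dird v f) x \<bullet> b"
    unfolding * by (intro dird_commute_real smooth_linear_comp[OF bounded_linear_inner_left] f)
qed

lemma dird_bilinear:
  assumes "bounded_bilinear B" "smooth f" "smooth g"
  shows "dird v (\<lambda>x. B (f x) (g x)) x = B (f x) (dird v g x) + B (dird v f x) (g x)"
  by (rule dird_eqI[OF bounded_bilinear.FDERIV[OF assms(1) smooth_has_derivative[OF assms(2)] smooth_has_derivative[OF assms(3)]]])

lemma dird_compose:
  assumes "smooth f" "smooth g" shows "dird v (\<lambda>x. f (g x)) x = dird (dird v g x) f (g x)"
  by (rule dird_eqI[OF has_derivative_compose[OF smooth_has_derivative[OF assms(2)] smooth_has_derivative[OF assms(1)]]])

lemma dird_add: "smooth f \<Longrightarrow> smooth g \<Longrightarrow> dird v (\<lambda>x. f x + g x) x = dird v f x + dird v g x"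
  and dird_diff: "smooth f \<Longrightarrow> smooth g \<Longrightarrow> dird v (\<lambda>x. f x - g x) x = dird v f x - dird v g x"
  and dird_sum: "(\<And>i. i \<in> I \<Longrightarrow> smooth (F i)) \<Longrightarrow> dird v (\<lambda>x. \<Sum>i\<in>I. F i x) x = (\<Sum>i\<in>I. dird v (F i) x)"
  by (intro dird_eqI has_derivative_add has_derivative_diff has_derivative_sum smooth_has_derivative; assumption)+

lemma dird_const [simp]: "dird v (\<lambda>x. c) x = 0"
  by (intro dird_eqI has_derivative_const)

lemma dird_ident [simp]: "dird v (\<lambda>x. x) x = v"
  by (intro dird_eqI has_derivative_ident)

lemma dird_linear: "linear L \<Longrightarrow> dird v L x = L v" for L :: "'a::euclidean_space \<Rightarrow> 'b::real_normed_vector"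
  by (intro dird_eqI) (simp add: linear_conv_bounded_linear bounded_linear_imp_has_derivative)

lemma dird_cong_open:
  assumes "open S" "x \<in> S" "\<And>y. y \<in> S \<Longrightarrow> f y = g y" shows "dird v f x = dird v g x"
proof -
  have "(f has_derivative D) (at x) \<longleftrightarrow> (g has_derivative D) (at x)" for D
    using has_derivative_transform_within_open[of f D x UNIV S g] has_derivative_transform_within_open[of g D x UNIV S f] assms
    by auto
  then show ?thesis unfolding dird_def frechet_derivative_def by simp
qed

text \<open>The derivative of \<open>x \<mapsto> x\<^sup>-\<^sup>n exp (-1/x)\<close> is a combination of functions of the same shape.\<close>

definition flat_exp :: "nat \<Rightarrow> real \<Rightarrow> real" where
  "flat_exp n x = (if x > 0 then (1 / x) ^ n * exp (- (1 / x)) else 0)"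

lemma flat_exp_has_derivative:
  "(flat_exp n has_real_derivative (flat_exp (n + 2) x - real n * flat_exp (Suc n) x)) (at x)"
proof (cases x "0::real" rule: linorder_cases)
  case less
  have "((\<lambda>_. 0) has_real_derivative 0) (at x)" by simp
  then have "(flat_exp n has_real_derivative 0) (at x)"
    by (rule has_field_derivative_transform_within_open[where S="{..<0}"]) (use less in \<open>auto simp: flat_exp_def\<close>)
  then show ?thesis using less by (simp add: flat_exp_def)
next
  case greater
  have "((\<lambda>x. (1 / x) ^ n * exp (- (1 / x))) has_real_derivative
     (1 / x) ^ n * (exp (- (1 / x)) * (1 / x^2)) + real n * (1/x)^(n - 1) * (- (1 / x^2)) * exp (- (1 / x))) (at x)"
    using greater by (auto intro!: derivative_eq_intros simp: power2_eq_square)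
  also have "(1 / x) ^ n * (exp (- (1 / x)) * (1 / x^2)) + real n * (1/x)^(n - 1) * (- (1 / x^2)) * exp (- (1 / x))
     = flat_exp (n + 2) x - real n * flat_exp (Suc n) x"
    using greater by (cases n) (auto simp: flat_exp_def power2_eq_square field_simps)
  finally show ?thesis
    by (rule has_field_derivative_transform_within_open[where S="{0<..}"]) (use greater in \<open>auto simp: flat_exp_def\<close>)
next
  case equal
  \<comment> \<open>At 0 the difference quotient of \<open>flat_exp n\<close> is
    \<open>flat_exp (Suc n)\<close>, so it remains to see that this function tends to 0 there. From
    the right this is the decay of \<open>y ^ Suc n * exp (- y)\<close> at infinity.\<close>
  have lim: "((\<lambda>y. y ^ Suc n * exp (- y)) \<longlongrightarrow> (0::real)) at_top"
    using tendsto_power_div_exp_0[of "Suc n"] by (simp add: exp_minus field_simps)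
  have "(flat_exp (Suc n) \<longlongrightarrow> 0) (at_right 0)"
  proof -
    have "((\<lambda>x. (1/x) ^ Suc n * exp (- (1/x))) \<longlongrightarrow> 0) (at_right (0::real))"
      using filterlim_compose[OF lim filterlim_inverse_at_top_right] by (simp add: inverse_eq_divide)
    then show ?thesis
      by (rule Lim_transform_eventually) (auto simp: flat_exp_def eventually_at_filter)
  qed
  moreover have "(flat_exp (Suc n) \<longlongrightarrow> 0) (at_left 0)"
    by (rule Lim_transform_eventually[OF tendsto_const]) (auto simp: flat_exp_def eventually_at_filter)
  ultimately have "(flat_exp (Suc n) \<longlongrightarrow> 0) (at 0)" by (simp add: filterlim_at_split)
  then have "((\<lambda>h. flat_exp n h / h) \<longlongrightarrow> 0) (at 0)"
    by (rule Lim_transform_eventually) (auto simp: flat_exp_def eventually_at_filter)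
  then show ?thesis using equal by (simp add: has_field_derivative_iff flat_exp_def)
qed

lemma smooth_flat_exp: "smooth (flat_exp n)"
proof -
  have "Ck k (flat_exp n)" for k
  proof (induction k arbitrary: n)
    case 0 show ?case
      using flat_exp_has_derivative by (auto intro!: continuous_at_imp_continuous_on DERIV_isCont)
  next
    case (Suc k)
    have d: "(flat_exp n has_derivative (\<lambda>v. v * (flat_exp (n + 2) x - real n * flat_exp (Suc n) x))) (at x)" for x
      using flat_exp_has_derivative[of n x] by (simp add: has_field_derivative_def mult.commute[of _ "_::real"] mult_commute_abs)
    have e: "(\<lambda>x. frechet_derivative (flat_exp n) (at x) v) = (\<lambda>x. v * (flat_exp (n + 2) x + (- real n) * flat_exp (Suc n) x))" for v
      using frechet_derivative_at[OF d, symmetric] by (auto simp: fun_eq_iff)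
    have "Ck k (\<lambda>x. v * (flat_exp (n + 2) x + (- real n) * flat_exp (Suc n) x))" for v
      by (intro Ck_linear_comp[OF bounded_linear_mult_right] Ck_add Suc.IH)
    then show ?case using d e by (auto simp: differentiable_def)
  qed
  then show ?thesis by (simp add: smooth_def)
qed

lemma smooth_bump:
  fixes S :: "'a::euclidean_space set"
  assumes "open S" "a \<in> S"
  obtains b :: "'a \<Rightarrow> real" and K where "smooth b" "\<And>x. 0 \<le> b x" "b a > 0" "compact K" "K \<subseteq> S" "\<And>x. x \<notin> K \<Longrightarrow> b x = 0"
proof -
  obtain r where r: "r > 0" "cball a r \<subseteq> S" using assms open_contains_cball by blast
  define b where "b x = flat_exp 0 (r\<^sup>2 - (x - a) \<bullet> (x - a))" for x
  have "smooth (\<lambda>x. r\<^sup>2 - (x - a) \<bullet> (x - a))" by (intro smooth_diff smooth_inner smooth_const smooth_id)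
  then have "smooth b" unfolding b_def using smooth_compose[OF smooth_flat_exp] by blast
  moreover have "b x = 0" if "x \<notin> cball a r" for x
  proof -
    have "r < norm (x - a)" using that by (simp add: dist_norm norm_minus_commute)
    then have "r\<^sup>2 < (norm (x - a))\<^sup>2" using r by (intro power_strict_mono) auto
    then show ?thesis by (simp add: b_def flat_exp_def power2_norm_eq_inner)
  qed
  moreover have "0 \<le> b x" for x by (simp add: b_def flat_exp_def)
  moreover have "b a > 0" using r by (simp add: b_def flat_exp_def)
  ultimately show ?thesis using that[of b "cball a r"] r by auto
qed

section \<open>Linear operators depending on a point\<close>

lemma linear_vec_expand:
  fixes L :: "real^'n \<Rightarrow> 'b::real_vector"
  assumes "linear L" shows "L v = (\<Sum>k\<in>UNIV. (v $ k) *\<^sub>R L (axis k 1))"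
proof -
  have "L v = L (\<Sum>k\<in>UNIV. (v $ k) *\<^sub>R axis k 1)"
    using basis_expansion[of v] by (simp add: scalar_mult_eq_scaleR)
  then show ?thesis using assms by (simp add: linear_sum linear_cmul)
qed

lemma dird_vec_expand:
  fixes f :: "real^'n \<Rightarrow> 'b::real_normed_vector"
  shows "smooth f \<Longrightarrow> dird v f x = (\<Sum>k\<in>UNIV. (v $ k) *\<^sub>R dird (axis k 1) f x)"
  by (rule linear_vec_expand[OF linear_dird])

lemma smooth_linear_family:
  fixes L :: "'a::euclidean_space \<Rightarrow> real^'n \<Rightarrow> 'b::real_normed_vector"
  assumes "\<And>x. linear (L x)" "\<And>v. smooth (\<lambda>x. L x v)" "smooth g" shows "smooth (\<lambda>x. L x (g x))"
proof -
  have "smooth (\<lambda>x. \<Sum>k\<in>UNIV. (g x $ k) *\<^sub>R L x (axis k 1))"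
    by (intro smooth_sum smooth_scaleR smooth_component assms)
  then show ?thesis using linear_vec_expand[OF assms(1), symmetric] by simp
qed

text \<open>Product rule for an operator \<open>L x\<close> applied to a moving vector
  \<open>g x\<close>; the expansion in coordinates needs only smoothness of each
  \<open>L x v\<close>, not a norm on operators. It serves for derivatives along vector fields,
  whose direction moves with the point.\<close>

lemma dird_linear_family:
  fixes L :: "'a::euclidean_space \<Rightarrow> real^'n \<Rightarrow> 'b::real_normed_vector"
  assumes "\<And>x. linear (L x)" "\<And>v. smooth (\<lambda>x. L x v)" "smooth g"
  shows "dird u (\<lambda>x. L x (g x)) x = dird u (\<lambda>y. L y (g x)) x + L x (dird u g x)"
proof -
  have e: "(\<lambda>x. L x (g x)) = (\<lambda>x. \<Sum>k\<in>UNIV. (g x $ k) *\<^sub>R L x (axis k 1))"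
    using linear_vec_expand[OF assms(1)] by blast
  have e2: "(\<lambda>y. L y (g x)) = (\<lambda>y. \<Sum>k\<in>UNIV. (g x $ k) *\<^sub>R L y (axis k 1))"
    using linear_vec_expand[OF assms(1)] by blast
  have "dird u (\<lambda>x. L x (g x)) x = (\<Sum>k\<in>UNIV. (g x $ k) *\<^sub>R dird u (\<lambda>y. L y (axis k 1)) x
      + (dird u g x $ k) *\<^sub>R L x (axis k 1))"
    unfolding e using assms
    by (simp add: dird_sum smooth_scaleR smooth_component dird_bilinear[OF bounded_bilinear_scaleR]
        dird_linear_comp[OF bounded_linear_vec_nth])
  also have "\<dots> = dird u (\<lambda>y. L y (g x)) x + L x (dird u g x)"
    unfolding e2 linear_vec_expand[OF assms(1), of x "dird u g x"] using assms
    by (simp add: dird_sum smooth_scaleR dird_bilinear[OF bounded_bilinear_scaleR] sum.distrib)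
  finally show ?thesis .
qed

lemma smooth_eq_if_deriv_eq_0:
  fixes f :: "real \<Rightarrow> 'b::euclidean_space"
  assumes "smooth f" "\<And>t. dird 1 f t = 0" shows "f a = f b"
proof -
  have "(f has_derivative (\<lambda>v. 0)) (at t within UNIV)" for t
  proof -
    have "dird v f t = 0" for v
      using linear_cmul[OF linear_dird[OF assms(1)], of v 1 t] assms(2) by simp
    then show ?thesis using smooth_has_derivative[OF assms(1), of t] by simp
  qed
  then show ?thesis using has_derivative_zero_unique[of UNIV f a b] by auto
qed

lemma dird_line: "dird v (\<lambda>s. (s - c) *\<^sub>R p) t = v *\<^sub>R p" "dird v (\<lambda>s. s *\<^sub>R p) t = v *\<^sub>R p"
  by (rule dird_eqI[where f'="\<lambda>v. v *\<^sub>R p"]; auto intro!: derivative_eq_intros)+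

subsection \<open>Carnot groups\<close>

locale carnot =
  fixes gmul :: "('n::{finite,linorder}) group_law" and w :: "'n \<Rightarrow> nat" and step :: nat
  assumes carnot: "carnot_group gmul w step"
begin

lemma gmul_assoc: "gmul (gmul p q) r = gmul p (gmul q r)"
  and gmul_0_left [simp]: "gmul 0 p = p" and gmul_0_right [simp]: "gmul p 0 = p"
  and smooth_gmul_pair: "smooth (\<lambda>(p, q). gmul p q)"
  and gmul_line: "gmul (s *\<^sub>R v) (t *\<^sub>R v) = (s + t) *\<^sub>R v"
  and w_ge_1: "w j \<ge> 1"
  and span_bracket: "i \<ge> 1 \<Longrightarrow> span {lie_bracket gmul u v | u v. u \<in> layer w 1 \<and> v \<in> layer w i} = layer w (Suc i)"
  using carnot unfolding carnot_group_def by (blast, blast, blast, blast, blast, force, blast)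

lemmas gmul_inverse [simp] = carnot_group_inverse[OF carnot]

lemma gmul_cancel [simp]: "gmul (- p) (gmul p q) = q" "gmul p (gmul (- p) q) = q"
  by (simp_all flip: gmul_assoc)

lemma minus_gmul: "- gmul p q = gmul (- q) (- p)"
proof -
  have "gmul (gmul p q) (gmul (- q) (- p)) = 0" by (simp add: gmul_assoc)
  then show ?thesis using gmul_cancel(1)[of "gmul p q" "gmul (- q) (- p)"] by simp
qed

lemma smooth_gmul [intro]:
  fixes f g :: "'a::euclidean_space \<Rightarrow> 'n point"
  shows "smooth f \<Longrightarrow> smooth g \<Longrightarrow> smooth (\<lambda>x. gmul (f x) (g x))"
  using smooth_compose[OF smooth_gmul_pair smooth_Pair, of f g] by simp

text \<open>Smoothness is given for the joint group law, so partial derivatives are written as joint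
  ones; this is how \<open>X v\<close> and \<open>Th\<close> become smooth in the base
  point.\<close>

lemma dird_gmul_left: "dird v (gmul p) q = dird (0, v) (\<lambda>(p, q). gmul p q) (p, q)"
proof -
  have "dird v (\<lambda>q. (\<lambda>(p, q). gmul p q) (p, q)) q = dird (dird v (\<lambda>q. (p, q)) q) (\<lambda>(p, q). gmul p q) (p, q)"
    by (rule dird_compose[OF smooth_gmul_pair]) auto
  moreover have "dird v (\<lambda>q. (p, q)) q = (0, v)" by (intro dird_eqI) (auto intro!: derivative_eq_intros)
  ultimately show ?thesis by simp
qed

lemma dird_gmul_right: "dird v (\<lambda>p. gmul p q) p = dird (v, 0) (\<lambda>(p, q). gmul p q) (p, q)"
proof -
  have "dird v (\<lambda>p. (\<lambda>(p, q). gmul p q) (p, q)) p = dird (dird v (\<lambda>p. (p, q)) p) (\<lambda>(p, q). gmul p q) (p, q)"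
    by (rule dird_compose[OF smooth_gmul_pair]) auto
  moreover have "dird v (\<lambda>p. (p, q)) p = (v, 0)" by (intro dird_eqI) (auto intro!: derivative_eq_intros)
  ultimately show ?thesis by simp
qed

text \<open>The left-invariant field with value \<open>v\<close> at the identity is \<open>X v\<close>, the Maurer--Cartan form at \<open>p\<close> is \<open>Th p\<close>,
  inverse to \<open>v \<mapsto> X v p\<close>, and \<open>br\<close> is the Lie bracket on the tangent space at the identity.\<close>

definition X :: "'n point \<Rightarrow> 'n point \<Rightarrow> 'n point" where "X v p = dird v (gmul p) 0"

definition Th :: "'n point \<Rightarrow> 'n point \<Rightarrow> 'n point" where "Th p v = dird v (gmul (- p)) p"

definition lder :: "'n point \<Rightarrow> ('n point \<Rightarrow> 'b::real_normed_vector) \<Rightarrow> 'n point \<Rightarrow> 'b" where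
  "lder v h p = dird (X v p) h p"

definition br :: "'n point \<Rightarrow> 'n point \<Rightarrow> 'n point" where "br u v = dird u (X v) 0 - dird v (X u) 0"

lemma left_inv_field_eq: "left_inv_field gmul v = X v"
  by (simp add: left_inv_field_def X_def dird_def fun_eq_iff)

lemma smooth_gmul_left [intro]: "smooth (gmul p)"
  using smooth_gmul[of "\<lambda>_. p" "\<lambda>x. x"] by auto

lemma linear_X: "linear (\<lambda>v. X v p)"
  unfolding X_def by (intro linear_dird smooth_gmul_left)

lemma linear_Th: "linear (Th p)"
  unfolding Th_def by (intro linear_dird smooth_gmul_left)

lemma smooth_X [intro]: "smooth (X v)"
proof -
  have "smooth (\<lambda>p. dird (0, v) (\<lambda>(p, q). gmul p q) (p, 0))"
    by (rule smooth_compose[OF smooth_dird[OF smooth_gmul_pair]]) auto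
  then show ?thesis by (simp add: X_def[abs_def] dird_gmul_left)
qed

lemma smooth_Th: "smooth (\<lambda>p. Th p v)"
proof -
  have "smooth (\<lambda>p. dird (0, v) (\<lambda>(p, q). gmul p q) (- p, p))"
    by (rule smooth_compose[OF smooth_dird[OF smooth_gmul_pair]]) auto
  then show ?thesis by (simp add: Th_def[abs_def] dird_gmul_left)
qed

lemma smooth_Th_comp: "smooth f \<Longrightarrow> smooth g \<Longrightarrow> smooth (\<lambda>x. Th (f x) (g x))" for f :: "'a::euclidean_space \<Rightarrow> _"
  by (rule smooth_linear_family[where L="\<lambda>x. Th (f x)", OF linear_Th smooth_compose[OF smooth_Th]])

lemma X_0 [simp]: "X v 0 = v"
proof -
  have "gmul 0 = (\<lambda>x. x)" by auto
  then show ?thesis unfolding X_def by simp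
qed

lemma X_gmul: "X v (gmul p q) = dird (X v q) (gmul p) q"
proof -
  have "gmul (gmul p q) = (\<lambda>r. gmul p (gmul q r))" by (simp add: fun_eq_iff gmul_assoc)
  then show ?thesis unfolding X_def by (simp add: dird_compose[OF smooth_gmul_left smooth_gmul_left])
qed

lemma Th_X [simp]: "Th p (X v p) = v"
proof -
  have "dird v (\<lambda>q. gmul (- p) (gmul p q)) 0 = dird (dird v (gmul p) 0) (gmul (- p)) (gmul p 0)"
    by (rule dird_compose[OF smooth_gmul_left smooth_gmul_left])
  then show ?thesis by (simp add: Th_def X_def)
qed

lemma X_Th [simp]: "X (Th p v) p = v"
proof -
  have "dird v (\<lambda>q. gmul p (gmul (- p) q)) p = dird (dird v (gmul (- p)) p) (gmul p) (gmul (- p) p)"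
    by (rule dird_compose[OF smooth_gmul_left smooth_gmul_left])
  then show ?thesis by (simp add: Th_def X_def)
qed

lemma Th_0 [simp]: "Th 0 v = v"
  using Th_X[of 0 v] unfolding X_0 .

lemma lie_bracket_eq: "lie_bracket gmul u v = br u v"
  by (simp add: lie_bracket_def field_bracket_def left_inv_field_eq br_def dird_def)

lemma smooth_lder [intro]: "smooth h \<Longrightarrow> smooth (lder v h)"
proof -
  assume h: "smooth h"
  have "lder v h = (\<lambda>p. \<Sum>k\<in>UNIV. (X v p $ k) *\<^sub>R dird (axis k 1) h p)"
    by (rule ext, unfold lder_def, rule dird_vec_expand[OF h])
  then show ?thesis using h by (auto intro!: smooth_sum smooth_scaleR smooth_component smooth_dird)
qed

lemma lder_gmul: "smooth h \<Longrightarrow> lder v (\<lambda>q. h (gmul p q)) q = lder v h (gmul p q)"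
  unfolding lder_def by (simp add: dird_compose[OF _ smooth_gmul_left] X_gmul)

lemma lder_0: "lder v h 0 = dird v h 0" by (simp add: lder_def)

lemma lder_id: "lder v (\<lambda>x. x) = X v"
  by (simp add: lder_def[abs_def])

lemma lder_diff: "smooth f \<Longrightarrow> smooth g \<Longrightarrow> lder v (\<lambda>x. f x - g x) p = lder v f p - lder v g p"
  by (simp add: lder_def dird_diff)

lemma lder_add: "smooth f \<Longrightarrow> smooth g \<Longrightarrow> lder v (\<lambda>x. f x + g x) p = lder v f p + lder v g p"
  by (simp add: lder_def dird_add)

lemma linear_lder: "smooth h \<Longrightarrow> linear (\<lambda>v. lder v h p)"
  unfolding lder_def using linear_compose[OF linear_X linear_dird[of h p], of p] by (simp add: o_def)

lemma dird_eq_lder: "dird v h p = lder (Th p v) h p"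
  by (simp add: lder_def)

text \<open>At the identity the second-order parts cancel because second derivatives are symmetric,
  and the remaining first-order parts are the definition of \<open>br\<close>. Left translation
  carries this to every point, since \<open>lder\<close> commutes with it.\<close>

lemma lder_comm:
  fixes h :: "'n point \<Rightarrow> 'b::euclidean_space"
  assumes h: "smooth h"
  shows "lder u (lder v h) p - lder v (lder u h) p = lder (br u v) h p"
proof -
  have *: "lder u (lder v h) 0 - lder v (lder u h) 0 = lder (br u v) h 0"
    if h: "smooth h" for h :: "'n point \<Rightarrow> 'b"
  proof -
    have 1: "lder u (lder v h) 0 = dird u (dird v h) 0 + dird (dird u (X v) 0) h 0" for u v
    proof -
      have "lder u (lder v h) 0 = dird u (\<lambda>q. dird (X v q) h q) 0"
        by (simp add: lder_0 lder_def[of v, abs_def])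
      also have "\<dots> = dird u (\<lambda>q. dird (X v 0) h q) 0 + dird (dird u (X v) 0) h 0"
        by (rule dird_linear_family[where L="\<lambda>q v. dird v h q"]) (use h in \<open>auto intro: linear_dird smooth_dird\<close>)
      finally show ?thesis by simp
    qed
    show ?thesis unfolding 1 unfolding lder_0 br_def
      using dird_commute[OF h, of u v 0] linear_diff[OF linear_dird[OF h]] by simp
  qed
  have 2: "lder u (lder v h) p = lder u (lder v (\<lambda>q. h (gmul p q))) 0" for u v
  proof -
    have "lder v (\<lambda>q. h (gmul p q)) = (\<lambda>q. lder v h (gmul p q))" by (rule ext, rule lder_gmul[OF h])
    then show ?thesis using lder_gmul[OF smooth_lder[OF h, of v], of u p 0] by simp
  qed
  have hp: "smooth (\<lambda>q. h (gmul p q))" using smooth_compose[OF h smooth_gmul_left] .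
  show ?thesis unfolding 2 using *[OF hp] lder_gmul[OF h, of "br u v" p 0] by simp
qed

text \<open>The commutator identity for the coordinate functions, collected in the identity
  map.\<close>

lemma X_comm: "lder u (X v) p - lder v (X u) p = X (br u v) p"
  using lder_comm[OF smooth_id, of u v p] by (simp add: lder_id)

lemma bilinear_br: "bilinear br"
proof -
  have lin: "linear (br u)" for u
  proof -
    have "linear (\<lambda>v. dird u (X v) 0)"
    proof -
      have "dird u (X v) 0 = (\<Sum>k\<in>UNIV. (v $ k) *\<^sub>R dird u (X (axis k 1)) 0)" for v
      proof -
        have "X v = (\<lambda>p. \<Sum>k\<in>UNIV. (v $ k) *\<^sub>R X (axis k 1) p)"
          using linear_vec_expand[OF linear_X] by blast
        then have "dird u (X v) 0 = dird u (\<lambda>p. \<Sum>k\<in>UNIV. (v $ k) *\<^sub>R X (axis k 1) p) 0" by simp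
        then show ?thesis
          by (simp add: dird_sum smooth_scaleR smooth_X dird_linear_comp[OF bounded_linear_scaleR_right])
      qed
      then have "(\<lambda>v. dird u (X v) 0) = (\<lambda>v. \<Sum>k\<in>UNIV. (v $ k) *\<^sub>R dird u (X (axis k 1)) 0)" by (rule ext)
      moreover have "linear (\<lambda>v::'n point. \<Sum>k\<in>UNIV. (v $ k) *\<^sub>R dird u (X (axis k 1)) 0)"
        by (auto intro!: linearI simp: algebra_simps sum.distrib scaleR_sum_right)
      ultimately show ?thesis by (simp only:)
    qed
    then show ?thesis unfolding br_def by (intro linear_compose_sub linear_dird smooth_X)
  qed
  have br_anti: "br u v = - br v u" for u v by (simp add: br_def)
  have "linear (\<lambda>u. br u v)" for v
  proof -
    have "(\<lambda>u. br u v) = (\<lambda>u. - br v u)" by (rule ext, rule br_anti)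
    then show ?thesis using linear_compose_neg[OF lin, of v] by (simp only:)
  qed
  with lin show ?thesis by (simp add: bilinear_def)
qed

text \<open>Applied to the identity map at 0, \<open>lder v\<close> returns \<open>v\<close>, so the
  Jacobi identity is inherited from commutators of differential operators.\<close>

lemma jacobi: "br (br u v) x = br u (br v x) - br v (br u x)"
proof -
  let ?h = "\<lambda>x::'n point. x"
  have c: "lder (br a b) h = (\<lambda>p. lder a (lder b h) p - lder b (lder a h) p)" if "smooth h" for a b and h :: "'n point \<Rightarrow> 'n point"
    using lder_comm[OF that, of a b] by (simp add: fun_eq_iff)
  have s: "smooth (lder a (lder b ?h))" "smooth (lder a ?h)" "smooth (lder c (lder a (lder b ?h)))" for a b c by auto
  have "lder (br (br u v) x) ?h 0 = lder (br u (br v x)) ?h 0 - lder (br v (br u x)) ?h 0"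
    by (simp add: c lder_diff s)
  then show ?thesis by (simp add: lder_0)
qed

section \<open>The grading of the Lie bracket\<close>

lemma layer_iff: "v \<in> layer w i \<longleftrightarrow> (\<forall>j. w j \<noteq> i \<longrightarrow> v $ j = 0)"
proof
  assume "v \<in> layer w i"
  moreover have "layer w i \<subseteq> {v. \<forall>j. w j \<noteq> i \<longrightarrow> v $ j = 0}"
    unfolding layer_def by (rule span_minimal) (auto simp: axis_def subspace_def)
  ultimately show "\<forall>j. w j \<noteq> i \<longrightarrow> v $ j = 0" by blast
next
  assume *: "\<forall>j. w j \<noteq> i \<longrightarrow> v $ j = 0"
  have "v = (\<Sum>j\<in>UNIV. (v $ j) *\<^sub>R axis j 1)"
    using basis_expansion[of v] by (simp add: scalar_mult_eq_scaleR)
  also have "\<dots> \<in> layer w i"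
    unfolding layer_def
    by (intro subspace_sum[OF subspace_span]) (use * in \<open>metis (mono_tags, lifting) mem_Collect_eq scaleR_zero_left span_base span_mul span_zero\<close>)
  finally show "v \<in> layer w i" .
qed

lemma axis_in_layer: "axis j 1 \<in> layer w (w j)"
  unfolding layer_def by (intro span_base) blast

lemma subspace_layer: "subspace (layer w i)" by (simp add: layer_def)

text \<open>The definition only controls brackets with the first layer. Layer \<open>i + 1\<close>
  is spanned by brackets of \<open>a\<close> in layer 1 and \<open>b\<close> in layer
  \<open>i\<close>, and \<open>jacobi\<close> splits \<open>br (br a b) v\<close> into brackets
  covered by layer 1 and by the induction hypothesis. The index \<open>j\<close> is generalised
  because the second term brackets \<open>b\<close> with layer \<open>j + 1\<close>.\<close>

lemma br_layer:
  assumes "i \<ge> 1" shows "u \<in> layer w i \<Longrightarrow> j \<ge> 1 \<Longrightarrow> v \<in> layer w j \<Longrightarrow> br u v \<in> layer w (i + j)"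
  using assms
proof (induction i arbitrary: u v j rule: dec_induct)
  case base
  then have "br u v \<in> span {lie_bracket gmul u v | u v. u \<in> layer w 1 \<and> v \<in> layer w j}"
    by (intro span_base) (auto simp: lie_bracket_eq)
  then show ?case using span_bracket[of j] base by simp
next
  case (step i)
  have "u \<in> span {lie_bracket gmul u v | u v. u \<in> layer w 1 \<and> v \<in> layer w i}"
    using span_bracket[of i] step by simp
  then show ?case
  proof (induction rule: span_induct_alt)
    case base
    then show ?case using bilinear_br subspace_0[OF subspace_layer] by (simp add: bilinear_lzero)
  next
    case (step c x y)
    from step(1) obtain a b where ab: "x = br a b" "a \<in> layer w 1" "b \<in> layer w i" by (auto simp: lie_bracket_eq)
    have one: "br a z \<in> layer w (Suc k)" if "z \<in> layer w k" "k \<ge> 1" for z k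
      using span_bracket[of k] that ab(2) by (metis (mono_tags, lifting) lie_bracket_eq mem_Collect_eq span_base)
    have "br a (br b v) \<in> layer w (Suc (i + j))" using one[of "br b v" "i + j"] \<open>1 \<le> i\<close>
      step.IH \<open>\<And>u v j. u \<in> layer w i \<Longrightarrow> 1 \<le> j \<Longrightarrow> v \<in> layer w j \<Longrightarrow> br u v \<in> layer w (i + j)\<close> ab \<open>1 \<le> j\<close> \<open>v \<in> layer w j\<close> by simp
    moreover have "br b (br a v) \<in> layer w (i + Suc j)"
      using \<open>\<And>u v j. u \<in> layer w i \<Longrightarrow> 1 \<le> j \<Longrightarrow> v \<in> layer w j \<Longrightarrow> br u v \<in> layer w (i + j)\<close>[of b "Suc j"] ab one[of v j] \<open>1 \<le> j\<close> \<open>v \<in> layer w j\<close>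
      by simp
    ultimately have "br x v \<in> layer w (Suc i + j)"
      unfolding ab(1) jacobi by (auto intro: subspace_diff[OF subspace_layer])
    with step show ?case using bilinear_br
      by (auto simp: bilinear_ladd bilinear_lmul intro!: subspace_add[OF subspace_layer] subspace_scale[OF subspace_layer])
  qed
qed

text \<open>The grading in terms of structure constants, the form in which it enters the homogeneity
  of dilations and of \<open>d0\<close>.\<close>

lemma br_axis_nz: "br (axis i 1) (axis j 1) $ k \<noteq> 0 \<Longrightarrow> w k = w i + w j"
  using br_layer[OF w_ge_1 axis_in_layer w_ge_1 axis_in_layer, of i j] unfolding layer_iff by blast

lemma br_expand: "br u v = (\<Sum>i\<in>UNIV. \<Sum>j\<in>UNIV. (u $ i * v $ j) *\<^sub>R br (axis i 1) (axis j 1))"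
proof -
  have "br u v = (\<Sum>i\<in>UNIV. (u $ i) *\<^sub>R br (axis i 1) v)"
    by (rule linear_vec_expand[where L="\<lambda>u. br u v"]) (use bilinear_br in \<open>simp add: bilinear_def\<close>)
  moreover have "br (axis i 1) v = (\<Sum>j\<in>UNIV. (v $ j) *\<^sub>R br (axis i 1) (axis j 1))" for i
    by (rule linear_vec_expand) (use bilinear_br in \<open>simp add: bilinear_def\<close>)
  ultimately show ?thesis by (simp add: scaleR_sum_right)
qed

section \<open>Dilations as automorphisms\<close>

abbreviation dil :: "real \<Rightarrow> 'n point \<Rightarrow> 'n point" where "dil \<equiv> dilation w"

lemma linear_dil: "linear (dil l)"
  by (auto intro!: linearI simp: dilation_def vec_eq_iff algebra_simps)

lemma dil_br: "dil l (br u v) = br (dil l u) (dil l v)"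
proof -
  have "(l ^ w k) * ((u $ i * v $ j) * br (axis i 1) (axis j 1) $ k)
      = (dil l u $ i * dil l v $ j) * br (axis i 1) (axis j 1) $ k" for i j k
    using br_axis_nz[of i j k] by (cases "br (axis i 1) (axis j 1) $ k = 0") (auto simp: dilation_def power_add)
  then have "l ^ w k * (\<Sum>i\<in>UNIV. \<Sum>j\<in>UNIV. (u $ i * v $ j) * br (axis i 1) (axis j 1) $ k)
      = (\<Sum>i\<in>UNIV. \<Sum>j\<in>UNIV. (dil l u $ i * dil l v $ j) * br (axis i 1) (axis j 1) $ k)" for k
    unfolding sum_distrib_left by (intro sum.cong refl)
  then show ?thesis
    unfolding vec_eq_iff br_expand[of u v] br_expand[of "dil l u"] dilation_def[of w l "sum _ _"]
    by simp
qed

text \<open>Differentiating the constant \<open>Th q (X v q)\<close> expresses the derivative of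
  \<open>Th\<close> through that of \<open>X v\<close>, and antisymmetrising leaves the commutator
  of two fields. The vectors \<open>a\<close> and \<open>b\<close> are written as values of
  left-invariant fields at \<open>p\<close>.\<close>

lemma maurer_cartan:
  "dird a (\<lambda>q. Th q b) p - dird b (\<lambda>q. Th q a) p = - br (Th p a) (Th p b)"
proof -
  have 1: "dird (X u p) (\<lambda>q. Th q (X v p)) p = - Th p (lder u (X v) p)" for u v
  proof -
    have "dird (X u p) (\<lambda>q. Th q (X v q)) p = dird (X u p) (\<lambda>q. Th q (X v p)) p + Th p (dird (X u p) (X v) p)"
      by (rule dird_linear_family[OF linear_Th smooth_Th smooth_X])
    then show ?thesis by (simp add: lder_def add_eq_0_iff)
  qed
  have "dird (X u p) (\<lambda>q. Th q (X v p)) p - dird (X v p) (\<lambda>q. Th q (X u p)) p = - br u v" for u v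
  proof -
    have "Th p (lder u (X v) p) - Th p (lder v (X u) p) = br u v"
      using Th_X[of p "br u v"] unfolding X_comm[of u v p, symmetric] linear_diff[OF linear_Th[of p]] .
    then show ?thesis unfolding 1 by (simp add: algebra_simps)
  qed
  from this[of "Th p a" "Th p b"] show ?thesis by simp
qed

text \<open>This is where exponential coordinates are used: the line through \<open>p\<close> is a
  one-parameter subgroup, so its velocity \<open>p\<close> is left invariant along it.\<close>

lemma Th_self_scaled [simp]: "Th (t *\<^sub>R p) p = p"
proof -
  have "gmul (- (t *\<^sub>R p)) (s *\<^sub>R p) = (s - t) *\<^sub>R p" for s
    using gmul_line[of "- t" p s] by (simp add: algebra_simps)
  then have "dird 1 (\<lambda>s. gmul (- (t *\<^sub>R p)) (s *\<^sub>R p)) t = dird 1 (\<lambda>s. (s - t) *\<^sub>R p) t" by simp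
  moreover have "dird 1 (\<lambda>s. (s - t) *\<^sub>R p) t = p"
    by (simp add: dird_line)
  moreover have "dird 1 (\<lambda>s. gmul (- (t *\<^sub>R p)) (s *\<^sub>R p)) t = dird (dird 1 (\<lambda>s. s *\<^sub>R p) t) (gmul (- (t *\<^sub>R p))) (t *\<^sub>R p)"
    by (rule dird_compose[OF smooth_gmul_left]) auto
  moreover have "dird 1 (\<lambda>s. s *\<^sub>R p) t = p" by (simp add: dird_line)
  ultimately show ?thesis by (simp add: Th_def)
qed

lemma Th_self [simp]: "Th p p = p" using Th_self_scaled[of 1 p] by simp

lemma X_self_scaled [simp]: "X p (t *\<^sub>R p) = p" using X_Th[of "t *\<^sub>R p" p] by simp

text \<open>Maurer-Cartan along a ray: the equation solved by
  \<open>(1 - exp (- t ad p)) / ad p\<close> applied to \<open>v\<close>, the classical formula for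
  the differential of the exponential map. Its only coefficient is the bracket, so maps that
  preserve the bracket are compatible with \<open>Th\<close>.\<close>

lemma Th_curve_ode:
  "dird 1 (\<lambda>t. t *\<^sub>R Th (t *\<^sub>R p) v) t = v - br p (t *\<^sub>R Th (t *\<^sub>R p) v)"
proof -
  define M where "M q a b = dird a (\<lambda>q. Th q b) q" for q a b
  have M: "M q a b - M q b a = - br (Th q a) (Th q b)" for q a b unfolding M_def by (rule maurer_cartan)
  \<comment> \<open>Differentiating \<open>Th q q = q\<close> in direction \<open>v\<close>
    evaluates the term that the Maurer-Cartan equation leaves open.\<close>
  have "dird v (\<lambda>q. Th q q) q = M q v q + Th q (dird v (\<lambda>x. x) q)" for q
    unfolding M_def by (rule dird_linear_family[OF linear_Th smooth_Th smooth_id])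
  then have vq: "v = M q v q + Th q v" for q by simp
  have l3: "M q a (t *\<^sub>R b) = t *\<^sub>R M q a b" for q a b t
  proof -
    have "(\<lambda>q. Th q (t *\<^sub>R b)) = (\<lambda>q. t *\<^sub>R Th q b)" using linear_cmul[OF linear_Th] by blast
    then show ?thesis unfolding M_def by (simp add: dird_linear_comp[OF bounded_linear_scaleR_right smooth_Th])
  qed
  have "dird 1 (\<lambda>t. Th (t *\<^sub>R p) v) t = dird (dird 1 (\<lambda>t. t *\<^sub>R p) t) (\<lambda>q. Th q v) (t *\<^sub>R p)"
    by (rule dird_compose[OF smooth_Th]) auto
  also have "dird 1 (\<lambda>t. t *\<^sub>R p) t = p" by (simp add: dird_line)
  finally have d1: "dird 1 (\<lambda>t. Th (t *\<^sub>R p) v) t = M (t *\<^sub>R p) p v" by (simp add: M_def)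
  have sm: "smooth (\<lambda>t. Th (t *\<^sub>R p) v)" for p v :: "'n point" by (rule smooth_Th_comp) auto
  have "dird 1 (\<lambda>t. t *\<^sub>R Th (t *\<^sub>R p) v) t = t *\<^sub>R M (t *\<^sub>R p) p v + dird 1 (\<lambda>t. t) t *\<^sub>R Th (t *\<^sub>R p) v"
    unfolding d1[symmetric] by (rule dird_bilinear[OF bounded_bilinear_scaleR]) (auto intro: sm)
  also have "dird 1 (\<lambda>t. t) t = (1::real)" by simp
  also have "M (t *\<^sub>R p) p v = M (t *\<^sub>R p) v p - br p (Th (t *\<^sub>R p) v)" using M[of "t *\<^sub>R p" p v] by (simp add: algebra_simps)
  also have "t *\<^sub>R (M (t *\<^sub>R p) v p - br p (Th (t *\<^sub>R p) v)) = M (t *\<^sub>R p) v (t *\<^sub>R p) - br p (t *\<^sub>R Th (t *\<^sub>R p) v)"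
    using bilinear_br by (simp add: l3 algebra_simps bilinear_rmul)
  also have "M (t *\<^sub>R p) v (t *\<^sub>R p) = v - Th (t *\<^sub>R p) v" using vq[of "t *\<^sub>R p"] by (simp add: algebra_simps)
  finally show ?thesis by simp
qed

text \<open>By weights, \<open>ad p\<close> is strictly triangular, so the linear equation is solved coordinate by coordinate.\<close>

lemma linear_ode_unique:
  fixes b :: "real \<Rightarrow> 'n point"
  assumes b: "smooth b" "\<And>t. dird 1 b t = - br p (b t)" "b 0 = 0"
  shows "b t = 0"
proof -
  have "\<forall>k t. w k = m \<longrightarrow> b t $ k = 0" for m
  proof (induction m rule: less_induct)
    case (less m)
    show ?case
    proof (intro allI impI)
      fix k t assume k: "w k = m"
      have "dird 1 (\<lambda>t. b t $ k) s = 0" for s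
      proof -
        have "dird 1 (\<lambda>t. b t $ k) s = - br p (b s) $ k"
          using dird_linear_comp[OF bounded_linear_vec_nth b(1)] b(2) by simp
        also have "\<dots> = - (\<Sum>i\<in>UNIV. \<Sum>j\<in>UNIV. (p $ i * b s $ j) * br (axis i 1) (axis j 1) $ k)"
          by (subst br_expand) simp
        also have "(\<Sum>i\<in>UNIV. \<Sum>j\<in>UNIV. (p $ i * b s $ j) * br (axis i 1) (axis j 1) $ k) = 0"
        proof (intro sum.neutral ballI)
          fix i j
          show "(p $ i * b s $ j) * br (axis i 1) (axis j 1) $ k = 0"
          proof (cases "br (axis i 1) (axis j 1) $ k = 0")
            case False
            then have "w j < m" using br_axis_nz[OF False] w_ge_1[of i] k by linarith
            with less show ?thesis by auto
          qed simp
        qed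
        finally show ?thesis by simp
      qed
      then have "b t $ k = b 0 $ k"
        by (intro smooth_eq_if_deriv_eq_0[where f="\<lambda>t. b t $ k"] smooth_component b(1))
      then show "b t $ k = 0" by (simp add: b(3))
    qed
  qed
  then show ?thesis by (simp add: vec_eq_iff)
qed

text \<open>Multiplied by \<open>t\<close> and taken along the rays through \<open>p\<close> and
  \<open>dil l p\<close>, both sides solve the equation of \<open>Th_curve_ode\<close> for
  \<open>dil l p\<close> and \<open>dil l v\<close> and vanish at 0. The value at
  \<open>t = 1\<close> is the claim.\<close>

lemma dil_Th: "dil l (Th p v) = Th (dil l p) (dil l v)"
proof -
  define b where "b t = dil l (t *\<^sub>R Th (t *\<^sub>R p) v) - t *\<^sub>R Th (t *\<^sub>R dil l p) (dil l v)" for t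
  have bl: "bounded_linear (dil l)" using linear_dil by (simp add: linear_conv_bounded_linear)
  have sm: "smooth (\<lambda>t. t *\<^sub>R Th (t *\<^sub>R p) v)" for p v :: "'n point" by (intro smooth_scaleR smooth_Th_comp) auto
  have "b 1 = 0"
  proof (rule linear_ode_unique[where p="dil l p"])
    show "smooth b" unfolding b_def by (intro smooth_diff smooth_linear_comp[OF bl] sm)
    show "b 0 = 0" by (simp add: b_def linear_0[OF linear_dil])
    fix t
    have "dird 1 b t = dil l (dird 1 (\<lambda>t. t *\<^sub>R Th (t *\<^sub>R p) v) t) - dird 1 (\<lambda>t. t *\<^sub>R Th (t *\<^sub>R dil l p) (dil l v)) t"
      unfolding b_def using sm by (simp add: dird_diff smooth_linear_comp[OF bl] dird_linear_comp[OF bl])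
    also have "\<dots> = - br (dil l p) (b t)"
      unfolding Th_curve_ode linear_diff[OF linear_dil] dil_br b_def using bilinear_br by (simp add: bilinear_rsub)
    finally show "dird 1 b t = - br (dil l p) (b t)" .
  qed
  then show ?thesis by (simp add: b_def)
qed

lemma dil_X: "dil l (X v p) = X (dil l v) (dil l p)"
proof -
  have "dil l v = Th (dil l p) (dil l (X v p))" using dil_Th[of l p "X v p"] by simp
  then show ?thesis by simp
qed

text \<open>Multiplying the curve on the right by \<open>- s *\<^sub>R q\<close> gives a constant:
  both factors move with the velocity of the same one-parameter subgroup, in opposite
  directions.\<close>

lemma integral_curve_unique:
  assumes c: "smooth c" "\<And>s. dird 1 c s = X q (c s)"
  shows "c s = gmul (c 0) (s *\<^sub>R q)"
proof -
  let ?G = "\<lambda>(p, q). gmul p q"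
  let ?F = "\<lambda>s. gmul (c s) (- s *\<^sub>R q)"
  have "dird 1 ?F s = 0" for s
  proof -
    have "dird 1 (\<lambda>s. ?G (c s, - s *\<^sub>R q)) s = dird (dird 1 (\<lambda>s. (c s, - s *\<^sub>R q)) s) ?G (c s, - s *\<^sub>R q)"
      by (rule dird_compose[OF smooth_gmul_pair]) (intro smooth_Pair c smooth_scaleR smooth_minus smooth_id smooth_const)
    also have "dird 1 (\<lambda>s. (c s, - s *\<^sub>R q)) s = (X q (c s), - q)"
    proof -
      have d: "((\<lambda>s. (c s, - s *\<^sub>R q)) has_derivative (\<lambda>v. (dird v c s, - v *\<^sub>R q))) (at s)"
        using smooth_has_derivative[OF c(1)] by (auto intro!: derivative_eq_intros)
      show ?thesis using dird_eqI[OF d, of 1] c(2) by simp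
    qed
    also have "\<dots> = (X q (c s), 0) + - (0, q)" by simp
    also have "dird \<dots> ?G (c s, - s *\<^sub>R q) = dird (X q (c s)) (\<lambda>p. gmul p (- s *\<^sub>R q)) (c s) - dird q (gmul (c s)) (- s *\<^sub>R q)"
      unfolding dird_gmul_left dird_gmul_right
      by (simp only: linear_add[OF linear_dird[OF smooth_gmul_pair]] linear_neg[OF linear_dird[OF smooth_gmul_pair]]) simp
    \<comment> \<open>A factor \<open>t *\<^sub>R q\<close> placed between \<open>c s\<close> and
      \<open>- s *\<^sub>R q\<close> can be absorbed into either of them, as both \<open>q\<close>
      factors lie on one line; the two readings give the two sides.\<close>
    also have "dird q (gmul (c s)) (- s *\<^sub>R q) = dird (X q (c s)) (\<lambda>p. gmul p (- s *\<^sub>R q)) (c s)"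
    proof -
      have 1: "dird 1 (\<lambda>t. gmul (gmul (c s) (t *\<^sub>R q)) (- s *\<^sub>R q)) 0
          = dird (dird 1 (\<lambda>t. gmul (c s) (t *\<^sub>R q)) 0) (\<lambda>p. gmul p (- s *\<^sub>R q)) (gmul (c s) (0 *\<^sub>R q))"
        by (rule dird_compose[where g="\<lambda>t. gmul (c s) (t *\<^sub>R q)"]) (intro smooth_gmul smooth_scaleR smooth_const smooth_id)+
      have 2: "dird 1 (\<lambda>t. gmul (c s) (t *\<^sub>R q)) 0 = dird (dird 1 (\<lambda>t. t *\<^sub>R q) 0) (gmul (c s)) (0 *\<^sub>R q)"
        by (rule dird_compose[OF smooth_gmul_left]) auto
      have 3: "dird 1 (\<lambda>t. gmul (c s) ((t - s) *\<^sub>R q)) 0 = dird (dird 1 (\<lambda>t. (t - s) *\<^sub>R q) 0) (gmul (c s)) ((0 - s) *\<^sub>R q)"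
        by (rule dird_compose[OF smooth_gmul_left]) (intro smooth_scaleR smooth_diff smooth_const smooth_id)
      have 4: "dird 1 (\<lambda>t. t *\<^sub>R q) 0 = q" "dird 1 (\<lambda>t. (t - s) *\<^sub>R q) 0 = q"
        by (simp_all add: dird_line)
      have "gmul (gmul (c s) (t *\<^sub>R q)) (- s *\<^sub>R q) = gmul (c s) ((t - s) *\<^sub>R q)" for t
        unfolding gmul_assoc gmul_line by simp
      then show ?thesis using 1 2 3 unfolding 4 by (simp add: X_def)
    qed
    finally show ?thesis by simp
  qed
  then have "?F s = ?F 0"
    by (intro smooth_eq_if_deriv_eq_0[where f="?F"]) (auto intro!: smooth_gmul c smooth_scaleR smooth_minus)
  then have "gmul (?F s) (s *\<^sub>R q) = gmul (c 0) (s *\<^sub>R q)" by simp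
  then show ?thesis by (simp only: gmul_assoc gmul_line) simp
qed

text \<open>The curve \<open>gmul p (s *\<^sub>R q)\<close> follows \<open>X q\<close>; by
  \<open>dil_X\<close> its dilation follows \<open>X (dil l q)\<close> starting from
  \<open>dil l p\<close>, and \<open>integral_curve_unique\<close> identifies it.\<close>

lemma dil_gmul: "dil l (gmul p q) = gmul (dil l p) (dil l q)"
proof -
  have bl: "bounded_linear (dil l)" using linear_dil by (simp add: linear_conv_bounded_linear)
  have sm: "smooth (\<lambda>s::real. gmul p (s *\<^sub>R q))" by (intro smooth_gmul smooth_const smooth_scaleR smooth_id)
  have "dil l (gmul p (1 *\<^sub>R q)) = gmul (dil l (gmul p (0 *\<^sub>R q))) (1 *\<^sub>R dil l q)"
  proof (rule integral_curve_unique)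
    show "smooth (\<lambda>s. dil l (gmul p (s *\<^sub>R q)))" by (rule smooth_linear_comp[OF bl sm])
    fix s :: real
    have "dird 1 (\<lambda>s. gmul p (s *\<^sub>R q)) s = dird (dird 1 (\<lambda>s. s *\<^sub>R q) s) (gmul p) (s *\<^sub>R q)"
      by (rule dird_compose[OF smooth_gmul_left]) auto
    also have "dird 1 (\<lambda>s. s *\<^sub>R q) s = q" by (simp add: dird_line)
    also have "dird q (gmul p) (s *\<^sub>R q) = X q (gmul p (s *\<^sub>R q))" by (simp add: X_gmul)
    finally show "dird 1 (\<lambda>s. dil l (gmul p (s *\<^sub>R q))) s = X (dil l q) (dil l (gmul p (s *\<^sub>R q)))"
      using dird_linear_comp[OF bl sm] dil_X by simp
  qed
  then show ?thesis by simp
qed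

lemma lder_dil:
  assumes h: "smooth h" shows "lder v (\<lambda>x. h (dil l x)) p = lder (dil l v) h (dil l p)"
proof -
  have "dird (X v p) (\<lambda>x. h (dil l x)) p = dird (dird (X v p) (dil l) p) h (dil l p)"
    by (rule dird_compose[OF h smooth_linear[OF linear_dil]])
  then show ?thesis by (simp add: lder_def dird_linear[OF linear_dil] dil_X)
qed

end

subsection \<open>Differential forms\<close>

lemma bounded_bilinear_wedge: "bounded_bilinear (wedge :: ('n::{finite,linorder}) covector \<Rightarrow> _)"
proof -
  have "bilinear (wedge :: 'n covector \<Rightarrow> 'n covector \<Rightarrow> 'n covector)"
    unfolding bilinear_def
    by (auto intro!: linearI simp: wedge_def algebra_simps sum.distrib scaleR_sum_right)
  then show ?thesis by (simp add: bilinear_conv_bounded_bilinear)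
qed

interpretation wedge: bounded_bilinear "wedge :: ('n::{finite,linorder}) covector \<Rightarrow> _"
  by (rule bounded_bilinear_wedge)

lemma wedge_axis: "wedge (axis I 1) (axis J 1) = wedge_sign I J *\<^sub>R (axis (I \<union> J) 1 :: ('n::{finite,linorder}) covector)"
proof -
  have *: "(axis I (1::real) $ I' * axis J 1 $ J' * wedge_sign I' J') *\<^sub>R (axis (I' \<union> J') 1 :: 'n covector)
     = (if I' = I then if J' = J then wedge_sign I J *\<^sub>R axis (I \<union> J) 1 else 0 else 0)" for I' J'
    by (simp add: axis_def)
  have "(\<Sum>J'\<in>UNIV. if I' = I then if J' = J then c else 0 else 0) = (if I' = I then c else 0)"
    for I' and c :: "'n covector"
    by (cases "I' = I") simp_all
  then show ?thesis unfolding wedge_def * by simp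
qed

lemma covector_expand: "\<alpha> = (\<Sum>I\<in>UNIV. (\<alpha> $ I) *\<^sub>R (axis I 1 :: ('n::finite) covector))"
  using basis_expansion[of \<alpha>] by (simp add: scalar_mult_eq_scaleR)

lemma linear_covector_expand:
  fixes L :: "('n::finite) covector \<Rightarrow> 'b::real_vector"
  assumes "linear L" shows "L \<alpha> = (\<Sum>I\<in>UNIV. (\<alpha> $ I) *\<^sub>R L (axis I 1))"
  using linear_vec_expand[OF assms] .

lemma linear_covector_eqI:
  fixes L :: "('n::finite) covector \<Rightarrow> 'b::real_vector"
  assumes "linear L" "linear M" "\<And>I. L (axis I 1) = M (axis I 1)" shows "L \<alpha> = M \<alpha>"
  using linear_covector_expand[OF assms(1), of \<alpha>] linear_covector_expand[OF assms(2), of \<alpha>] assms(3) by simp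

lemma wedge_sign_singleton:
  "wedge_sign {j} J = (if j \<in> J then 0 else (-1) ^ card {i \<in> (J::('n::{finite,linorder}) set). i < j})"
proof -
  have "{(i, k). i \<in> {j} \<and> k \<in> J \<and> k < i} = Pair j ` {i \<in> J. i < j}" by auto
  then have "card {(i, k). i \<in> {j} \<and> k \<in> J \<and> k < i} = card {i \<in> J. i < j}"
    by (simp add: card_image inj_on_def)
  then show ?thesis by (auto simp: wedge_sign_def)
qed

lemma wedge_sign_insert:
  fixes i j :: "'n::{finite,linorder}"
  assumes "i \<noteq> j" "j \<notin> J" "i \<notin> J"
  shows "wedge_sign {i} (insert j J) = (if j < i then - wedge_sign {i} J else wedge_sign {i} J)"
proof -
  have "{k \<in> insert j J. k < i} = (if j < i then insert j {k \<in> J. k < i} else {k \<in> J. k < i})" by auto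
  then show ?thesis using assms by (simp add: wedge_sign_singleton)
qed

lemma wedge_axis_anticommute:
  "wedge (axis {i} 1) (wedge (axis {j} 1) \<beta>) = - wedge (axis {j} 1) (wedge (axis {i} 1) (\<beta> :: ('n::{finite,linorder}) covector))"
proof (rule linear_covector_eqI[where L="\<lambda>\<beta>. wedge (axis {i} 1) (wedge (axis {j} 1) \<beta>)" and M="\<lambda>\<beta>. - wedge (axis {j} 1) (wedge (axis {i} 1) \<beta>)"])
  show "linear (\<lambda>\<beta>. wedge (axis {i} 1) (wedge (axis {j} 1) (\<beta> :: 'n covector)))" for i j
    by (auto intro!: linearI simp: wedge.add_right wedge.scaleR_right)
  then show "linear (\<lambda>\<beta>. - wedge (axis {j} 1) (wedge (axis {i} 1) (\<beta> :: 'n covector)))"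
    by (rule linear_compose_neg)
  fix J
  show "wedge (axis {i} 1) (wedge (axis {j} 1) (axis J 1)) = - wedge (axis {j} 1) (wedge (axis {i} 1) (axis J 1 :: 'n covector))"
  proof (cases "i = j \<or> i \<in> J \<or> j \<in> J")
    case True then show ?thesis
      by (auto simp: wedge_axis wedge.scaleR_right wedge_sign_singleton)
  next
    case False
    moreover have "insert i (insert j J) = insert j (insert i J)" by blast
    ultimately show ?thesis
      by (cases i j rule: linorder_cases) (auto simp: wedge_axis wedge.scaleR_right wedge_sign_insert)
  qed
qed

definition cov :: "real^('n::finite) \<Rightarrow> 'n covector" where "cov a = (\<Sum>k\<in>UNIV. (a $ k) *\<^sub>R axis {k} 1)"

lemma wedge_cov: "wedge (cov a) \<beta> = (\<Sum>k\<in>UNIV. (a $ k) *\<^sub>R wedge (axis {k} 1) \<beta>)"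
  by (simp add: cov_def wedge.sum_left wedge.scaleR_left)

lemma wedge_cov_cov:
  "wedge (cov a) (wedge (cov b) \<beta>) = (\<Sum>k\<in>UNIV. \<Sum>l\<in>UNIV. (a $ k * b $ l) *\<^sub>R wedge (axis {k} 1) (wedge (axis {l} 1) \<beta>))"
  unfolding wedge_cov[of a] wedge_cov[of b] by (simp add: wedge.sum_right wedge.scaleR_right scaleR_sum_right)

lemma wedge_cov_anticommute: "wedge (cov a) (wedge (cov b) \<beta>) = - wedge (cov b) (wedge (cov a) \<beta>)"
proof -
  have f: "- (\<Sum>k\<in>UNIV. \<Sum>l\<in>UNIV. (b $ k * a $ l) *\<^sub>R wedge (axis {k} 1) (wedge (axis {l} 1) \<beta>))
     = (\<Sum>k\<in>UNIV. \<Sum>l\<in>UNIV. (a $ l * b $ k) *\<^sub>R wedge (axis {l} 1) (wedge (axis {k} 1) \<beta>))"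
    unfolding sum_negf[symmetric]
    by (intro sum.cong refl) (subst wedge_axis_anticommute, simp add: mult.commute)
  show ?thesis unfolding wedge_cov_cov f by (rule sum.swap)
qed

lemma cov_axis: "cov (axis j 1) = axis {j} 1"
  by (simp add: cov_def axis_def if_distrib[of "\<lambda>x. x *\<^sub>R _"] cong: if_cong)

section \<open>Coframes and the exterior algebra maps they induce\<close>

definition wedge_list :: "('n::{finite,linorder} \<Rightarrow> 'n covector) \<Rightarrow> 'n set \<Rightarrow> 'n covector" where
  "wedge_list t I = foldr (\<lambda>j. wedge (t j)) (sorted_list_of_set I) (axis {} 1)"

text \<open>For one-forms \<open>t j\<close> this is the algebra homomorphism of the exterior
  algebra sending \<open>axis {j} 1\<close> to \<open>t j\<close>; for the left-invariant coframe it
  is the change of frame.\<close>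

definition coframe_map :: "('n::{finite,linorder} \<Rightarrow> 'n covector) \<Rightarrow> 'n covector \<Rightarrow> 'n covector" where
  "coframe_map t \<gamma> = (\<Sum>I\<in>UNIV. (\<gamma> $ I) *\<^sub>R wedge_list t I)"

lemma wedge_list_empty: "wedge_list t {} = axis {} 1" by (simp add: wedge_list_def)

lemma wedge_list_insert_min:
  assumes "\<forall>a\<in>A. b < a" shows "wedge_list t (insert b A) = wedge (t b) (wedge_list t A)"
proof -
  have "b \<notin> A" using assms by blast
  then have "sorted_list_of_set (insert b A) = insort b (sorted_list_of_set A)"
    by (simp add: sorted_list_of_set.sorted_key_list_of_set_insert)
  also have "\<dots> = b # sorted_list_of_set A"
    using assms by (intro insort_is_Cons) (auto simp: less_imp_le)
  finally show ?thesis by (simp add: wedge_list_def)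
qed

lemma wedge_sign_min:
  assumes "\<forall>a\<in>A. (b::'n::{finite,linorder}) < a" shows "wedge_sign {b} A = 1"
proof -
  have b: "b \<notin> A" and e: "{i \<in> A. i < b} = {}" using assms by (auto dest: less_asym)
  show ?thesis using b by (simp only: wedge_sign_singleton e card.empty if_False power_0)
qed

lemma finite_min_induct [case_names empty insert]:
  fixes I :: "('n::{finite,linorder}) set"
  assumes "P {}" "\<And>b A. \<forall>a\<in>A. b < a \<Longrightarrow> P A \<Longrightarrow> P (insert b A)" shows "P I"
  using finite[of I] by (induction I rule: finite_linorder_min_induct) (use assms in auto)

text \<open>The factor \<open>t j\<close> moves past the smaller factors, one sign each, to its
  sorted place, and a repeated factor vanishes by antisymmetry. Induction peels off the least index,
  so that \<open>j\<close> has to be compared with that index only.\<close>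

lemma wedge_wedge_list:
  assumes "\<And>i. t i = cov (a i)"
  shows "wedge (t j) (wedge_list t I) = wedge_sign {j} I *\<^sub>R wedge_list t (insert j I)"
proof (induction I rule: finite_min_induct)
  case empty
  have "wedge_list t (insert j {}) = wedge (t j) (wedge_list t {})" by (rule wedge_list_insert_min) simp
  then show ?case by (simp add: wedge_sign_singleton)
next
  case (insert b A)
  consider "j < b" | "j = b" | "b < j" by (rule linorder_cases)
  then show ?case
  proof cases
    case 1
    then have m: "\<forall>a\<in>insert b A. j < a" using insert.hyps by (auto intro: less_trans)
    show ?thesis using wedge_list_insert_min[OF m, of t] wedge_sign_min[OF m] by simp
  next
    case 2
    have "wedge (t b) (wedge (t b) \<beta>) = 0" for \<beta>
      using wedge_cov_anticommute[of "a b" "a b" \<beta>] unfolding assms[symmetric] by (simp add: eq_neg_iff_add_eq_0 flip: scaleR_2)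
    then show ?thesis using 2 by (simp add: wedge_list_insert_min[OF insert.hyps(1)] wedge_sign_singleton)
  next
    case 3
    have "wedge (t j) (wedge_list t (insert b A)) = - wedge (t b) (wedge (t j) (wedge_list t A))"
      unfolding wedge_list_insert_min[OF insert.hyps(1)] assms by (rule wedge_cov_anticommute)
    also have "\<dots> = - (wedge_sign {j} A *\<^sub>R wedge (t b) (wedge_list t (insert j A)))"
      by (simp add: insert.IH wedge.scaleR_right)
    also have "wedge (t b) (wedge_list t (insert j A)) = wedge_list t (insert j (insert b A))"
      using wedge_list_insert_min[of "insert j A" b t] insert.hyps(1) 3 by (auto simp: insert_commute)
    also have "- (wedge_sign {j} A *\<^sub>R wedge_list t (insert j (insert b A))) = wedge_sign {j} (insert b A) *\<^sub>R wedge_list t (insert j (insert b A))"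
    proof (cases "j \<in> A")
      case False
      moreover have "b \<notin> A" using insert.hyps(1) by blast
      ultimately show ?thesis using wedge_sign_insert[of j b A] 3 by auto
    qed (simp add: wedge_sign_singleton)
    finally show ?thesis .
  qed
qed

lemma linear_coframe_map: "linear (coframe_map t)"
  by (auto intro!: linearI simp: coframe_map_def algebra_simps sum.distrib scaleR_sum_right)

lemma coframe_map_axis: "coframe_map t (axis I 1) = wedge_list t I"
  by (simp add: coframe_map_def axis_def if_distrib[of "\<lambda>x. x *\<^sub>R _"] cong: if_cong)

lemma coframe_map_wedge:
  assumes "\<And>i. t i = cov (a i)"
  shows "coframe_map t (wedge (axis {j} 1) \<gamma>) = wedge (t j) (coframe_map t \<gamma>)"
proof (rule linear_covector_eqI[where L="\<lambda>\<gamma>. coframe_map t (wedge (axis {j} 1) \<gamma>)" and M="\<lambda>\<gamma>. wedge (t j) (coframe_map t \<gamma>)"])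
  note l = linear_coframe_map[of t]
  show "linear (\<lambda>\<gamma>. coframe_map t (wedge (axis {j} 1) \<gamma>))" "linear (\<lambda>\<gamma>. wedge (t j) (coframe_map t \<gamma>))"
    by (auto intro!: linearI simp: wedge.add_right wedge.scaleR_right linear_add[OF l] linear_cmul[OF l])
  show "coframe_map t (wedge (axis {j} 1) (axis I 1)) = wedge (t j) (coframe_map t (axis I 1))" for I
    by (simp add: wedge_axis linear_cmul[OF l] coframe_map_axis) (rule wedge_wedge_list[OF assms, symmetric])
qed

text \<open>The composite respects wedge products with one-forms and fixes the generators because
  the coefficient matrices are inverse to each other; products are reached by peeling off the least
  factor.\<close>

lemma coframe_map_inverse:
  assumes t: "\<And>j. t j = cov (a j)" and s: "\<And>j. s j = cov (b j)"
    and inv: "\<And>j. (\<Sum>k\<in>UNIV. (a j $ k) *\<^sub>R s k) = axis {j} 1"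
  shows "coframe_map s (coframe_map t \<gamma>) = \<gamma>"
proof -
  note l = linear_coframe_map[of s]
  have "coframe_map s (wedge_list t I) = axis I 1" for I
  proof (induction I rule: finite_min_induct)
    case empty then show ?case by (simp add: wedge_list_empty coframe_map_axis)
  next
    case (insert b A)
    have 1: "wedge_list t (insert b A) = (\<Sum>k\<in>UNIV. (a b $ k) *\<^sub>R wedge (axis {k} 1) (wedge_list t A))"
      unfolding wedge_list_insert_min[OF insert.hyps(1)] t[of b] by (rule wedge_cov)
    have "coframe_map s (wedge_list t (insert b A)) = (\<Sum>k\<in>UNIV. (a b $ k) *\<^sub>R wedge (s k) (axis A 1))"
      unfolding 1 by (simp only: linear_sum[OF l] linear_cmul[OF l] coframe_map_wedge[OF s] insert.IH)
    also have "\<dots> = wedge (\<Sum>k\<in>UNIV. (a b $ k) *\<^sub>R s k) (axis A 1)"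
      by (simp add: wedge.sum_left wedge.scaleR_left)
    also have "\<dots> = axis (insert b A) 1" unfolding inv by (simp add: wedge_axis wedge_sign_min[OF insert.hyps(1)])
    finally show ?case .
  qed
  then show ?thesis
    using linear_covector_expand[OF linear_compose[OF linear_coframe_map[of t] l], of \<gamma>] covector_expand[of \<gamma>]
    by (simp add: coframe_map_axis)
qed

section \<open>The exterior differential in coordinates\<close>

lemma ext_d_eq: "ext_d \<omega> p = (\<Sum>j\<in>UNIV. wedge (axis {j} 1) (dird (axis j 1) \<omega> p))"
  by (simp add: ext_d_def dird_def)

lemma sum_antisym_eq_0:
  fixes F :: "'a \<Rightarrow> 'a \<Rightarrow> 'b::real_vector"
  assumes "\<And>i j. F i j = - F j i" shows "(\<Sum>i\<in>A. \<Sum>j\<in>A. F i j) = 0"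
proof -
  have "(\<Sum>i\<in>A. \<Sum>j\<in>A. F i j) = (\<Sum>i\<in>A. \<Sum>j\<in>A. F j i)" by (rule sum.swap)
  also have "\<dots> = - (\<Sum>i\<in>A. \<Sum>j\<in>A. F i j)" by (subst assms) (simp add: sum_negf)
  finally show ?thesis by (simp add: eq_neg_iff_add_eq_0 flip: scaleR_2)
qed

text \<open>Symmetric second derivatives are summed against the antisymmetric wedge product.\<close>

lemma ext_d_ext_d:
  assumes "smooth \<omega>" shows "ext_d (ext_d \<omega>) p = 0"
proof -
  have "dird (axis i 1) (ext_d \<omega>) p = (\<Sum>j\<in>UNIV. wedge (axis {j} 1) (dird (axis i 1) (dird (axis j 1) \<omega>) p))" for i
    unfolding ext_d_eq[abs_def] using assms
    by (simp add: dird_sum dird_linear_comp[OF wedge.bounded_linear_right] smooth_linear_comp[OF wedge.bounded_linear_right] smooth_dird)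
  then have "ext_d (ext_d \<omega>) p = (\<Sum>i\<in>UNIV. \<Sum>j\<in>UNIV. wedge (axis {i} 1) (wedge (axis {j} 1) (dird (axis i 1) (dird (axis j 1) \<omega>) p)))"
    unfolding ext_d_eq[of "ext_d \<omega>"] by (simp add: wedge.sum_right)
  also have "\<dots> = 0"
    by (rule sum_antisym_eq_0) (subst dird_commute[OF assms], rule wedge_axis_anticommute)
  finally show ?thesis .
qed

lemma ext_d_wedge_cov:
  assumes a: "smooth a" and b: "smooth \<beta>"
  shows "ext_d (\<lambda>p. wedge (cov (a p)) (\<beta> p)) p =
    (\<Sum>j\<in>UNIV. \<Sum>k\<in>UNIV. (dird (axis j 1) a p $ k) *\<^sub>R wedge (axis {j} 1) (wedge (axis {k} 1) (\<beta> p)))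
    - wedge (cov (a p)) (ext_d \<beta> p)"
proof -
  have bl: "bounded_linear cov"
    by (simp add: linear_conv_bounded_linear[symmetric] cov_def[abs_def])
       (auto intro!: linearI simp: algebra_simps sum.distrib scaleR_sum_right)
  have "dird v (\<lambda>p. wedge (cov (a p)) (\<beta> p)) p = wedge (cov (a p)) (dird v \<beta> p) + wedge (cov (dird v a p)) (\<beta> p)" for v
    using dird_bilinear[OF bounded_bilinear_wedge smooth_linear_comp[OF bl a] b] dird_linear_comp[OF bl a] by simp
  moreover have "wedge (axis {j} 1) (wedge (cov (a p)) c) = - wedge (cov (a p)) (wedge (axis {j} 1) c)" for j c
    unfolding cov_axis[symmetric] by (rule wedge_cov_anticommute)
  ultimately show ?thesis
    by (simp add: ext_d_eq wedge.add_right sum.distrib wedge_cov[of "dird _ _ _"] wedge.sum_right wedge.scaleR_right sum_subtractf)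
qed

context carnot
begin

section \<open>The left-invariant coframe\<close>

definition th :: "'n \<Rightarrow> 'n point \<Rightarrow> 'n point" where "th j p = (\<chi> k. Th p (axis k 1) $ j)"

text \<open>The rows of the matrix inverse to \<open>th\<close>: the coefficients of the coordinate
  covector \<open>axis {j} 1\<close> in the left-invariant coframe.\<close>

definition xi :: "'n \<Rightarrow> 'n point \<Rightarrow> 'n point" where "xi j p = (\<chi> k. X (axis k 1) p $ j)"

lemma theta_eq: "theta gmul j p = cov (th j p)"
  by (simp add: theta_def cov_def th_def Th_def dird_def)

abbreviation Fr :: "'n point \<Rightarrow> 'n covector \<Rightarrow> 'n covector" where
  "Fr p \<equiv> coframe_map (\<lambda>j. cov (th j p))"

lemma theta_set_eq: "theta_set gmul I p = wedge_list (\<lambda>j. cov (th j p)) I"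
  by (simp add: theta_set_def wedge_list_def theta_eq)

lemma frame_eq: "frame gmul p = Fr p"
  by (simp add: frame_def[abs_def] coframe_map_def[abs_def] theta_set_eq)

lemma sum_th_xi: "(\<Sum>k\<in>UNIV. (th j p $ k) *\<^sub>R cov (xi k p)) = axis {j} 1"
proof -
  have "(\<Sum>k\<in>UNIV. th j p $ k * xi k p $ l) = axis j 1 $ l" for l
  proof -
    have "axis l 1 $ j = Th p (X (axis l 1) p) $ j" by simp
    also have "Th p (X (axis l 1) p) $ j = (\<Sum>k\<in>UNIV. X (axis l 1) p $ k * Th p (axis k 1) $ j)"
      by (subst linear_vec_expand[OF linear_Th]) simp
    also have "axis l 1 $ j = axis j (1::real) $ l" by (simp add: axis_def)
    finally show ?thesis by (simp add: th_def xi_def mult.commute)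
  qed
  then have "(\<Sum>k\<in>UNIV. th j p $ k *\<^sub>R xi k p) = axis j 1" by (simp add: vec_eq_iff)
  moreover have "linear (cov :: 'n point \<Rightarrow> _)"
    by (auto intro!: linearI simp: cov_def algebra_simps sum.distrib scaleR_sum_right)
  ultimately show ?thesis using cov_axis[of j] by (metis (no_types, lifting) linear_cmul linear_sum sum.cong)
qed

lemma sum_xi_th: "(\<Sum>k\<in>UNIV. (xi j p $ k) *\<^sub>R cov (th k p)) = axis {j} 1"
proof -
  have "(\<Sum>k\<in>UNIV. xi j p $ k * th k p $ l) = axis j 1 $ l" for l
  proof -
    have "axis l 1 $ j = X (Th p (axis l 1)) p $ j" by simp
    also have "X (Th p (axis l 1)) p $ j = (\<Sum>k\<in>UNIV. Th p (axis l 1) $ k * X (axis k 1) p $ j)"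
      by (subst linear_vec_expand[OF linear_X]) simp
    also have "axis l 1 $ j = axis j (1::real) $ l" by (simp add: axis_def)
    finally show ?thesis by (simp add: th_def xi_def mult.commute)
  qed
  then have "(\<Sum>k\<in>UNIV. xi j p $ k *\<^sub>R th k p) = axis j 1" by (simp add: vec_eq_iff)
  moreover have "linear (cov :: 'n point \<Rightarrow> _)"
    by (auto intro!: linearI simp: cov_def algebra_simps sum.distrib scaleR_sum_right)
  ultimately show ?thesis using cov_axis[of j] by (metis (no_types, lifting) linear_cmul linear_sum sum.cong)
qed

lemma inv_Fr [simp]: "inv (Fr p) (Fr p \<gamma>) = \<gamma>"
proof -
  have "inj (Fr p)"
    by (rule inj_on_inverseI[where g="coframe_map (\<lambda>j. cov (xi j p))"]) (rule coframe_map_inverse[OF refl refl sum_th_xi])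
  then show ?thesis by simp
qed

lemma Fr_inv [simp]: "Fr p (inv (Fr p) \<gamma>) = \<gamma>"
proof -
  have "surj (Fr p)" using coframe_map_inverse[OF refl refl sum_xi_th] by (metis surjI)
  then show ?thesis by (rule surj_f_inv_f)
qed

lemma smooth_th: "smooth (th j)"
  unfolding th_def[abs_def] by (intro smooth_vec) (simp add: smooth_component smooth_Th)

lemma bounded_linear_cov: "bounded_linear (cov :: 'n point \<Rightarrow> _)"
  by (simp add: linear_conv_bounded_linear[symmetric] cov_def[abs_def])
     (auto intro!: linearI simp: algebra_simps sum.distrib scaleR_sum_right)

lemma smooth_wedge_list: "smooth (\<lambda>p. wedge_list (\<lambda>j. cov (th j p)) I)"
  by (induction I rule: finite_min_induct)
     (simp_all add: wedge_list_empty wedge_list_insert_min smooth_bilinear[OF bounded_bilinear_wedge]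
       smooth_linear_comp[OF bounded_linear_cov smooth_th])

lemma smooth_Fr: "smooth \<omega> \<Longrightarrow> smooth (\<lambda>p. Fr p (\<omega> p))"
  unfolding coframe_map_def by (intro smooth_sum smooth_scaleR smooth_component smooth_wedge_list)

text \<open>Wedge multiplication by the differential of the coframe form of index \<open>b\<close>,
  written with structure constants for an arbitrary coframe \<open>t\<close>. In this form it makes
  sense both at the identity and at \<open>p\<close>, and \<open>Fr p\<close> links the two.\<close>

definition struct_op :: "'n \<Rightarrow> ('n \<Rightarrow> 'n covector) \<Rightarrow> 'n covector \<Rightarrow> 'n covector" where
  "struct_op b t \<beta> = (- 1 / 2) *\<^sub>R (\<Sum>r\<in>UNIV. \<Sum>s\<in>UNIV. (br (axis r 1) (axis s 1) $ b) *\<^sub>R wedge (t r) (wedge (t s) \<beta>))"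

lemma struct_op_th:
  "(\<Sum>j\<in>UNIV. \<Sum>k\<in>UNIV. (dird (axis j 1) (th b) p $ k) *\<^sub>R wedge (axis {j} 1) (wedge (axis {k} 1) \<beta>))
     = struct_op b (\<lambda>j. cov (th j p)) \<beta>"
proof -
  define T where "T j k = dird (axis j 1) (\<lambda>q. Th q (axis k 1)) p $ b" for j k
  define E where "E j k = wedge (axis {j} 1) (wedge (axis {k} 1) \<beta>)" for j k
  have E: "E j k = - E k j" for j k unfolding E_def by (rule wedge_axis_anticommute)
  have T: "dird (axis j 1) (th b) p $ k = T j k" for j k
  proof -
    have "dird (axis j 1) (\<lambda>q. th b q $ k) p = dird (axis j 1) (th b) p $ k"
      by (rule dird_linear_comp[OF bounded_linear_vec_nth smooth_th])
    moreover have "dird (axis j 1) (\<lambda>q. Th q (axis k 1) $ b) p = T j k"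
      unfolding T_def by (rule dird_linear_comp[OF bounded_linear_vec_nth smooth_Th])
    ultimately show ?thesis by (simp add: th_def)
  qed
  have mc: "T j k - T k j = - br (Th p (axis j 1)) (Th p (axis k 1)) $ b" for j k
    unfolding T_def using maurer_cartan[of "axis j 1" "axis k 1" p] by (metis vector_minus_component vector_uminus_component)
  have swp: "(\<Sum>j\<in>UNIV. \<Sum>k\<in>UNIV. T k j *\<^sub>R E j k) = - (\<Sum>j\<in>UNIV. \<Sum>k\<in>UNIV. T j k *\<^sub>R E j k)"
    by (subst sum.swap, subst E) (simp add: sum_negf)
  \<comment> \<open>The wedge product sees only the antisymmetric part of \<open>T\<close>, and this
    part is given by \<open>maurer_cartan\<close>.\<close>
  have "2 *\<^sub>R (\<Sum>j\<in>UNIV. \<Sum>k\<in>UNIV. T j k *\<^sub>R E j k) = (\<Sum>j\<in>UNIV. \<Sum>k\<in>UNIV. (T j k - T k j) *\<^sub>R E j k)"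
    using swp by (simp add: scaleR_diff_left sum_subtractf scaleR_2)
  also have "\<dots> = - (\<Sum>j\<in>UNIV. \<Sum>k\<in>UNIV. \<Sum>r\<in>UNIV. \<Sum>s\<in>UNIV.
      (Th p (axis j 1) $ r * Th p (axis k 1) $ s * br (axis r 1) (axis s 1) $ b) *\<^sub>R E j k)"
    unfolding mc by (subst br_expand) (simp add: sum_negf scaleR_sum_left)
  also have "(\<Sum>j\<in>UNIV. \<Sum>k\<in>UNIV. \<Sum>r\<in>UNIV. \<Sum>s\<in>UNIV.
      (Th p (axis j 1) $ r * Th p (axis k 1) $ s * br (axis r 1) (axis s 1) $ b) *\<^sub>R E j k)
    = (\<Sum>r\<in>UNIV. \<Sum>s\<in>UNIV. \<Sum>j\<in>UNIV. \<Sum>k\<in>UNIV.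
      (Th p (axis j 1) $ r * Th p (axis k 1) $ s * br (axis r 1) (axis s 1) $ b) *\<^sub>R E j k)"
  proof -
    have "(\<Sum>j\<in>UNIV. \<Sum>k\<in>UNIV. \<Sum>r\<in>UNIV. \<Sum>s\<in>UNIV. F j k r s) = (\<Sum>r\<in>UNIV. \<Sum>s\<in>UNIV. \<Sum>j\<in>UNIV. \<Sum>k\<in>UNIV. F j k r s)"
      for F :: "'n \<Rightarrow> 'n \<Rightarrow> 'n \<Rightarrow> 'n \<Rightarrow> 'n covector"
    proof -
      have *: "(\<Sum>j\<in>UNIV. \<Sum>k\<in>UNIV. \<Sum>r\<in>UNIV. G j k r) = (\<Sum>r\<in>UNIV. \<Sum>j\<in>UNIV. \<Sum>k\<in>UNIV. G j k r)"
        for G :: "'n \<Rightarrow> 'n \<Rightarrow> 'n \<Rightarrow> 'n covector"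
      proof -
        have "(\<Sum>j\<in>UNIV. \<Sum>k\<in>UNIV. \<Sum>r\<in>UNIV. G j k r) = (\<Sum>j\<in>UNIV. \<Sum>r\<in>UNIV. \<Sum>k\<in>UNIV. G j k r)"
          by (rule sum.cong[OF refl], rule sum.swap)
        also have "\<dots> = (\<Sum>r\<in>UNIV. \<Sum>j\<in>UNIV. \<Sum>k\<in>UNIV. G j k r)" by (rule sum.swap)
        finally show ?thesis .
      qed
      show ?thesis unfolding *[of "\<lambda>j k r. \<Sum>s\<in>UNIV. F j k r s"] by (rule sum.cong[OF refl], rule *)
    qed
    then show ?thesis .
  qed
  also have "\<dots> = (\<Sum>r\<in>UNIV. \<Sum>s\<in>UNIV. (br (axis r 1) (axis s 1) $ b) *\<^sub>R wedge (cov (th r p)) (wedge (cov (th s p)) \<beta>))"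
    by (simp add: wedge_cov_cov scaleR_sum_right E_def th_def mult_ac)
  finally have "2 *\<^sub>R (\<Sum>j\<in>UNIV. \<Sum>k\<in>UNIV. T j k *\<^sub>R E j k) = 2 *\<^sub>R struct_op b (\<lambda>j. cov (th j p)) \<beta>"
    by (simp add: struct_op_def)
  then show ?thesis by (simp add: T E_def)
qed

definition dtheta :: "'n set \<Rightarrow> 'n point \<Rightarrow> 'n covector" where
  "dtheta I p = ext_d (\<lambda>q. wedge_list (\<lambda>j. cov (th j q)) I) p"

lemma dtheta_empty: "dtheta {} p = 0"
  by (simp add: dtheta_def wedge_list_empty ext_d_eq wedge.zero_right)

lemma dtheta_insert_min:
  assumes "\<forall>a\<in>A. b < a"
  shows "dtheta (insert b A) p = struct_op b (\<lambda>j. cov (th j p)) (wedge_list (\<lambda>j. cov (th j p)) A) - wedge (cov (th b p)) (dtheta A p)"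
  unfolding dtheta_def wedge_list_insert_min[OF assms] ext_d_wedge_cov[OF smooth_th smooth_wedge_list] struct_op_th ..

lemma th_0: "cov (th j 0) = axis {j} 1"
proof -
  have "th j 0 = axis j 1" by (simp add: th_def vec_eq_iff axis_def eq_commute)
  then show ?thesis by (simp add: cov_axis)
qed

lemma wedge_list_axis: "wedge_list (\<lambda>j. axis {j} 1) I = axis (I :: 'n set) 1"
  by (induction I rule: finite_min_induct)
     (simp_all add: wedge_list_empty wedge_list_insert_min wedge_axis wedge_sign_min)

lemma Fr_0: "Fr 0 \<gamma> = \<gamma>"
  using covector_expand[of \<gamma>] by (simp add: th_0 coframe_map_def wedge_list_axis)

lemma Fr_struct_op: "Fr p (struct_op b (\<lambda>j. axis {j} 1) \<beta>) = struct_op b (\<lambda>j. cov (th j p)) (Fr p \<beta>)"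
  unfolding struct_op_def
  by (simp only: linear_cmul[OF linear_coframe_map] linear_sum[OF linear_coframe_map] coframe_map_wedge[OF refl])

text \<open>The recursion \<open>dtheta_insert_min\<close> involves structure constants and wedge
  products alone, and \<open>Fr p\<close> transports both from the identity to
  \<open>p\<close>.\<close>

lemma dtheta_left_invariant: "dtheta I p = Fr p (dtheta I 0)"
proof (induction I rule: finite_min_induct)
  case empty then show ?case by (simp add: dtheta_empty linear_0[OF linear_coframe_map])
next
  case (insert b A)
  show ?case
    unfolding dtheta_insert_min[OF insert.hyps(1)] insert.IH
    by (simp only: th_0 wedge_list_axis linear_diff[OF linear_coframe_map] Fr_struct_op coframe_map_wedge[OF refl] coframe_map_axis)
qed

lemma d0_axis: "d0 gmul (axis I 1) = dtheta I 0"
proof -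
  have i: "inv (Fr 0) \<gamma> = \<gamma>" for \<gamma> using inv_Fr[of 0 \<gamma>] unfolding Fr_0 .
  have "form_d gmul (\<lambda>_. axis I 1) 0 = dtheta I 0" for I
    unfolding form_d_def frame_eq i dtheta_def coframe_map_axis ..
  then show ?thesis by (simp add: d0_def axis_def[of I] if_distrib[of "\<lambda>x. x *\<^sub>R _"] cong: if_cong)
qed

lemma linear_d0: "linear (d0 gmul)"
  by (auto intro!: linearI simp: d0_def algebra_simps sum.distrib scaleR_sum_right)

text \<open>In the left-invariant frame \<open>d\<close> splits: differentiating coefficients along
  \<open>axis j 1\<close> raises the weight by \<open>w j\<close>, while the differentials of the
  frame forms make up the weight-preserving \<open>d0\<close>. The weight arguments for the Rumin
  complex start from this splitting.\<close>

lemma form_d_eq: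
  assumes w: "smooth \<omega>"
  shows "form_d gmul \<omega> p = (\<Sum>j\<in>UNIV. wedge (axis {j} 1) (lder (axis j 1) \<omega> p)) + d0 gmul (\<omega> p)"
proof -
  let ?W = "\<lambda>p I. wedge_list (\<lambda>j. cov (th j p)) I"
  have d: "dird v (\<lambda>x. Fr x (\<omega> x)) p = Fr p (dird v \<omega> p) + (\<Sum>I\<in>UNIV. (\<omega> p $ I) *\<^sub>R dird v (\<lambda>x. ?W x I) p)" for v
    unfolding coframe_map_def
    using w by (simp add: dird_sum smooth_scaleR smooth_component smooth_wedge_list dird_bilinear[OF bounded_bilinear_scaleR]
        dird_linear_comp[OF bounded_linear_vec_nth] sum.distrib)
  have "ext_d (\<lambda>x. Fr x (\<omega> x)) p = (\<Sum>j\<in>UNIV. wedge (axis {j} 1) (Fr p (dird (axis j 1) \<omega> p)))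
      + (\<Sum>j\<in>UNIV. \<Sum>I\<in>UNIV. (\<omega> p $ I) *\<^sub>R wedge (axis {j} 1) (dird (axis j 1) (\<lambda>x. ?W x I) p))"
    unfolding ext_d_eq d by (simp add: wedge.add_right sum.distrib wedge.sum_right wedge.scaleR_right)
  also have "(\<Sum>j\<in>UNIV. \<Sum>I\<in>UNIV. (\<omega> p $ I) *\<^sub>R wedge (axis {j} 1) (dird (axis j 1) (\<lambda>x. ?W x I) p))
      = (\<Sum>I\<in>UNIV. (\<omega> p $ I) *\<^sub>R dtheta I p)"
    by (subst sum.swap) (simp add: dtheta_def ext_d_eq scaleR_sum_right)
  also have "\<dots> = Fr p (d0 gmul (\<omega> p))"
    unfolding linear_covector_expand[OF linear_d0, of "\<omega> p"] d0_axis
    by (simp only: linear_cmul[OF linear_coframe_map] linear_sum[OF linear_coframe_map] dtheta_left_invariant[symmetric])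
  \<comment> \<open>Expanding \<open>axis {j} 1\<close> in the left-invariant coframe turns
    coordinate derivatives into left-invariant ones.\<close>
  also have "(\<Sum>j\<in>UNIV. wedge (axis {j} 1) (Fr p (dird (axis j 1) \<omega> p)))
      = (\<Sum>j\<in>UNIV. \<Sum>k\<in>UNIV. (xi j p $ k) *\<^sub>R wedge (cov (th k p)) (Fr p (dird (axis j 1) \<omega> p)))"
    by (subst sum_xi_th[symmetric, of _ p]) (simp add: wedge.sum_left wedge.scaleR_left)
  also have "\<dots> = (\<Sum>k\<in>UNIV. \<Sum>j\<in>UNIV. (xi j p $ k) *\<^sub>R wedge (cov (th k p)) (Fr p (dird (axis j 1) \<omega> p)))"
    by (rule sum.swap)
  also have "\<dots> = (\<Sum>k\<in>UNIV. Fr p (wedge (axis {k} 1) (lder (axis k 1) \<omega> p)))"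
  proof (rule sum.cong[OF refl])
    fix k
    have "lder (axis k 1) \<omega> p = (\<Sum>j\<in>UNIV. (xi j p $ k) *\<^sub>R dird (axis j 1) \<omega> p)"
      unfolding lder_def by (subst dird_vec_expand[OF w]) (simp add: xi_def)
    then show "(\<Sum>j\<in>UNIV. (xi j p $ k) *\<^sub>R wedge (cov (th k p)) (Fr p (dird (axis j 1) \<omega> p)))
        = Fr p (wedge (axis {k} 1) (lder (axis k 1) \<omega> p))"
      by (simp only: coframe_map_wedge[OF refl] linear_cmul[OF linear_coframe_map] linear_sum[OF linear_coframe_map] wedge.sum_right wedge.scaleR_right)
  qed
  also have "\<dots> + Fr p (d0 gmul (\<omega> p)) = Fr p ((\<Sum>j\<in>UNIV. wedge (axis {j} 1) (lder (axis j 1) \<omega> p)) + d0 gmul (\<omega> p))"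
    by (simp add: linear_add[OF linear_coframe_map] linear_sum[OF linear_coframe_map])
  finally show ?thesis by (simp add: form_d_def frame_eq)
qed

lemma smooth_form_d: "smooth \<omega> \<Longrightarrow> smooth (form_d gmul \<omega>)"
proof -
  assume w: "smooth \<omega>"
  have "bounded_linear (d0 gmul)" using linear_d0 by (simp add: linear_conv_bounded_linear)
  then have "smooth (\<lambda>p. (\<Sum>j\<in>UNIV. wedge (axis {j} 1) (lder (axis j 1) \<omega> p)) + d0 gmul (\<omega> p))"
    using w by (intro smooth_add smooth_sum smooth_linear_comp[OF wedge.bounded_linear_right] smooth_lder) (auto intro: smooth_linear_comp)
  then show ?thesis by (simp add: form_d_eq[OF w, abs_def])
qed

lemma form_d_form_d:
  assumes w: "smooth \<omega>" shows "form_d gmul (form_d gmul \<omega>) p = 0"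
proof -
  have "(\<lambda>x. Fr x (form_d gmul \<omega> x)) = ext_d (\<lambda>x. Fr x (\<omega> x))"
    by (simp add: form_d_def frame_eq fun_eq_iff)
  then have "form_d gmul (form_d gmul \<omega>) p = inv (Fr p) (Fr p 0)"
    using ext_d_ext_d[OF smooth_Fr[OF w], of p] by (simp add: form_d_def frame_eq linear_0[OF linear_coframe_map])
  then show ?thesis by simp
qed

lemma form_d_diff:
  assumes "smooth \<alpha>" "smooth \<beta>" shows "form_d gmul (\<lambda>x. \<alpha> x - \<beta> x) p = form_d gmul \<alpha> p - form_d gmul \<beta> p"
  using assms by (simp add: form_d_eq smooth_diff lder_diff linear_diff[OF linear_d0] wedge.diff_right sum_subtractf)

lemma form_d_add:
  assumes "smooth \<alpha>" "smooth \<beta>" shows "form_d gmul (\<lambda>x. \<alpha> x + \<beta> x) p = form_d gmul \<alpha> p + form_d gmul \<beta> p"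
  using assms by (simp add: form_d_eq smooth_add lder_add linear_add[OF linear_d0] wedge.add_right sum.distrib)

section \<open>Weights of forms\<close>

definition wt :: "'n set \<Rightarrow> nat" where "wt I = sum w I"

definition homog :: "nat \<Rightarrow> nat \<Rightarrow> 'n covector \<Rightarrow> bool" where
  "homog m k \<alpha> \<longleftrightarrow> (\<forall>I. \<alpha> $ I \<noteq> 0 \<longrightarrow> wt I = m \<and> card I = k)"

lemma wedge_axis_nth_nz:
  assumes "wedge (axis {j} 1) \<alpha> $ J \<noteq> 0" shows "\<exists>I. j \<notin> I \<and> J = insert j I \<and> \<alpha> $ I \<noteq> 0"
proof -
  have "wedge (axis {j} 1) \<alpha> = (\<Sum>I\<in>UNIV. (\<alpha> $ I) *\<^sub>R wedge (axis {j} 1) (axis I 1))"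
    by (rule linear_covector_expand) (auto intro!: linearI simp: wedge.add_right wedge.scaleR_right)
  then have "(\<Sum>I\<in>UNIV. (\<alpha> $ I) * (wedge_sign {j} I * axis (insert j I) 1 $ J)) \<noteq> 0"
    using assms by (simp add: wedge_axis mult.assoc)
  then obtain I where "(\<alpha> $ I) * (wedge_sign {j} I * axis (insert j I) 1 $ J) \<noteq> 0" by (metis (mono_tags, lifting) sum.neutral)
  then show ?thesis by (auto simp: axis_def wedge_sign_singleton split: if_splits)
qed

lemma homog_wedge: "homog m k \<alpha> \<Longrightarrow> homog (m + w j) (Suc k) (wedge (axis {j} 1) \<alpha>)"
  unfolding homog_def using wedge_axis_nth_nz[of j \<alpha>] by (fastforce simp: wt_def)

lemma homog_0: "homog m k 0" by (simp add: homog_def)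

lemma homog_diff: "homog m k \<alpha> \<Longrightarrow> homog m k \<beta> \<Longrightarrow> homog m k (\<alpha> - \<beta>)"
  unfolding homog_def by (metis diff_self vector_minus_component)

lemma homog_scale: "homog m k \<alpha> \<Longrightarrow> homog m k (c *\<^sub>R \<alpha>)"
  unfolding homog_def by fastforce

lemma homog_sum: "(\<And>i. i \<in> S \<Longrightarrow> homog m k (f i)) \<Longrightarrow> homog m k (sum f S)"
  unfolding homog_def by (metis (mono_tags, lifting) sum.neutral sum_component)

lemma homog_struct_op:
  assumes "homog m k \<beta>" shows "homog (m + w b) (Suc (Suc k)) (struct_op b (\<lambda>j. axis {j} 1) \<beta>)"
  unfolding struct_op_def
proof (rule homog_scale, rule homog_sum, rule homog_sum)
  fix r s
  show "homog (m + w b) (Suc (Suc k)) ((br (axis r 1) (axis s 1) $ b) *\<^sub>R wedge (axis {r} 1) (wedge (axis {s} 1) \<beta>))"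
  proof (cases "br (axis r 1) (axis s 1) $ b = 0")
    case False
    then show ?thesis
      using homog_scale[OF homog_wedge[OF homog_wedge[OF assms, of s], of r]] br_axis_nz[OF False] by (simp add: add_ac)
  qed (simp add: homog_0)
qed

text \<open>In the recursion for \<open>dtheta\<close> the factor of index \<open>b\<close> is
  replaced by two factors whose weights add up to \<open>w b\<close>, by \<open>br_axis_nz\<close>;
  so the weight is kept while the degree grows by one.\<close>

lemma homog_d0_axis: "homog (wt I) (Suc (card I)) (d0 gmul (axis I 1))"
proof (induction I rule: finite_min_induct)
  case empty then show ?case by (simp add: d0_axis dtheta_empty homog_0)
next
  case (insert b A)
  have "b \<notin> A" using insert.hyps by blast
  then have e: "wt (insert b A) = wt A + w b" "card (insert b A) = Suc (card A)" by (auto simp: wt_def)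
  have h: "homog (wt A) (card A) (axis A 1)" by (simp add: homog_def axis_def)
  show ?case
    unfolding d0_axis dtheta_insert_min[OF insert.hyps(1)] th_0 wedge_list_axis e
    by (intro homog_diff homog_struct_op homog_wedge h insert.IH[unfolded d0_axis])
qed

lemma d0_nth_nz: "d0 gmul (axis I 1) $ J \<noteq> 0 \<Longrightarrow> wt J = wt I \<and> card J = Suc (card I)"
  using homog_d0_axis[of I] by (auto simp: homog_def)

end

subsection \<open>The Rumin differential in degree \<open>n - 1\<close>\<close>

lemma kernel_adjoint_comp:
  assumes "linear (L :: 'a::euclidean_space \<Rightarrow> 'b::euclidean_space)" "adjoint L (L \<alpha>) = 0"
  shows "L \<alpha> = 0"
  using adjoint_works[OF assms(1), of \<alpha> "L \<alpha>"] assms(2) by simp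

lemma least_squares_ex1:
  \<comment> \<open>Justifies the definite description in \<open>d0_inv\<close>: the part of
    \<open>\<beta>\<close> orthogonal to the range is killed by the adjoint, and a preimage of the
    rest becomes unique once its kernel component is removed.\<close>
  fixes L :: "'a::euclidean_space \<Rightarrow> 'b::euclidean_space"
  assumes L: "linear L"
  shows "\<exists>!\<alpha>. \<alpha> \<in> {\<gamma>. L \<gamma> = 0}\<^sup>\<bottom> \<and> adjoint L (L \<alpha>) = adjoint L \<beta>"
proof -
  let ?K = "{\<gamma>. L \<gamma> = 0}"
  have K: "subspace ?K" using L by (auto simp: subspace_def linear_0 linear_add linear_cmul)
  have R: "subspace (range L)" using linear_subspace_image[OF L subspace_UNIV] .
  note A = adjoint_linear[OF L]
  have "\<beta> \<in> range L + (range L)\<^sup>\<bottom>" using subspace_sum_orthogonal_comp[OF R] by simp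
  then obtain y z where b: "\<beta> = L y + z" and z: "z \<in> (range L)\<^sup>\<bottom>" by (auto elim!: set_plus_elim)
  have "x \<bullet> adjoint L z = 0" for x
    using z adjoint_works[OF L, of x z] by (auto simp: orthogonal_comp_def orthogonal_def)
  then have "adjoint L z = 0" using inner_eq_zero_iff by blast
  then have b': "adjoint L \<beta> = adjoint L (L y)" by (simp add: b linear_add[OF A])
  have "y \<in> ?K + ?K\<^sup>\<bottom>" using subspace_sum_orthogonal_comp[OF K] by simp
  then obtain k a where y: "y = k + a" "L k = 0" "a \<in> ?K\<^sup>\<bottom>" by (auto elim!: set_plus_elim)
  have "adjoint L (L a) = adjoint L \<beta>" using y by (simp add: b' linear_add[OF L])
  moreover have "a = a'" if a': "a' \<in> ?K\<^sup>\<bottom>" "adjoint L (L a') = adjoint L \<beta>" for a'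
  proof -
    have "adjoint L (L (a - a')) = 0"
      using a' \<open>adjoint L (L a) = adjoint L \<beta>\<close> by (simp add: linear_diff[OF L] linear_diff[OF A])
    then have "a - a' \<in> ?K" using kernel_adjoint_comp[OF L] by blast
    moreover have "a - a' \<in> ?K\<^sup>\<bottom>" using y(3) a'(1) by (rule subspace_diff[OF subspace_orthogonal_comp])
    ultimately have "(a - a') \<bullet> (a - a') = 0" unfolding orthogonal_comp_def orthogonal_def by blast
    then show ?thesis by simp
  qed
  ultimately show ?thesis using y(3) by blast
qed

context carnot
begin

section \<open>The partial inverse of d0 and the splitting into E and F\<close>

abbreviation "D0 \<equiv> d0 gmul"
abbreviation "D0T \<equiv> adjoint (d0 gmul)"
abbreviation "Di \<equiv> d0_inv gmul"

lemma linear_D0T: "linear D0T" by (rule adjoint_linear[OF linear_d0])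

lemma inner_D0T: "x \<bullet> D0T y = D0 x \<bullet> y" by (rule adjoint_works[OF linear_d0])

lemma Di_works: "Di \<beta> \<in> {\<gamma>. D0 \<gamma> = 0}\<^sup>\<bottom>" "D0T (D0 (Di \<beta>)) = D0T \<beta>"
  using theI'[OF least_squares_ex1[OF linear_d0, of \<beta>]] unfolding d0_inv_def by blast+

lemma Di_eqI: "\<alpha> \<in> {\<gamma>. D0 \<gamma> = 0}\<^sup>\<bottom> \<Longrightarrow> D0T (D0 \<alpha>) = D0T \<beta> \<Longrightarrow> Di \<beta> = \<alpha>"
  using least_squares_ex1[OF linear_d0, of \<beta>] Di_works[of \<beta>] by blast

lemma linear_Di: "linear Di"
proof (rule linearI)
  show "Di (x + y) = Di x + Di y" for x y
    by (rule Di_eqI)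
       (rule subspace_add[OF subspace_orthogonal_comp Di_works(1) Di_works(1)],
        simp only: linear_add[OF linear_d0] linear_add[OF linear_D0T] Di_works(2))
  show "Di (c *\<^sub>R x) = c *\<^sub>R Di x" for c x
    by (rule Di_eqI)
       (rule subspace_scale[OF subspace_orthogonal_comp Di_works(1)],
        simp only: linear_cmul[OF linear_d0] linear_cmul[OF linear_D0T] Di_works(2))
qed

lemma Di_eq_0: "D0T \<beta> = 0 \<Longrightarrow> Di \<beta> = 0"
  by (rule Di_eqI) (auto simp: subspace_0[OF subspace_orthogonal_comp] linear_0[OF linear_d0] linear_0[OF linear_D0T])

lemma Di_D0: "\<gamma> \<in> {\<gamma>. D0 \<gamma> = 0}\<^sup>\<bottom> \<Longrightarrow> Di (D0 \<gamma>) = \<gamma>"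
  by (rule Di_eqI) auto

lemma smooth_Di: "smooth \<beta> \<Longrightarrow> smooth (\<lambda>x. Di (\<beta> x))"
  by (rule smooth_linear_comp[OF linear_Di[unfolded linear_conv_bounded_linear]])

definition wproj :: "nat \<Rightarrow> 'n covector \<Rightarrow> 'n covector" where
  "wproj m \<alpha> = (\<chi> I. if wt I = m then \<alpha> $ I else 0)"

lemma wproj_D0: "wproj m (D0 \<alpha>) = D0 (wproj m \<alpha>)"
proof -
  have "wproj m (D0 \<alpha>) $ J = D0 (wproj m \<alpha>) $ J" for J
  proof -
    have e: "D0 \<beta> $ J = (\<Sum>I\<in>UNIV. \<beta> $ I * D0 (axis I 1) $ J)" for \<beta>
      by (subst linear_covector_expand[OF linear_d0]) simp
    have "(if wt J = m then \<alpha> $ I * D0 (axis I 1) $ J else 0) = wproj m \<alpha> $ I * D0 (axis I 1) $ J" for I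
      using d0_nth_nz[of I J] by (cases "D0 (axis I 1) $ J = 0") (auto simp: wproj_def)
    then have "(\<Sum>I\<in>UNIV. if wt J = m then \<alpha> $ I * D0 (axis I 1) $ J else 0) = (\<Sum>I\<in>UNIV. wproj m \<alpha> $ I * D0 (axis I 1) $ J)"
      by (intro sum.cong refl)
    then have "(if wt J = m then (\<Sum>I\<in>UNIV. \<alpha> $ I * D0 (axis I 1) $ J) else 0) = (\<Sum>I\<in>UNIV. wproj m \<alpha> $ I * D0 (axis I 1) $ J)"
      by (cases "wt J = m") simp_all
    then show ?thesis unfolding e[symmetric] by (simp add: wproj_def)
  qed
  then show ?thesis by (simp add: vec_eq_iff)
qed

lemma inner_wproj: "wproj m \<alpha> \<bullet> \<beta> = \<alpha> \<bullet> wproj m \<beta>"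
  by (auto simp: inner_vec_def wproj_def intro!: sum.cong)

lemma wproj_D0T: "wproj m (D0T \<alpha>) = D0T (wproj m \<alpha>)"
proof -
  have "x \<bullet> wproj m (D0T \<alpha>) = x \<bullet> D0T (wproj m \<alpha>)" for x
    by (simp add: inner_D0T flip: inner_wproj wproj_D0)
  then have "\<forall>x. x \<bullet> wproj m (D0T \<alpha>) = x \<bullet> D0T (wproj m \<alpha>)" by (rule allI)
  then show ?thesis by (simp only: vector_eq_ldot)
qed

text \<open>Both \<open>D0\<close> and its adjoint preserve weights, so the weight component of
  \<open>Di \<beta>\<close> satisfies the conditions that characterise \<open>Di\<close> of the
  weight component.\<close>

lemma wproj_Di: "Di (wproj m \<beta>) = wproj m (Di \<beta>)"
proof (rule Di_eqI)
  show "wproj m (Di \<beta>) \<in> {\<gamma>. D0 \<gamma> = 0}\<^sup>\<bottom>"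
  proof -
    have "y \<bullet> wproj m (Di \<beta>) = 0" if "D0 y = 0" for y
    proof -
      have "D0 (wproj m y) = 0" unfolding wproj_D0[symmetric] that by (simp add: wproj_def vec_eq_iff)
      then have "wproj m y \<bullet> Di \<beta> = 0" using Di_works(1)[of \<beta>] by (auto simp: orthogonal_comp_def orthogonal_def)
      then show ?thesis by (simp add: inner_wproj)
    qed
    then show ?thesis by (auto simp: orthogonal_comp_def orthogonal_def)
  qed
  show "D0T (D0 (wproj m (Di \<beta>))) = D0T (wproj m \<beta>)"
    by (simp add: Di_works flip: wproj_D0 wproj_D0T)
qed

lemma lder_nth: "smooth \<gamma> \<Longrightarrow> lder v \<gamma> x $ I = lder v (\<lambda>x. \<gamma> x $ I) x" for \<gamma> :: "'n point \<Rightarrow> 'n covector"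
  unfolding lder_def by (rule dird_linear_comp[OF bounded_linear_vec_nth, symmetric])

lemma lder_const [simp]: "lder v (\<lambda>x. c) x = 0" by (simp add: lder_def)

text \<open>On the range of \<open>d\<^sub>0\<^sup>-\<^sup>1\<close> the operator \<open>d\<^sub>0\<^sup>-\<^sup>1 d\<close> is the identity plus an operator that strictly
  raises weights; hence it is injective there, which makes the sum \<open>E + F\<close> direct.\<close>

lemma d0_inv_d_injective:
  assumes s: "smooth \<gamma>" and K: "\<And>x. \<gamma> x \<in> {\<gamma>. D0 \<gamma> = 0}\<^sup>\<bottom>" and 0: "\<And>x. Di (form_d gmul \<gamma> x) = 0"
  shows "\<gamma> x = 0"
proof -
  have g: "\<gamma> x = - Di (\<Sum>j\<in>UNIV. wedge (axis {j} 1) (lder (axis j 1) \<gamma> x))" for x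
    using 0[of x] Di_D0[OF K[of x]] unfolding form_d_eq[OF s] linear_add[OF linear_Di] by (simp add: add_eq_0_iff)
  have "\<forall>x. wproj m (\<gamma> x) = 0" for m
  proof (induction m rule: less_induct)
    case (less m)
    show ?case
    proof
      fix x
      have z: "wproj m (\<Sum>j\<in>UNIV. wedge (axis {j} 1) (lder (axis j 1) \<gamma> x)) = 0"
      proof -
        have "wedge (axis {j} 1) (lder (axis j 1) \<gamma> x) $ J = 0" if J: "wt J = m" for j J
        proof (rule ccontr)
          assume "\<not> ?thesis"
          then obtain I where I: "j \<notin> I" "J = insert j I" "lder (axis j 1) \<gamma> x $ I \<noteq> 0" using wedge_axis_nth_nz by blast
          then have "wt I < m" using J w_ge_1[of j] by (simp add: wt_def)
          then have "wproj (wt I) (\<gamma> y) $ I = 0" for y using less by simp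
          then have "(\<lambda>y. \<gamma> y $ I) = (\<lambda>_. 0)" by (simp add: wproj_def)
          then have "lder (axis j 1) \<gamma> x $ I = 0" unfolding lder_nth[OF s] by simp
          with I show False by simp
        qed
        then show ?thesis by (simp add: wproj_def vec_eq_iff)
      qed
      have "wproj m (\<gamma> x) = - wproj m (Di (\<Sum>j\<in>UNIV. wedge (axis {j} 1) (lder (axis j 1) \<gamma> x)))"
        by (subst g) (simp add: wproj_def vec_eq_iff)
      then show "wproj m (\<gamma> x) = 0" unfolding wproj_Di[symmetric] z linear_0[OF linear_Di] by simp
    qed
  qed
  then have "wproj (wt I) (\<gamma> x) $ I = 0" for I by simp
  then show ?thesis by (simp add: wproj_def vec_eq_iff)
qed

text \<open>Write the form as \<open>Di a\<close> plus the differential of \<open>Di b\<close>. As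
  \<open>d\<close> squares to zero, \<open>Di\<close> kills the differential of \<open>Di a\<close>,
  so \<open>Di a = 0\<close> by \<open>d0_inv_d_injective\<close>; the same argument then applies to
  \<open>Di b\<close>.\<close>

lemma rumin_E_F_disjoint:
  assumes E: "\<omega> \<in> rumin_E gmul" and F: "\<omega> \<in> rumin_F gmul" shows "\<omega> x = 0"
proof -
  obtain a b where ab: "smooth a" "smooth b" and e: "\<omega> = (\<lambda>x. Di (a x) + form_d gmul (\<lambda>y. Di (b y)) x)"
    using F unfolding rumin_F_def by blast
  have db: "form_d gmul (\<lambda>x. Di (a x)) x = form_d gmul \<omega> x" for x
    unfolding e using ab by (simp add: form_d_add smooth_Di smooth_form_d form_d_form_d)
  have a0: "Di (a x) = 0" for x
  proof (rule d0_inv_d_injective[of "\<lambda>x. Di (a x)"])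
    show "Di (form_d gmul (\<lambda>x. Di (a x)) x) = 0" for x
      unfolding db using E by (simp add: rumin_E_def)
  qed (auto intro: smooth_Di ab Di_works)
  then have e': "\<omega> = form_d gmul (\<lambda>y. Di (b y))" by (simp add: e)
  have "Di (b x) = 0" for x
  proof (rule d0_inv_d_injective[of "\<lambda>x. Di (b x)"])
    show "Di (form_d gmul (\<lambda>x. Di (b x)) x) = 0" for x
      unfolding e'[symmetric] using E by (simp add: rumin_E_def)
  qed (auto intro: smooth_Di ab Di_works)
  then show ?thesis unfolding e' by (simp add: form_d_eq linear_0[OF linear_d0] wedge.zero_right)
qed

text \<open>Directness of the sum supplies the uniqueness that the definite description asks
  for.\<close>

lemma proj_E_fixes:
  assumes a: "\<alpha> \<in> rumin_E gmul" shows "proj_E gmul \<alpha> = \<alpha>"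
  unfolding proj_E_def
proof (rule the_equality)
  have "(\<lambda>x. 0) \<in> rumin_F gmul"
    unfolding rumin_F_def mem_Collect_eq
    by (rule exI[of _ "\<lambda>_. 0"], rule exI[of _ "\<lambda>_. 0"])
       (simp add: linear_0[OF linear_Di] form_d_eq linear_0[OF linear_d0] wedge.zero_right)
  then show "\<alpha> \<in> rumin_E gmul \<and> (\<lambda>x. \<alpha> x - \<alpha> x) \<in> rumin_F gmul" using a by simp
  fix \<epsilon> assume *: "\<epsilon> \<in> rumin_E gmul \<and> (\<lambda>x. \<alpha> x - \<epsilon> x) \<in> rumin_F gmul"
  have s: "smooth \<alpha>" "smooth \<epsilon>" using a * by (auto simp: rumin_E_def)
  have "(\<lambda>x. \<alpha> x - \<epsilon> x) \<in> rumin_E gmul"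
    using a * s by (auto simp: rumin_E_def form_d_diff linear_diff[OF linear_Di])
  then have "\<alpha> x - \<epsilon> x = 0" for x using rumin_E_F_disjoint * by blast
  then show "\<epsilon> = \<alpha>" by (simp add: fun_eq_iff)
qed

section \<open>Forms of degree n - 1 and n\<close>

lemma wt_UNIV_minus: "wt UNIV \<ge> wt I + card (UNIV - I)"
proof -
  have "wt UNIV = wt I + sum w (UNIV - I)" unfolding wt_def by (metis add.commute finite subset_UNIV sum.subset_diff)
  moreover have "sum w (UNIV - I) \<ge> (\<Sum>j\<in>UNIV - I. 1)" by (intro sum_mono w_ge_1)
  ultimately show ?thesis by simp
qed

text \<open>\<open>D0\<close> keeps the weight but adds an index, and every index weighs at least 1.
  From degree n - 1 the only possible target is the top form, whose full weight would have to be
  present with one index missing; from degree n there is no target.\<close>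

lemma d0_axis_codim1: "Suc (card I) \<ge> CARD('n) \<Longrightarrow> D0 (axis I 1) = 0"
proof (rule ccontr)
  assume c: "Suc (card I) \<ge> CARD('n)" "D0 (axis I 1) \<noteq> 0"
  then obtain J where J: "D0 (axis I 1) $ J \<noteq> 0" by (auto simp: vec_eq_iff)
  then have wJ: "wt J = wt I" "card J = Suc (card I)" using d0_nth_nz by blast+
  have "card J \<le> CARD('n)" by (simp add: card_mono)
  then have "card J = CARD('n)" using c wJ by simp
  then have "J = UNIV" by (simp add: card_subset_eq)
  with wJ wt_UNIV_minus[of I] have "card (UNIV - I) = 0" by simp
  then have "I = UNIV" by auto
  with wJ \<open>J = UNIV\<close> show False by simp
qed

lemma D0_codim1:
  assumes "\<And>I. card I \<noteq> CARD('n) - 1 \<Longrightarrow> \<alpha> $ I = 0" shows "D0 \<alpha> = 0"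
proof -
  have "\<alpha> $ I *\<^sub>R D0 (axis I 1) = 0" for I
    using assms[of I] d0_axis_codim1[of I] by (cases "card I = CARD('n) - 1") auto
  then show ?thesis unfolding linear_covector_expand[OF linear_d0, of \<alpha>] by (intro sum.neutral ballI)
qed

lemma D0T_top:
  assumes "\<And>I. I \<noteq> UNIV \<Longrightarrow> \<alpha> $ I = 0" shows "D0T \<alpha> = 0"
proof -
  have "axis I 1 \<bullet> D0T \<alpha> = 0" for I
  proof -
    have "D0 (axis I 1) $ UNIV = 0"
    proof (rule ccontr)
      assume c: "\<not> ?thesis"
      then have "CARD('n) = Suc (card I)" using d0_nth_nz by blast
      then show False using d0_axis_codim1[of I] c by simp
    qed
    then have "D0 (axis I 1) $ J * \<alpha> $ J = 0" for J using assms[of J] by (cases "J = UNIV") auto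
    then show ?thesis unfolding inner_D0T unfolding inner_vec_def by (intro sum.neutral ballI) simp
  qed
  then show ?thesis by (simp add: vec_eq_iff inner_axis')
qed

lemma D0_top:
  assumes "\<And>I. I \<noteq> UNIV \<Longrightarrow> \<alpha> $ I = 0" shows "D0 \<alpha> = 0"
proof -
  have "\<alpha> $ I *\<^sub>R D0 (axis I 1) = 0" for I
    using assms[of I] d0_axis_codim1[of I] by (cases "I = UNIV") auto
  then show ?thesis unfolding linear_covector_expand[OF linear_d0, of \<alpha>] by (intro sum.neutral ballI)
qed

lemma E0_top: "E0 gmul CARD('n) = {\<alpha>. \<forall>I. I \<noteq> UNIV \<longrightarrow> \<alpha> $ I = 0}"
proof -
  have "card I \<noteq> CARD('n) \<longleftrightarrow> I \<noteq> UNIV" for I :: "'n set" by (metis card_subset_eq finite subset_UNIV)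
  then show ?thesis using D0_top D0T_top by (auto simp: E0_def E0_all_def)
qed

text \<open>Leaving out one index of weight 1 costs weight 1, whereas a form of degree n - 2 falls
  short of the full weight by at least 2. So \<open>D0\<close> of such forms has no component here,
  and the form is orthogonal to the range of \<open>D0\<close>.\<close>

lemma horizontal_E0: "w a = 1 \<Longrightarrow> axis (UNIV - {a}) 1 \<in> E0 gmul (CARD('n) - 1)"
proof -
  assume a: "w a = 1"
  let ?A = "axis (UNIV - {a}) 1 :: 'n covector"
  have c: "card (UNIV - {a}) = CARD('n) - 1" by (simp add: card_Diff_singleton)
  then have d: "\<And>I. card I \<noteq> CARD('n) - 1 \<Longrightarrow> ?A $ I = 0" by (auto simp: axis_def)
  have "axis I 1 \<bullet> D0T ?A = 0" for I
  proof (rule ccontr)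
    assume "\<not> ?thesis"
    then have "D0 (axis I 1) $ (UNIV - {a}) \<noteq> 0" unfolding inner_D0T by (simp add: inner_axis)
    then have *: "wt (UNIV - {a}) = wt I" "card (UNIV - {a}) = Suc (card I)" using d0_nth_nz by blast+
    have "wt UNIV = wt (UNIV - {a}) + w a" unfolding wt_def by (simp add: sum.remove[of UNIV a])
    moreover have "card (UNIV - I) = CARD('n) - card I" by (simp add: card_Diff_subset)
    moreover have "card I < CARD('n) - 1" using * c by simp
    ultimately show False using wt_UNIV_minus[of I] * a by simp
  qed
  then have "D0T ?A = 0" by (simp add: vec_eq_iff inner_axis')
  then show ?thesis using D0_codim1[OF d] d by (simp add: E0_def E0_all_def)
qed

lemma subspace_E0_all: "subspace (E0_all gmul)"
  by (auto simp: subspace_def E0_all_def linear_0[OF linear_d0] linear_0[OF linear_D0T] linear_add[OF linear_d0]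
      linear_add[OF linear_D0T] linear_cmul[OF linear_d0] linear_cmul[OF linear_D0T])

lemma subspace_E0: "subspace (E0 gmul h)"
  using subspace_E0_all by (auto simp: subspace_def E0_def)

lemma proj_E0_fixes: "\<alpha> \<in> E0_all gmul \<Longrightarrow> proj_E0 gmul \<alpha> = \<alpha>"
  unfolding proj_E0_def
proof (rule the_equality)
  show "\<alpha> \<in> E0_all gmul \<Longrightarrow> \<alpha> \<in> E0_all gmul \<and> \<alpha> - \<alpha> \<in> (E0_all gmul)\<^sup>\<bottom>"
    by (simp add: subspace_0[OF subspace_orthogonal_comp])
  fix \<beta> assume a: "\<alpha> \<in> E0_all gmul" and b: "\<beta> \<in> E0_all gmul \<and> \<alpha> - \<beta> \<in> (E0_all gmul)\<^sup>\<bottom>"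
  then have "\<alpha> - \<beta> \<in> E0_all gmul" using subspace_diff[OF subspace_E0_all] by blast
  then have "(\<alpha> - \<beta>) \<bullet> (\<alpha> - \<beta>) = 0" using b by (auto simp: orthogonal_comp_def orthogonal_def)
  then show "\<beta> = \<alpha>" by simp
qed

text \<open>The sign that appears when the coframe form of index \<open>j\<close> is wedged in front
  of the product of all the others to give the volume form.\<close>

definition sg :: "'n \<Rightarrow> real" where "sg j = wedge_sign {j} (UNIV - {j})"

lemma sg_sq: "sg j * sg j = 1" "\<bar>sg j\<bar> = 1"
  by (simp_all add: sg_def wedge_sign_singleton power_mult_distrib[symmetric] flip: power_add)

lemma form_d_codim1:
  assumes s: "smooth \<alpha>" and d: "\<And>x I. card I \<noteq> CARD('n) - 1 \<Longrightarrow> \<alpha> x $ I = 0"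
  shows "form_d gmul \<alpha> x = (\<Sum>j\<in>UNIV. sg j * lder (axis j 1) (\<lambda>x. \<alpha> x $ (UNIV - {j})) x) *\<^sub>R axis UNIV 1"
proof -
  have "wedge (axis {j} 1) (lder (axis j 1) \<alpha> x) = (sg j * lder (axis j 1) (\<lambda>x. \<alpha> x $ (UNIV - {j})) x) *\<^sub>R axis UNIV 1" for j
  proof -
    let ?v = "lder (axis j 1) \<alpha> x"
    have "wedge (axis {j} 1) ?v = (\<Sum>I\<in>UNIV. (?v $ I) *\<^sub>R wedge (axis {j} 1) (axis I 1))"
      by (rule linear_covector_expand) (auto intro!: linearI simp: wedge.add_right wedge.scaleR_right)
    also have "\<dots> = (\<Sum>I\<in>UNIV. if I = UNIV - {j} then (?v $ I * sg j) *\<^sub>R axis UNIV 1 else 0)"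
    proof (rule sum.cong[OF refl])
      fix I :: "'n set"
      show "(?v $ I) *\<^sub>R wedge (axis {j} 1) (axis I 1) = (if I = UNIV - {j} then (?v $ I * sg j) *\<^sub>R axis UNIV 1 else 0)"
      proof (cases "card I = CARD('n) - 1 \<and> j \<notin> I")
        case True
        moreover have "I = UNIV - {j}"
          using True by (intro card_subset_eq) (auto simp: card_Diff_singleton)
        ultimately show ?thesis by (simp add: wedge_axis sg_def)
      next
        case False
        then have "I \<noteq> UNIV - {j}" by (auto simp: card_Diff_singleton)
        moreover have "?v $ I = 0 \<or> wedge_sign {j} I = 0"
        proof (cases "j \<in> I")
          case False
          then have "(\<lambda>x. \<alpha> x $ I) = (\<lambda>x. 0)" using d \<open>\<not> (card I = CARD('n) - 1 \<and> j \<notin> I)\<close> by auto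
          then show ?thesis unfolding lder_nth[OF s] by simp
        qed (simp add: wedge_sign_singleton)
        ultimately show ?thesis by (auto simp: wedge_axis)
      qed
    qed
    also have "\<dots> = (?v $ (UNIV - {j}) * sg j) *\<^sub>R axis UNIV 1" by simp
    finally show ?thesis unfolding lder_nth[OF s] by (simp add: mult.commute)
  qed
  then show ?thesis unfolding form_d_eq[OF s] using D0_codim1[of "\<alpha> x"] d by (simp add: scaleR_sum_left)
qed

text \<open>Such a form already lies in \<open>rumin_E\<close>: \<open>D0T\<close> kills its values,
  and its differential is a top form, on which \<open>Di\<close> vanishes because \<open>D0\<close>
  never reaches the top degree. Hence both projections act as the identity.\<close>

lemma rumin_d_codim1:
  assumes s: "smooth \<alpha>" and E: "\<And>x. \<alpha> x \<in> E0 gmul (CARD('n) - 1)"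
  shows "rumin_d gmul \<alpha> x = (\<Sum>j\<in>UNIV. sg j * lder (axis j 1) (\<lambda>x. \<alpha> x $ (UNIV - {j})) x) *\<^sub>R axis UNIV 1"
proof -
  have d: "\<And>x I. card I \<noteq> CARD('n) - 1 \<Longrightarrow> \<alpha> x $ I = 0" using E by (simp add: E0_def)
  note fd = form_d_codim1[OF s d]
  have t: "\<And>x I. I \<noteq> UNIV \<Longrightarrow> form_d gmul \<alpha> x $ I = 0" by (simp add: fd axis_def)
  have "\<alpha> \<in> rumin_E gmul"
    using s E Di_eq_0 D0T_top[OF t] by (auto simp: rumin_E_def E0_def E0_all_def)
  then have "rumin_d gmul \<alpha> x = proj_E0 gmul (form_d gmul \<alpha> x)" by (simp add: rumin_d_def proj_E_fixes)
  also have "\<dots> = form_d gmul \<alpha> x" by (rule proj_E0_fixes) (simp add: E0_all_def D0_top[OF t] D0T_top[OF t])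
  finally show ?thesis by (rule trans[OF _ fd])
qed

end

subsection \<open>Integration on the group\<close>

lemma integrable_compact_support:
  fixes f :: "'a::euclidean_space \<Rightarrow> 'b::euclidean_space"
  assumes "compact K" "continuous_on K f" "\<And>x. x \<notin> K \<Longrightarrow> f x = 0"
  shows "integrable lborel f"
proof -
  have "f = (\<lambda>x. indicator K x *\<^sub>R f x)" using assms(3) by (auto simp: fun_eq_iff indicator_def)
  then show ?thesis using borel_integrable_compact[OF assms(1,2)] by simp
qed

text \<open>Integrating the fundamental theorem of calculus over the space variable.\<close>

lemma integral_flow_difference:
  fixes F G :: "real \<Rightarrow> 'a::euclidean_space \<Rightarrow> real"
  assumes K: "compact K" and G0: "\<And>s x. s \<in> {0..1} \<Longrightarrow> x \<notin> K \<Longrightarrow> G s x = 0"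
    and D: "\<And>s x. s \<in> {0..1} \<Longrightarrow> ((\<lambda>s. F s x) has_real_derivative G s x) (at s)"
    and cG: "continuous_on ({0..1} \<times> K) (\<lambda>(s, x). G s x)"
    and F0: "integrable lborel (F 0)" and F1: "integrable lborel (F 1)"
  shows "(LINT x|lborel. F 1 x) - (LINT x|lborel. F 0 x) = (LINT s:{0..1}|lborel. LINT x|lborel. G s x)"
proof -
  define g where "g s x = indicator {0..1} s *\<^sub>R G s x" for s :: real and x
  have "integrable lborel (\<lambda>z. indicator ({0..1} \<times> K) z *\<^sub>R (\<lambda>(s, x). G s x) z)"
    by (intro borel_integrable_compact compact_Times compact_Icc K cG)
  also have "(\<lambda>z. indicator ({0..1} \<times> K) z *\<^sub>R (\<lambda>(s, x). G s x) z) = case_prod g"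
    using G0 by (auto simp: g_def fun_eq_iff indicator_def)
  finally have i: "integrable (lborel \<Otimes>\<^sub>M lborel) (case_prod g)" by (simp add: lborel_prod)
  have f: "(LINT s|lborel. g s x) = F 1 x - F 0 x" for x
  proof -
    have c: "continuous_on {0..1} (\<lambda>s. G s x)"
    proof (cases "x \<in> K")
      case True
      then have "(\<lambda>s. (s, x)) ` {0..1} \<subseteq> {0..1} \<times> K" by auto
      moreover have "continuous_on {0..1} (\<lambda>s::real. (s, x))" by (intro continuous_intros)
      ultimately show ?thesis using continuous_on_compose2[OF cG, of "{0..1}" "\<lambda>s. (s, x)"] by simp
    next
      case False
      have "continuous_on {0..1} (\<lambda>s. G s x) = continuous_on {0..1::real} (\<lambda>s. 0::real)"
        by (rule continuous_on_cong) (use G0 False in auto)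
      then show ?thesis by simp
    qed
    show ?thesis unfolding g_def
      by (rule integral_FTC_atLeastAtMost[OF _ _ c])
         (auto simp: has_real_derivative_iff_has_vector_derivative[symmetric] intro!: DERIV_subset[OF D])
  qed
  have "(LINT x|lborel. F 1 x) - (LINT x|lborel. F 0 x) = (LINT x|lborel. LINT s|lborel. g s x)"
    unfolding f using F0 F1 by simp
  also have "\<dots> = (LINT s|lborel. LINT x|lborel. g s x)"
    by (rule lborel_pair.Fubini_integral[OF i])
  finally show ?thesis by (simp add: g_def set_lebesgue_integral_def)
qed

section \<open>Test functions and integration by parts\<close>

definition csupp :: "('a::euclidean_space \<Rightarrow> real) \<Rightarrow> bool" where
  "csupp h \<longleftrightarrow> smooth h \<and> (\<exists>K. compact K \<and> (\<forall>x. x \<notin> K \<longrightarrow> h x = 0))"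

lemma dird_eq_0_outside:
  assumes "closed K" "\<And>x. x \<notin> K \<Longrightarrow> h x = 0" "x \<notin> K" shows "dird v h x = 0"
proof -
  have "dird v h x = dird v (\<lambda>x. 0) x"
    by (rule dird_cong_open[of "- K"]) (use assms in auto)
  then show ?thesis by simp
qed

lemma csupp_dird: "csupp h \<Longrightarrow> csupp (dird v h)"
  unfolding csupp_def using dird_eq_0_outside compact_imp_closed by (metis smooth_dird)

lemma csupp_integrable: "csupp h \<Longrightarrow> integrable lborel h"
  unfolding csupp_def using integrable_compact_support smooth_continuous_on by metis

lemma csupp_mult: "smooth f \<Longrightarrow> csupp g \<Longrightarrow> csupp (\<lambda>x. f x * g x)"
  unfolding csupp_def by (metis mult_zero_right smooth_mult)

lemma csupp_mult': "csupp f \<Longrightarrow> smooth g \<Longrightarrow> csupp (\<lambda>x. f x * g x)"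
  using csupp_mult[of g f] by (simp add: mult.commute)

lemma csupp_smooth: "csupp h \<Longrightarrow> smooth h" by (simp add: csupp_def)

lemma smooth_has_real_derivative_line:
  fixes h :: "'a::euclidean_space \<Rightarrow> real"
  assumes "smooth h" shows "((\<lambda>s. h (x + s *\<^sub>R v)) has_real_derivative dird v h (x + s *\<^sub>R v)) (at s)"
proof -
  have "((\<lambda>a. h (x + a *\<^sub>R v)) has_derivative (\<lambda>t. dird (t *\<^sub>R v) h (x + s *\<^sub>R v))) (at s)"
    by (rule has_derivative_compose[of "\<lambda>a. x + a *\<^sub>R v", OF _ smooth_has_derivative[OF assms]])
       (auto intro!: derivative_eq_intros)
  moreover have "(\<lambda>t. dird (t *\<^sub>R v) h (x + s *\<^sub>R v)) = (*) (dird v h (x + s *\<^sub>R v))"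
    by (simp add: fun_eq_iff linear_cmul[OF linear_dird[OF assms]])
  ultimately show ?thesis by (simp add: has_field_derivative_def)
qed

lemma lborel_integral_translate: "(LINT x|lborel. f (x + a)) = (LINT x|lborel. f x :: real)" for a :: "'a::euclidean_space"
proof (cases "f \<in> borel_measurable borel")
  case True
  have "(LINT x|lborel. f x) = (LINT x|distr lborel borel ((+) a). f x)" by (simp only: lborel_distr_plus)
  also have "\<dots> = (LINT x|lborel. f (a + x))" by (rule integral_distr) (use True in auto)
  finally show ?thesis by (simp add: add.commute)
next
  case False
  \<comment> \<open>If \<open>f\<close> is not measurable, neither is its translate, and both
    integrals take the default value 0.\<close>
  have "(\<lambda>x. f (x + a)) \<notin> borel_measurable borel"
  proof
    assume "(\<lambda>x. f (x + a)) \<in> borel_measurable borel"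
    then have "(\<lambda>x. f (x + a)) \<circ> (\<lambda>x. x - a) \<in> borel_measurable borel" by (rule measurable_comp[rotated]) auto
    then show False using False by (simp add: o_def)
  qed
  then have "\<not> integrable lborel f" "\<not> integrable lborel (\<lambda>x. f (x + a))" using False by auto
  then show ?thesis by (simp add: not_integrable_integral_eq)
qed

text \<open>The integral of \<open>h (x + s *\<^sub>R v)\<close> does not depend on
  \<open>s\<close>, and its \<open>s\<close>-derivative is the integral in question, again by
  translation invariance.\<close>

lemma integral_dird_eq_0:
  fixes h :: "'a::euclidean_space \<Rightarrow> real"
  assumes h: "csupp h" shows "(LINT x|lborel. dird v h x) = 0"
proof -
  obtain K where K: "compact K" "\<And>x. x \<notin> K \<Longrightarrow> h x = 0" and s: "smooth h" using h by (auto simp: csupp_def)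
  \<comment> \<open>One compact set that contains the supports of all translates along the
    segment.\<close>
  define K' where "K' = (\<lambda>(s, k). k - s *\<^sub>R v) ` ({0..1::real} \<times> K)"
  have K': "compact K'" unfolding K'_def
    by (intro compact_continuous_image compact_Times K compact_Icc) (auto simp: case_prod_beta intro!: continuous_intros)
  have out: "x + s *\<^sub>R v \<notin> K" if "s \<in> {0..1}" "x \<notin> K'" for s x
  proof
    assume "x + s *\<^sub>R v \<in> K"
    then have "(\<lambda>(s, k). k - s *\<^sub>R v) (s, x + s *\<^sub>R v) \<in> K'" unfolding K'_def using that by blast
    then show False using that by simp
  qed
  have "(LINT x|lborel. h (x + 1 *\<^sub>R v)) - (LINT x|lborel. h (x + 0 *\<^sub>R v)) = (LINT s:{0..1}|lborel. LINT x|lborel. dird v h (x + s *\<^sub>R v))"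
  proof (rule integral_flow_difference[OF K'])
    show "dird v h (x + s *\<^sub>R v) = 0" if "s \<in> {0..1}" "x \<notin> K'" for s x
      using dird_eq_0_outside[OF compact_imp_closed[OF K(1)] K(2) out[OF that]] .
    show "continuous_on ({0..1} \<times> K') (\<lambda>(s, x). dird v h (x + s *\<^sub>R v))"
      unfolding case_prod_beta
      by (intro smooth_continuous_on smooth_compose[OF smooth_dird[OF s]] smooth_add smooth_scaleR smooth_fst smooth_snd smooth_id smooth_const)
    have 1: "h (x + s *\<^sub>R v) = 0" if "s \<in> {0..1}" "x \<notin> K'" for s x using K(2) out[OF that] by blast
    have 2: "integrable lborel (\<lambda>x. h (x + s *\<^sub>R v))" if "s \<in> {0..1}" for s
      by (rule integrable_compact_support[OF K'])
         (intro smooth_continuous_on smooth_compose[OF s] smooth_add smooth_id smooth_const, rule 1[OF that])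
    show "integrable lborel (\<lambda>x. h (x + 0 *\<^sub>R v))" "integrable lborel (\<lambda>x. h (x + 1 *\<^sub>R v))"
      using 2[of 0] 2[of 1] by auto
  qed (rule smooth_has_real_derivative_line[OF s])
  then have "0 = (LINT s:{0..1::real}|lborel. (LINT x|lborel. dird v h x))"
    unfolding lborel_integral_translate by simp
  then show ?thesis by (simp add: set_lebesgue_integral_def)
qed

lemma integral_divergence_free:
  fixes h :: "real^'n \<Rightarrow> real"
  assumes V: "smooth V" and d: "\<And>k x. dird (axis k 1) (\<lambda>x. V x $ k) x = 0" and h: "csupp h"
  shows "(LINT x|lborel. dird (V x) h x) = 0"
proof -
  note s = csupp_smooth[OF h]
  have "dird (V x) h x = (\<Sum>k\<in>UNIV. dird (axis k 1) (\<lambda>x. V x $ k * h x) x)" for x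
    by (subst dird_vec_expand[OF s])
       (simp add: dird_bilinear[OF bounded_bilinear_mult smooth_component[OF V] s] d)
  moreover have c: "csupp (\<lambda>x. V x $ k * h x)" for k by (rule csupp_mult[OF smooth_component[OF V] h])
  ultimately show ?thesis
    using csupp_integrable[OF csupp_dird[OF c]] by (simp add: integral_dird_eq_0[OF c])
qed

lemma smooth_prod:
  fixes F :: "'i \<Rightarrow> 'a::euclidean_space \<Rightarrow> real"
  shows "(\<And>i. i \<in> I \<Longrightarrow> smooth (F i)) \<Longrightarrow> smooth (\<lambda>x. \<Prod>i\<in>I. F i x)"
  by (induction I rule: infinite_finite_induct) (auto intro: smooth_mult)

text \<open>Boxes are increasing limits of test functions since \<open>exp (-1/(n t))\<close> increases to 1 for \<open>t > 0\<close>.\<close>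

lemma lborel_eqI_test_functions:
  fixes T :: "'a::euclidean_space \<Rightarrow> 'a"
  assumes T: "T \<in> borel_measurable borel"
    and eq: "\<And>h. csupp h \<Longrightarrow> (\<And>x. 0 \<le> h x) \<Longrightarrow> (\<integral>\<^sup>+x. ennreal (h (T x)) \<partial>lborel) = (\<integral>\<^sup>+x. ennreal (h x) \<partial>lborel)"
  shows "distr lborel borel T = lborel"
proof (rule lborel_eqI[symmetric])
  fix l u :: 'a assume le: "\<And>b. b \<in> Basis \<Longrightarrow> l \<bullet> b \<le> u \<bullet> b"
  define \<psi> where "\<psi> x = (\<Prod>b\<in>Basis. flat_exp 0 ((x - l) \<bullet> b) * flat_exp 0 ((u - x) \<bullet> b))" for x
  define h where "h n x = flat_exp 0 (real n * \<psi> x)" for n x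
  have \<psi>s: "smooth \<psi>" unfolding \<psi>_def
    by (intro smooth_prod smooth_mult smooth_compose[OF smooth_flat_exp] smooth_inner smooth_diff smooth_id smooth_const)
  have \<psi>0: "0 \<le> \<psi> x" for x unfolding \<psi>_def by (intro prod_nonneg) (auto simp: flat_exp_def)
  have \<psi>_pos: "0 < \<psi> x \<longleftrightarrow> x \<in> box l u" for x
  proof
    assume "x \<in> box l u"
    then show "0 < \<psi> x" unfolding \<psi>_def by (intro prod_pos) (auto simp: box_def flat_exp_def inner_diff_left)
  next
    assume "0 < \<psi> x"
    have "\<psi> x = 0" if "b \<in> Basis" "flat_exp 0 ((x - l) \<bullet> b) * flat_exp 0 ((u - x) \<bullet> b) = 0" for b
      unfolding \<psi>_def by (rule prod_zero) (use that in auto)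
    then have "\<forall>b\<in>Basis. flat_exp 0 ((x - l) \<bullet> b) * flat_exp 0 ((u - x) \<bullet> b) \<noteq> 0"
      using \<open>0 < \<psi> x\<close> by force
    then show "x \<in> box l u" by (auto simp: box_def flat_exp_def inner_diff_left split: if_splits)
  qed
  have hs: "csupp (h n)" for n
    unfolding csupp_def h_def
  proof (intro conjI exI[of _ "cbox l u"] allI impI)
    show "smooth (\<lambda>x. flat_exp 0 (real n * \<psi> x))"
      by (intro smooth_compose[OF smooth_flat_exp] smooth_mult \<psi>s smooth_const)
    show "flat_exp 0 (real n * \<psi> x) = 0" if "x \<notin> cbox l u" for x
    proof -
      have "\<psi> x = 0" using \<psi>_pos[of x] \<psi>0[of x] that box_subset_cbox[of l u] by fastforce
      then show ?thesis by (simp add: flat_exp_def)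
    qed
  qed simp
  have h0: "0 \<le> h n x" for n x by (simp add: h_def flat_exp_def)
  have inc: "incseq (\<lambda>n x. ennreal (h n x))"
  proof (intro incseq_SucI le_funI ennreal_leI)
    fix n x
    show "h n x \<le> h (Suc n) x"
    proof (cases "0 < real n * \<psi> x")
      case True
      then have "\<psi> x > 0" "real n > 0" by (auto simp: zero_less_mult_iff \<psi>0 not_less[symmetric])
      then have "1 / (real (Suc n) * \<psi> x) \<le> 1 / (real n * \<psi> x)" by (intro divide_left_mono mult_right_mono) auto
      then show ?thesis using \<open>\<psi> x > 0\<close> True by (simp add: h_def flat_exp_def)
    qed (simp add: h_def flat_exp_def)
  qed
  have sup: "(SUP n. ennreal (h n x)) = indicator (box l u) x" for x
  proof (cases "x \<in> box l u")
    case True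
    then have p: "\<psi> x > 0" using \<psi>_pos by blast
    have "(\<lambda>n. 1 / (real n * \<psi> x)) \<longlonglongrightarrow> 0"
      using tendsto_mult_left_zero[OF lim_1_over_n, of "1 / \<psi> x"] by (simp add: field_simps)
    then have "(\<lambda>n. exp (- (1 / (real n * \<psi> x)))) \<longlonglongrightarrow> exp (- 0)" by (intro tendsto_intros)
    then have "(\<lambda>n. exp (- (1 / (real n * \<psi> x)))) \<longlonglongrightarrow> 1" by simp
    then have "(\<lambda>n. h n x) \<longlonglongrightarrow> 1"
      by (rule Lim_transform_eventually)
         (use p in \<open>auto simp: h_def flat_exp_def intro!: eventually_mono[OF eventually_gt_at_top[of 0]]\<close>)
    then have "(\<lambda>n. ennreal (h n x)) \<longlonglongrightarrow> ennreal 1" by (intro tendsto_ennrealI)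
    moreover have "(\<lambda>n. ennreal (h n x)) \<longlonglongrightarrow> (SUP n. ennreal (h n x))"
      using inc by (intro LIMSEQ_SUP) (auto simp: incseq_def le_fun_def)
    ultimately show ?thesis using True LIMSEQ_unique by fastforce
  next
    case False
    then have "\<psi> x = 0" using \<psi>_pos[of x] \<psi>0[of x] by fastforce
    then show ?thesis using False by (simp add: h_def flat_exp_def)
  qed
  have hm: "h n \<in> borel_measurable borel" for n
    using borel_measurable_integrable[OF csupp_integrable[OF hs[of n]]] by simp
  have "emeasure (distr lborel borel T) (box l u) = (\<integral>\<^sup>+x. indicator (box l u) (T x) \<partial>lborel)"
    using T by (simp add: nn_integral_indicator[symmetric] nn_integral_distr del: nn_integral_indicator)
  also have "\<dots> = (SUP n. \<integral>\<^sup>+x. ennreal (h n (T x)) \<partial>lborel)"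
    unfolding sup[symmetric] using inc T hm
    by (intro nn_integral_monotone_convergence_SUP) (auto simp: incseq_def le_fun_def)
  also have "\<dots> = (SUP n. \<integral>\<^sup>+x. ennreal (h n x) \<partial>lborel)"
    using eq[OF hs h0] by simp
  also have "\<dots> = (\<integral>\<^sup>+x. indicator (box l u) x \<partial>lborel)"
    unfolding sup[symmetric] using inc hm
    by (intro nn_integral_monotone_convergence_SUP[symmetric]) auto
  also have "\<dots> = (\<Prod>b\<in>Basis. (u - l) \<bullet> b)" using le by (simp add: emeasure_lborel_box)
  finally show "emeasure (distr lborel borel T) (box l u) = (\<Prod>b\<in>Basis. (u - l) \<bullet> b)" .
qed simp

context carnot
begin

lemma dil_axis: "dil l (axis j 1) = l ^ w j *\<^sub>R axis j 1"
  by (simp add: dilation_def vec_eq_iff axis_def)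

lemma continuous_dil: "continuous_on S (\<lambda>l. dil l x)"
  unfolding dilation_def by (intro continuous_on_vec_lambda continuous_intros)

lemma dil_0 [simp]: "dil 0 x = 0"
proof -
  have "dil 0 x $ j = 0" for j using w_ge_1[of j] by (simp add: dilation_def power_0_left)
  then show ?thesis by (simp add: vec_eq_iff)
qed

text \<open>The derivative of a component of weight \<open>w k\<close> in direction \<open>k\<close> has negative weight, so it vanishes.\<close>

lemma homogeneous_divergence_free:
  assumes V: "smooth V" and m: "m \<ge> 1" and h: "\<And>l x. dil l (V x) = l ^ m *\<^sub>R V (dil l x)"
  shows "dird (axis k 1) (\<lambda>x. V x $ k) x = 0"
proof -
  define f where "f x = V x $ k" for x
  have f: "smooth f" unfolding f_def by (rule smooth_component[OF V])
  have hf: "l ^ w k * f x = l ^ m * f (dil l x)" for l x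
    using h[of l x] unfolding f_def by (simp add: vec_eq_iff dilation_def[of w l "V x"])
  have d: "l ^ w k * dird (axis k 1) f x = l ^ m * (l ^ w k * dird (axis k 1) f (dil l x))" for l x
  proof -
    have "l ^ w k * dird (axis k 1) f x = dird (axis k 1) (\<lambda>x. l ^ w k * f x) x"
      by (rule dird_linear_comp[OF bounded_linear_mult_right f, symmetric])
    also have "\<dots> = dird (axis k 1) (\<lambda>x. l ^ m * f (dil l x)) x" unfolding hf ..
    also have "\<dots> = l ^ m * dird (axis k 1) (\<lambda>x. f (dil l x)) x"
      by (rule dird_linear_comp[OF bounded_linear_mult_right smooth_compose[OF f smooth_linear[OF linear_dil]]])
    also have "dird (axis k 1) (\<lambda>x. f (dil l x)) x = dird (dil l (axis k 1)) f (dil l x)"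
      using dird_compose[OF f smooth_linear[OF linear_dil], of "axis k 1" l x] by (simp add: dird_linear[OF linear_dil])
    also have "\<dots> = l ^ w k * dird (axis k 1) f (dil l x)"
      unfolding dil_axis by (simp add: linear_cmul[OF linear_dird[OF f]])
    finally show ?thesis .
  qed
  have e: "dird (axis k 1) f x = l ^ m * dird (axis k 1) f (dil l x)" if "l \<noteq> 0" for l
    using d[of l x] that by simp
  \<comment> \<open>In \<open>e\<close> the left side does not depend on \<open>l\<close>, while the
    right side tends to a multiple of \<open>0 ^ m\<close> as \<open>l\<close> tends to 0.\<close>
  have "continuous_on UNIV (\<lambda>l. l ^ m * dird (axis k 1) f (dil l x))"
    by (intro continuous_intros continuous_on_compose2[OF smooth_continuous_on[OF smooth_dird[OF f]]] continuous_dil) auto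
  then have "((\<lambda>l. l ^ m * dird (axis k 1) f (dil l x)) \<longlongrightarrow> 0 ^ m * dird (axis k 1) f (dil 0 x)) (at 0)"
    unfolding continuous_on_def by (rule bspec[OF _ UNIV_I])
  moreover have "((\<lambda>l. l ^ m * dird (axis k 1) f (dil l x)) \<longlongrightarrow> dird (axis k 1) f x) (at 0)"
    by (rule Lim_transform_eventually[OF tendsto_const]) (use e in \<open>auto simp: eventually_at_filter\<close>)
  ultimately have "dird (axis k 1) f x = 0 ^ m * dird (axis k 1) f (dil 0 x)"
    using tendsto_unique[OF at_neq_bot] by blast
  then show ?thesis using m by (simp add: f_def[abs_def])
qed

lemma X_divergence_free: "dird (axis k 1) (\<lambda>x. X (axis j 1) x $ k) x = 0"
  by (rule homogeneous_divergence_free[OF smooth_X w_ge_1[of j]])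
     (simp add: dil_X dil_axis linear_cmul[OF linear_X])

lemma integral_lder_eq_0:
  assumes h: "csupp h" shows "(LINT x|lborel. lder v h x) = 0"
proof -
  have c: "csupp (lder v h)" for v
  proof -
    obtain K where K: "compact K" "\<forall>x. x \<notin> K \<longrightarrow> h x = 0" using h by (auto simp: csupp_def)
    then have "\<forall>x. x \<notin> K \<longrightarrow> lder v h x = 0"
      unfolding lder_def using dird_eq_0_outside[OF compact_imp_closed[OF K(1)], of h] by blast
    then show ?thesis unfolding csupp_def using K(1) smooth_lder[OF csupp_smooth[OF h]] by blast
  qed
  have "(LINT x|lborel. lder (axis j 1) h x) = 0" for j
    unfolding lder_def by (rule integral_divergence_free[OF smooth_X X_divergence_free h])
  moreover have "lder v h x = (\<Sum>j\<in>UNIV. v $ j * lder (axis j 1) h x)" for x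
    using linear_vec_expand[OF linear_lder[OF csupp_smooth[OF h]], of v x] by simp
  ultimately show ?thesis using csupp_integrable[OF c] by simp
qed

lemma csupp_lder: "csupp h \<Longrightarrow> csupp (lder v h)"
proof -
  assume h: "csupp h"
  obtain K where K: "compact K" "\<forall>x. x \<notin> K \<longrightarrow> h x = 0" using h by (auto simp: csupp_def)
  then have "\<forall>x. x \<notin> K \<longrightarrow> lder v h x = 0"
    unfolding lder_def using dird_eq_0_outside[OF compact_imp_closed[OF K(1)], of h] by blast
  then show ?thesis unfolding csupp_def using K(1) smooth_lder[OF csupp_smooth[OF h]] by blast
qed

lemma lder_mult:
  fixes f g :: "'n point \<Rightarrow> real"
  shows "smooth f \<Longrightarrow> smooth g \<Longrightarrow> lder v (\<lambda>x. f x * g x) x = f x * lder v g x + lder v f x * g x"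
  unfolding lder_def by (rule dird_bilinear[OF bounded_bilinear_mult])

lemma lder_by_parts:
  assumes f: "csupp f" and g: "smooth g"
  shows "(LINT x|lborel. f x * lder v g x) = - (LINT x|lborel. lder v f x * g x)"
proof -
  note s = csupp_smooth[OF f]
  have "(LINT x|lborel. f x * lder v g x + lder v f x * g x) = 0"
    using integral_lder_eq_0[OF csupp_mult'[OF f g], of v] by (simp add: lder_mult[OF s g])
  moreover have "integrable lborel (\<lambda>x. f x * lder v g x)" "integrable lborel (\<lambda>x. lder v f x * g x)"
    using csupp_integrable[OF csupp_mult'[OF f smooth_lder[OF g]]] csupp_integrable[OF csupp_mult'[OF csupp_lder[OF f] g]] by auto
  ultimately show ?thesis by simp
qed

section \<open>Left invariance of Lebesgue measure\<close>

definition rinv :: "'n point \<Rightarrow> 'n point \<Rightarrow> 'n point" where "rinv v y = dird v (\<lambda>p. gmul p y) 0"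

lemma smooth_gmul_right [intro]: "smooth (\<lambda>p. gmul p y)" by auto

lemma smooth_R: "smooth (rinv v)"
proof -
  have "smooth (\<lambda>y. dird (v, 0) (\<lambda>(p, q). gmul p q) (0, y))"
    by (rule smooth_compose[OF smooth_dird[OF smooth_gmul_pair]]) auto
  then show ?thesis by (simp add: rinv_def[abs_def] dird_gmul_right)
qed

lemma linear_R: "linear (\<lambda>v. rinv v y)"
  unfolding rinv_def by (intro linear_dird smooth_gmul_right)

lemma dil_R: "dil l (rinv v y) = rinv (dil l v) (dil l y)"
proof -
  have bl: "bounded_linear (dil l)" using linear_dil by (simp add: linear_conv_bounded_linear)
  have "dil l (rinv v y) = dird v (\<lambda>p. dil l (gmul p y)) 0"
    unfolding rinv_def by (rule dird_linear_comp[OF bl smooth_gmul_right, symmetric])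
  also have "\<dots> = dird v (\<lambda>p. gmul (dil l p) (dil l y)) 0" by (simp only: dil_gmul)
  also have "\<dots> = dird (dird v (dil l) 0) (\<lambda>p. gmul p (dil l y)) (dil l 0)"
    by (rule dird_compose[OF smooth_gmul_right smooth_linear[OF linear_dil]])
  also have "\<dots> = rinv (dil l v) (dil l y)"
    by (simp add: dird_linear[OF linear_dil] rinv_def linear_0[OF linear_dil])
  finally show ?thesis .
qed

lemma integral_R_eq_0:
  assumes h: "csupp h" shows "(LINT x|lborel. dird (rinv v x) h x) = 0"
proof -
  have R0: "dird (axis k 1) (\<lambda>x. rinv (axis j 1) x $ k) x = 0" for j k x
    by (rule homogeneous_divergence_free[OF smooth_R w_ge_1[of j]])
       (simp add: dil_R dil_axis linear_cmul[OF linear_R])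
  have e: "rinv v x = (\<Sum>j\<in>UNIV. (v $ j) *\<^sub>R rinv (axis j 1) x)" for x by (rule linear_vec_expand[OF linear_R])
  have "dird (axis k 1) (\<lambda>x. rinv v x $ k) x = 0" for k x
    unfolding e by (simp add: dird_sum smooth_mult smooth_component smooth_R dird_linear_comp[OF bounded_linear_mult_right] R0)
  then show ?thesis by (rule integral_divergence_free[OF smooth_R _ h])
qed

lemma csupp_translate: "csupp h \<Longrightarrow> csupp (\<lambda>x. h (gmul p x))"
proof -
  assume h: "csupp h"
  obtain K where K: "compact K" "\<And>x. x \<notin> K \<Longrightarrow> h x = 0" using h by (auto simp: csupp_def)
  have "compact (gmul (- p) ` K)"
    by (intro compact_continuous_image K smooth_continuous_on smooth_gmul_left)
  moreover have "h (gmul p x) = 0" if "x \<notin> gmul (- p) ` K" for x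
    using K(2)[of "gmul p x"] that by (metis gmul_cancel(1) image_eqI)
  ultimately show ?thesis unfolding csupp_def using smooth_compose[OF csupp_smooth[OF h] smooth_gmul_left] by blast
qed

text \<open>\<open>rinv p\<close> is the right-invariant field that generates left translation by
  \<open>s *\<^sub>R p\<close>. It is divergence free by homogeneity, so the integral of the
  translated function is constant in \<open>s\<close>.\<close>

lemma integral_translate_csupp:
  assumes h: "csupp h" shows "(LINT x|lborel. h (gmul p x)) = (LINT x|lborel. h x)"
proof -
  obtain K where K: "compact K" "\<And>x. x \<notin> K \<Longrightarrow> h x = 0" and s: "smooth h" using h by (auto simp: csupp_def)
  define H where "H = (\<lambda>(s, x). h (gmul (s *\<^sub>R p) x))"
  have H: "smooth H" unfolding H_def case_prod_beta
    by (intro smooth_compose[OF s] smooth_gmul smooth_scaleR smooth_fst smooth_snd smooth_id smooth_const)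
  define K' where "K' = (\<lambda>(s, k). gmul (- (s *\<^sub>R p)) k) ` ({0..1::real} \<times> K)"
  have K': "compact K'" unfolding K'_def
    by (intro compact_continuous_image compact_Times K compact_Icc smooth_continuous_on, unfold case_prod_beta)
       (intro smooth_gmul smooth_minus smooth_scaleR smooth_fst smooth_snd smooth_id smooth_const)
  have out: "gmul (s *\<^sub>R p) x \<notin> K" if "s \<in> {0..1}" "x \<notin> K'" for s x
  proof
    assume "gmul (s *\<^sub>R p) x \<in> K"
    then have "(\<lambda>(s, k). gmul (- (s *\<^sub>R p)) k) (s, gmul (s *\<^sub>R p) x) \<in> K'" unfolding K'_def using that by blast
    then show False using that by simp
  qed
  have G: "dird (1, 0) H (s, x) = dird (rinv p x) (\<lambda>x. h (gmul (s *\<^sub>R p) x)) x" for s x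
  proof -
    have sm: "smooth (\<lambda>x. h (gmul (s *\<^sub>R p) x))" by (rule smooth_compose[OF s smooth_gmul_left])
    have "dird 1 (\<lambda>t. H (s + t, x)) 0 = dird (dird 1 (\<lambda>t. (s + t, x)) 0) H (s + 0, x)"
      by (rule dird_compose[OF H]) (intro smooth_Pair smooth_add smooth_const smooth_id)
    moreover have "dird 1 (\<lambda>t. (s + t, x)) 0 = (1::real, 0)"
      by (rule dird_eqI[where f'="\<lambda>v. (v, 0)", of _ 0, simplified]) (auto intro!: derivative_eq_intros)
    moreover have "(\<lambda>t. H (s + t, x)) = (\<lambda>t. (\<lambda>x. h (gmul (s *\<^sub>R p) x)) (gmul (t *\<^sub>R p) x))"
      by (simp add: H_def gmul_line[symmetric] gmul_assoc)
    moreover have "dird 1 (\<lambda>t. (\<lambda>x. h (gmul (s *\<^sub>R p) x)) (gmul (t *\<^sub>R p) x)) 0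
      = dird (dird 1 (\<lambda>t. gmul (t *\<^sub>R p) x) 0) (\<lambda>x. h (gmul (s *\<^sub>R p) x)) (gmul (0 *\<^sub>R p) x)"
      by (rule dird_compose[OF sm]) (intro smooth_gmul smooth_scaleR smooth_id smooth_const)
    moreover have "dird 1 (\<lambda>t. gmul (t *\<^sub>R p) x) 0 = dird (dird 1 (\<lambda>t. t *\<^sub>R p) 0) (\<lambda>p. gmul p x) (0 *\<^sub>R p)"
      by (rule dird_compose[OF smooth_gmul_right]) (intro smooth_scaleR smooth_id smooth_const)
    ultimately show ?thesis by (simp add: dird_line rinv_def)
  qed
  have "(LINT x|lborel. H (1, x)) - (LINT x|lborel. H (0, x)) = (LINT s:{0..1}|lborel. LINT x|lborel. dird (1, 0) H (s, x))"
  proof (rule integral_flow_difference[OF K'])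
    show "dird (1, 0) H (s, x) = 0" if "s \<in> {0..1}" "x \<notin> K'" for s x
    proof -
      have "h (gmul (s *\<^sub>R p) y) = 0" if "y \<notin> gmul (- (s *\<^sub>R p)) ` K" for y
        using K(2)[of "gmul (s *\<^sub>R p) y"] that by (metis gmul_cancel(1) image_eqI)
      moreover have "closed (gmul (- (s *\<^sub>R p)) ` K)"
        by (intro compact_imp_closed compact_continuous_image K smooth_continuous_on smooth_gmul_left)
      moreover have "x \<notin> gmul (- (s *\<^sub>R p)) ` K" using out[OF that] by auto
      ultimately show ?thesis unfolding G by (intro dird_eq_0_outside) auto
    qed
    show "continuous_on ({0..1} \<times> K') (\<lambda>(s, x). dird (1, 0) H (s, x))"
      using smooth_continuous_on[OF smooth_dird[OF H]] by (simp add: case_prod_beta')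
    show "((\<lambda>s. H (s, x)) has_real_derivative dird (1, 0) H (s, x)) (at s)" for s x
      using smooth_has_real_derivative_line[OF H, of "(0, x)" "(1, 0)" s] by simp
    show "integrable lborel (\<lambda>x. H (0, x))" "integrable lborel (\<lambda>x. H (1, x))"
      using csupp_integrable[OF csupp_translate[OF h]] csupp_integrable[OF h] by (simp_all add: H_def)
  qed
  also have "(LINT s:{0..1}|lborel. LINT x|lborel. dird (1, 0) H (s, x)) = 0"
    unfolding G integral_R_eq_0[OF csupp_translate[OF h]] by (simp add: set_lebesgue_integral_def)
  finally show ?thesis by (simp add: H_def)
qed

lemma measurable_gmul [measurable]: "gmul p \<in> borel_measurable borel"
  by (intro borel_measurable_continuous_onI smooth_continuous_on smooth_gmul_left)

lemma lborel_distr_gmul: "distr lborel borel (gmul p) = lborel"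
proof (rule lborel_eqI_test_functions[OF measurable_gmul])
  fix h :: "'n point \<Rightarrow> real" assume h: "csupp h" "\<And>x. 0 \<le> h x"
  have "(\<integral>\<^sup>+x. ennreal (h (gmul p x)) \<partial>lborel) = ennreal (LINT x|lborel. h (gmul p x))"
    using h by (intro nn_integral_eq_integral csupp_integrable csupp_translate) auto
  also have "\<dots> = (\<integral>\<^sup>+x. ennreal (h x) \<partial>lborel)"
    unfolding integral_translate_csupp[OF h(1)] using h by (intro nn_integral_eq_integral[symmetric] csupp_integrable) auto
  finally show "(\<integral>\<^sup>+x. ennreal (h (gmul p x)) \<partial>lborel) = (\<integral>\<^sup>+x. ennreal (h x) \<partial>lborel)" .
qed

lemma nn_integral_gmul: "f \<in> borel_measurable borel \<Longrightarrow> (\<integral>\<^sup>+x. f (gmul p x) \<partial>lborel) = (\<integral>\<^sup>+x. f x \<partial>lborel)"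
  using nn_integral_distr[of "gmul p" lborel borel f] by (simp add: lborel_distr_gmul)

lemma integral_gmul:
  fixes f :: "'n point \<Rightarrow> real"
  shows "f \<in> borel_measurable borel \<Longrightarrow> (LINT x|lborel. f (gmul p x)) = (LINT x|lborel. f x)"
  using integral_distr[of "gmul p" lborel borel f] by (simp add: lborel_distr_gmul)

section \<open>Homogeneous dimension and integrals under dilations\<close>

definition hdim :: nat where "hdim = sum w UNIV"

lemma homogeneous_dim_eq: "homogeneous_dim w step = hdim"
proof -
  have "dim (layer w i) = card {j. w j = i}" for i
  proof -
    have "{axis j 1 | j. w j = i} = (\<lambda>j. axis j (1::real)) ` {j. w j = i}" by auto
    moreover have "independent ((\<lambda>j. axis j (1::real) :: 'n point) ` {j. w j = i})"
      by (rule independent_mono[OF independent_Basis]) (auto simp: Basis_vec_def)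
    moreover have "inj_on (\<lambda>j. axis j (1::real) :: 'n point) {j. w j = i}"
      by (auto simp: inj_on_def axis_eq_axis)
    ultimately show ?thesis unfolding layer_def by (simp add: dim_eq_card_independent card_image)
  qed
  then have "homogeneous_dim w step = (\<Sum>i=1..step. \<Sum>j\<in>{j. w j = i}. w j)" by (simp add: homogeneous_dim_def mult.commute)
  also have "\<dots> = (\<Sum>i=1..step. \<Sum>j\<in>{j \<in> UNIV. w j = i}. w j)" by simp
  also have "\<dots> = sum w UNIV"
    by (rule sum.group) (use carnot in \<open>auto simp: carnot_group_def\<close>)
  finally show ?thesis by (simp add: hdim_def)
qed

lemma measurable_dil [measurable]: "dil l \<in> borel_measurable borel"
  by (intro borel_measurable_continuous_onI smooth_continuous_on smooth_linear linear_dil)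

lemma lborel_dil: "l > 0 \<Longrightarrow> lborel = density (distr lborel borel (dil l)) (\<lambda>_. ennreal (l ^ hdim))"
proof -
  assume l: "l > 0"
  define c :: "'n point \<Rightarrow> real" where "c b = (\<Sum>j\<in>UNIV. l ^ w j * b $ j)" for b
  have c: "c (axis j 1) = l ^ w j" for j by (simp add: c_def axis_def if_distrib cong: if_cong)
  have B: "Basis = range (\<lambda>j. axis j (1::real) :: 'n point)" by (auto simp: Basis_vec_def)
  have inj: "inj (\<lambda>j. axis j (1::real) :: 'n point)" by (auto simp: inj_on_def axis_eq_axis)
  have "lborel = density (distr lborel borel (\<lambda>x. 0 + (\<Sum>j\<in>Basis. (c j * (x \<bullet> j)) *\<^sub>R j))) (\<lambda>_. ennreal (\<Prod>j\<in>Basis. \<bar>c j\<bar>))"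
    by (rule lborel_affine_euclidean) (use l c in \<open>auto simp: B\<close>)
  moreover have "(\<Sum>j\<in>Basis. (c j * (x \<bullet> j)) *\<^sub>R j) = dil l x" for x
    unfolding B sum.reindex[OF inj] o_def c
    by (simp add: vec_eq_iff dilation_def inner_axis) (simp add: axis_def if_distrib cong: if_cong)
  moreover have "(\<Prod>j\<in>Basis. \<bar>c j\<bar>) = l ^ hdim"
    unfolding B prod.reindex[OF inj] o_def c using l by (simp add: hdim_def power_sum)
  ultimately show ?thesis by simp
qed

lemma nn_integral_dil:
  assumes l: "l > 0" and f: "f \<in> borel_measurable borel"
  shows "(\<integral>\<^sup>+x. f x \<partial>lborel) = ennreal (l ^ hdim) * (\<integral>\<^sup>+x. f (dil l x) \<partial>lborel)"
  by (subst lborel_dil[OF l]) (use f l in \<open>simp add: nn_integral_density nn_integral_distr nn_integral_cmult\<close>)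

lemma integral_dil:
  fixes f :: "'n point \<Rightarrow> real"
  assumes l: "l > 0" and f: "f \<in> borel_measurable borel"
  shows "(LINT x|lborel. f x) = l ^ hdim * (LINT x|lborel. f (dil l x))"
  by (subst lborel_dil[OF l]) (use f l in \<open>simp add: integral_density integral_distr\<close>)

section \<open>The formal adjoint of the Rumin differential\<close>

lemma orthogonal_projection_exists:
  assumes S: "subspace (S :: 'a::euclidean_space set)"
  obtains P where "linear P" "\<And>x. P x \<in> S" "\<And>x s. s \<in> S \<Longrightarrow> s \<bullet> P x = s \<bullet> x"
proof -
  have "\<exists>y. y \<in> S \<and> x - y \<in> S\<^sup>\<bottom>" for x
  proof -
    have "x \<in> S + S\<^sup>\<bottom>" using subspace_sum_orthogonal_comp[OF S] by simp
    then show ?thesis by (auto elim!: set_plus_elim)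
  qed
  then obtain P where P: "\<And>x. P x \<in> S" "\<And>x. x - P x \<in> S\<^sup>\<bottom>" by metis
  have u: "P x = y" if "y \<in> S" "x - y \<in> S\<^sup>\<bottom>" for x y
  proof -
    have "P x - y \<in> S" using P that subspace_diff[OF S] by blast
    moreover have "(x - y) - (x - P x) \<in> S\<^sup>\<bottom>" using P that subspace_diff[OF subspace_orthogonal_comp] by blast
    ultimately have "(P x - y) \<bullet> (P x - y) = 0" by (auto simp: orthogonal_comp_def orthogonal_def)
    then show ?thesis by simp
  qed
  have "linear P"
  proof (rule linearI)
    show "P (x + y) = P x + P y" for x y
    proof (rule u)
      have "x + y - (P x + P y) = (x - P x) + (y - P y)" by simp
      then show "x + y - (P x + P y) \<in> S\<^sup>\<bottom>" using subspace_add[OF subspace_orthogonal_comp P(2) P(2)] by metis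
    qed (use P subspace_add[OF S] in blast)
    show "P (c *\<^sub>R x) = c *\<^sub>R P x" for c x
    proof (rule u)
      have "c *\<^sub>R x - c *\<^sub>R P x = c *\<^sub>R (x - P x)" by (simp add: algebra_simps)
      then show "c *\<^sub>R x - c *\<^sub>R P x \<in> S\<^sup>\<bottom>" using subspace_scale[OF subspace_orthogonal_comp P(2)] by metis
    qed (use P subspace_scale[OF S] in blast)
  qed
  moreover have "s \<bullet> P x = s \<bullet> x" if "s \<in> S" for s x
    using P(2)[of x] that by (auto simp: orthogonal_comp_def orthogonal_def inner_diff_right)
  ultimately show ?thesis using that P by blast
qed

text \<open>What integration by parts of \<open>rumin_d_codim1\<close> against \<open>g\<close>
  times the volume form leaves on the test form. Its values need not lie in \<open>E0\<close>, so a
  fibrewise projection follows in \<open>rumin_d_adj_eq\<close>.\<close>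

definition hgrad_form :: "('n point \<Rightarrow> real) \<Rightarrow> 'n point \<Rightarrow> 'n covector" where
  "hgrad_form g x = - (\<Sum>j\<in>UNIV. (sg j * lder (axis j 1) g x) *\<^sub>R axis (UNIV - {j}) 1)"

lemma smooth_hgrad_form: "smooth g \<Longrightarrow> smooth (hgrad_form g)"
  unfolding hgrad_form_def[abs_def] by (intro smooth_minus smooth_sum smooth_scaleR smooth_mult smooth_lder smooth_const)

lemma lebesgue_integral_smooth: "smooth f \<Longrightarrow> (LINT x|lebesgue. f x) = (LINT x|lborel. f x :: real)"
  by (rule integral_completion) (simp add: borel_measurable_continuous_onI smooth_continuous_on)

lemma rumin_d_integral:
  assumes a: "\<alpha> \<in> test_forms gmul (CARD('n) - 1) UNIV" and p: "smooth \<psi>"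
  shows "(LINT x|lebesgue. rumin_d gmul \<alpha> x \<bullet> \<psi> x) = (LINT x|lebesgue. \<alpha> x \<bullet> hgrad_form (\<lambda>x. \<psi> x $ UNIV) x)"
proof -
  define g where "g x = \<psi> x $ UNIV" for x
  define al where "al j x = \<alpha> x $ (UNIV - {j})" for j x
  have g: "smooth g" unfolding g_def by (rule smooth_component[OF p])
  have s: "smooth \<alpha>" and E: "\<And>x. \<alpha> x \<in> E0 gmul (CARD('n) - 1)" using a by (auto simp: test_forms_def)
  have al: "csupp (al j)" for j
    using a smooth_component[OF s] unfolding al_def csupp_def test_forms_def by force
  have "rumin_d gmul \<alpha> x \<bullet> \<psi> x = (\<Sum>j\<in>UNIV. sg j * (lder (axis j 1) (al j) x * g x))" for x
    unfolding rumin_d_codim1[OF s E] by (simp add: inner_axis' g_def al_def[abs_def] sum_distrib_right mult.assoc)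
  moreover have i1: "csupp (\<lambda>x. lder (axis j 1) (al j) x * g x)" for j by (rule csupp_mult'[OF csupp_lder[OF al] g])
  moreover have "\<alpha> x \<bullet> hgrad_form g x = (\<Sum>j\<in>UNIV. - sg j * (al j x * lder (axis j 1) g x))" for x
    by (simp add: hgrad_form_def inner_sum_right inner_axis al_def sum_negf mult_ac)
  moreover have i2: "csupp (\<lambda>x. al j x * lder (axis j 1) g x)" for j by (rule csupp_mult'[OF al smooth_lder[OF g]])
  moreover have "(LINT x|lborel. al j x * lder (axis j 1) g x) = - (LINT x|lborel. lder (axis j 1) (al j) x * g x)" for j
    by (rule lder_by_parts[OF al g])
  moreover have "smooth (\<lambda>x. \<Sum>j\<in>UNIV. sg j * (lder (axis j 1) (al j) x * g x))"
    "smooth (\<lambda>x. \<Sum>j\<in>UNIV. - sg j * (al j x * lder (axis j 1) g x))"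
    by (intro smooth_sum smooth_mult smooth_const csupp_smooth[OF i1] csupp_smooth[OF i2])+
  ultimately show ?thesis
    unfolding g_def[symmetric] by (simp add: lebesgue_integral_smooth csupp_integrable)
qed

text \<open>Evaluates the definite description in \<open>rumin_d_adj\<close>. Existence is
  integration by parts followed by the projection \<open>P\<close>, which pairing with sections of
  \<open>E0\<close> does not notice; uniqueness tests the difference of two candidates against
  itself times a bump.\<close>

lemma rumin_d_adj_eq:
  assumes p: "smooth \<psi>" and P: "linear P" "\<And>x. P x \<in> E0 gmul (CARD('n) - 1)"
    "\<forall>x. \<forall>s \<in> E0 gmul (CARD('n) - 1). s \<bullet> P x = s \<bullet> x"
  shows "rumin_d_adj gmul (CARD('n) - 1) \<psi> = (\<lambda>x. P (hgrad_form (\<lambda>x. \<psi> x $ UNIV) x))"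
  unfolding rumin_d_adj_def
proof (rule the_equality)
  let ?v = "hgrad_form (\<lambda>x. \<psi> x $ UNIV)" and ?E = "E0 gmul (CARD('n) - 1)"
  have sv: "smooth (\<lambda>x. P (?v x))"
    by (rule smooth_linear_comp[OF P(1)[unfolded linear_conv_bounded_linear]], rule smooth_hgrad_form, rule smooth_component[OF p])
  have inner: "\<alpha> x \<bullet> P (?v x) = \<alpha> x \<bullet> ?v x" if "\<alpha> \<in> test_forms gmul (CARD('n) - 1) UNIV" for \<alpha> x
    using that P(3) by (auto simp: test_forms_def)
  show *: "smooth (\<lambda>x. P (?v x)) \<and> (\<forall>x. P (?v x) \<in> ?E) \<and>
     (\<forall>\<alpha> \<in> test_forms gmul (CARD('n) - 1) UNIV.
        (LINT x|lebesgue. rumin_d gmul \<alpha> x \<bullet> \<psi> x) = (LINT x|lebesgue. \<alpha> x \<bullet> P (?v x)))"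
    using sv P(2) inner rumin_d_integral[OF _ p] by auto
  fix \<eta> assume \<eta>: "smooth \<eta> \<and> (\<forall>x. \<eta> x \<in> ?E) \<and>
     (\<forall>\<alpha> \<in> test_forms gmul (CARD('n) - 1) UNIV.
        (LINT x|lebesgue. rumin_d gmul \<alpha> x \<bullet> \<psi> x) = (LINT x|lebesgue. \<alpha> x \<bullet> \<eta> x))"
  define \<delta> where "\<delta> x = \<eta> x - P (?v x)" for x
  have \<delta>: "smooth \<delta>" unfolding \<delta>_def using \<eta> sv by auto
  have "\<delta> a = 0" for a
  proof -
    obtain b :: "'n point \<Rightarrow> real" and K where b: "smooth b" "\<And>x. 0 \<le> b x" "b a > 0" "compact K" "\<And>x. x \<notin> K \<Longrightarrow> b x = 0"
      using smooth_bump[of UNIV a] by auto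
    define \<alpha> where "\<alpha> x = b x *\<^sub>R \<delta> x" for x
    have sa: "smooth \<alpha>" unfolding \<alpha>_def by (intro smooth_scaleR b \<delta>)
    have "\<alpha> x \<in> ?E" for x
      unfolding \<alpha>_def \<delta>_def by (intro subspace_scale[OF subspace_E0] subspace_diff[OF subspace_E0]) (use \<eta> P in auto)
    then have t: "\<alpha> \<in> test_forms gmul (CARD('n) - 1) UNIV"
      using sa b by (auto simp: test_forms_def \<alpha>_def intro!: exI[of _ K])
    define f where "f x = b x * (\<delta> x \<bullet> \<delta> x)" for x
    have f: "csupp f" unfolding f_def csupp_def using b by (auto intro!: smooth_mult smooth_inner \<delta> exI[of _ K])
    have "integrable lborel (\<lambda>x. \<alpha> x \<bullet> \<beta> x)" if "smooth \<beta>" for \<beta>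
      by (rule integrable_compact_support[OF b(4)])
         (rule smooth_continuous_on, rule smooth_inner[OF sa that], simp add: \<alpha>_def b(5))
    then have i: "integrable lborel (\<lambda>x. \<alpha> x \<bullet> \<eta> x)" "integrable lborel (\<lambda>x. \<alpha> x \<bullet> P (?v x))"
      using \<eta> sv by auto
    have 1: "(LINT x|lebesgue. rumin_d gmul \<alpha> x \<bullet> \<psi> x) = (LINT x|lebesgue. \<alpha> x \<bullet> \<eta> x)"
      using \<eta> t by blast
    have 2: "(LINT x|lebesgue. rumin_d gmul \<alpha> x \<bullet> \<psi> x) = (LINT x|lebesgue. \<alpha> x \<bullet> P (?v x))"
      using * t by blast
    from 1 2 have "(LINT x|lborel. \<alpha> x \<bullet> \<eta> x) = (LINT x|lborel. \<alpha> x \<bullet> P (?v x))"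
      using \<eta> by (simp add: lebesgue_integral_smooth smooth_inner sa sv)
    then have "(LINT x|lborel. f x) = 0"
      using Bochner_Integration.integral_diff[OF i] by (simp add: f_def \<alpha>_def \<delta>_def inner_diff_right right_diff_distrib)
    then have "AE x in lborel. f x = 0"
      by (subst integral_nonneg_eq_0_iff_AE[OF csupp_integrable[OF f], symmetric]) (use b(2) in \<open>auto simp: f_def[abs_def]\<close>)
    \<comment> \<open>The zero set is closed and of full measure, hence everything.\<close>
    then have "AE x in lebesgue. x \<in> {x. f x = 0}" by (simp add: AE_completion)
    moreover have "closed {x. f x = 0}"
      using smooth_continuous_on[OF csupp_smooth[OF f]] by (intro closed_Collect_eq) auto
    ultimately have "f a = 0" using mem_closed_if_AE_lebesgue[of "{x. f x = 0}"] by blast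
    then show ?thesis using b(3) by (simp add: f_def)
  qed
  then show "\<eta> = (\<lambda>x. P (?v x))" by (simp add: \<delta>_def fun_eq_iff)
qed

lemma weak_rumin_d_horizontal:
  assumes \<phi>: "\<And>x. \<phi> x = - (\<Sum>a | w a = 1. (sg a * u a x) *\<^sub>R axis (UNIV - {a}) 1)"
    and eq: "\<And>g K. smooth g \<Longrightarrow> compact K \<Longrightarrow> K \<subseteq> U \<Longrightarrow> (\<And>x. x \<notin> K \<Longrightarrow> g x = 0) \<Longrightarrow>
      (LINT x:U|lebesgue. (\<Sum>a | w a = 1. u a x * lder (axis a 1) g x)) = (LINT x:U|lebesgue. \<omega> x $ UNIV * g x)"
  shows "weak_rumin_d gmul (CARD('n) - 1) U \<phi> \<omega>"
  unfolding weak_rumin_d_def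
proof
  fix \<psi> assume t: "\<psi> \<in> test_forms gmul (Suc (CARD('n) - 1)) U"
  define g where "g x = \<psi> x $ UNIV" for x
  have c: "Suc (CARD('n) - 1) = CARD('n)" by simp
  obtain K where s: "smooth \<psi>" and E: "\<And>x. \<psi> x \<in> E0 gmul CARD('n)" and K: "compact K" "K \<subseteq> U" "\<And>x. x \<notin> K \<Longrightarrow> \<psi> x = 0"
    using t unfolding test_forms_def c by blast
  obtain P where P: "linear P" "\<And>x. P x \<in> E0 gmul (CARD('n) - 1)"
    "\<forall>x. \<forall>s \<in> E0 gmul (CARD('n) - 1). s \<bullet> P x = s \<bullet> x"
    using orthogonal_projection_exists[OF subspace_E0[of "CARD('n) - 1"]] by metis
  have \<phi>E: "\<phi> x \<in> E0 gmul (CARD('n) - 1)" for x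
    unfolding \<phi> by (intro subspace_neg[OF subspace_E0] subspace_sum[OF subspace_E0] subspace_scale[OF subspace_E0] horizontal_E0) auto
  have "\<phi> x \<bullet> rumin_d_adj gmul (CARD('n) - 1) \<psi> x = (\<Sum>a | w a = 1. u a x * lder (axis a 1) g x)" for x
  proof -
    have "\<phi> x \<bullet> rumin_d_adj gmul (CARD('n) - 1) \<psi> x = \<phi> x \<bullet> hgrad_form g x"
      unfolding rumin_d_adj_eq[OF s P] g_def using P(3) \<phi>E by blast
    also have "\<dots> = (\<Sum>a | w a = 1. (sg a * u a x) * (sg a * lder (axis a 1) g x))"
    proof -
      have "hgrad_form g x $ (UNIV - {a}) = - (sg a * lder (axis a 1) g x)" for a
      proof -
        have "axis (UNIV - {j}) (1::real) $ (UNIV - {a}) = (if j = a then 1 else 0)" for j by (auto simp: axis_def)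
        then show ?thesis by (simp add: hgrad_form_def if_distrib[of "\<lambda>x. _ * x"] cong: if_cong)
      qed
      then show ?thesis unfolding \<phi> by (simp add: inner_sum_left inner_axis' sum_negf)
    qed
    also have "\<dots> = (\<Sum>a | w a = 1. u a x * lder (axis a 1) g x)"
    proof (rule sum.cong[OF refl])
      fix a
      have "(sg a * u a x) * (sg a * lder (axis a 1) g x) = (sg a * sg a) * (u a x * lder (axis a 1) g x)" by (simp add: mult_ac)
      then show "(sg a * u a x) * (sg a * lder (axis a 1) g x) = u a x * lder (axis a 1) g x" by (simp add: sg_sq)
    qed
    finally show ?thesis .
  qed
  moreover have "\<omega> x \<bullet> \<psi> x = \<omega> x $ UNIV * g x" for x
  proof -
    have "\<psi> x = g x *\<^sub>R axis UNIV 1" using E[of x] unfolding E0_top by (auto simp: g_def vec_eq_iff axis_def)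
    then show ?thesis by (simp add: inner_axis)
  qed
  moreover have "(LINT x:U|lebesgue. (\<Sum>a | w a = 1. u a x * lder (axis a 1) g x)) = (LINT x:U|lebesgue. \<omega> x $ UNIV * g x)"
  proof (rule eq[OF _ K(1,2)])
    show "smooth g" unfolding g_def by (rule smooth_component[OF s])
  qed (simp add: g_def K)
  ultimately show "(LINT x:U|lebesgue. \<phi> x \<bullet> rumin_d_adj gmul (CARD('n) - 1) \<psi> x) = (LINT x:U|lebesgue. \<omega> x \<bullet> \<psi> x)" by simp
qed

end

subsection \<open>Homogeneous norms\<close>

text \<open>The inequality \<open>hdim \<ge> 2\<close> comes from \<open>1 \<le> p < Q\<close> in
  the theorem. It makes the exponent \<open>hdim - 1\<close> of the kernel positive and the integral
  of \<open>(1 / t) ^ hdim\<close> converge at infinity.\<close>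

locale carnot_norm = carnot gmul w step
  for gmul :: "('n::{finite,linorder}) group_law" and w :: "'n \<Rightarrow> nat" and step :: nat +
  fixes N :: "'n point \<Rightarrow> real"
  assumes hnorm: "homogeneous_norm gmul w N" and hdim2: "hdim \<ge> 2"
begin

lemma N_continuous: "continuous_on S N"
  and N_nonneg [simp]: "0 \<le> N p" and N_eq_0 [simp]: "N p = 0 \<longleftrightarrow> p = 0"
  and N_minus [simp]: "N (- p) = N p" and N_dil: "l > 0 \<Longrightarrow> N (dil l p) = l * N p"
  and N_gmul: "N (gmul p q) \<le> N p + N q"
  using hnorm continuous_on_subset[of UNIV N S] unfolding homogeneous_norm_def by auto

lemma N_measurable [measurable]: "N \<in> borel_measurable borel"
  by (intro borel_measurable_continuous_onI N_continuous)

lemma N_swap: "N (gmul (- p) q) = N (gmul (- q) p)"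
  using N_minus[of "gmul (- p) q"] minus_gmul[of "- p" q] by simp

text \<open>A dilation brings a point outside the Euclidean unit ball onto the unit sphere, where
  \<open>N\<close> is at least some \<open>m > 0\<close> by compactness. Its parameter is then at
  least \<open>m / c\<close>, which bounds every coordinate since no weight exceeds
  \<open>step\<close>.\<close>

lemma norm_le_N:
  obtains A where "\<And>x. N x \<le> c \<Longrightarrow> norm x \<le> A"
proof -
  have "sphere (0::'n point) 1 \<noteq> {}" by simp
  then obtain x0 where x0: "x0 \<in> sphere (0::'n point) 1" "\<And>x. x \<in> sphere 0 1 \<Longrightarrow> N x0 \<le> N x"
    using continuous_attains_inf[OF compact_sphere _ N_continuous] by blast
  define m where "m = N x0"
  have "x0 \<noteq> 0" using x0 by auto
  then have m: "m > 0" unfolding m_def using N_nonneg[of x0] N_eq_0[of x0] by (simp add: less_le)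
  have "norm x \<le> max 1 (real CARD('n) * (c / m) ^ step)" if x: "N x \<le> c" for x
  proof (cases "norm x \<le> 1")
    case False
    have "continuous_on {0..1} (\<lambda>l. norm (dil l x))" by (intro continuous_intros continuous_dil)
    then obtain l where l: "0 \<le> l" "l \<le> 1" "norm (dil l x) = 1"
    proof -
      have "dil 1 x = x" by (simp add: dilation_def)
      then have "norm (dil 0 x) \<le> 1" "1 \<le> norm (dil 1 x)" using False by simp_all
      then show ?thesis using IVT'[of "\<lambda>l. norm (dil l x)" 0 1 1] that
          \<open>continuous_on {0..1} (\<lambda>l. norm (dil l x))\<close> zero_le_one by blast
    qed
    then have l0: "l > 0" using dil_0[of x] by (cases "l = 0") auto
    have "m \<le> N (dil l x)" unfolding m_def using l by (intro x0) simp
    then have "m \<le> l * c" using N_dil[OF l0, of x] x mult_left_mono[OF x, of l] l0 by linarith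
    moreover have "c > 0"
    proof (rule ccontr)
      assume "\<not> c > 0" then have "l * c \<le> 0" using l0 by (simp add: mult_nonneg_nonpos)
      then show False using \<open>m \<le> l * c\<close> m by simp
    qed
    ultimately have il: "1 / l \<le> c / m" using m l0 by (simp add: field_simps)
    have "\<bar>x $ j\<bar> \<le> (c / m) ^ step" for j
    proof -
      have "\<bar>l ^ w j * x $ j\<bar> \<le> 1" using component_le_norm_cart[of "dil l x" j] l by (simp add: dilation_def)
      then have "\<bar>x $ j\<bar> \<le> (1 / l) ^ w j" using l0 by (simp add: abs_mult power_divide field_simps)
      also have "\<dots> \<le> (1 / l) ^ step" using l l0 carnot by (intro power_increasing) (auto simp: carnot_group_def)
      also have "\<dots> \<le> (c / m) ^ step" using il l0 by (intro power_mono) auto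
      finally show ?thesis .
    qed
    then have "(\<Sum>j\<in>UNIV. \<bar>x $ j\<bar>) \<le> (\<Sum>j\<in>(UNIV::'n set). (c / m) ^ step)" by (intro sum_mono)
    then show ?thesis using norm_le_l1_cart[of x] by simp
  qed simp
  then show ?thesis using that by blast
qed

lemma compact_N_le: "compact {x. N x \<le> c}"
proof -
  obtain A where A: "\<And>x. N x \<le> c \<Longrightarrow> norm x \<le> A" using norm_le_N[of c] by blast
  have "bounded {x. N x \<le> c}" using A by (auto simp: bounded_iff)
  moreover have "closed {x. N x \<le> c}" by (intro closed_Collect_le N_continuous continuous_on_const)
  ultimately show ?thesis by (simp add: compact_eq_bounded_closed)
qed

definition vol1 :: real where "vol1 = measure lborel {x. N x \<le> 1}"

lemma emeasure_N_le: "c > 0 \<Longrightarrow> emeasure lborel {x. N x \<le> c} = ennreal (c ^ hdim * vol1)"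
proof -
  assume c: "c > 0"
  have [measurable]: "{x. N x \<le> a} \<in> sets borel" for a by measurable
  have "emeasure lborel {x. N x \<le> c} = (\<integral>\<^sup>+x. indicator {x. N x \<le> c} x \<partial>lborel)" by simp
  also have "\<dots> = ennreal (c ^ hdim) * (\<integral>\<^sup>+x. indicator {x. N x \<le> c} (dil c x) \<partial>lborel)"
    by (rule nn_integral_dil[OF c]) simp
  also have "(\<lambda>x. indicator {x. N x \<le> c} (dil c x)) = (indicator {x. N x \<le> 1} :: _ \<Rightarrow> ennreal)"
    using c by (auto simp: fun_eq_iff indicator_def N_dil)
  also have "(\<integral>\<^sup>+x. indicator {x. N x \<le> 1} x \<partial>lborel) = ennreal vol1"
    using emeasure_compact_finite[OF compact_N_le[of 1]]
    by (simp add: vol1_def emeasure_eq_ennreal_measure)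
  finally show ?thesis using c by (simp add: ennreal_mult'[symmetric] vol1_def)
qed

text \<open>Junk value: \<open>rk 0 = 0\<close>, so bounds by \<open>rk\<close> are stated away from the identity.\<close>

definition rk :: "'n point \<Rightarrow> real" where "rk x = 1 / N x ^ (hdim - 1)"

lemma rk_nonneg [simp]: "0 \<le> rk x" by (simp add: rk_def)

lemma rk_measurable [measurable]: "rk \<in> borel_measurable borel" unfolding rk_def[abs_def] by measurable

lemma rk_dil: "l > 0 \<Longrightarrow> rk (dil l x) = rk x / l ^ (hdim - 1)"
  by (simp add: rk_def N_dil power_mult_distrib)

end

subsection \<open>Horizontal representation of left-invariant derivatives\<close>

context carnot
begin

text \<open>Differentiates in the second variable only; the first is a parameter that later places
  the bump.\<close>

definition ldz :: "'n point \<Rightarrow> ('n point \<times> 'n point \<Rightarrow> real) \<Rightarrow> 'n point \<times> 'n point \<Rightarrow> real" where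
  "ldz v c q = dird (0, X v (snd q)) c q"

lemma ldz_eq: "smooth c \<Longrightarrow> ldz v c (p, z) = lder v (\<lambda>z. c (p, z)) z"
proof -
  assume c: "smooth c"
  have "dird (X v z) (\<lambda>z. c (p, z)) z = dird (dird (X v z) (\<lambda>z. (p, z)) z) c (p, z)"
    by (rule dird_compose[OF c]) (intro smooth_Pair smooth_const smooth_id)
  also have "dird (X v z) (\<lambda>z. (p, z)) z = (0, X v z)"
    by (rule dird_eqI[where f'="\<lambda>v. (0, v)"]) (auto intro!: derivative_eq_intros)
  finally show ?thesis by (simp add: ldz_def lder_def)
qed

lemma smooth_ldz: "smooth c \<Longrightarrow> smooth (ldz v c)"
proof -
  assume c: "smooth c"
  have "linear (\<lambda>u. dird (0, u) c q)" for q
  proof (rule linearI)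
    note l = linear_dird[OF c, of q]
    show "dird (0, x + y) c q = dird (0, x) c q + dird (0, y) c q" for x y
      using linear_add[OF l, of "(0, x)" "(0, y)"] by simp
    show "dird (0, r *\<^sub>R x) c q = r *\<^sub>R dird (0, x) c q" for r x
      using linear_cmul[OF l, of r "(0, x)"] by simp
  qed
  then have "smooth (\<lambda>q. dird (0, X v (snd q)) c q)"
    by (rule smooth_linear_family[where L="\<lambda>q u. dird (0, u) c q" and g="\<lambda>q. X v (snd q)"])
       (intro smooth_dird c smooth_compose[OF smooth_X] smooth_snd smooth_id)+
  then show ?thesis by (simp add: ldz_def[abs_def])
qed

lemma csupp_section:
  fixes c :: "'n point \<times> 'n point \<Rightarrow> real"
  assumes "smooth c" "compact {z. (p, z) \<in> Z}" "\<And>q. q \<notin> Z \<Longrightarrow> c q = 0" shows "csupp (\<lambda>z. c (p, z))"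
  unfolding csupp_def
proof (intro conjI exI[of _ "{z. (p, z) \<in> Z}"])
  show "smooth (\<lambda>z. c (p, z))" using assms(1) by (rule smooth_compose) (intro smooth_Pair smooth_const smooth_id)
qed (use assms in auto)

text \<open>A derivative along \<open>v\<close> against a test function can be traded for horizontal
  derivatives whose coefficients are smooth and supported in the same set. The coefficients are
  chosen before \<open>p\<close> and \<open>h\<close> and are jointly smooth in \<open>p\<close>, so
  that compactness later bounds them uniformly.\<close>

definition horizontalizable :: "('n point \<times> 'n point) set \<Rightarrow> 'n point \<Rightarrow> bool" where
  "horizontalizable Z v \<longleftrightarrow> (\<forall>c :: 'n point \<times> 'n point \<Rightarrow> real. smooth c \<and> (\<forall>q. q \<notin> Z \<longrightarrow> c q = 0) \<longrightarrow>
     (\<exists>C. (\<forall>a. smooth (C a) \<and> (\<forall>q. q \<notin> Z \<longrightarrow> C a q = 0)) \<and>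
       (\<forall>p h. smooth h \<longrightarrow> (LINT z|lborel. c (p, z) * lder v h z)
          = (LINT z|lborel. (\<Sum>a | w a = 1. C a (p, z) * lder (axis a 1) h z)))))"

context
  fixes Z :: "('n point \<times> 'n point) set"
  assumes Z: "closed Z" "\<And>p. compact {z. (p, z) \<in> Z}"
begin

lemma integrable_section:
  fixes c :: "'n point \<times> 'n point \<Rightarrow> real"
  assumes "smooth c" "\<forall>q. q \<notin> Z \<longrightarrow> c q = 0" "smooth h"
  shows "integrable lborel (\<lambda>z. c (p, z) * h z)"
  using csupp_integrable[OF csupp_mult'[OF csupp_section[OF assms(1) Z(2)] assms(3)]] assms(2) by blast

lemma integrable_hsum:
  fixes C :: "'n \<Rightarrow> 'n point \<times> 'n point \<Rightarrow> real"
  assumes "\<forall>a. smooth (C a) \<and> (\<forall>q. q \<notin> Z \<longrightarrow> C a q = 0)" "smooth h"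
  shows "integrable lborel (\<lambda>z. \<Sum>a | w a = 1. C a (p, z) * lder (axis a 1) h z)"
proof (rule Bochner_Integration.integrable_sum)
  fix a
  have "smooth (C a)" "\<forall>q. q \<notin> Z \<longrightarrow> C a q = 0" using assms(1) by blast+
  then show "integrable lborel (\<lambda>z. C a (p, z) * lder (axis a 1) h z)"
    by (rule integrable_section[OF _ _ smooth_lder[OF assms(2)]])
qed

lemma subspace_horizontalizable: "subspace {v. horizontalizable Z v}"
  unfolding subspace_def mem_Collect_eq
proof (intro conjI allI impI ballI)
  show "horizontalizable Z 0"
    unfolding horizontalizable_def
    by (intro allI impI exI[of _ "\<lambda>a q. 0"]) (simp add: linear_0[OF linear_lder])
next
  fix x y assume xy: "x \<in> {v. horizontalizable Z v}" "y \<in> {v. horizontalizable Z v}"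
  show "horizontalizable Z (x + y)" unfolding horizontalizable_def
  proof (intro allI impI)
    fix c :: "'n point \<times> 'n point \<Rightarrow> real" assume c: "smooth c \<and> (\<forall>q. q \<notin> Z \<longrightarrow> c q = 0)"
    obtain C where C: "\<forall>a. smooth (C a) \<and> (\<forall>q. q \<notin> Z \<longrightarrow> C a q = 0)"
      "\<forall>p h. smooth h \<longrightarrow> (LINT z|lborel. c (p, z) * lder x h z) = (LINT z|lborel. (\<Sum>a | w a = 1. C a (p, z) * lder (axis a 1) h z))"
      using xy(1) c unfolding horizontalizable_def by blast
    obtain D where D: "\<forall>a. smooth (D a) \<and> (\<forall>q. q \<notin> Z \<longrightarrow> D a q = 0)"
      "\<forall>p h. smooth h \<longrightarrow> (LINT z|lborel. c (p, z) * lder y h z) = (LINT z|lborel. (\<Sum>a | w a = 1. D a (p, z) * lder (axis a 1) h z))"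
      using xy(2) c unfolding horizontalizable_def by blast
    show "\<exists>C. (\<forall>a. smooth (C a) \<and> (\<forall>q. q \<notin> Z \<longrightarrow> C a q = 0)) \<and>
       (\<forall>p h. smooth h \<longrightarrow> (LINT z|lborel. c (p, z) * lder (x + y) h z)
          = (LINT z|lborel. (\<Sum>a | w a = 1. C a (p, z) * lder (axis a 1) h z)))"
    proof (intro exI[of _ "\<lambda>a q. C a q + D a q"] conjI allI impI)
      fix p and h :: "'n point \<Rightarrow> real" assume h: "smooth h"
      have "(LINT z|lborel. c (p, z) * lder (x + y) h z) = (LINT z|lborel. c (p, z) * lder x h z) + (LINT z|lborel. c (p, z) * lder y h z)"
        using c h by (simp add: linear_add[OF linear_lder] distrib_left integrable_section smooth_lder)
      also have "\<dots> = (LINT z|lborel. (\<Sum>a | w a = 1. C a (p, z) * lder (axis a 1) h z)) + (LINT z|lborel. (\<Sum>a | w a = 1. D a (p, z) * lder (axis a 1) h z))"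
        using C D h by simp
      also have "\<dots> = (LINT z|lborel. (\<Sum>a | w a = 1. (C a (p, z) + D a (p, z)) * lder (axis a 1) h z))"
        using integrable_hsum[OF C(1) h] integrable_hsum[OF D(1) h] by (simp add: distrib_right sum.distrib)
      finally show "(LINT z|lborel. c (p, z) * lder (x + y) h z) = (LINT z|lborel. (\<Sum>a | w a = 1. (C a (p, z) + D a (p, z)) * lder (axis a 1) h z))" .
    qed (use C D in auto)
  qed
next
  fix r x assume x: "x \<in> {v. horizontalizable Z v}"
  show "horizontalizable Z (r *\<^sub>R x)" unfolding horizontalizable_def
  proof (intro allI impI)
    fix c :: "'n point \<times> 'n point \<Rightarrow> real" assume c: "smooth c \<and> (\<forall>q. q \<notin> Z \<longrightarrow> c q = 0)"
    obtain C where C: "\<forall>a. smooth (C a) \<and> (\<forall>q. q \<notin> Z \<longrightarrow> C a q = 0)"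
      "\<forall>p h. smooth h \<longrightarrow> (LINT z|lborel. c (p, z) * lder x h z) = (LINT z|lborel. (\<Sum>a | w a = 1. C a (p, z) * lder (axis a 1) h z))"
      using x c unfolding horizontalizable_def by blast
    show "\<exists>C. (\<forall>a. smooth (C a) \<and> (\<forall>q. q \<notin> Z \<longrightarrow> C a q = 0)) \<and>
       (\<forall>p h. smooth h \<longrightarrow> (LINT z|lborel. c (p, z) * lder (r *\<^sub>R x) h z)
          = (LINT z|lborel. (\<Sum>a | w a = 1. C a (p, z) * lder (axis a 1) h z)))"
    proof (intro exI[of _ "\<lambda>a q. r * C a q"] conjI allI impI)
      fix p and h :: "'n point \<Rightarrow> real" assume h: "smooth h"
      have "(LINT z|lborel. c (p, z) * lder (r *\<^sub>R x) h z) = r * (LINT z|lborel. c (p, z) * lder x h z)"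
        using c h by (simp add: linear_cmul[OF linear_lder] mult.left_commute)
      also have "\<dots> = (LINT z|lborel. r * (\<Sum>a | w a = 1. C a (p, z) * lder (axis a 1) h z))"
        using C h by simp
      finally show "(LINT z|lborel. c (p, z) * lder (r *\<^sub>R x) h z) = (LINT z|lborel. (\<Sum>a | w a = 1. r * C a (p, z) * lder (axis a 1) h z))"
        by (simp add: sum_distrib_left mult.assoc)
    qed (use C in auto)
  qed
qed

text \<open>The commutator is a difference of two second-order terms. In each, one derivative is
  integrated by parts onto \<open>c\<close>, which stays supported in \<open>Z\<close>, and the
  remaining derivative is covered by assumption.\<close>

lemma horizontalizable_br:
  assumes a: "horizontalizable Z a" and b: "horizontalizable Z b" shows "horizontalizable Z (br a b)"
  unfolding horizontalizable_def
proof (intro allI impI)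
  fix c :: "'n point \<times> 'n point \<Rightarrow> real" assume c: "smooth c \<and> (\<forall>q. q \<notin> Z \<longrightarrow> c q = 0)"
  have out: "ldz v c q = 0" if "q \<notin> Z" for v q
    unfolding ldz_def by (rule dird_eq_0_outside[OF Z(1) _ that]) (use c in blast)
  have cv: "smooth (ldz v c) \<and> (\<forall>q. q \<notin> Z \<longrightarrow> ldz v c q = 0)" for v using c out smooth_ldz by blast
  obtain C where C: "\<forall>a. smooth (C a) \<and> (\<forall>q. q \<notin> Z \<longrightarrow> C a q = 0)"
    "\<forall>p h. smooth h \<longrightarrow> (LINT z|lborel. ldz a c (p, z) * lder b h z) = (LINT z|lborel. (\<Sum>a | w a = 1. C a (p, z) * lder (axis a 1) h z))"
    using b cv[of a] unfolding horizontalizable_def by blast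
  obtain D where D: "\<forall>a. smooth (D a) \<and> (\<forall>q. q \<notin> Z \<longrightarrow> D a q = 0)"
    "\<forall>p h. smooth h \<longrightarrow> (LINT z|lborel. ldz b c (p, z) * lder a h z) = (LINT z|lborel. (\<Sum>a | w a = 1. D a (p, z) * lder (axis a 1) h z))"
    using a cv[of b] unfolding horizontalizable_def by blast
  show "\<exists>C. (\<forall>a. smooth (C a) \<and> (\<forall>q. q \<notin> Z \<longrightarrow> C a q = 0)) \<and>
     (\<forall>p h. smooth h \<longrightarrow> (LINT z|lborel. c (p, z) * lder (br a b) h z)
        = (LINT z|lborel. (\<Sum>a | w a = 1. C a (p, z) * lder (axis a 1) h z)))"
  proof (intro exI[of _ "\<lambda>a q. D a q - C a q"] conjI allI impI)
    fix p and h :: "'n point \<Rightarrow> real" assume h: "smooth h"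
    have cs: "csupp (\<lambda>z. c (p, z))" using csupp_section[OF _ Z(2)] c by blast
    have parts: "(LINT z|lborel. c (p, z) * lder u (lder v h) z) = - (LINT z|lborel. ldz u c (p, z) * lder v h z)" for u v
      using lder_by_parts[OF cs smooth_lder[OF h], of u v] ldz_eq[of c u p] c by simp
    have "(LINT z|lborel. c (p, z) * lder (br a b) h z)
        = (LINT z|lborel. c (p, z) * lder a (lder b h) z) - (LINT z|lborel. c (p, z) * lder b (lder a h) z)"
      using c h by (simp add: lder_comm[OF h, symmetric] right_diff_distrib integrable_section smooth_lder)
    also have "\<dots> = (LINT z|lborel. (\<Sum>a | w a = 1. D a (p, z) * lder (axis a 1) h z)) - (LINT z|lborel. (\<Sum>a | w a = 1. C a (p, z) * lder (axis a 1) h z))"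
      unfolding parts using C D h by simp
    also have "\<dots> = (LINT z|lborel. (\<Sum>a | w a = 1. (D a (p, z) - C a (p, z)) * lder (axis a 1) h z))"
      using integrable_hsum[OF C(1) h] integrable_hsum[OF D(1) h] by (simp add: left_diff_distrib sum_subtractf)
    finally show "(LINT z|lborel. c (p, z) * lder (br a b) h z) = (LINT z|lborel. (\<Sum>a | w a = 1. (D a (p, z) - C a (p, z)) * lder (axis a 1) h z))" .
  qed (use C D in auto)
qed

lemma horizontalizable_first_layer:
  assumes "v \<in> layer w 1" shows "horizontalizable Z v"
proof -
  have "horizontalizable Z (axis b 1)" if "w b = 1" for b
    unfolding horizontalizable_def
  proof (intro allI impI)
    fix c :: "'n point \<times> 'n point \<Rightarrow> real" assume c: "smooth c \<and> (\<forall>q. q \<notin> Z \<longrightarrow> c q = 0)"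
    have *: "(if a = b then c q else 0) * t = (if a = b then c q * t else 0)" for a q and t :: real by simp
    have "smooth (\<lambda>q. if a = b then c q else 0)" for a using c by (cases "a = b") auto
    then show "\<exists>C. (\<forall>a. smooth (C a) \<and> (\<forall>q. q \<notin> Z \<longrightarrow> C a q = 0)) \<and>
     (\<forall>p h. smooth h \<longrightarrow> (LINT z|lborel. c (p, z) * lder (axis b 1) h z)
        = (LINT z|lborel. (\<Sum>a | w a = 1. C a (p, z) * lder (axis a 1) h z)))"
      by (intro exI[of _ "\<lambda>a q. if a = b then c q else 0"]) (use c that in \<open>simp add: *\<close>)
  qed
  then have "layer w 1 \<subseteq> {v. horizontalizable Z v}"
    unfolding layer_def by (intro span_minimal subspace_horizontalizable) auto
  then show ?thesis using assms by auto
qed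

lemma horizontalizable_layer: "i \<ge> 1 \<Longrightarrow> v \<in> layer w i \<Longrightarrow> horizontalizable Z v"
proof (induction i arbitrary: v rule: dec_induct)
  case base
  then show ?case by (rule horizontalizable_first_layer)
next
  case (step i)
  have "span {lie_bracket gmul u v | u v. u \<in> layer w 1 \<and> v \<in> layer w i} \<subseteq> {v. horizontalizable Z v}"
    by (intro span_minimal subspace_horizontalizable)
       (use horizontalizable_first_layer step.IH horizontalizable_br in \<open>auto simp: lie_bracket_eq\<close>)
  then show ?case using step span_bracket[of i] by auto
qed

lemma horizontalizable_axis: "horizontalizable Z (axis j 1)"
  by (rule horizontalizable_layer[OF w_ge_1 axis_in_layer])

end

text \<open>The value at \<open>z\<close> of the generator of the dilations.\<close>

definition euler :: "'n point \<Rightarrow> 'n point" where "euler z = (\<chi> j. real (w j) * z $ j)"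

lemma smooth_euler: "smooth euler"
  unfolding euler_def[abs_def] by (intro smooth_vec) (simp add: smooth_mult smooth_component)

lemma euler_horizontal:
  fixes e :: "'n point \<times> 'n point \<Rightarrow> real"
  assumes Z: "closed Z" "\<And>p. compact {z. (p, z) \<in> Z}" and e: "smooth e" "\<And>q. q \<notin> Z \<Longrightarrow> e q = 0"
  obtains C where "\<And>a. smooth (C a)" "\<And>a q. q \<notin> Z \<Longrightarrow> C a q = 0"
    "\<And>p h. smooth h \<Longrightarrow> (LINT z|lborel. e (p, z) * dird (euler z) h z)
       = (LINT z|lborel. (\<Sum>a | w a = 1. C a (p, z) * lder (axis a 1) h z))"
proof -
  \<comment> \<open>The coefficients of \<open>e\<close> times the Euler field in the left-invariant
    frame; \<open>horizontalizable_axis\<close> treats them one at a time.\<close>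
  define b where "b j q = Th (snd q) (euler (snd q)) $ j * e q" for j and q :: "'n point \<times> 'n point"
  have b: "smooth (b j)" "\<forall>q. q \<notin> Z \<longrightarrow> b j q = 0" for j
  proof -
    have "smooth (\<lambda>q. Th (snd q) (euler (snd q)) :: 'n point)"
      by (rule smooth_Th_comp[OF smooth_snd[OF smooth_id] smooth_compose[OF smooth_euler smooth_snd[OF smooth_id]]])
    then show "smooth (b j)" unfolding b_def by (intro smooth_mult smooth_component e)
    show "\<forall>q. q \<notin> Z \<longrightarrow> b j q = 0" using e(2) by (simp add: b_def)
  qed
  define P where "P j C \<longleftrightarrow> (\<forall>a. smooth (C a) \<and> (\<forall>q. q \<notin> Z \<longrightarrow> C a q = 0)) \<and>
       (\<forall>p h. smooth h \<longrightarrow> (LINT z|lborel. b j (p, z) * lder (axis j 1) h z)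
          = (LINT z|lborel. (\<Sum>a | w a = 1. C a (p, z) * lder (axis a 1) h z)))"
    for j and C :: "'n \<Rightarrow> 'n point \<times> 'n point \<Rightarrow> real"
  have "\<exists>C. P j C" for j
    using horizontalizable_axis[OF Z, of j] b[of j] unfolding horizontalizable_def P_def by blast
  then obtain C0 where C0: "\<And>j. P j (C0 j)" using choice[of P] by blast
  define C where "C = C0"
  have C: "\<And>j. \<forall>a. smooth (C j a) \<and> (\<forall>q. q \<notin> Z \<longrightarrow> C j a q = 0)"
    "\<And>j p h. smooth h \<Longrightarrow> (LINT z|lborel. b j (p, z) * lder (axis j 1) h z)
          = (LINT z|lborel. (\<Sum>a | w a = 1. C j a (p, z) * lder (axis a 1) h z))"
    using C0 unfolding P_def C_def by blast+
  show ?thesis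
  proof (rule that[of "\<lambda>a q. \<Sum>j\<in>UNIV. C j a q"])
    show "smooth (\<lambda>q. \<Sum>j\<in>UNIV. C j a q)" for a using C by (intro smooth_sum) auto
    show "(\<Sum>j\<in>UNIV. C j a q) = 0" if "q \<notin> Z" for a q
      by (rule sum.neutral, rule ballI) (use C(1) that in blast)
    fix p and h :: "'n point \<Rightarrow> real" assume h: "smooth h"
    have "e (p, z) * dird (euler z) h z = (\<Sum>j\<in>UNIV. b j (p, z) * lder (axis j 1) h z)" for z
      unfolding dird_eq_lder linear_vec_expand[OF linear_lder[OF h], of "Th z (euler z)"]
      by (simp add: b_def sum_distrib_left mult_ac)
    then have "(LINT z|lborel. e (p, z) * dird (euler z) h z) = (\<Sum>j\<in>UNIV. LINT z|lborel. b j (p, z) * lder (axis j 1) h z)"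
      using integrable_section[OF Z b smooth_lder[OF h]] by simp
    also have "\<dots> = (LINT z|lborel. (\<Sum>j\<in>UNIV. \<Sum>a | w a = 1. C j a (p, z) * lder (axis a 1) h z))"
      unfolding C(2)[OF h] using integrable_hsum[OF Z C(1) h] by simp
    also have "\<dots> = (LINT z|lborel. (\<Sum>a | w a = 1. (\<Sum>j\<in>UNIV. C j a (p, z)) * lder (axis a 1) h z))"
      by (subst sum.swap) (simp add: sum_distrib_right)
    finally show "(LINT z|lborel. e (p, z) * dird (euler z) h z)
       = (LINT z|lborel. (\<Sum>a | w a = 1. (\<Sum>j\<in>UNIV. C j a (p, z)) * lder (axis a 1) h z))" .
  qed
qed

lemma smooth_dil_joint: "smooth (\<lambda>(t, x). dil t x)"
  unfolding case_prod_beta dilation_def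
  by (intro smooth_vec) (simp add: smooth_mult smooth_power smooth_component smooth_fst smooth_snd)

text \<open>The \<open>t\<close>-derivative is turned into a horizontal one; homogeneity makes the powers of \<open>t\<close> cancel.\<close>

lemma dilation_flow_integral:
  fixes e :: "'n point \<times> 'n point \<Rightarrow> real" and C :: "'n \<Rightarrow> 'n point \<times> 'n point \<Rightarrow> real"
  assumes Z: "closed Z" "\<And>p. compact {z. (p, z) \<in> Z}" and e: "smooth e" "\<And>q. q \<notin> Z \<Longrightarrow> e q = 0"
    and C: "\<And>p h. smooth h \<Longrightarrow> (LINT z|lborel. e (p, z) * dird (euler z) h z)
       = (LINT z|lborel. (\<Sum>a | w a = 1. C a (p, z) * lder (axis a 1) h z))"
    and g: "smooth g"
  shows "(LINT z|lborel. e (p, z) * g z) - g 0 * (LINT z|lborel. e (p, z))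
     = (LINT t:{0<..1}|lborel. LINT z|lborel. (\<Sum>a | w a = 1. C a (p, z) * lder (axis a 1) g (dil t z)))"
proof -
  define G where "G = (\<lambda>(t, z). g (dil t z))"
  have G: "smooth G" unfolding G_def case_prod_beta
    using smooth_compose[OF g smooth_dil_joint] by (simp add: case_prod_beta')
  have cse: "csupp (\<lambda>z. e (p, z))" by (rule csupp_section[OF e(1) Z(2) e(2)])
  have st: "smooth (\<lambda>z. g (dil t z))" for t by (rule smooth_compose[OF g smooth_linear[OF linear_dil]])
  define \<Gamma> where "\<Gamma> t z = e (p, z) * dird (1, 0) G (t, z)" for t z
  have "(LINT z|lborel. e (p, z) * G (1, z)) - (LINT z|lborel. e (p, z) * G (0, z)) = (LINT t:{0..1}|lborel. LINT z|lborel. \<Gamma> t z)"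
  proof (rule integral_flow_difference[OF Z(2)[of p]])
    show "\<Gamma> t z = 0" if "z \<notin> {z. (p, z) \<in> Z}" for t z using that e(2) by (simp add: \<Gamma>_def)
    show "((\<lambda>t. e (p, z) * G (t, z)) has_real_derivative \<Gamma> t z) (at t)" for t z
      unfolding \<Gamma>_def using smooth_has_real_derivative_line[OF G, of "(0, z)" "(1, 0)" t]
      by (intro DERIV_cmult) simp
    show "continuous_on ({0..1} \<times> {z. (p, z) \<in> Z}) (\<lambda>(t, z). \<Gamma> t z)"
      unfolding case_prod_beta \<Gamma>_def
      by (intro smooth_continuous_on smooth_mult smooth_compose[OF e(1)] smooth_compose[OF smooth_dird[OF G]] smooth_Pair smooth_fst smooth_snd smooth_const smooth_id)
    show "integrable lborel (\<lambda>z. e (p, z) * G (0, z))" "integrable lborel (\<lambda>z. e (p, z) * G (1, z))"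
      unfolding G_def prod.case by (rule csupp_integrable[OF csupp_mult'[OF cse st]])+
  qed
  also have "(LINT z|lborel. e (p, z) * G (1, z)) = (LINT z|lborel. e (p, z) * g z)" by (simp add: G_def dilation_def)
  also have "(LINT z|lborel. e (p, z) * G (0, z)) = g 0 * (LINT z|lborel. e (p, z))" by (simp add: G_def mult.commute)
  \<comment> \<open>The endpoint 0 is dropped because a factor \<open>1 / t\<close> appears
    below.\<close>
  also have "(LINT t:{0..1}|lborel. LINT z|lborel. \<Gamma> t z) = (LINT t:{0<..1}|lborel. LINT z|lborel. \<Gamma> t z)"
    unfolding set_lebesgue_integral_def
  proof (rule Bochner_Integration.integral_cong_AE)
    have m: "(\<lambda>t. LINT z|lborel. \<Gamma> t z) \<in> borel_measurable borel"
    proof -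
      have "continuous_on UNIV (\<lambda>q. \<Gamma> (fst q) (snd q))" unfolding \<Gamma>_def
        by (intro smooth_continuous_on smooth_mult smooth_compose[OF e(1)] smooth_compose[OF smooth_dird[OF G]] smooth_Pair smooth_fst smooth_snd smooth_const smooth_id)
      then have "(\<lambda>q. \<Gamma> (fst q) (snd q)) \<in> borel_measurable (borel \<Otimes>\<^sub>M borel)"
        unfolding borel_prod by (rule borel_measurable_continuous_onI)
      then have "(\<lambda>(t, z). \<Gamma> t z) \<in> borel_measurable (lborel \<Otimes>\<^sub>M lborel)"
        by (simp add: case_prod_beta' cong: measurable_cong_sets sets_pair_measure_cong)
      then have "(\<lambda>t. LINT z|lborel. \<Gamma> t z) \<in> borel_measurable lborel"
        by (rule lborel.borel_measurable_lebesgue_integral)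
      then show ?thesis by simp
    qed
    show "(\<lambda>t. indicator {0..1} t *\<^sub>R (LINT z|lborel. \<Gamma> t z)) \<in> borel_measurable lborel" using m by simp
    show "(\<lambda>t. indicator {0<..1} t *\<^sub>R (LINT z|lborel. \<Gamma> t z)) \<in> borel_measurable lborel" using m by simp
    have "AE t in lborel. t \<noteq> (0::real)" by (rule AE_lborel_singleton)
    then show "AE t in lborel. indicator {0..1} t *\<^sub>R (LINT z|lborel. \<Gamma> t z) = indicator {0<..1} t *\<^sub>R (LINT z|lborel. \<Gamma> t z)"
      by eventually_elim (auto simp: indicator_def)
  qed
  also have "\<dots> = (LINT t:{0<..1}|lborel. LINT z|lborel. (\<Sum>a | w a = 1. C a (p, z) * lder (axis a 1) g (dil t z)))"
  proof (rule set_lebesgue_integral_cong)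
    show "\<forall>t. t \<in> {0<..1} \<longrightarrow> (LINT z|lborel. \<Gamma> t z) = (LINT z|lborel. (\<Sum>a | w a = 1. C a (p, z) * lder (axis a 1) g (dil t z)))"
    proof (intro allI impI)
      fix t :: real assume "t \<in> {0<..1}" then have t: "t > 0" by simp
      \<comment> \<open>The curve \<open>dil t z\<close> has velocity \<open>dil t (euler z)\<close>
        divided by \<open>t\<close>, which is the Euler derivative taken before dilating.\<close>
      have d: "dird (1, 0) G (t, z) = (1 / t) * dird (euler z) (\<lambda>z. g (dil t z)) z" for z
      proof -
        have D1: "((\<lambda>s. dil s z) has_derivative (\<lambda>h. h *\<^sub>R (1 / t) *\<^sub>R dil t (euler z))) (at t)"
        proof -
          have "((\<lambda>s. s ^ w j * z $ j) has_derivative (\<lambda>h. h * ((1 / t) * (t ^ w j * (real (w j) * z $ j))))) (at t)" for j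
          proof -
            have "((\<lambda>s. s ^ w j * z $ j) has_real_derivative (real (w j) * t ^ (w j - 1)) * z $ j) (at t)"
              by (auto intro!: derivative_eq_intros)
            moreover have "t ^ w j = t * t ^ (w j - 1)" using w_ge_1[of j] by (cases "w j") auto
            then have "(real (w j) * t ^ (w j - 1)) * z $ j = (1 / t) * (t ^ w j * (real (w j) * z $ j))" using t by simp
            moreover have "(\<lambda>h. h * r) = (*) r" for r :: real by (simp add: fun_eq_iff mult.commute)
            ultimately show ?thesis by (simp only: has_field_derivative_def)
          qed
          then show ?thesis
            unfolding dilation_def euler_def by (subst has_derivative_componentwise_within) (auto simp: Basis_vec_def inner_axis)
        qed
        have "((\<lambda>s. g (dil s z)) has_derivative (\<lambda>h. dird (h *\<^sub>R (1 / t) *\<^sub>R dil t (euler z)) g (dil t z))) (at t)"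
          by (rule has_derivative_compose[OF D1 smooth_has_derivative[OF g]])
        then have "dird 1 (\<lambda>s. g (dil s z)) t = dird ((1 / t) *\<^sub>R dil t (euler z)) g (dil t z)"
          using dird_eqI[of "\<lambda>s. g (dil s z)" _ t 1] by simp
        also have "\<dots> = (1 / t) * dird (dil t (euler z)) g (dil t z)" by (simp add: linear_cmul[OF linear_dird[OF g]])
        also have "dird (dil t (euler z)) g (dil t z) = dird (euler z) (\<lambda>z. g (dil t z)) z"
          using dird_compose[OF g smooth_linear[OF linear_dil], of "euler z" t z] by (simp add: dird_linear[OF linear_dil])
        finally have 1: "dird 1 (\<lambda>s. g (dil s z)) t = (1 / t) * dird (euler z) (\<lambda>z. g (dil t z)) z" .
        have "((\<lambda>s. g (dil s z)) has_real_derivative dird (1, 0) G (t, z)) (at t)"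
          using smooth_has_real_derivative_line[OF G, of "(0, z)" "(1, 0)" t] by (simp add: G_def)
        then have "((\<lambda>s. g (dil s z)) has_derivative (*) (dird (1, 0) G (t, z))) (at t)" by (simp add: has_field_derivative_def)
        from dird_eqI[OF this, of 1] 1 show ?thesis by simp
      qed
      have "(LINT z|lborel. \<Gamma> t z) = (1 / t) * (LINT z|lborel. e (p, z) * dird (euler z) (\<lambda>z. g (dil t z)) z)"
        unfolding \<Gamma>_def d by (simp add: mult.left_commute)
      also have "\<dots> = (1 / t) * (LINT z|lborel. (\<Sum>a | w a = 1. C a (p, z) * lder (axis a 1) (\<lambda>z. g (dil t z)) z))"
        unfolding C[OF st] ..
      also have "\<dots> = (1 / t) * (LINT z|lborel. (\<Sum>a | w a = 1. C a (p, z) * (t * lder (axis a 1) g (dil t z))))"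
      proof -
        have "lder (axis a 1) (\<lambda>z. g (dil t z)) z = t * lder (axis a 1) g (dil t z)" if "w a = 1" for a z
          unfolding lder_dil[OF g] dil_axis that by (simp add: linear_cmul[OF linear_lder[OF g]])
        then have "(\<Sum>a | w a = 1. C a (p, z) * lder (axis a 1) (\<lambda>z. g (dil t z)) z)
            = (\<Sum>a | w a = 1. C a (p, z) * (t * lder (axis a 1) g (dil t z)))" for z
          by (intro sum.cong refl) simp
        then show ?thesis by (simp only:)
      qed
      also have "\<dots> = (1 / t) * (t * (LINT z|lborel. (\<Sum>a | w a = 1. C a (p, z) * lder (axis a 1) g (dil t z))))"
        by (simp add: mult.left_commute sum_distrib_left[symmetric])
      finally show "(LINT z|lborel. \<Gamma> t z) = (LINT z|lborel. (\<Sum>a | w a = 1. C a (p, z) * lder (axis a 1) g (dil t z)))"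
        using t by simp
    qed
  qed simp
  finally show ?thesis .
qed

end

text \<open>No integrability is assumed: without it the left side is the default value 0.\<close>

lemma abs_integral_le_nn_integral: "ennreal \<bar>LINT x|M. f x\<bar> \<le> (\<integral>\<^sup>+x. ennreal \<bar>f x\<bar> \<partial>M)"
proof (cases "integrable M f")
  case True then show ?thesis using integral_norm_bound_ennreal[OF True] by simp
next
  case False then show ?thesis by (simp add: not_integrable_integral_eq)
qed

subsection \<open>The kernel\<close>

lemma measurable_fst_borel [measurable]: "fst \<in> borel_measurable (borel :: ('a::euclidean_space \<times> 'b::euclidean_space) measure)"
  by (intro borel_measurable_continuous_onI continuous_intros)

lemma measurable_snd_borel [measurable]: "snd \<in> borel_measurable (borel :: ('a::euclidean_space \<times> 'b::euclidean_space) measure)"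
  by (intro borel_measurable_continuous_onI continuous_intros)

lemma smooth_measurable: "smooth f \<Longrightarrow> f \<in> borel_measurable borel"
  by (intro borel_measurable_continuous_onI smooth_continuous_on)

lemma dyadic_below:
  assumes "0 < u" "u \<le> (1::real)" obtains k :: nat where "u \<le> (1/2) ^ k" "(1/2) ^ Suc k < u"
proof -
  obtain n where n: "(1/2) ^ n < u" using real_arch_pow_inv[of u "1/2"] assms by auto
  define m where "m = (LEAST n. (1/2::real) ^ n < u)"
  have m: "(1/2) ^ m < u" unfolding m_def using n by (rule LeastI)
  have "m \<noteq> 0" using m assms by (cases m) auto
  then obtain k where k: "m = Suc k" using not0_implies_Suc by blast
  have "\<not> (1/2::real) ^ k < u" using not_less_Least[of k "\<lambda>n. (1/2::real) ^ n < u"] k by (simp add: m_def)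
  then show ?thesis using that[of k] m k by simp
qed

lemma dyadic_above:
  assumes "u > (1::real)" obtains k :: nat where "2 ^ k \<le> u" "u \<le> 2 ^ Suc k"
proof -
  obtain n where n: "u < 2 ^ n" using real_arch_pow[of 2 u] by auto
  define m where "m = (LEAST n. u < (2::real) ^ n)"
  have m: "u < 2 ^ m" unfolding m_def using n by (rule LeastI)
  have "m \<noteq> 0" using m assms by (cases m) auto
  then obtain k where k: "m = Suc k" using not0_implies_Suc by blast
  have "\<not> u < (2::real) ^ k" using not_less_Least[of k "\<lambda>n. u < (2::real) ^ n"] k by (simp add: m_def)
  then show ?thesis using that[of k] m k by simp
qed

lemma suminf_geometric_finite:
  assumes "0 \<le> q" "q < (1::real)" "0 \<le> c" shows "(\<Sum>k. ennreal (c * q ^ k)) < \<infinity>"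
proof -
  have "summable (\<lambda>k. c * q ^ k)" using assms by (intro summable_mult summable_geometric) auto
  then have "(\<Sum>k. ennreal (c * q ^ k)) = ennreal (\<Sum>k. c * q ^ k)" using assms by (intro suminf_ennreal2) auto
  then show ?thesis by simp
qed

context carnot_norm
begin

section \<open>Integrability of powers of the kernel\<close>

lemma N_0 [simp]: "N 0 = 0" by simp

lemma rk_0 [simp]: "rk 0 = 0" using hdim2 by (simp add: rk_def)

text \<open>Dyadic shells: where \<open>N x\<close> lies between \<open>(1/2) ^ Suc k\<close> and
  \<open>(1/2) ^ k\<close> the integrand is at most \<open>(2 powr \<beta>) ^ Suc k\<close>, and the
  ball of radius \<open>(1/2) ^ k\<close> has volume \<open>((1/2) ^ k) ^ hdim * vol1\<close>. The
  resulting geometric series has ratio \<open>2 powr (\<beta> - real hdim)\<close>, below 1 by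
  assumption.\<close>

lemma rk_powr_inner_finite:
  assumes s: "s > 0" "real (hdim - 1) * s < real hdim"
  shows "(\<integral>\<^sup>+x. ennreal (rk x powr s) * indicator {x. N x \<le> 1} x \<partial>lborel) < \<infinity>"
proof -
  define \<beta> where "\<beta> = real (hdim - 1) * s"
  define f where "f k x = ennreal ((2 powr \<beta>) ^ Suc k) * indicator {x. N x \<le> (1/2) ^ k} x" for k :: nat and x
  have fm: "f k \<in> borel_measurable lborel" for k
  proof -
    have "{x. N x \<le> (1/2) ^ k} \<in> sets borel" by measurable
    then show ?thesis unfolding f_def by simp
  qed
  have "(\<integral>\<^sup>+x. ennreal (rk x powr s) * indicator {x. N x \<le> 1} x \<partial>lborel) \<le> (\<integral>\<^sup>+x. (\<Sum>k. f k x) \<partial>lborel)"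
  proof (rule nn_integral_mono)
    fix x
    show "ennreal (rk x powr s) * indicator {x. N x \<le> 1} x \<le> (\<Sum>k. f k x)"
    proof (cases "N x \<le> 1 \<and> x \<noteq> 0")
      case True
      then have u: "0 < N x" "N x \<le> 1" using N_nonneg[of x] N_eq_0[of x] by (auto simp: less_le)
      obtain k where k: "N x \<le> (1/2) ^ k" "(1/2) ^ Suc k < N x" using dyadic_below[OF u] .
      have "rk x \<le> 1 / ((1/2) ^ Suc k) ^ (hdim - 1)"
        unfolding rk_def using k u by (intro divide_left_mono power_mono) auto
      also have "\<dots> = (2 ^ Suc k) powr real (hdim - 1)" by (simp add: power_one_over powr_realpow)
      finally have "rk x powr s \<le> ((2 ^ Suc k) powr real (hdim - 1)) powr s" using s by (intro powr_mono2) auto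
      also have "\<dots> = (2 powr \<beta>) ^ Suc k"
      proof -
        have "((2::real) ^ n) powr \<beta> = (2 powr \<beta>) ^ n" for n
          by (simp add: powr_powr mult.commute flip: powr_realpow)
        then show ?thesis unfolding powr_powr \<beta>_def[symmetric] .
      qed
      finally have "ennreal (rk x powr s) * indicator {x. N x \<le> 1} x \<le> f k x"
        using k u by (simp add: f_def ennreal_leI)
      also have "\<dots> = sum (\<lambda>k. f k x) {k}" by simp
      also have "\<dots> \<le> (\<Sum>k. f k x)" by (rule sum_le_suminf) auto
      finally show ?thesis .
    next
      case False
      then show ?thesis by (auto simp: indicator_def)
    qed
  qed
  also have "\<dots> = (\<Sum>k. \<integral>\<^sup>+x. f k x \<partial>lborel)" by (rule nn_integral_suminf[OF fm])
  also have "\<dots> = (\<Sum>k. ennreal (2 powr \<beta> * vol1 * (2 powr (\<beta> - real hdim)) ^ k))"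
  proof (rule suminf_cong)
    fix k
    have m: "{x. N x \<le> (1/2) ^ k} \<in> sets lborel" by measurable
    have "(\<integral>\<^sup>+x. f k x \<partial>lborel) = ennreal ((2 powr \<beta>) ^ Suc k) * ennreal (((1/2) ^ k) ^ hdim * vol1)"
      unfolding f_def using m by (simp add: nn_integral_cmult_indicator emeasure_N_le)
    also have "\<dots> = ennreal ((2 powr \<beta>) ^ Suc k * (((1/2) ^ k) ^ hdim * vol1))"
      by (subst ennreal_mult) (auto simp: vol1_def)
    also have "(2 powr \<beta>) ^ Suc k * (((1/2) ^ k) ^ hdim * vol1) = 2 powr \<beta> * vol1 * (2 powr (\<beta> - real hdim)) ^ k"
      by (simp add: powr_diff powr_realpow power_divide power_one_over power_mult[symmetric] mult.commute)
    finally show "(\<integral>\<^sup>+x. f k x \<partial>lborel) = ennreal (2 powr \<beta> * vol1 * (2 powr (\<beta> - real hdim)) ^ k)" .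
  qed
  also have "\<dots> < \<infinity>"
  proof (rule suminf_geometric_finite)
    have "\<beta> - real hdim < 0" using s(2) unfolding \<beta>_def by linarith
    then have "2 powr (\<beta> - real hdim) < 2 powr 0" by (intro powr_less_mono) auto
    then show "2 powr (\<beta> - real hdim) < 1" by simp
  qed (auto simp: vol1_def)
  finally show ?thesis .
qed

text \<open>The same shells outwards, with powers of 2; the ratio is now
  \<open>2 powr (real hdim - \<beta>)\<close>.\<close>

lemma rk_powr_outer_finite:
  assumes s: "s > 0" "real (hdim - 1) * s > real hdim"
  shows "(\<integral>\<^sup>+x. ennreal (rk x powr s) * indicator {x. N x > 1} x \<partial>lborel) < \<infinity>"
proof -
  define \<beta> where "\<beta> = real (hdim - 1) * s"
  define f where "f k x = ennreal ((2 powr - \<beta>) ^ k) * indicator {x. N x \<le> 2 ^ Suc k} x" for k :: nat and x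
  have fm: "f k \<in> borel_measurable lborel" for k
  proof -
    have "{x. N x \<le> 2 ^ Suc k} \<in> sets borel" by measurable
    then show ?thesis unfolding f_def by simp
  qed
  have "(\<integral>\<^sup>+x. ennreal (rk x powr s) * indicator {x. N x > 1} x \<partial>lborel) \<le> (\<integral>\<^sup>+x. (\<Sum>k. f k x) \<partial>lborel)"
  proof (rule nn_integral_mono)
    fix x
    show "ennreal (rk x powr s) * indicator {x. N x > 1} x \<le> (\<Sum>k. f k x)"
    proof (cases "N x > 1")
      case True
      obtain k where k: "2 ^ k \<le> N x" "N x \<le> 2 ^ Suc k" using dyadic_above[OF True] .
      have "rk x \<le> 1 / (2 ^ k) ^ (hdim - 1)"
        unfolding rk_def using k True by (intro divide_left_mono power_mono) auto
      also have "\<dots> = (2 ^ k) powr - real (hdim - 1)" by (simp add: powr_realpow powr_minus divide_inverse)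
      finally have "rk x powr s \<le> ((2 ^ k) powr - real (hdim - 1)) powr s" using s by (intro powr_mono2) auto
      also have "\<dots> = (2 powr - \<beta>) ^ k"
        by (simp add: powr_powr \<beta>_def mult_ac flip: powr_realpow)
      finally have "ennreal (rk x powr s) * indicator {x. N x > 1} x \<le> f k x"
        using k True by (simp add: f_def ennreal_leI)
      also have "\<dots> = sum (\<lambda>k. f k x) {k}" by simp
      also have "\<dots> \<le> (\<Sum>k. f k x)" by (rule sum_le_suminf) auto
      finally show ?thesis .
    qed simp
  qed
  also have "\<dots> = (\<Sum>k. \<integral>\<^sup>+x. f k x \<partial>lborel)" by (rule nn_integral_suminf[OF fm])
  also have "\<dots> = (\<Sum>k. ennreal (2 ^ hdim * vol1 * (2 powr (real hdim - \<beta>)) ^ k))"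
  proof (rule suminf_cong)
    fix k
    have m: "{x. N x \<le> 2 ^ Suc k} \<in> sets lborel" by measurable
    have "(\<integral>\<^sup>+x. f k x \<partial>lborel) = ennreal ((2 powr - \<beta>) ^ k) * ennreal ((2 ^ Suc k) ^ hdim * vol1)"
      unfolding f_def using m by (simp add: nn_integral_cmult_indicator emeasure_N_le del: power_Suc)
    also have "\<dots> = ennreal ((2 powr - \<beta>) ^ k * ((2 ^ Suc k) ^ hdim * vol1))"
      by (subst ennreal_mult) (auto simp: vol1_def)
    also have "(2 powr - \<beta>) ^ k * ((2 ^ Suc k) ^ hdim * vol1) = 2 ^ hdim * vol1 * (2 powr (real hdim - \<beta>)) ^ k"
      by (simp add: powr_diff powr_minus powr_realpow power_divide divide_inverse power_inverse power_mult_distrib power_mult[symmetric] mult_ac)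
    finally show "(\<integral>\<^sup>+x. f k x \<partial>lborel) = ennreal (2 ^ hdim * vol1 * (2 powr (real hdim - \<beta>)) ^ k)" .
  qed
  also have "\<dots> < \<infinity>"
  proof (rule suminf_geometric_finite)
    have "real hdim - \<beta> < 0" using s(2) unfolding \<beta>_def by linarith
    then have "2 powr (real hdim - \<beta>) < 2 powr 0" by (intro powr_less_mono) auto
    then show "2 powr (real hdim - \<beta>) < 1" by simp
  qed (auto simp: vol1_def)
  finally show ?thesis .
qed

text \<open>The substitution \<open>x = dil t z\<close> turns the integral over \<open>t\<close> and
  \<open>z\<close> in \<open>dilation_flow_integral\<close> into an integral over \<open>x\<close>,
  with Jacobian factor \<open>(1 / t) ^ hdim\<close>. Carrying out the integration in
  \<open>t\<close> leaves this kernel.\<close>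

definition hK :: "('n point \<times> 'n point \<Rightarrow> real) \<Rightarrow> 'n point \<Rightarrow> 'n point \<Rightarrow> real" where
  "hK c p x = (LINT t|lborel. indicator {0<..1} t * ((1 / t) ^ hdim * c (p, dil (1 / t) x)))"

lemma measurable_dil2: "(\<lambda>q. dil (fst q) (snd q)) \<in> borel_measurable borel"
  using smooth_measurable[OF smooth_dil_joint] by (simp add: case_prod_beta')

lemma measurable_dil_inverse [measurable (raw)]:
  assumes [measurable]: "f \<in> borel_measurable M" "h \<in> borel_measurable M" shows "(\<lambda>q. dil (1 / f q) (h q)) \<in> borel_measurable M"
proof -
  have "(\<lambda>q. (1 / f q, h q)) \<in> M \<rightarrow>\<^sub>M borel" unfolding borel_prod[symmetric] by measurable
  from measurable_compose[OF this measurable_dil2] show ?thesis by simp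
qed

lemma hK_measurable:
  assumes c: "smooth c" and [measurable]: "f \<in> borel_measurable M" "h \<in> borel_measurable M"
  shows "(\<lambda>q. hK c (f q) (h q)) \<in> borel_measurable M"
  unfolding hK_def
proof (rule lborel.borel_measurable_lebesgue_integral)
  have [measurable]: "c \<in> borel_measurable borel" by (rule smooth_measurable[OF c])
  have "(\<lambda>q. (f (fst q), dil (1 / snd q) (h (fst q)))) \<in> M \<Otimes>\<^sub>M lborel \<rightarrow>\<^sub>M borel"
    unfolding borel_prod[symmetric] by measurable
  then have [measurable]: "(\<lambda>q. c (f (fst q), dil (1 / snd q) (h (fst q)))) \<in> borel_measurable (M \<Otimes>\<^sub>M lborel)" by measurable
  show "(\<lambda>(q, t). indicator {0<..1} t * ((1 / t) ^ hdim * c (f q, dil (1 / t) (h q)))) \<in> borel_measurable (M \<Otimes>\<^sub>M lborel)"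
    unfolding case_prod_beta' by measurable
qed

lemma N_dil_inverse: "t > 0 \<Longrightarrow> N (dil (1 / t) x) = N x / t"
  using N_dil[of "1 / t" x] by simp

lemma hK_support:
  assumes "\<And>z. c (p, z) \<noteq> 0 \<Longrightarrow> N z \<le> R" "N x > R" shows "hK c p x = 0"
proof -
  have "indicator {0<..1} t * ((1 / t) ^ hdim * c (p, dil (1 / t) x)) = 0" for t :: real
  proof (cases "t \<in> {0<..1}")
    case True
    then have "N x \<le> N (dil (1 / t) x)" by (simp add: N_dil_inverse le_divide_eq mult_left_le)
    then have "c (p, dil (1 / t) x) = 0" using assms by force
    then show ?thesis by simp
  qed simp
  then have "(\<lambda>t. indicator {0<..1} t * ((1 / t) ^ hdim * c (p, dil (1 / t) x))) = (\<lambda>t::real. 0)" by (rule ext)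
  then show ?thesis unfolding hK_def by (simp only: Bochner_Integration.integral_zero)
qed

text \<open>The support of \<open>c\<close> forces \<open>t \<ge> N x / R\<close>, so the kernel is
  at most \<open>A\<close> times the integral of \<open>(1 / t) ^ hdim\<close> from there to
  infinity, which has the order of \<open>rk x\<close>.\<close>

lemma hK_bound:
  assumes c: "\<And>z. c (p, z) \<noteq> 0 \<Longrightarrow> N z \<le> R" "\<And>z. \<bar>c (p, z)\<bar> \<le> A" and R: "R > 0" and x: "x \<noteq> 0"
  shows "\<bar>hK c p x\<bar> \<le> A * R ^ (hdim - 1) * rk x"
proof -
  have A: "0 \<le> A" using c(2)[of 0] by simp
  have Nx: "N x > 0" using x N_nonneg[of x] N_eq_0[of x] by (simp add: less_le)
  define s where "s = N x / R"
  have s: "s > 0" using Nx R by (simp add: s_def)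
  \<comment> \<open>With \<open>hdim = d + 2\<close> the antiderivative has exponent
    \<open>d + 1 \<ge> 1\<close> and therefore vanishes at infinity.\<close>
  obtain d where d: "hdim = Suc (Suc d)" using hdim2 by (metis add_2_eq_Suc le_Suc_ex)
  have "ennreal \<bar>hK c p x\<bar> \<le> (\<integral>\<^sup>+t. ennreal \<bar>indicator {0<..1} t * ((1 / t) ^ hdim * c (p, dil (1 / t) x))\<bar> \<partial>lborel)"
    unfolding hK_def by (rule abs_integral_le_nn_integral)
  also have "\<dots> \<le> (\<integral>\<^sup>+t. ennreal (A * (1 / t) ^ hdim * indicator {s..} t) * indicator {s..} t \<partial>lborel)"
  proof (rule nn_integral_mono)
    fix t :: real
    show "ennreal \<bar>indicator {0<..1} t * ((1 / t) ^ hdim * c (p, dil (1 / t) x))\<bar> \<le> ennreal (A * (1 / t) ^ hdim * indicator {s..} t) * indicator {s..} t"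
    proof (cases "t \<in> {0<..1} \<and> c (p, dil (1 / t) x) \<noteq> 0")
      case True
      then have t: "t > 0" "t \<le> 1" and "N x / t \<le> R" using c(1)[of "dil (1 / t) x"] by (auto simp: N_dil_inverse)
      then have "t \<ge> s" using R by (simp add: s_def field_simps)
      then show ?thesis using t c(2)[of "dil (1 / t) x"]
        by (auto simp: abs_mult mult.commute[of A] intro!: ennreal_leI mult_left_mono)
    qed auto
  qed
  also have "\<dots> = (0 - (- (A / real (Suc d) * (1 / s) ^ Suc d)))"
  proof (subst nn_integral_FTC_atLeast[where F="\<lambda>t. - (A / real (Suc d) * (1 / t) ^ Suc d)" and T=0])
    show "(\<lambda>t. A * (1 / t) ^ hdim * indicator {s..} t) \<in> borel_measurable borel" by measurable
    show "DERIV (\<lambda>t. - (A / real (Suc d) * (1 / t) ^ Suc d)) t :> A * (1 / t) ^ hdim * indicator {s..} t" if "s \<le> t" for t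
    proof -
      have t: "t > 0" using s that by simp
      have "DERIV (\<lambda>t. 1 / t) t :> - (1 / t\<^sup>2)"
        using t by (auto intro!: derivative_eq_intros simp: power2_eq_square)
      from DERIV_power[OF this, of "Suc d"]
      have "DERIV (\<lambda>t. (1 / t) ^ Suc d) t :> real (Suc d) * (1 / t) ^ d * (- (1 / t\<^sup>2))"
        by (simp only: diff_Suc_Suc diff_zero mult_ac)
      from DERIV_cmult[OF this, of "- (A / real (Suc d))"]
      have "DERIV (\<lambda>t. - (A / real (Suc d) * (1 / t) ^ Suc d)) t :> - (A / real (Suc d)) * (real (Suc d) * (1 / t) ^ d * (- (1 / t\<^sup>2)))" by simp
      also have "- (A / real (Suc d)) * (real (Suc d) * (1 / t) ^ d * (- (1 / t\<^sup>2))) = A * (1 / t) ^ hdim * indicator {s..} t"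
        using that t by (simp add: d power2_eq_square field_simps del: of_nat_Suc)
      finally show ?thesis .
    qed
    show "0 \<le> A * (1 / t) ^ hdim * indicator {s..} t" if "s \<le> t" for t using A s that by auto
    have "((\<lambda>t::real. 1 / t) \<longlongrightarrow> 0) at_top" by (rule tendsto_divide_0[OF tendsto_const filterlim_at_top_imp_at_infinity[OF filterlim_ident]])
    then have "((\<lambda>t::real. - (A / real (Suc d) * (1 / t) ^ Suc d)) \<longlongrightarrow> - (A / real (Suc d) * 0 ^ Suc d)) at_top"
      by (intro tendsto_intros)
    then show "((\<lambda>t::real. - (A / real (Suc d) * (1 / t) ^ Suc d)) \<longlongrightarrow> 0) at_top" by simp
  qed simp
  finally have "\<bar>hK c p x\<bar> \<le> A / real (Suc d) * (1 / s) ^ Suc d" using A s by (simp add: ennreal_le_iff)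
  \<comment> \<open>The factor \<open>1 / (d + 1)\<close> is at most 1.\<close>
  also have "\<dots> \<le> A * (1 / s) ^ Suc d" using A s by (intro mult_right_mono) (auto simp: field_simps)
  also have "\<dots> = A * R ^ (hdim - 1) * rk x" by (simp add: d s_def rk_def power_divide)
  finally show ?thesis .
qed

text \<open>Fubini after the substitution in \<open>hK\<close>. Absolute integrability holds because
  for each \<open>t\<close> scaling back by \<open>dil t\<close> cancels the singular factor and
  leaves the bound \<open>A * B\<close> on a fixed compact set, the same for all
  \<open>t\<close>.\<close>

lemma kernel_representation:
  fixes e :: "'n point \<times> 'n point \<Rightarrow> real" and C :: "'n \<Rightarrow> 'n point \<times> 'n point \<Rightarrow> real"
  assumes Z: "closed Z" "\<And>p. compact {z. (p, z) \<in> Z}" and e: "smooth e" "\<And>q. q \<notin> Z \<Longrightarrow> e q = 0"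
    and Cs: "\<And>a. smooth (C a)" "\<And>a q. q \<notin> Z \<Longrightarrow> C a q = 0"
    and C: "\<And>p h. smooth h \<Longrightarrow> (LINT z|lborel. e (p, z) * dird (euler z) h z)
       = (LINT z|lborel. (\<Sum>a | w a = 1. C a (p, z) * lder (axis a 1) h z))"
    and R: "\<And>z. (p, z) \<in> Z \<Longrightarrow> N z \<le> R"
    and g: "smooth g"
  shows "(LINT z|lborel. e (p, z) * g z) - g 0 * (LINT z|lborel. e (p, z))
       = (LINT x|lborel. (\<Sum>a | w a = 1. hK (C a) p x * lder (axis a 1) g x))"
    and "integrable lborel (\<lambda>x. hK (C a) p x * lder (axis a 1) g x)"
proof -
  let ?G = "\<lambda>a. lder (axis a 1) g"
  define \<Phi> where "\<Phi> a t x = indicator {0<..1} t * ((1 / t) ^ hdim * C a (p, dil (1 / t) x)) * ?G a x" for a and t :: real and x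
  have Gm [measurable]: "?G a \<in> borel_measurable borel" for a by (rule smooth_measurable[OF smooth_lder[OF g]])
  have Cm [measurable]: "(\<lambda>z. C a (p, z)) \<in> borel_measurable borel" for a
    by (rule smooth_measurable, rule smooth_compose[OF Cs(1)]) (intro smooth_Pair smooth_const smooth_id)
  have int: "integrable (lborel \<Otimes>\<^sub>M lborel) (\<lambda>(t, x). \<Phi> a t x)" for a
  proof -
    let ?K = "{z. (p, z) \<in> Z}"
    have ck: "compact ((\<lambda>z. C a (p, z)) ` ?K)"
      by (intro compact_continuous_image Z(2) smooth_continuous_on, rule smooth_compose[OF Cs(1)]) (intro smooth_Pair smooth_const smooth_id)
    obtain A where A: "\<And>z. z \<in> ?K \<Longrightarrow> \<bar>C a (p, z)\<bar> \<le> A" using compact_imp_bounded[OF ck] by (auto simp: bounded_iff)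
    have cG: "compact (?G a ` {x. N x \<le> R})"
      by (intro compact_continuous_image compact_N_le smooth_continuous_on smooth_lder g)
    obtain B where B: "\<And>x. N x \<le> R \<Longrightarrow> \<bar>?G a x\<bar> \<le> B" using compact_imp_bounded[OF cG] by (auto simp: bounded_iff)
    have m: "(\<lambda>(t, x). \<Phi> a t x) \<in> borel_measurable (lborel \<Otimes>\<^sub>M lborel)"
      unfolding \<Phi>_def case_prod_beta' by measurable
    have "(\<integral>\<^sup>+t. \<integral>\<^sup>+x. ennreal \<bar>\<Phi> a t x\<bar> \<partial>lborel \<partial>lborel) \<le> (\<integral>\<^sup>+t. (ennreal (A * B) * emeasure lborel ?K) * indicator {0<..1::real} t \<partial>lborel)"
    proof (rule nn_integral_mono)
      fix t :: real
      show "(\<integral>\<^sup>+x. ennreal \<bar>\<Phi> a t x\<bar> \<partial>lborel) \<le> (ennreal (A * B) * emeasure lborel ?K) * indicator {0<..1::real} t"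
      proof (cases "t \<in> {0<..1}")
        case True
        then have t: "t > 0" "t \<le> 1" by auto
        have "(\<integral>\<^sup>+x. ennreal \<bar>\<Phi> a t x\<bar> \<partial>lborel) = ennreal (t ^ hdim) * (\<integral>\<^sup>+x. ennreal \<bar>\<Phi> a t (dil t x)\<bar> \<partial>lborel)"
          by (rule nn_integral_dil[OF t(1)]) (unfold \<Phi>_def, measurable)
        also have "\<dots> = (\<integral>\<^sup>+x. ennreal (t ^ hdim) * ennreal \<bar>\<Phi> a t (dil t x)\<bar> \<partial>lborel)"
          by (rule nn_integral_cmult[symmetric]) (unfold \<Phi>_def, measurable)
        also have "\<dots> \<le> (\<integral>\<^sup>+x. ennreal (A * B) * indicator ?K x \<partial>lborel)"
        proof (rule nn_integral_mono)
          fix x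
          have "dil (1 / t) (dil t x) = x" using t by (simp add: dilation_def vec_eq_iff power_one_over)
          then have e: "t ^ hdim * \<bar>\<Phi> a t (dil t x)\<bar> = \<bar>C a (p, x)\<bar> * \<bar>?G a (dil t x)\<bar>"
            using t by (simp add: \<Phi>_def abs_mult power_one_over)
          have "\<bar>C a (p, x)\<bar> * \<bar>?G a (dil t x)\<bar> \<le> A * B * indicator ?K x"
          proof (cases "x \<in> ?K")
            case True
            have "N (dil t x) \<le> R" using R[of x] True t mult_left_le_one_le[of "N x" t] by (simp add: N_dil)
            then show ?thesis using A[OF True] B True by (auto intro!: mult_mono)
          qed (simp add: Cs(2))
          then have "ennreal (t ^ hdim * \<bar>\<Phi> a t (dil t x)\<bar>) \<le> ennreal (A * B * indicator ?K x)"
            unfolding e by (rule ennreal_leI)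
          moreover have "ennreal (A * B * indicator ?K x) = ennreal (A * B) * indicator ?K x" by (simp add: indicator_def)
          ultimately show "ennreal (t ^ hdim) * ennreal \<bar>\<Phi> a t (dil t x)\<bar> \<le> ennreal (A * B) * indicator ?K x"
            using t by (simp add: ennreal_mult')
        qed
        also have "\<dots> = ennreal (A * B) * emeasure lborel ?K"
          by (rule nn_integral_cmult_indicator) (use Z(2)[of p] in \<open>simp add: compact_imp_closed borel_closed\<close>)
        finally show ?thesis using True by simp
      qed (simp add: \<Phi>_def)
    qed
    also have "\<dots> = (ennreal (A * B) * emeasure lborel ?K) * emeasure lborel {0<..1::real}"
      by (rule nn_integral_cmult_indicator) simp
    also have "\<dots> < \<infinity>"
      using emeasure_compact_finite[OF Z(2)[of p]] by (simp add: ennreal_mult_less_top)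
    finally have "(\<integral>\<^sup>+z. ennreal \<bar>(\<lambda>(t, x). \<Phi> a t x) z\<bar> \<partial>(lborel \<Otimes>\<^sub>M lborel)) < \<infinity>"
      by (subst lborel.nn_integral_fst[symmetric]) (use m in auto)
    then show ?thesis using m by (intro integrableI_bounded) auto
  qed
  have hKx: "(LINT t|lborel. \<Phi> a t x) = hK (C a) p x * ?G a x" for a x
    unfolding \<Phi>_def hK_def by simp
  show "integrable lborel (\<lambda>x. hK (C a) p x * ?G a x)" for a
    using lborel_pair.integrable_snd[OF int[of a]] unfolding hKx .
  note i2 = this
  have inner: "(LINT z|lborel. (\<Sum>a | w a = 1. C a (p, z) * ?G a (dil t z))) = (\<Sum>a | w a = 1. (LINT x|lborel. \<Phi> a t x))"
    if "t \<in> {0<..1}" for t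
  proof -
    have t: "t > 0" "t \<le> 1" using that by auto
    have cs: "csupp (\<lambda>z. C a (p, z))" for a by (rule csupp_section[OF Cs(1) Z(2) Cs(2)])
    have "integrable lborel (\<lambda>z. C a (p, z) * ?G a (dil t z))" for a
      by (rule csupp_integrable[OF csupp_mult'[OF cs]]) (rule smooth_compose[OF smooth_lder[OF g] smooth_linear[OF linear_dil]])
    then have "(LINT z|lborel. (\<Sum>a | w a = 1. C a (p, z) * ?G a (dil t z))) = (\<Sum>a | w a = 1. (LINT z|lborel. C a (p, z) * ?G a (dil t z)))" by simp
    also have "\<dots> = (\<Sum>a | w a = 1. (LINT x|lborel. \<Phi> a t x))"
    proof (rule sum.cong[OF refl])
      fix a
      have dd: "dil (1 / t) (dil t x) = x" for x using t by (simp add: dilation_def vec_eq_iff power_one_over)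
      have "(LINT x|lborel. \<Phi> a t x) = t ^ hdim * (LINT x|lborel. \<Phi> a t (dil t x))"
        by (rule integral_dil[OF t(1)]) (unfold \<Phi>_def, measurable)
      also have "(LINT x|lborel. \<Phi> a t (dil t x)) = (LINT x|lborel. (1 / t) ^ hdim * (C a (p, x) * ?G a (dil t x)))"
        unfolding \<Phi>_def dd using that by (simp add: mult.assoc)
      finally show "(LINT z|lborel. C a (p, z) * ?G a (dil t z)) = (LINT x|lborel. \<Phi> a t x)"
        using t by (simp add: power_one_over)
    qed
    finally show ?thesis .
  qed
  have "(LINT z|lborel. e (p, z) * g z) - g 0 * (LINT z|lborel. e (p, z))
     = (LINT t:{0<..1}|lborel. LINT z|lborel. (\<Sum>a | w a = 1. C a (p, z) * ?G a (dil t z)))"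
    by (rule dilation_flow_integral[OF Z e C g])
  also have "\<dots> = (LINT t:{0<..1}|lborel. (\<Sum>a | w a = 1. (LINT x|lborel. \<Phi> a t x)))"
    using inner by (intro set_lebesgue_integral_cong) auto
  also have "\<dots> = (LINT t|lborel. (\<Sum>a | w a = 1. (LINT x|lborel. \<Phi> a t x)))"
  proof -
    have *: "indicator {0<..1} t *\<^sub>R (\<Sum>a | w a = 1. (LINT x|lborel. \<Phi> a t x)) = (\<Sum>a | w a = 1. (LINT x|lborel. \<Phi> a t x))" for t :: real
      by (cases "t \<in> {0<..1}") (auto simp: \<Phi>_def)
    show ?thesis unfolding set_lebesgue_integral_def * ..
  qed
  also have "\<dots> = (\<Sum>a | w a = 1. (LINT t|lborel. LINT x|lborel. \<Phi> a t x))"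
    using lborel_pair.integrable_fst[OF int] by simp
  also have "\<dots> = (\<Sum>a | w a = 1. (LINT x|lborel. LINT t|lborel. \<Phi> a t x))"
    by (intro sum.cong refl lborel_pair.Fubini_integral[OF int, symmetric])
  also have "\<dots> = (LINT x|lborel. (\<Sum>a | w a = 1. hK (C a) p x * ?G a x))"
    unfolding hKx using i2 by simp
  finally show "(LINT z|lborel. e (p, z) * g z) - g 0 * (LINT z|lborel. e (p, z))
       = (LINT x|lborel. (\<Sum>a | w a = 1. hK (C a) p x * lder (axis a 1) g x))" .
qed


section \<open>Reproducing kernels on balls\<close>

lemma smooth_unit_bump:
  assumes "\<epsilon> > 0"
  obtains \<eta> :: "'n point \<Rightarrow> real" where "csupp \<eta>" "\<And>x. 0 \<le> \<eta> x" "\<And>x. \<eta> x \<noteq> 0 \<Longrightarrow> N x \<le> \<epsilon>" "(LINT x|lborel. \<eta> x) = 1"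
proof -
  have "open {x. N x < \<epsilon>}" by (intro open_Collect_less N_continuous continuous_on_const)
  then obtain b :: "'n point \<Rightarrow> real" and K where b: "smooth b" "\<And>x. 0 \<le> b x" "b 0 > 0" "compact K" "K \<subseteq> {x. N x < \<epsilon>}" "\<And>x. x \<notin> K \<Longrightarrow> b x = 0"
    using smooth_bump[of "{x. N x < \<epsilon>}" 0] assms by auto
  have cb: "csupp b" using b by (auto simp: csupp_def)
  have "(LINT x|lborel. b x) \<noteq> 0"
  proof
    assume "(LINT x|lborel. b x) = 0"
    then have "AE x in lborel. b x = 0"
      by (subst integral_nonneg_eq_0_iff_AE[OF csupp_integrable[OF cb], symmetric]) (use b(2) in auto)
    then have "AE x in lebesgue. x \<in> {x. b x = 0}" by (simp add: AE_completion)
    moreover have "closed {x. b x = 0}"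
      using smooth_continuous_on[OF b(1)] by (intro closed_Collect_eq) auto
    ultimately have "b 0 = 0" using mem_closed_if_AE_lebesgue[of "{x. b x = 0}"] by blast
    then show False using b by simp
  qed
  moreover have "(LINT x|lborel. b x) \<ge> 0" using b(2) by (intro Bochner_Integration.integral_nonneg) auto
  ultimately have I: "(LINT x|lborel. b x) > 0" by simp
  define \<eta> where "\<eta> x = b x / (LINT x|lborel. b x)" for x
  show ?thesis
  proof (rule that[of \<eta>])
    have "csupp (\<lambda>x. (1 / (LINT x|lborel. b x)) * b x)" by (rule csupp_mult[OF smooth_const cb])
    then show "csupp \<eta>" by (simp add: \<eta>_def[abs_def])
    show "0 \<le> \<eta> x" for x using I b by (simp add: \<eta>_def)
    show "N x \<le> \<epsilon>" if "\<eta> x \<noteq> 0" for x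
    proof -
      have "x \<in> K" using that b(6) by (auto simp: \<eta>_def)
      then show ?thesis using b(5) by force
    qed
    show "(LINT x|lborel. \<eta> x) = 1" using I by (simp add: \<eta>_def)
  qed
qed

lemma rk_inner_finite: "R > 0 \<Longrightarrow> (\<integral>\<^sup>+x. ennreal (rk x) * indicator {x. N x \<le> R} x \<partial>lborel) < \<infinity>"
proof -
  assume R: "R > 0"
  have [measurable]: "{x. N x \<le> c} \<in> sets borel" for c by measurable
  have "(\<integral>\<^sup>+x. ennreal (rk x) * indicator {x. N x \<le> R} x \<partial>lborel)
     = ennreal (R ^ hdim) * (\<integral>\<^sup>+x. ennreal (rk (dil R x)) * indicator {x. N x \<le> R} (dil R x) \<partial>lborel)"
    by (rule nn_integral_dil[OF R]) measurable
  also have "\<dots> = ennreal (R ^ hdim) * (\<integral>\<^sup>+x. ennreal (1 / R ^ (hdim - 1)) * (ennreal (rk x powr 1) * indicator {x. N x \<le> 1} x) \<partial>lborel)"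
  proof -
    have "ennreal (rk (dil R x)) * indicator {x. N x \<le> R} (dil R x) = ennreal (1 / R ^ (hdim - 1)) * (ennreal (rk x powr 1) * indicator {x. N x \<le> 1} x)" for x
      using R by (auto simp: rk_dil N_dil indicator_def ennreal_mult'[symmetric])
    then show ?thesis by simp
  qed
  also have "\<dots> = ennreal (R ^ hdim) * (ennreal (1 / R ^ (hdim - 1)) * (\<integral>\<^sup>+x. ennreal (rk x powr 1) * indicator {x. N x \<le> 1} x \<partial>lborel))"
    by (subst nn_integral_cmult) auto
  also have "\<dots> < \<infinity>"
    using rk_powr_inner_finite[of 1] hdim2 by (simp add: ennreal_mult_less_top)
  finally show ?thesis .
qed

lemma continuous_N_gmul: "continuous_on UNIV (\<lambda>q. N (gmul (fst q) (snd q)))"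
  by (rule continuous_on_compose2[OF N_continuous[of UNIV]])
     (intro smooth_continuous_on smooth_gmul smooth_fst smooth_snd smooth_id, simp)

lemma N_le_gmul: "N z \<le> N p + N (gmul p z)"
  using N_gmul[of "- p" "gmul p z"] by simp

lemma measurable_gmul2 [measurable (raw)]:
  assumes [measurable]: "f \<in> borel_measurable M" "h \<in> borel_measurable M" shows "(\<lambda>q. gmul (f q) (h q)) \<in> borel_measurable M"
proof -
  have "(\<lambda>q. (f q, h q)) \<in> M \<rightarrow>\<^sub>M borel" unfolding borel_prod[symmetric] by measurable
  from measurable_compose[OF this smooth_measurable[OF smooth_gmul_pair]] show ?thesis by simp
qed

text \<open>The functional \<open>m\<close> stands for an average of \<open>g\<close>; what matters
  is that it does not depend on \<open>y\<close>, since the mean zero condition then removes it. The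
  size bound excludes \<open>x = y\<close>, where \<open>rk\<close> has the value 0. The radius
  \<open>s\<close> bounds the support in \<open>x\<close>.\<close>

definition reproducing_kernel :: "'n point \<Rightarrow> real \<Rightarrow> real \<Rightarrow> real \<Rightarrow> ('n \<Rightarrow> 'n point \<Rightarrow> 'n point \<Rightarrow> real) \<Rightarrow> (('n point \<Rightarrow> real) \<Rightarrow> real) \<Rightarrow> bool" where
  "reproducing_kernel x0 r s M k m \<longleftrightarrow>
     (\<forall>a. (\<lambda>q. k a (fst q) (snd q)) \<in> borel_measurable borel) \<and>
     (\<forall>a x y. N (gmul (- x0) y) < r \<longrightarrow> x \<noteq> y \<longrightarrow> \<bar>k a x y\<bar> \<le> M * rk (gmul (- y) x)) \<and>
     (\<forall>a x y. N (gmul (- x0) y) < r \<longrightarrow> s < N (gmul (- x0) x) \<longrightarrow> k a x y = 0) \<and>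
     (\<forall>g y. smooth g \<longrightarrow> N (gmul (- x0) y) < r \<longrightarrow>
        g y - m g = (LINT x|lborel. (\<Sum>a | w a = 1. k a x y * lder (axis a 1) g x)))"

text \<open>Averaging the representation based at \<open>v\<close> against a bump function \<open>\<eta>\<close> in \<open>v\<close> replaces the average, which depends on
  the base point, by the functional \<open>g \<mapsto> \<integral> \<eta> g\<close>, the same for all base points.\<close>

proposition base_kernel:
  assumes l: "1 < (l::real)"
  obtains k :: "'n \<Rightarrow> 'n point \<Rightarrow> 'n point \<Rightarrow> real" and M \<rho> :: real and m :: "('n point \<Rightarrow> real) \<Rightarrow> real"
  where "0 \<le> M" "0 < \<rho>" "\<rho> < l" "\<And>a. (\<lambda>q. k a (fst q) (snd q)) \<in> borel_measurable borel"
    "\<And>a x y. N y < 1 \<Longrightarrow> x \<noteq> y \<Longrightarrow> \<bar>k a x y\<bar> \<le> M * rk (gmul (- y) x)"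
    "\<And>a x y. N y < 1 \<Longrightarrow> \<rho> < N x \<Longrightarrow> k a x y = 0"
    "\<And>g y. smooth g \<Longrightarrow> N y < 1 \<Longrightarrow> g y - m g = (LINT x|lborel. (\<Sum>a | w a = 1. k a x y * lder (axis a 1) g x))"
proof -
  \<comment> \<open>A quarter of the gap leaves room for three errors of size
    \<open>\<epsilon>\<close>: the support radius will be
    \<open>1 + 3 * \<epsilon> < l\<close>.\<close>
  define \<epsilon> where "\<epsilon> = (l - 1) / 4"
  have \<epsilon>: "\<epsilon> > 0" using l by (simp add: \<epsilon>_def)
  obtain \<eta> :: "'n point \<Rightarrow> real" where \<eta>: "csupp \<eta>" "\<And>x. 0 \<le> \<eta> x" "\<And>x. \<eta> x \<noteq> 0 \<Longrightarrow> N x \<le> \<epsilon>" "(LINT x|lborel. \<eta> x) = 1"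
    using smooth_unit_bump[OF \<epsilon>] by metis
  note \<eta>s = csupp_smooth[OF \<eta>(1)]
  have \<eta>i: "integrable lborel \<eta>" by (rule csupp_integrable[OF \<eta>(1)])
  have \<eta>m [measurable]: "\<eta> \<in> borel_measurable borel" by (rule smooth_measurable[OF \<eta>s])
  define Z :: "('n point \<times> 'n point) set" where "Z = {q. N (gmul (fst q) (snd q)) \<le> \<epsilon>}"
  \<comment> \<open>The parameter shifts the bump: for base point \<open>v\<close> and
    \<open>p = gmul (- y) v\<close>, the function \<open>e (p, _)\<close> is the bump around
    \<open>y\<close> as seen from \<open>v\<close>.\<close>
  define e :: "'n point \<times> 'n point \<Rightarrow> real" where "e q = \<eta> (gmul (fst q) (snd q))" for q
  have Zc: "closed Z" unfolding Z_def by (intro closed_Collect_le continuous_N_gmul continuous_on_const)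
  have Zk: "compact {z. (p, z) \<in> Z}" for p
  proof -
    have "{z. (p, z) \<in> Z} = gmul (- p) ` {x. N x \<le> \<epsilon>}"
      unfolding Z_def by (auto simp: image_iff) (metis gmul_cancel(1))
    then show ?thesis
      by (simp add: compact_continuous_image compact_N_le smooth_continuous_on smooth_gmul_left)
  qed
  have es: "smooth e" unfolding e_def by (intro smooth_compose[OF \<eta>s] smooth_gmul smooth_fst smooth_snd smooth_id)
  have e0: "e q = 0" if "q \<notin> Z" for q using \<eta>(3) that unfolding Z_def e_def by blast
  obtain C where C: "\<And>a. smooth (C a)" "\<And>a q. q \<notin> Z \<Longrightarrow> C a q = 0"
    "\<And>p h. smooth h \<Longrightarrow> (LINT z|lborel. e (p, z) * dird (euler z) h z)
       = (LINT z|lborel. (\<Sum>a | w a = 1. C a (p, z) * lder (axis a 1) h z))"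
    by (rule euler_horizontal[OF Zc Zk es e0], assumption, rule that)
  have ZN: "N z \<le> N p + \<epsilon>" if "(p, z) \<in> Z" for p z
    using N_le_gmul[of z p] that by (simp add: Z_def)
  \<comment> \<open>For \<open>N p \<le> 1 + \<epsilon>\<close> every \<open>z\<close> with
    \<open>(p, z)\<close> in \<open>Z\<close> has \<open>N z \<le> R\<close>.\<close>
  define R where "R = 1 + 2 * \<epsilon>"
  have R: "R > 0" using \<epsilon> by (simp add: R_def)
  obtain A where A: "\<And>a p z. N p \<le> 1 + \<epsilon> \<Longrightarrow> \<bar>C a (p, z)\<bar> \<le> A"
  proof -
    let ?S = "{p. N p \<le> 1 + \<epsilon>} \<times> {z. N z \<le> R}"
    have "\<forall>a. \<exists>B. \<forall>q\<in>?S. \<bar>C a q\<bar> \<le> B"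
    proof
      fix a
      have "compact (C a ` ?S)" by (intro compact_continuous_image compact_Times compact_N_le smooth_continuous_on C)
      from compact_imp_bounded[OF this] show "\<exists>B. \<forall>q\<in>?S. \<bar>C a q\<bar> \<le> B" by (auto simp: bounded_iff)
    qed
    then obtain B where B: "\<And>a q. q \<in> ?S \<Longrightarrow> \<bar>C a q\<bar> \<le> B a" by metis
    have "\<bar>C a (p, z)\<bar> \<le> (\<Sum>a\<in>UNIV. \<bar>B a\<bar>)" if "N p \<le> 1 + \<epsilon>" for a p z
    proof (cases "(p, z) \<in> Z")
      case True
      then have "(p, z) \<in> ?S" using ZN[OF True] that by (simp add: R_def)
      then have "\<bar>C a (p, z)\<bar> \<le> \<bar>B a\<bar>" using B[of "(p, z)" a] by linarith
      also have "\<dots> \<le> (\<Sum>a\<in>UNIV. \<bar>B a\<bar>)" by (rule member_le_sum) auto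
      finally show ?thesis .
    qed (simp add: C sum_nonneg)
    then show ?thesis using that by blast
  qed
  have A0: "0 \<le> A" using A[of 0 undefined 0] \<epsilon> by simp
  define M1 where "M1 = A * R ^ (hdim - 1)"
  have M1: "0 \<le> M1" using A0 R by (simp add: M1_def)
  have hb: "\<bar>hK (C a) p x\<bar> \<le> M1 * rk x" if "N p \<le> 1 + \<epsilon>" "x \<noteq> 0" for a p x
    unfolding M1_def
  proof (rule hK_bound)
    show "\<bar>C a (p, z)\<bar> \<le> A" for z by (rule A[OF that(1)])
    show "N z \<le> R" if "C a (p, z) \<noteq> 0" for z
    proof -
      have "(p, z) \<in> Z" using C(2) that by blast
      from ZN[OF this] show ?thesis using \<open>N p \<le> 1 + \<epsilon>\<close> by (simp add: R_def)
    qed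
  qed (use R that in auto)
  have hs: "hK (C a) p x = 0" if "N p + \<epsilon> < N x" for a p x
    by (rule hK_support[where R="N p + \<epsilon>"]) (use ZN C(2) that in blast)+
  have hKm: "(\<lambda>q. hK (C a) (f q) (h q)) \<in> borel_measurable M" if "f \<in> borel_measurable M" "h \<in> borel_measurable M" for a f h and M :: "'z measure"
    by (rule hK_measurable[OF C(1) that])
  have rep: "(LINT z|lborel. e (p, z) * g (gmul v z)) - g v = (LINT x|lborel. (\<Sum>a | w a = 1. hK (C a) p (gmul (- v) x) * lder (axis a 1) g x))"
    "integrable lborel (\<lambda>x. hK (C a) p (gmul (- v) x) * lder (axis a 1) g x)" if g: "smooth g" for g p v a
  proof -
    have gv: "smooth (\<lambda>z. g (gmul v z))" by (rule smooth_compose[OF g smooth_gmul_left])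
    have [measurable]: "lder (axis a 1) g \<in> borel_measurable borel" for a by (rule smooth_measurable[OF smooth_lder[OF g]])
    have [measurable]: "(\<lambda>x. hK (C a) p (gmul (- v) x)) \<in> borel_measurable borel" for a
      by (rule hKm) measurable
    have 1: "lder (axis a 1) (\<lambda>z. g (gmul v z)) x = lder (axis a 1) g (gmul v x)" for a x by (rule lder_gmul[OF g])
    have ie: "(LINT z|lborel. e (p, z)) = 1"
      using integral_gmul[OF \<eta>m, of p] \<eta>(4) by (simp add: e_def)
    define F where "F x = (\<Sum>a | w a = 1. hK (C a) p (gmul (- v) x) * lder (axis a 1) g x)" for x
    have "(LINT z|lborel. e (p, z) * g (gmul v z)) - g (gmul v 0) * (LINT z|lborel. e (p, z))
       = (LINT x|lborel. (\<Sum>a | w a = 1. hK (C a) p x * lder (axis a 1) (\<lambda>z. g (gmul v z)) x))"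
      by (rule kernel_representation(1)[OF Zc Zk es e0 C ZN gv])
    also have "\<dots> = (LINT x|lborel. F (gmul v x))" unfolding 1 F_def by simp
    also have "\<dots> = (LINT x|lborel. F x)" by (rule integral_gmul) (unfold F_def, measurable)
    finally show "(LINT z|lborel. e (p, z) * g (gmul v z)) - g v = (LINT x|lborel. (\<Sum>a | w a = 1. hK (C a) p (gmul (- v) x) * lder (axis a 1) g x))"
      unfolding ie F_def by simp
    define H where "H x = hK (C a) p (gmul (- v) x) * lder (axis a 1) g x" for x
    have Hm: "H \<in> borel_measurable borel" unfolding H_def by measurable
    have "integrable lborel (\<lambda>x. hK (C a) p x * lder (axis a 1) (\<lambda>z. g (gmul v z)) x)"
      by (rule kernel_representation(2)[OF Zc Zk es e0 C ZN gv])
    then have "integrable lborel (\<lambda>x. H (gmul v x))" unfolding 1 H_def by simp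
    then have "integrable (distr lborel borel (gmul v)) H" using Hm by (subst integrable_distr_eq) auto
    then show "integrable lborel (\<lambda>x. hK (C a) p (gmul (- v) x) * lder (axis a 1) g x)"
      unfolding lborel_distr_gmul H_def .
  qed
  \<comment> \<open>Two contractions of the same bump around \<open>y\<close>:
    \<open>hK (C a) 0\<close> belongs to the one ending at \<open>y\<close>, and \<open>k2\<close>
    to those ending at \<open>v\<close>, averaged over \<open>v\<close> with weight
    \<open>\<eta>\<close>. In their difference the average around \<open>y\<close> disappears and
    \<open>m\<close>, the average around 0, remains.\<close>
  define k2 where "k2 a x y = (LINT v|lborel. \<eta> v * hK (C a) (gmul (- y) v) (gmul (- v) x))" for a x y
  define k where "k a x y = k2 a x y - hK (C a) 0 (gmul (- y) x)" for a x y
  define m where "m g = (LINT v|lborel. \<eta> v * g v)" for g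
  define J where "J = enn2real (\<integral>\<^sup>+x. ennreal (rk x) * indicator {x. N x \<le> R} x \<partial>lborel)"
  have J: "(\<integral>\<^sup>+x. ennreal (rk x) * indicator {x. N x \<le> R} x \<partial>lborel) = ennreal J"
    unfolding J_def using rk_inner_finite[OF R] by simp
  have J0: "0 \<le> J" by (simp add: J_def)
  have [measurable]: "{x. N x \<le> c} \<in> sets borel" for c by measurable
  obtain H where H: "\<And>x. \<eta> x \<le> H"
  proof -
    have "compact (\<eta> ` {x. N x \<le> \<epsilon>})" by (intro compact_continuous_image compact_N_le smooth_continuous_on \<eta>s)
    from compact_imp_bounded[OF this] obtain H where H: "\<And>x. N x \<le> \<epsilon> \<Longrightarrow> \<bar>\<eta> x\<bar> \<le> H" by (auto simp: bounded_iff)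
    have "\<eta> x \<le> \<bar>H\<bar>" for x using H[of x] \<eta>(3)[of x] by (cases "\<eta> x = 0") auto
    then show ?thesis using that by blast
  qed
  have H0: "0 \<le> H" using H[of 0] \<eta>(2)[of 0] by linarith
  have pN: "N (gmul (- y) v) \<le> 1 + \<epsilon>" if "N y < 1" "\<eta> v \<noteq> 0" for y v
    using N_gmul[of "- y" v] \<eta>(3)[OF that(2)] that by simp
  have pt: "\<bar>\<eta> v * hK (C a) (gmul (- y) v) (gmul (- v) x)\<bar> \<le> \<eta> v * (M1 * (rk (gmul (- v) x) * indicator {x. N x \<le> R} (gmul (- v) x)))"
    if y: "N y < 1" and vx: "v \<noteq> x" for y v x a
  proof (cases "\<eta> v = 0")
    case False
    have nz: "gmul (- v) x \<noteq> 0" using vx by (metis gmul_0_right gmul_cancel(2))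
    have "\<bar>hK (C a) (gmul (- y) v) (gmul (- v) x)\<bar> \<le> M1 * (rk (gmul (- v) x) * indicator {x. N x \<le> R} (gmul (- v) x))"
    proof (cases "N (gmul (- v) x) \<le> R")
      case True then show ?thesis using hb[OF pN[OF y False] nz, of a] by simp
    next
      case nR: False
      then have "hK (C a) (gmul (- y) v) (gmul (- v) x) = 0" using pN[OF y False] by (intro hs) (simp add: R_def)
      then show ?thesis using M1 by simp
    qed
    then show ?thesis using \<eta>(2)[of v] by (simp add: abs_mult mult_left_mono)
  qed simp
  show ?thesis
  proof (rule that[of "M1 + H * M1 * J * (2 + 3 * \<epsilon>) ^ (hdim - 1)" "1 + 3 * \<epsilon>" k m])
    show "0 \<le> M1 + H * M1 * J * (2 + 3 * \<epsilon>) ^ (hdim - 1)" using M1 H0 J0 \<epsilon> by simp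
    show "0 < 1 + 3 * \<epsilon>" "1 + 3 * \<epsilon> < l" using \<epsilon> l by (simp_all add: \<epsilon>_def field_simps)
    show "(\<lambda>q. k a (fst q) (snd q)) \<in> borel_measurable borel" for a
      unfolding k_def k2_def
    proof (intro borel_measurable_diff lborel.borel_measurable_lebesgue_integral)
      have "(\<lambda>r. \<eta> (snd r) * hK (C a) (gmul (- snd (fst r)) (snd r)) (gmul (- snd r) (fst (fst r)))) \<in> borel_measurable (borel \<Otimes>\<^sub>M lborel)"
        by (intro borel_measurable_times hKm) measurable
      then show "(\<lambda>(q, v). \<eta> v * hK (C a) (gmul (- snd q) v) (gmul (- v) (fst q))) \<in> borel_measurable (borel \<Otimes>\<^sub>M lborel)"
        by (simp add: case_prod_beta')
      show "(\<lambda>q. hK (C a) 0 (gmul (- snd q) (fst q))) \<in> borel_measurable borel" by (rule hKm) measurable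
    qed
    \<comment> \<open>As a function of \<open>v\<close> the singularity sits at \<open>v = x\<close>
      and is integrable, so averaging over \<open>v\<close> leaves a bounded function.\<close>
    have k2b: "\<bar>k2 a x y\<bar> \<le> H * M1 * J" if y: "N y < 1" for a x y
    proof -
      have "ennreal \<bar>k2 a x y\<bar> \<le> (\<integral>\<^sup>+v. ennreal \<bar>\<eta> v * hK (C a) (gmul (- y) v) (gmul (- v) x)\<bar> \<partial>lborel)"
        unfolding k2_def by (rule abs_integral_le_nn_integral)
      also have "\<dots> \<le> (\<integral>\<^sup>+v. ennreal (H * M1) * (ennreal (rk (gmul (- x) v)) * indicator {x. N x \<le> R} (gmul (- x) v)) \<partial>lborel)"
      proof (rule nn_integral_mono_AE)
        have "AE v in lborel. v \<noteq> x" by (rule AE_lborel_singleton)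
        then show "AE v in lborel. ennreal \<bar>\<eta> v * hK (C a) (gmul (- y) v) (gmul (- v) x)\<bar> \<le> ennreal (H * M1) * (ennreal (rk (gmul (- x) v)) * indicator {x. N x \<le> R} (gmul (- x) v))"
        proof eventually_elim
          case (elim v)
          have "rk (gmul (- v) x) * indicator {x. N x \<le> R} (gmul (- v) x) = rk (gmul (- x) v) * indicator {x. N x \<le> R} (gmul (- x) v)"
            using N_swap[of v x] by (simp add: rk_def indicator_def)
          then have "\<bar>\<eta> v * hK (C a) (gmul (- y) v) (gmul (- v) x)\<bar> \<le> \<eta> v * (M1 * (rk (gmul (- x) v) * indicator {x. N x \<le> R} (gmul (- x) v)))"
            using pt[OF y elim, of a] by simp
          also have "\<dots> \<le> H * (M1 * (rk (gmul (- x) v) * indicator {x. N x \<le> R} (gmul (- x) v)))"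
            using H M1 by (intro mult_right_mono) auto
          finally have "ennreal \<bar>\<eta> v * hK (C a) (gmul (- y) v) (gmul (- v) x)\<bar> \<le> ennreal (H * M1 * (rk (gmul (- x) v) * indicator {x. N x \<le> R} (gmul (- x) v)))"
            by (intro ennreal_leI) (simp add: mult.assoc)
          also have "\<dots> = ennreal (H * M1) * (ennreal (rk (gmul (- x) v)) * indicator {x. N x \<le> R} (gmul (- x) v))"
            using H0 M1 by (auto simp: indicator_def ennreal_mult'[symmetric])
          finally show ?case .
        qed
      qed
      also have "\<dots> = ennreal (H * M1) * (\<integral>\<^sup>+v. ennreal (rk (gmul (- x) v)) * indicator {x. N x \<le> R} (gmul (- x) v) \<partial>lborel)"
        by (rule nn_integral_cmult) measurable
      also have "(\<integral>\<^sup>+v. ennreal (rk (gmul (- x) v)) * indicator {x. N x \<le> R} (gmul (- x) v) \<partial>lborel) = ennreal J"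
        unfolding J[symmetric] by (rule nn_integral_gmul) measurable
      also have "ennreal (H * M1) * ennreal J = ennreal (H * M1 * J)" using H0 M1 by (simp add: ennreal_mult')
      finally show ?thesis using H0 M1 J0 by (simp add: ennreal_le_iff)
    qed
    have k2s: "k2 a x y = 0" if y: "N y < 1" and x: "1 + 3 * \<epsilon> < N x" for a x y
    proof -
      have *: "\<eta> v * hK (C a) (gmul (- y) v) (gmul (- v) x) = 0" for v
      proof (cases "\<eta> v = 0")
        case False
        have "N x \<le> N v + N (gmul (- v) x)" using N_le_gmul[of x "- v"] by simp
        then have "hK (C a) (gmul (- y) v) (gmul (- v) x) = 0"
          using pN[OF y False] \<eta>(3)[OF False] x by (intro hs) simp
        then show ?thesis by simp
      qed simp
      show ?thesis unfolding k2_def * by simp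
    qed
    show "k a x y = 0" if y: "N y < 1" and x: "1 + 3 * \<epsilon> < N x" for a x y
    proof -
      have "N x \<le> N y + N (gmul (- y) x)" using N_le_gmul[of x "- y"] by simp
      then have "hK (C a) 0 (gmul (- y) x) = 0" using x y \<epsilon> by (intro hs) simp
      then show ?thesis using k2s[OF y x] by (simp add: k_def)
    qed
    show "\<bar>k a x y\<bar> \<le> (M1 + H * M1 * J * (2 + 3 * \<epsilon>) ^ (hdim - 1)) * rk (gmul (- y) x)" if y: "N y < 1" and xy: "x \<noteq> y" for a x y
    proof -
      have nz: "gmul (- y) x \<noteq> 0" using xy by (metis gmul_0_right gmul_cancel(2))
      then have pos: "N (gmul (- y) x) > 0" using N_nonneg[of "gmul (- y) x"] N_eq_0[of "gmul (- y) x"] by (simp add: less_le)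
      have "\<bar>hK (C a) 0 (gmul (- y) x)\<bar> \<le> M1 * rk (gmul (- y) x)" using \<epsilon> by (intro hb nz) simp
      \<comment> \<open>Where \<open>k2\<close> does not vanish,
        \<open>N (gmul (- y) x) \<le> 2 + 3 * \<epsilon>\<close>; there \<open>rk\<close> has a
        positive lower bound, which absorbs the bounded term.\<close>
      moreover have "\<bar>k2 a x y\<bar> \<le> H * M1 * J * (2 + 3 * \<epsilon>) ^ (hdim - 1) * rk (gmul (- y) x)"
      proof (cases "1 + 3 * \<epsilon> < N x")
        case True
        then show ?thesis using k2s[OF y True] H0 M1 J0 \<epsilon> by simp
      next
        case False
        then have "N (gmul (- y) x) \<le> 2 + 3 * \<epsilon>" using N_gmul[of "- y" x] y by simp
        then have "N (gmul (- y) x) ^ (hdim - 1) \<le> (2 + 3 * \<epsilon>) ^ (hdim - 1)" by (intro power_mono) auto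
        then have "1 \<le> (2 + 3 * \<epsilon>) ^ (hdim - 1) * rk (gmul (- y) x)" using pos by (simp add: rk_def)
        then have "H * M1 * J * 1 \<le> H * M1 * J * ((2 + 3 * \<epsilon>) ^ (hdim - 1) * rk (gmul (- y) x))"
          using H0 M1 J0 by (intro mult_left_mono) auto
        then show ?thesis using k2b[OF y, of a x] by (simp add: mult.assoc)
      qed
      ultimately show ?thesis unfolding k_def by (simp add: distrib_right)
    qed
    show "g y - m g = (LINT x|lborel. (\<Sum>a | w a = 1. k a x y * lder (axis a 1) g x))" if g: "smooth g" and y: "N y < 1" for g y
    proof -
      let ?G = "\<lambda>a. lder (axis a 1) g"
      have Gm [measurable]: "?G a \<in> borel_measurable borel" for a by (rule smooth_measurable[OF smooth_lder[OF g]])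
      have gm [measurable]: "g \<in> borel_measurable borel" by (rule smooth_measurable[OF g])
      define T where "T = (LINT z|lborel. \<eta> z * g (gmul y z))"
      have e00: "e (0, z) = \<eta> z" for z by (simp add: e_def)
      have S1: "T - g y = (LINT x|lborel. (\<Sum>a | w a = 1. hK (C a) 0 (gmul (- y) x) * ?G a x))"
        using rep(1)[OF g, of 0 y] unfolding T_def e00 .
      define I where "I v = (LINT x|lborel. (\<Sum>a | w a = 1. hK (C a) (gmul (- y) v) (gmul (- v) x) * ?G a x))" for v
      \<comment> \<open>By translation invariance the bump around \<open>y\<close> gives the same
        average \<open>T\<close> from every base point \<open>v\<close>.\<close>
      have S2: "T - g v = I v" for v
      proof -
        have "(LINT z|lborel. e (gmul (- y) v, z) * g (gmul v z)) = T"
        proof -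
          have "(LINT z|lborel. e (gmul (- y) v, z) * g (gmul v z)) = (LINT z|lborel. (\<lambda>x. \<eta> (gmul (- y) x) * g x) (gmul v z))"
            by (simp add: e_def gmul_assoc)
          also have "\<dots> = (LINT x|lborel. \<eta> (gmul (- y) x) * g x)" by (rule integral_gmul) measurable
          also have "\<dots> = (LINT x|lborel. \<eta> (gmul (- y) (gmul y x)) * g (gmul y x))"
            by (rule integral_gmul[symmetric]) measurable
          finally show ?thesis by (simp add: T_def)
        qed
        then show ?thesis using rep(1)[OF g, of "gmul (- y) v" v] by (simp add: I_def)
      qed
      define \<Psi> where "\<Psi> a v x = \<eta> v * hK (C a) (gmul (- y) v) (gmul (- v) x) * ?G a x" for a v x
      have \<Psi>i: "integrable (lborel \<Otimes>\<^sub>M lborel) (\<lambda>(v, x). \<Psi> a v x)" for a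
      proof -
        have cG: "compact (?G a ` {x. N x \<le> R + \<epsilon>})"
          by (intro compact_continuous_image compact_N_le smooth_continuous_on smooth_lder g)
        obtain B where B: "\<And>x. N x \<le> R + \<epsilon> \<Longrightarrow> \<bar>?G a x\<bar> \<le> B" using compact_imp_bounded[OF cG] by (auto simp: bounded_iff)
        have B0: "0 \<le> B" using B[of 0] R \<epsilon> by force
        have mm: "(\<lambda>(v, x). \<Psi> a v x) \<in> borel_measurable (lborel \<Otimes>\<^sub>M lborel)"
          unfolding \<Psi>_def case_prod_beta' by (intro borel_measurable_times hKm) measurable
        have "(\<integral>\<^sup>+v. \<integral>\<^sup>+x. ennreal \<bar>\<Psi> a v x\<bar> \<partial>lborel \<partial>lborel) \<le> (\<integral>\<^sup>+v. ennreal (M1 * B * J) * ennreal (\<eta> v) \<partial>lborel)"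
        proof (rule nn_integral_mono)
          fix v
          have "(\<integral>\<^sup>+x. ennreal \<bar>\<Psi> a v x\<bar> \<partial>lborel) \<le> (\<integral>\<^sup>+x. ennreal (M1 * B * \<eta> v) * (ennreal (rk (gmul (- v) x)) * indicator {x. N x \<le> R} (gmul (- v) x)) \<partial>lborel)"
          proof (rule nn_integral_mono_AE)
            have "AE x in lborel. x \<noteq> v" by (rule AE_lborel_singleton)
            then show "AE x in lborel. ennreal \<bar>\<Psi> a v x\<bar> \<le> ennreal (M1 * B * \<eta> v) * (ennreal (rk (gmul (- v) x)) * indicator {x. N x \<le> R} (gmul (- v) x))"
            proof eventually_elim
              case (elim x)
              let ?r = "rk (gmul (- v) x) * indicator {x. N x \<le> R} (gmul (- v) x)"
              have "\<bar>\<Psi> a v x\<bar> \<le> (\<eta> v * (M1 * ?r)) * B"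
              proof (cases "N (gmul (- v) x) \<le> R \<and> \<eta> v \<noteq> 0")
                case True
                then have "N x \<le> R + \<epsilon>" using N_le_gmul[of x "- v"] \<eta>(3)[of v] by simp
                then show ?thesis unfolding \<Psi>_def abs_mult[of _ "?G a x"]
                  using pt[OF y elim[symmetric], of a] B by (intro mult_mono) auto
              next
                case False
                then have "\<bar>\<eta> v * hK (C a) (gmul (- y) v) (gmul (- v) x)\<bar> \<le> 0" using pt[OF y elim[symmetric], of a] by auto
                then have z: "\<eta> v * hK (C a) (gmul (- y) v) (gmul (- v) x) = 0" by simp
                have "\<Psi> a v x = 0" unfolding \<Psi>_def z by simp
                then show ?thesis using B0 M1 \<eta>(2)[of v] by simp
              qed
              then have "ennreal \<bar>\<Psi> a v x\<bar> \<le> ennreal (M1 * B * \<eta> v * ?r)" by (intro ennreal_leI) (simp add: mult_ac)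
              also have "\<dots> = ennreal (M1 * B * \<eta> v) * (ennreal (rk (gmul (- v) x)) * indicator {x. N x \<le> R} (gmul (- v) x))"
                using M1 B0 \<eta>(2)[of v] by (auto simp: indicator_def ennreal_mult'[symmetric])
              finally show ?case .
            qed
          qed
          also have "\<dots> = ennreal (M1 * B * \<eta> v) * (\<integral>\<^sup>+x. ennreal (rk (gmul (- v) x)) * indicator {x. N x \<le> R} (gmul (- v) x) \<partial>lborel)"
            by (rule nn_integral_cmult) measurable
          also have "(\<integral>\<^sup>+x. ennreal (rk (gmul (- v) x)) * indicator {x. N x \<le> R} (gmul (- v) x) \<partial>lborel) = ennreal J"
            unfolding J[symmetric] by (rule nn_integral_gmul) measurable
          also have "ennreal (M1 * B * \<eta> v) * ennreal J = ennreal (M1 * B * J) * ennreal (\<eta> v)"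
            using M1 B0 J0 \<eta>(2)[of v] by (simp add: ennreal_mult'[symmetric] mult_ac)
          finally show "(\<integral>\<^sup>+x. ennreal \<bar>\<Psi> a v x\<bar> \<partial>lborel) \<le> ennreal (M1 * B * J) * ennreal (\<eta> v)" .
        qed
        also have "\<dots> = ennreal (M1 * B * J) * (\<integral>\<^sup>+v. ennreal (\<eta> v) \<partial>lborel)" by (rule nn_integral_cmult) measurable
        also have "(\<integral>\<^sup>+v. ennreal (\<eta> v) \<partial>lborel) = ennreal 1"
          unfolding \<eta>(4)[symmetric] using \<eta>(2) by (intro nn_integral_eq_integral[OF \<eta>i]) auto
        finally have "(\<integral>\<^sup>+v. \<integral>\<^sup>+x. ennreal \<bar>\<Psi> a v x\<bar> \<partial>lborel \<partial>lborel) < \<infinity>"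
          by (auto intro: le_less_trans simp: ennreal_mult_less_top)
        then have "(\<integral>\<^sup>+z. ennreal \<bar>(\<lambda>(v, x). \<Psi> a v x) z\<bar> \<partial>(lborel \<Otimes>\<^sub>M lborel)) < \<infinity>"
          by (subst lborel.nn_integral_fst[symmetric]) (use mm in auto)
        then show ?thesis using mm by (intro integrableI_bounded) auto
      qed
      have xint: "(LINT v|lborel. \<Psi> a v x) = k2 a x y * ?G a x" for a x
        unfolding \<Psi>_def k2_def by simp
      have i2: "integrable lborel (\<lambda>x. k2 a x y * ?G a x)" for a
        using lborel_pair.integrable_snd[OF \<Psi>i[of a]] unfolding xint .
      have "T - m g = (LINT v|lborel. \<eta> v * I v)"
      proof -
        have "(LINT v|lborel. \<eta> v * (T - g v)) = (LINT v|lborel. T * \<eta> v - \<eta> v * g v)" by (simp add: algebra_simps)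
        also have "\<dots> = T - m g"
          using \<eta>i csupp_integrable[OF csupp_mult'[OF \<eta>(1) g]] \<eta>(4) by (simp add: m_def)
        finally show ?thesis unfolding S2 ..
      qed
      also have "\<dots> = (LINT v|lborel. (\<Sum>a | w a = 1. (LINT x|lborel. \<Psi> a v x)))"
      proof (rule arg_cong[where f="integral\<^sup>L lborel"], rule ext)
        fix v
        have "I v = (\<Sum>a | w a = 1. (LINT x|lborel. hK (C a) (gmul (- y) v) (gmul (- v) x) * ?G a x))"
          unfolding I_def using rep(2)[OF g] by simp
        then show "\<eta> v * I v = (\<Sum>a | w a = 1. (LINT x|lborel. \<Psi> a v x))"
          unfolding \<Psi>_def mult.assoc by (simp add: sum_distrib_left)
      qed
      also have "\<dots> = (\<Sum>a | w a = 1. (LINT v|lborel. LINT x|lborel. \<Psi> a v x))"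
        using lborel_pair.integrable_fst[OF \<Psi>i] by simp
      also have "\<dots> = (\<Sum>a | w a = 1. (LINT x|lborel. LINT v|lborel. \<Psi> a v x))"
        by (intro sum.cong refl lborel_pair.Fubini_integral[OF \<Psi>i, symmetric])
      also have "\<dots> = (\<Sum>a | w a = 1. (LINT x|lborel. k2 a x y * ?G a x))" unfolding xint ..
      finally have TT: "T - m g = (\<Sum>a | w a = 1. (LINT x|lborel. k2 a x y * ?G a x))" .
      have S1': "T - g y = (\<Sum>a | w a = 1. (LINT x|lborel. hK (C a) 0 (gmul (- y) x) * ?G a x))"
        unfolding S1 using rep(2)[OF g] by simp
      have "g y - m g = (\<Sum>a | w a = 1. (LINT x|lborel. k2 a x y * ?G a x) - (LINT x|lborel. hK (C a) 0 (gmul (- y) x) * ?G a x))"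
        using TT S1' by (simp add: sum_subtractf)
      also have "\<dots> = (\<Sum>a | w a = 1. (LINT x|lborel. k a x y * ?G a x))"
        unfolding k_def left_diff_distrib using i2 rep(2)[OF g] by simp
      also have "\<dots> = (LINT x|lborel. (\<Sum>a | w a = 1. k a x y * ?G a x))"
      proof -
        have "integrable lborel (\<lambda>x. k a x y * ?G a x)" for a
          unfolding k_def left_diff_distrib using i2 rep(2)[OF g] by (intro Bochner_Integration.integrable_diff)
        then show ?thesis by simp
      qed
      finally show ?thesis .
    qed
  qed
qed

text \<open>The kernel of the unit ball is pulled back by a translation and a dilation. The factor
  \<open>(1 / r) ^ (hdim - 1)\<close> is exactly compensated by the homogeneity of
  \<open>rk\<close>, so \<open>M\<close> and \<open>\<rho>\<close> are the same for all balls; this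
  is one source of the uniform constant at the critical exponent.\<close>

proposition ball_kernel:
  assumes l: "1 < (l::real)"
  obtains M \<rho> :: real where "0 \<le> M" "0 < \<rho>" "\<rho> < l"
    "\<And>x0 r. 0 < r \<Longrightarrow> \<exists>k m. reproducing_kernel x0 r (\<rho> * r) M k m"
proof -
  obtain k :: "'n \<Rightarrow> 'n point \<Rightarrow> 'n point \<Rightarrow> real" and M \<rho> :: real and m :: "('n point \<Rightarrow> real) \<Rightarrow> real"
    where k: "0 \<le> M" "0 < \<rho>" "\<rho> < l" "\<And>a. (\<lambda>q. k a (fst q) (snd q)) \<in> borel_measurable borel"
    "\<And>a x y. N y < 1 \<Longrightarrow> x \<noteq> y \<Longrightarrow> \<bar>k a x y\<bar> \<le> M * rk (gmul (- y) x)"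
    "\<And>a x y. N y < 1 \<Longrightarrow> \<rho> < N x \<Longrightarrow> k a x y = 0"
    "\<And>g y. smooth g \<Longrightarrow> N y < 1 \<Longrightarrow> g y - m g = (LINT x|lborel. (\<Sum>a | w a = 1. k a x y * lder (axis a 1) g x))"
    by (rule base_kernel[OF l], rule that)
  show ?thesis
  proof (rule that[OF k(1-3)])
    fix x0 :: "'n point" and r :: real assume r: "0 < r"
    define S where "S x = dil (1 / r) (gmul (- x0) x)" for x
    define E where "E z = gmul x0 (dil r z)" for z
    have dd: "dil (1 / r) (dil r z) = z" "dil r (dil (1 / r) z) = z" for z
      using r by (auto simp: dilation_def vec_eq_iff power_one_over)
    have ES: "E (S x) = x" for x by (simp add: E_def S_def dd)
    have NS: "N (S x) = N (gmul (- x0) x) / r" for x using N_dil_inverse[OF r] by (simp add: S_def)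
    have S2: "gmul (- S y) (S x) = dil (1 / r) (gmul (- y) x)" for x y
    proof -
      have "- S y = dil (1 / r) (gmul (- y) x0)"
        using linear_neg[OF linear_dil, of "1 / r" "gmul (- x0) y"] minus_gmul[of "- x0" y] by (simp add: S_def)
      then show ?thesis by (simp add: S_def dil_gmul[symmetric] gmul_assoc)
    qed
    have Sm [measurable]: "S \<in> borel_measurable borel" unfolding S_def by measurable
    have sE: "smooth E" unfolding E_def by (rule smooth_compose[OF smooth_gmul_left smooth_linear[OF linear_dil]])
    define kr where "kr a x y = (1 / r) ^ (hdim - 1) * k a (S x) (S y)" for a x y
    have meas: "(\<lambda>q. kr a (fst q) (snd q)) \<in> borel_measurable borel" for a
    proof -
      have "(\<lambda>q. (S (fst q), S (snd q))) \<in> borel \<rightarrow>\<^sub>M borel" unfolding borel_prod[symmetric] by measurable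
      from measurable_compose[OF this k(4)[of a]] show ?thesis unfolding kr_def by simp
    qed
    have bound: "\<bar>kr a x y\<bar> \<le> M * rk (gmul (- y) x)" if y: "N (gmul (- x0) y) < r" and xy: "x \<noteq> y" for a x y
    proof -
      have "S x \<noteq> S y" using xy ES by metis
      then have "\<bar>k a (S x) (S y)\<bar> \<le> M * rk (gmul (- S y) (S x))" using y r by (intro k(5)) (simp_all add: NS)
      also have "rk (gmul (- S y) (S x)) = rk (gmul (- y) x) * r ^ (hdim - 1)"
        unfolding S2 using rk_dil[of "1 / r" "gmul (- y) x"] r by (simp add: power_one_over)
      finally have "(1 / r) ^ (hdim - 1) * \<bar>k a (S x) (S y)\<bar> \<le> (1 / r) ^ (hdim - 1) * (M * (rk (gmul (- y) x) * r ^ (hdim - 1)))"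
        using r by (intro mult_left_mono) auto
      then show ?thesis using r by (simp add: kr_def abs_mult power_one_over)
    qed
    have supp: "kr a x y = 0" if y: "N (gmul (- x0) y) < r" and x: "\<rho> * r < N (gmul (- x0) x)" for a x y
      unfolding kr_def using k(6)[of "S y" "S x" a] y x r by (simp add: NS field_simps)
    have rep: "g y - m (\<lambda>z. g (E z)) = (LINT x|lborel. (\<Sum>a | w a = 1. kr a x y * lder (axis a 1) g x))"
      if g: "smooth g" and y: "N (gmul (- x0) y) < r" for g y
    proof -
      have gE: "smooth (\<lambda>z. g (E z))" by (rule smooth_compose[OF g sE])
      have [measurable]: "lder (axis a 1) g \<in> borel_measurable borel" for a by (rule smooth_measurable[OF smooth_lder[OF g]])
      have [measurable]: "(\<lambda>z. k a z (S y)) \<in> borel_measurable borel" for a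
      proof -
        have "(\<lambda>z. (z, S y)) \<in> borel \<rightarrow>\<^sub>M borel" by (intro borel_measurable_continuous_onI continuous_intros)
        from measurable_compose[OF this k(4)[of a]] show ?thesis by simp
      qed
      have [measurable]: "E \<in> borel_measurable borel" by (rule smooth_measurable[OF sE])
      define F where "F z = (\<Sum>a | w a = 1. k a z (S y) * (r * lder (axis a 1) g (E z)))" for z
      have Fm: "F \<in> borel_measurable borel" unfolding F_def by measurable
      have "g (E (S y)) - m (\<lambda>z. g (E z)) = (LINT z|lborel. (\<Sum>a | w a = 1. k a z (S y) * lder (axis a 1) (\<lambda>z. g (E z)) z))"
        by (rule k(7)[OF gE]) (use y r in \<open>simp add: NS\<close>)
      also have "\<dots> = (LINT z|lborel. F z)"
      proof -
        have "lder (axis a 1) (\<lambda>z. g (E z)) z = r * lder (axis a 1) g (E z)" if "w a = 1" for a z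
        proof -
          have gl: "smooth (\<lambda>u. g (gmul x0 u))" by (rule smooth_compose[OF g smooth_gmul_left])
          have "lder (axis a 1) (\<lambda>z. g (E z)) z = lder (dil r (axis a 1)) (\<lambda>u. g (gmul x0 u)) (dil r z)"
            unfolding E_def by (rule lder_dil[OF gl])
          also have "\<dots> = lder (dil r (axis a 1)) g (E z)" unfolding E_def by (rule lder_gmul[OF g])
          finally show ?thesis unfolding dil_axis that by (simp add: linear_cmul[OF linear_lder[OF g]])
        qed
        then have "(\<Sum>a | w a = 1. k a z (S y) * lder (axis a 1) (\<lambda>z. g (E z)) z) = F z" for z
          unfolding F_def by (intro sum.cong refl) simp
        then show ?thesis by simp
      qed
      also have "\<dots> = (1 / r) ^ hdim * (LINT x|lborel. F (dil (1 / r) x))"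
        by (rule integral_dil[OF _ Fm]) (use r in simp)
      also have "(LINT x|lborel. F (dil (1 / r) x)) = (LINT x|lborel. F (S x))"
        unfolding S_def by (rule integral_gmul[symmetric, where f="\<lambda>x. F (dil (1 / r) x)"]) (use Fm in measurable)
      also have "(1 / r) ^ hdim * (LINT x|lborel. F (S x)) = (LINT x|lborel. (1 / r) ^ hdim * F (S x))" by simp
      also have "\<dots> = (LINT x|lborel. (\<Sum>a | w a = 1. kr a x y * lder (axis a 1) g x))"
      proof -
        \<comment> \<open>The Jacobian of the dilation against the factor \<open>r\<close> gained by
          a horizontal derivative.\<close>
        have "(1 / r) ^ hdim * r = (1 / r) ^ (hdim - 1)" using r hdim2 by (cases hdim) (auto simp: field_simps)
        then have *: "(1 / r) ^ hdim * (k a (S x) (S y) * (r * t)) = kr a x y * t" for a x t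
          by (simp add: kr_def mult_ac)
        show ?thesis unfolding F_def ES sum_distrib_left * ..
      qed
      finally show ?thesis unfolding ES .
    qed
    show "\<exists>k m. reproducing_kernel x0 r (\<rho> * r) M k m"
      unfolding reproducing_kernel_def
      by (intro exI[of _ kr] exI[of _ "\<lambda>g. m (\<lambda>z. g (E z))"] conjI allI impI meas bound supp rep)
  qed
qed

end

subsection \<open>The Riesz potential\<close>

lemma lborel_Fubini_nn:
  fixes f :: "'a::euclidean_space \<Rightarrow> 'b::euclidean_space \<Rightarrow> ennreal"
  assumes "(\<lambda>q. f (fst q) (snd q)) \<in> borel_measurable (borel \<Otimes>\<^sub>M borel)"
  shows "(\<integral>\<^sup>+x. \<integral>\<^sup>+y. f x y \<partial>lborel \<partial>lborel) = (\<integral>\<^sup>+y. \<integral>\<^sup>+x. f x y \<partial>lborel \<partial>lborel)"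
proof -
  have "sets (lborel \<Otimes>\<^sub>M lborel :: ('a \<times> 'b) measure) = sets (borel \<Otimes>\<^sub>M borel)"
    by (intro sets_pair_measure_cong) auto
  then have "case_prod f \<in> borel_measurable (lborel \<Otimes>\<^sub>M lborel)"
    using assms by (simp add: case_prod_beta' cong: measurable_cong_sets)
  then show ?thesis using lborel_pair.Fubini'[of "\<lambda>x y. f x y"] by simp
qed

text \<open>Young's inequality with a free weight \<open>\<mu>\<close>, tuned in
  \<open>riesz_level_estimate\<close> so that both terms reach the same size.\<close>

lemma young_powr:
  assumes "1 < p" "0 < \<mu>" "0 \<le> a" "0 \<le> (b::real)"
  shows "a * b \<le> \<mu> powr p * a powr p + \<mu> powr (- (p / (p - 1))) * b powr (p / (p - 1))"
proof -
  define p' where "p' = p / (p - 1)"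
  have p': "p' > 1" "1 / p + 1 / p' = 1" using assms(1) by (auto simp: p'_def field_simps)
  have "a * b = (\<mu> * a) * (b / \<mu>)" using assms by simp
  also have "\<dots> \<le> (\<mu> * a) powr p / p + (b / \<mu>) powr p' / p'"
    using assms p' by (intro Youngs_inequality) auto
  also have "\<dots> \<le> (\<mu> * a) powr p + (b / \<mu>) powr p'"
  proof (rule add_mono)
    have "t / r \<le> t" if "1 < r" "0 \<le> t" for t r :: real
      using divide_left_mono[of 1 r t] that by simp
    then show "(\<mu> * a) powr p / p \<le> (\<mu> * a) powr p" "(b / \<mu>) powr p' / p' \<le> (b / \<mu>) powr p'"
      using assms(1) p' by simp_all
  qed
  also have "\<dots> = \<mu> powr p * a powr p + \<mu> powr (- p') * b powr p'"
    using assms by (simp add: powr_mult powr_divide powr_minus_divide)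
  finally show ?thesis by (simp add: p'_def)
qed

lemma nn_integral_powr_Icc:
  assumes "a > -1" "c \<ge> (0::real)"
  shows "(\<integral>\<^sup>+s. ennreal (s powr a) * indicator {0..c} s \<partial>lborel) = ennreal (c powr (a + 1) / (a + 1))"
  by (rule nn_integral_has_integral_lebesgue'[OF _ has_integral_powr_from_0[OF assms]]) simp

context carnot_norm
begin

abbreviation "Qd \<equiv> real hdim"

lemma real_hdim_minus_1: "real (hdim - Suc 0) = Qd - 1" using hdim2 by simp

section \<open>Scaling of kernel integrals\<close>

lemma rk_powr_scale:
  assumes c: "c > 0" and A: "A \<in> sets borel"
  shows "(\<integral>\<^sup>+x. ennreal (rk x powr s) * indicator A x \<partial>lborel)
     = ennreal (c powr (Qd - (Qd - 1) * s)) * (\<integral>\<^sup>+x. ennreal (rk x powr s) * indicator {x. dil c x \<in> A} x \<partial>lborel)"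
proof -
  have m: "{x. dil c x \<in> A} \<in> sets borel"
    using measurable_sets[OF measurable_dil A, of c] by (simp add: vimage_def)
  have "(\<integral>\<^sup>+x. ennreal (rk x powr s) * indicator A x \<partial>lborel)
     = ennreal (c ^ hdim) * (\<integral>\<^sup>+x. ennreal (rk (dil c x) powr s) * indicator A (dil c x) \<partial>lborel)"
    by (rule nn_integral_dil[OF c]) (use A in measurable)
  also have "\<dots> = ennreal (c ^ hdim) * (\<integral>\<^sup>+x. ennreal (c powr (- (Qd - 1) * s)) * (ennreal (rk x powr s) * indicator {x. dil c x \<in> A} x) \<partial>lborel)"
  proof -
    have "rk (dil c x) powr s = c powr (- (Qd - 1) * s) * rk x powr s" for x
    proof -
      have "c ^ (hdim - 1) = c powr (Qd - 1)" using c by (simp add: powr_realpow[symmetric] real_hdim_minus_1)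
      then have "rk (dil c x) powr s = rk x powr s / c powr ((Qd - 1) * s)"
        using c by (simp add: rk_dil powr_divide powr_powr)
      also have "\<dots> = c powr (- (Qd - 1) * s) * rk x powr s"
      proof -
        have "- (Qd - 1) * s = - ((Qd - 1) * s)" by (simp only: mult_minus_left)
        then show ?thesis by (simp only: powr_minus divide_inverse mult.commute)
      qed
      finally show ?thesis .
    qed
    then have "ennreal (rk (dil c x) powr s) * indicator A (dil c x) = ennreal (c powr (- (Qd - 1) * s)) * (ennreal (rk x powr s) * indicator {x. dil c x \<in> A} x)" for x
      by (simp add: indicator_def ennreal_mult')
    then show ?thesis by simp
  qed
  also have "\<dots> = ennreal (c ^ hdim) * (ennreal (c powr (- (Qd - 1) * s)) * (\<integral>\<^sup>+x. ennreal (rk x powr s) * indicator {x. dil c x \<in> A} x \<partial>lborel))"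
    by (subst nn_integral_cmult) (use m in auto)
  also have "\<dots> = ennreal (c ^ hdim * c powr (- (Qd - 1) * s)) * (\<integral>\<^sup>+x. ennreal (rk x powr s) * indicator {x. dil c x \<in> A} x \<partial>lborel)"
    using c by (simp add: ennreal_mult' mult.assoc)
  also have "c ^ hdim * c powr (- (Qd - 1) * s) = c powr (Qd - (Qd - 1) * s)"
  proof -
    have "Qd + - (Qd - 1) * s = Qd - (Qd - 1) * s" by (simp add: algebra_simps)
    then show ?thesis unfolding powr_realpow[symmetric, OF c] powr_add[symmetric] by (simp only:)
  qed
  finally show ?thesis .
qed

lemma rk_powr_inner:
  assumes s: "s > 0" "(Qd - 1) * s < Qd"
  obtains J where "0 \<le> J" "\<And>c. c > 0 \<Longrightarrow>
    (\<integral>\<^sup>+x. ennreal (rk x powr s) * indicator {x. N x \<le> c} x \<partial>lborel) = ennreal (c powr (Qd - (Qd - 1) * s) * J)"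
proof -
  define J where "J = enn2real (\<integral>\<^sup>+x. ennreal (rk x powr s) * indicator {x. N x \<le> 1} x \<partial>lborel)"
  have J: "(\<integral>\<^sup>+x. ennreal (rk x powr s) * indicator {x. N x \<le> 1} x \<partial>lborel) = ennreal J"
    using rk_powr_inner_finite[of s] s by (simp add: J_def real_hdim_minus_1)
  show ?thesis
  proof (rule that[of J])
    fix c :: real assume c: "c > 0"
    have A: "{x. N x \<le> c} \<in> sets borel" by measurable
    have "{x. dil c x \<in> {x. N x \<le> c}} = {x. N x \<le> 1}" using c by (auto simp: N_dil)
    then show "(\<integral>\<^sup>+x. ennreal (rk x powr s) * indicator {x. N x \<le> c} x \<partial>lborel) = ennreal (c powr (Qd - (Qd - 1) * s) * J)"
      using rk_powr_scale[OF c A, of s] J by (simp add: ennreal_mult')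
  qed (simp add: J_def)
qed

lemma rk_powr_outer:
  assumes s: "s > 0" "(Qd - 1) * s > Qd"
  obtains J where "0 \<le> J" "\<And>c. c > 0 \<Longrightarrow>
    (\<integral>\<^sup>+x. ennreal (rk x powr s) * indicator {x. N x > c} x \<partial>lborel) = ennreal (c powr (Qd - (Qd - 1) * s) * J)"
proof -
  define J where "J = enn2real (\<integral>\<^sup>+x. ennreal (rk x powr s) * indicator {x. N x > 1} x \<partial>lborel)"
  have J: "(\<integral>\<^sup>+x. ennreal (rk x powr s) * indicator {x. N x > 1} x \<partial>lborel) = ennreal J"
    using rk_powr_outer_finite[of s] s by (simp add: J_def real_hdim_minus_1)
  show ?thesis
  proof (rule that[of J])
    fix c :: real assume c: "c > 0"
    have A: "{x. N x > c} \<in> sets borel" by measurable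
    have "{x. dil c x \<in> {x. N x > c}} = {x. N x > 1}" using c by (auto simp: N_dil)
    then show "(\<integral>\<^sup>+x. ennreal (rk x powr s) * indicator {x. N x > c} x \<partial>lborel) = ennreal (c powr (Qd - (Qd - 1) * s) * J)"
      using rk_powr_scale[OF c A, of s] J by (simp add: ennreal_mult')
  qed (simp add: J_def)
qed

text \<open>\<open>N\<close> is invariant under inversion, so \<open>gmul (- y) x\<close> may be
  replaced by \<open>gmul (- x) y\<close>, in which a left translation acts on the integration
  variable.\<close>

lemma nn_integral_N_swap:
  assumes [measurable]: "\<phi> \<in> borel_measurable borel"
  shows "(\<integral>\<^sup>+y. \<phi> (N (gmul (- y) x)) \<partial>lborel) = (\<integral>\<^sup>+y. \<phi> (N y) \<partial>lborel)"
proof -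
  have "(\<integral>\<^sup>+y. \<phi> (N (gmul (- y) x)) \<partial>lborel) = (\<integral>\<^sup>+y. (\<lambda>z. \<phi> (N z)) (gmul (- x) y) \<partial>lborel)"
    by (simp add: N_swap[of _ x])
  also have "\<dots> = (\<integral>\<^sup>+y. \<phi> (N y) \<partial>lborel)" by (rule nn_integral_gmul) measurable
  finally show ?thesis .
qed

lemma nn_integral_rk_swap:
  assumes A: "A \<in> sets borel"
  shows "(\<integral>\<^sup>+y. ennreal (rk (gmul (- y) x) powr s) * indicator {z. N z \<in> A} (gmul (- y) x) \<partial>lborel)
    = (\<integral>\<^sup>+y. ennreal (rk y powr s) * indicator {z. N z \<in> A} y \<partial>lborel)"
proof -
  define \<phi> :: "real \<Rightarrow> ennreal" where "\<phi> r = ennreal ((1 / r ^ (hdim - 1)) powr s) * indicator A r" for r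
  have [measurable]: "\<phi> \<in> borel_measurable borel" unfolding \<phi>_def using A by measurable
  have "ennreal (rk z powr s) * indicator {z. N z \<in> A} z = \<phi> (N z)" for z by (simp add: \<phi>_def rk_def indicator_def)
  then show ?thesis using nn_integral_N_swap[of \<phi> x] by simp
qed

section \<open>Estimates for the Riesz potential\<close>

definition riesz :: "('n point \<Rightarrow> real) \<Rightarrow> 'n point \<Rightarrow> ennreal" where
  "riesz f x = (\<integral>\<^sup>+y. ennreal (f y * rk (gmul (- y) x)) \<partial>lborel)"

text \<open>The potential may be infinite, so the estimate is stated for real minorants
  \<open>u\<close>; in the application \<open>u\<close> is the pointwise norm of the solution up to
  a constant. With the norm of \<open>f\<close> equal to 1, \<open>C\<close> bounds the
  \<open>q\<close>-th power of the norm of \<open>u\<close>. The sets \<open>A\<close> and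
  \<open>A'\<close> admit estimates that hold only locally.\<close>

definition riesz_bounded :: "real \<Rightarrow> real \<Rightarrow> 'n point set \<Rightarrow> 'n point set \<Rightarrow> real \<Rightarrow> bool" where
  "riesz_bounded p q A A' C \<longleftrightarrow> 0 \<le> C \<and> (\<forall>f u. f \<in> borel_measurable borel \<longrightarrow> (\<forall>y. 0 \<le> f y) \<longrightarrow>
      (\<integral>\<^sup>+y. ennreal (f y powr p) \<partial>lborel) = 1 \<longrightarrow> (\<forall>y. f y \<noteq> 0 \<longrightarrow> y \<in> A) \<longrightarrow>
      u \<in> borel_measurable borel \<longrightarrow> (\<forall>x. 0 \<le> u x) \<longrightarrow>
      (\<forall>x. ennreal (u x) \<le> riesz f x) \<longrightarrow> (\<forall>x. u x \<noteq> 0 \<longrightarrow> x \<in> A') \<longrightarrow>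
      (\<integral>\<^sup>+x. ennreal (u x powr q) \<partial>lborel) \<le> ennreal C)"

lemma riesz_bounded_mono: "riesz_bounded p q A A' C \<Longrightarrow> B \<subseteq> A \<Longrightarrow> B' \<subseteq> A' \<Longrightarrow> riesz_bounded p q B B' C"
  unfolding riesz_bounded_def by blast

text \<open>Weak estimate at level \<open>s\<close>: cutting the kernel at radius \<open>s powr (- p / Q)\<close> and \<open>f\<close> at height \<open>s\<close>,
  only the large values of \<open>f\<close> near the point can contribute.\<close>

lemma riesz_level_estimate:
  assumes p: "1 < p" "p < Qd"
  obtains J where "0 < J" "\<And>f u s. f \<in> borel_measurable borel \<Longrightarrow> (\<forall>y. 0 \<le> f y) \<Longrightarrow>
      (\<integral>\<^sup>+y. ennreal (f y powr p) \<partial>lborel) \<le> 1 \<Longrightarrow> u \<in> borel_measurable borel \<Longrightarrow>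
      (\<forall>x. ennreal (u x) \<le> riesz f x) \<Longrightarrow> 0 < s \<Longrightarrow>
      emeasure lborel {x. J * s powr (1 - p / Qd) < u x} \<le> ennreal (J / s) * (\<integral>\<^sup>+y. ennreal (f y) * indicator {y. s < f y} y \<partial>lborel)"
proof -
  define p' where "p' = p / (p - 1)"
  have p': "p' > 0" using p by (simp add: p'_def)
  \<comment> \<open>The condition \<open>p < Qd\<close> is what makes the \<open>p'\<close>-th power
    of the kernel integrable away from the identity.\<close>
  have e2: "(Qd - 1) * p' > Qd"
  proof -
    have "Qd * (p - 1) < (Qd - 1) * p" using p by (simp add: algebra_simps)
    then show ?thesis using p by (simp add: p'_def field_simps)
  qed
  obtain J1 where J1: "0 \<le> J1" "\<And>c. c > 0 \<Longrightarrow>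
    (\<integral>\<^sup>+x. ennreal (rk x powr 1) * indicator {x. N x \<le> c} x \<partial>lborel) = ennreal (c powr (Qd - (Qd - 1) * 1) * J1)"
    by (rule rk_powr_inner[of 1]) auto
  obtain J2 where J2: "0 \<le> J2" "\<And>c. c > 0 \<Longrightarrow>
    (\<integral>\<^sup>+x. ennreal (rk x powr p') * indicator {x. N x > c} x \<partial>lborel) = ennreal (c powr (Qd - (Qd - 1) * p') * J2)"
    by (rule rk_powr_outer[OF p' e2]) auto
  show ?thesis
  proof (rule that[of "J1 + J2 + 2"])
    show "0 < J1 + J2 + 2" using J1 J2 by simp
    fix f u :: "'n point \<Rightarrow> real" and s :: real
    assume [measurable]: "f \<in> borel_measurable borel" and f0: "\<forall>y. 0 \<le> f y" and fp: "(\<integral>\<^sup>+y. ennreal (f y powr p) \<partial>lborel) \<le> 1"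
      and [measurable]: "u \<in> borel_measurable borel" and uT: "\<forall>x. ennreal (u x) \<le> riesz f x" and s: "0 < s"
    let ?I = "\<integral>\<^sup>+y. ennreal (f y) * indicator {y. s < f y} y \<partial>lborel"
    \<comment> \<open>The radius is chosen so that \<open>s * c = \<alpha>\<close>: near the point,
      values of \<open>f\<close> up to \<open>s\<close> contribute at most
      \<open>\<alpha> * J1\<close>. The weight \<open>\<mu>\<close> makes both Young terms of the
      far part multiples of \<open>\<alpha>\<close>.\<close>
    define c where "c = s powr (- p / Qd)"
    define \<alpha> where "\<alpha> = s powr (1 - p / Qd)"
    define \<mu> where "\<mu> = \<alpha> powr (1 / p)"
    have c: "c > 0" and \<alpha>: "\<alpha> > 0" and \<mu>: "\<mu> > 0" using s by (simp_all add: c_def \<alpha>_def \<mu>_def)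
    have sc: "s * c = \<alpha>" using s powr_add[of s 1 "- p / Qd"] by (simp add: c_def \<alpha>_def)
    have \<mu>p: "\<mu> powr p = \<alpha>" using \<alpha> p by (simp add: \<mu>_def powr_powr)
    have ex: "\<mu> powr (- p') * c powr (Qd - (Qd - 1) * p') = \<alpha>"
    proof -
      have Q0: "Qd > 0" using hdim2 by simp
      have "\<mu> powr (- p') = s powr ((1 - p / Qd) * (1 / p) * (- p'))" by (simp add: \<mu>_def \<alpha>_def powr_powr)
      moreover have "c powr (Qd - (Qd - 1) * p') = s powr ((- p / Qd) * (Qd - (Qd - 1) * p'))" by (simp add: c_def powr_powr)
      moreover have "(1 - p / Qd) * (1 / p) * (- p') + (- p / Qd) * (Qd - (Qd - 1) * p') = 1 - p / Qd"
        using p Q0 by (simp add: p'_def divide_simps) (simp add: algebra_simps power2_eq_square)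
      ultimately show ?thesis by (simp add: \<alpha>_def powr_add[symmetric])
    qed
    define K1 where "K1 z = ennreal (rk z powr 1) * indicator {z. N z \<in> {..c}} z" for z
    define K2 where "K2 z = ennreal (rk z powr p') * indicator {z. N z \<in> {c<..}} z" for z
    have Am: "{z. N z \<in> {..c}} \<in> sets borel" "{z. N z \<in> {c<..}} \<in> sets borel" by measurable
    have K1m [measurable]: "K1 \<in> borel_measurable borel" unfolding K1_def using Am by measurable
    have K2m [measurable]: "K2 \<in> borel_measurable borel" unfolding K2_def using Am by measurable
    have K1i: "(\<integral>\<^sup>+y. K1 (gmul (- y) x) \<partial>lborel) = ennreal (c * J1)" for x
    proof -
      have "(\<integral>\<^sup>+y. K1 (gmul (- y) x) \<partial>lborel) = (\<integral>\<^sup>+y. ennreal (rk y powr 1) * indicator {z. N z \<in> {..c}} y \<partial>lborel)"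
        unfolding K1_def by (rule nn_integral_rk_swap) simp
      then show ?thesis using J1(2)[OF c] c by simp
    qed
    have K1i': "(\<integral>\<^sup>+x. K1 (gmul (- y) x) \<partial>lborel) = ennreal (c * J1)" for y
    proof -
      have "(\<integral>\<^sup>+x. K1 (gmul (- y) x) \<partial>lborel) = (\<integral>\<^sup>+x. K1 x \<partial>lborel)" by (rule nn_integral_gmul) measurable
      then show ?thesis unfolding K1_def using J1(2)[OF c] c by simp
    qed
    have K2i: "(\<integral>\<^sup>+y. K2 (gmul (- y) x) \<partial>lborel) = ennreal (c powr (Qd - (Qd - 1) * p') * J2)" for x
    proof -
      have "(\<integral>\<^sup>+y. K2 (gmul (- y) x) \<partial>lborel) = (\<integral>\<^sup>+y. ennreal (rk y powr p') * indicator {z. N z \<in> {c<..}} y \<partial>lborel)"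
        unfolding K2_def by (rule nn_integral_rk_swap) simp
      then show ?thesis using J2(2)[OF c] by simp
    qed
    define T1 where "T1 x = (\<integral>\<^sup>+y. (ennreal (f y) * indicator {y. s < f y} y) * K1 (gmul (- y) x) \<partial>lborel)" for x
    have sm [measurable]: "{y. s < f y} \<in> sets borel" by measurable
    have T1: "riesz f x \<le> T1 x + ennreal (\<alpha> * (J1 + J2 + 1))" for x
    proof -
      have "riesz f x \<le> (\<integral>\<^sup>+y. (ennreal (f y) * indicator {y. s < f y} y) * K1 (gmul (- y) x) + (ennreal s * K1 (gmul (- y) x)
          + (ennreal \<alpha> * ennreal (f y powr p) + ennreal (\<mu> powr (- p')) * K2 (gmul (- y) x))) \<partial>lborel)"
        unfolding riesz_def
      proof (rule nn_integral_mono)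
        fix y
        let ?z = "gmul (- y) x"
        show "ennreal (f y * rk ?z) \<le> (ennreal (f y) * indicator {y. s < f y} y) * K1 ?z + (ennreal s * K1 ?z
          + (ennreal \<alpha> * ennreal (f y powr p) + ennreal (\<mu> powr (- p')) * K2 ?z))"
        proof (cases "N ?z \<le> c")
          case True
          then have K: "K1 ?z = ennreal (rk ?z)" by (simp add: K1_def)
          show ?thesis
          proof (cases "s < f y")
            case True
            have "ennreal (f y * rk ?z) = (ennreal (f y) * indicator {y. s < f y} y) * K1 ?z" using f0 True by (simp add: K ennreal_mult')
            then show ?thesis by (simp add: add_increasing2)
          next
            case False
            have "ennreal (f y * rk ?z) \<le> ennreal (s * rk ?z)" using False by (intro ennreal_leI mult_right_mono) auto
            also have "\<dots> = ennreal s * K1 ?z" using s by (simp add: K ennreal_mult')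
            finally show ?thesis by (simp add: add_increasing add_increasing2)
          qed
        next
          case False
          then have K: "K2 ?z = ennreal (rk ?z powr p')" by (simp add: K2_def)
          have "f y * rk ?z \<le> \<mu> powr p * f y powr p + \<mu> powr (- p') * rk ?z powr p'"
            unfolding p'_def using f0 by (intro young_powr p \<mu>) auto
          then have "ennreal (f y * rk ?z) \<le> ennreal (\<alpha> * f y powr p + \<mu> powr (- p') * rk ?z powr p')"
            unfolding \<mu>p by (rule ennreal_leI)
          also have "\<dots> = ennreal \<alpha> * ennreal (f y powr p) + ennreal (\<mu> powr (- p')) * K2 ?z"
            using \<alpha> by (simp add: K ennreal_mult')
          finally show ?thesis by (simp add: add_increasing)
        qed
      qed
      also have "\<dots> = T1 x + (ennreal s * (\<integral>\<^sup>+y. K1 (gmul (- y) x) \<partial>lborel)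
          + (ennreal \<alpha> * (\<integral>\<^sup>+y. ennreal (f y powr p) \<partial>lborel) + ennreal (\<mu> powr (- p')) * (\<integral>\<^sup>+y. K2 (gmul (- y) x) \<partial>lborel)))"
        unfolding T1_def by (simp add: nn_integral_add nn_integral_cmult)
      also have "\<dots> \<le> T1 x + (ennreal s * ennreal (c * J1) + (ennreal \<alpha> * 1 + ennreal (\<mu> powr (- p')) * ennreal (c powr (Qd - (Qd - 1) * p') * J2)))"
        unfolding K1i K2i using fp by (intro add_left_mono add_right_mono mult_left_mono) auto
      also have "ennreal s * ennreal (c * J1) = ennreal (\<alpha> * J1)" using s sc by (simp add: ennreal_mult'[symmetric] mult.assoc[symmetric])
      also have "ennreal (\<mu> powr (- p')) * ennreal (c powr (Qd - (Qd - 1) * p') * J2) = ennreal (\<alpha> * J2)"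
        using ex by (simp add: ennreal_mult'[symmetric] mult.assoc[symmetric])
      also have "ennreal (\<alpha> * J1) + (ennreal \<alpha> * 1 + ennreal (\<alpha> * J2)) = ennreal (\<alpha> * (J1 + J2 + 1))"
        using \<alpha> J1 J2 by (simp add: ennreal_plus[symmetric] algebra_simps del: ennreal_plus)
      finally show ?thesis .
    qed
    \<comment> \<open>All contributions except \<open>T1\<close> add up to at most
      \<open>\<alpha> * (J1 + J2 + 1)\<close>, so a value of \<open>u\<close> above
      \<open>(J1 + J2 + 2) * \<alpha>\<close> leaves at least \<open>\<alpha>\<close> for
      \<open>T1\<close>.\<close>
    have low: "ennreal \<alpha> \<le> T1 x" if "(J1 + J2 + 2) * \<alpha> < u x" for x
    proof (cases "T1 x")
      case (real t)
      have "ennreal ((J1 + J2 + 2) * \<alpha>) \<le> ennreal (u x)" using that by (intro ennreal_leI) simp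
      also have "\<dots> \<le> ennreal t + ennreal (\<alpha> * (J1 + J2 + 1))" using uT T1[of x] real by (metis order_trans)
      also have "\<dots> = ennreal (t + \<alpha> * (J1 + J2 + 1))" using real \<alpha> J1 J2 by (simp add: ennreal_plus)
      finally have "(J1 + J2 + 2) * \<alpha> \<le> t + \<alpha> * (J1 + J2 + 1)"
        using real \<alpha> J1 J2 by (subst (asm) ennreal_le_iff) auto
      then have "\<alpha> \<le> t" by (simp add: algebra_simps)
      then show ?thesis using real by (simp add: ennreal_leI)
    qed simp
    let ?S = "{x. (J1 + J2 + 2) * s powr (1 - p / Qd) < u x}"
    have Sm: "?S \<in> sets borel" by measurable
    \<comment> \<open>Chebyshev's inequality for \<open>T1\<close>, whose integral Fubini reduces to
      the integral of the kernel over a ball.\<close>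
    have "ennreal \<alpha> * emeasure lborel ?S = (\<integral>\<^sup>+x. ennreal \<alpha> * indicator ?S x \<partial>lborel)"
      by (rule nn_integral_cmult_indicator[symmetric]) (use Sm in simp)
    also have "\<dots> \<le> (\<integral>\<^sup>+x. T1 x \<partial>lborel)"
      by (rule nn_integral_mono) (use low in \<open>auto simp: indicator_def \<alpha>_def\<close>)
    also have "\<dots> = (\<integral>\<^sup>+y. \<integral>\<^sup>+x. (ennreal (f y) * indicator {y. s < f y} y) * K1 (gmul (- y) x) \<partial>lborel \<partial>lborel)"
      unfolding T1_def by (rule lborel_Fubini_nn) measurable
    also have "\<dots> = (\<integral>\<^sup>+y. (ennreal (f y) * indicator {y. s < f y} y) * ennreal (c * J1) \<partial>lborel)"
      by (simp add: nn_integral_cmult K1i')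
    also have "\<dots> = ennreal (c * J1) * ?I"
      by (subst nn_integral_multc) (auto simp: mult.commute)
    finally have fin: "ennreal \<alpha> * emeasure lborel ?S \<le> ennreal (c * J1) * ?I" .
    have "emeasure lborel ?S = ennreal (1 / \<alpha>) * (ennreal \<alpha> * emeasure lborel ?S)"
      using \<alpha> by (simp add: mult.assoc[symmetric] ennreal_mult'[symmetric])
    also have "\<dots> \<le> ennreal (1 / \<alpha>) * (ennreal (c * J1) * ?I)"
      by (intro mult_left_mono fin) simp
    also have "\<dots> = ennreal (J1 / s) * ?I"
    proof -
      have "1 / \<alpha> * (c * J1) = J1 / s" using sc s c by (simp add: field_simps flip: sc)
      then show ?thesis using \<alpha> by (simp add: mult.assoc[symmetric] ennreal_mult'[symmetric])
    qed
    also have "\<dots> \<le> ennreal ((J1 + J2 + 2) / s) * ?I"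
      using s J1 J2 by (intro mult_right_mono ennreal_leI divide_right_mono) auto
    finally show "emeasure lborel ?S \<le> ennreal ((J1 + J2 + 2) / s) * ?I" .
  qed
qed

text \<open>The level estimates are integrated over \<open>s\<close> with weight
  \<open>s powr (p - 1)\<close>. Each sees only the values of \<open>f\<close> above
  \<open>s\<close>, so exchanging the integrals produces the integral of
  \<open>s powr (p - 2)\<close> from 0 to \<open>f y\<close>, which converges since
  \<open>p > 1\<close> and yields \<open>f y powr p\<close>.\<close>

proposition riesz_strong_estimate:
  assumes p: "1 < p" "p < Qd" and q: "q = p * Qd / (Qd - p)"
  obtains C where "riesz_bounded p q UNIV UNIV C"
proof -
  obtain J where J: "0 < J" "\<And>f u s. f \<in> borel_measurable borel \<Longrightarrow> (\<forall>y. 0 \<le> f y) \<Longrightarrow>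
      (\<integral>\<^sup>+y. ennreal (f y powr p) \<partial>lborel) \<le> 1 \<Longrightarrow> u \<in> borel_measurable borel \<Longrightarrow>
      (\<forall>x. ennreal (u x) \<le> riesz f x) \<Longrightarrow> 0 < s \<Longrightarrow>
      emeasure lborel {x. J * s powr (1 - p / Qd) < u x} \<le> ennreal (J / s) * (\<integral>\<^sup>+y. ennreal (f y) * indicator {y. s < f y} y \<partial>lborel)"
    by (rule riesz_level_estimate[OF p], rule that)
  have q0: "q > 0" using p by (simp add: q)
  have qp: "p / q = 1 - p / Qd" using p by (simp add: q field_simps)
  show ?thesis
  proof (rule that[of "J powr q * (p * J / (p - 1))"], unfold riesz_bounded_def, intro conjI allI impI)
    show "0 \<le> J powr q * (p * J / (p - 1))" using J p by simp
    fix f u :: "'n point \<Rightarrow> real"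
    assume [measurable]: "f \<in> borel_measurable borel" and f0: "\<forall>y. 0 \<le> f y" and fp: "(\<integral>\<^sup>+y. ennreal (f y powr p) \<partial>lborel) = 1"
      and [measurable]: "u \<in> borel_measurable borel" and u0: "\<forall>x. 0 \<le> u x" and uT: "\<forall>x. ennreal (u x) \<le> riesz f x"
    let ?G = "\<lambda>s x. ennreal (s powr (p - 1)) * (indicator {0<..} s * indicator {x. J * s powr (1 - p / Qd) < u x} x)"
    let ?H = "\<lambda>s y. ennreal (s powr (p - 2)) * (indicator {0<..} s * (ennreal (f y) * indicator {y. s < f y} y))"
    have layer: "ennreal (u x powr q) \<le> ennreal (J powr q * p) * (\<integral>\<^sup>+s. ?G s x \<partial>lborel)" for x
    proof -
      \<comment> \<open>Chosen so that \<open>u x = J * c powr (p / q)\<close>: the levels lying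
        below \<open>u x\<close> are those with \<open>s < c\<close>.\<close>
      define c where "c = (u x / J) powr (q / p)"
      have c0: "0 \<le> c" by (simp add: c_def)
      have "u x powr q = J powr q * (p * (c powr p / p))"
        using u0 J p q0 by (simp add: c_def powr_powr powr_divide)
      then have "ennreal (u x powr q) = ennreal (J powr q * p) * ennreal (c powr (p - 1 + 1) / (p - 1 + 1))"
        using p by (simp add: ennreal_mult'[symmetric] mult.assoc)
      also have "ennreal (c powr (p - 1 + 1) / (p - 1 + 1)) = (\<integral>\<^sup>+s. ennreal (s powr (p - 1)) * indicator {0..c} s \<partial>lborel)"
        by (rule nn_integral_powr_Icc[symmetric]) (use p c0 in auto)
      also have "\<dots> \<le> (\<integral>\<^sup>+s. ?G s x \<partial>lborel)"
      proof (rule nn_integral_mono_AE)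
        \<comment> \<open>At \<open>s = 0\<close> and \<open>s = c\<close> the strict conditions
          inside \<open>?G\<close> fail.\<close>
        have "AE s in lborel. s \<noteq> (0::real)" "AE s in lborel. s \<noteq> c" by (rule AE_lborel_singleton)+
        then show "AE s in lborel. ennreal (s powr (p - 1)) * indicator {0..c} s \<le> ?G s x"
        proof eventually_elim
          case (elim s)
          show ?case
          proof (cases "s \<in> {0..c}")
            case True
            then have s: "0 < s" "s < c" using elim by auto
            have "s powr (p / q) < c powr (p / q)" using s p q0 by (intro powr_less_mono2) auto
            also have "c powr (p / q) = u x / J" using p q0 u0 J by (simp add: c_def powr_powr)
            finally have "J * s powr (1 - p / Qd) < u x" using J by (simp add: qp field_simps)
            then show ?thesis using s True by simp
          qed simp
        qed
      qed
      finally show ?thesis by (simp add: mult_left_mono)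
    qed
    have m1: "(\<lambda>r. ?G (snd r) (fst r)) \<in> borel_measurable (borel \<Otimes>\<^sub>M (borel :: real measure))"
    proof -
      have "(\<lambda>r. indicator {r. J * snd r powr (1 - p / Qd) < u (fst r)} r :: ennreal) \<in> borel_measurable (borel \<Otimes>\<^sub>M (borel :: real measure))"
      proof (rule borel_measurable_indicator)
        have "{r \<in> space (borel \<Otimes>\<^sub>M borel). J * snd r powr (1 - p / Qd) < u (fst r)} \<in> sets (borel \<Otimes>\<^sub>M (borel :: real measure))" by measurable
        then show "{r. J * snd r powr (1 - p / Qd) < u (fst r)} \<in> sets (borel \<Otimes>\<^sub>M (borel :: real measure))" by (simp add: space_pair_measure)
      qed
      then have [measurable]: "(\<lambda>r. indicator {x. J * snd r powr (1 - p / Qd) < u x} (fst r) :: ennreal) \<in> borel_measurable (borel \<Otimes>\<^sub>M (borel :: real measure))"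
        by (simp add: indicator_def)
      show ?thesis by measurable
    qed
    have m2: "(\<lambda>r. ?H (fst r) (snd r)) \<in> borel_measurable ((borel :: real measure) \<Otimes>\<^sub>M borel)"
    proof -
      have "(\<lambda>r. indicator {r. fst r < f (snd r)} r :: ennreal) \<in> borel_measurable ((borel :: real measure) \<Otimes>\<^sub>M borel)"
      proof (rule borel_measurable_indicator)
        have "{r \<in> space (borel \<Otimes>\<^sub>M borel). fst r < f (snd r)} \<in> sets ((borel :: real measure) \<Otimes>\<^sub>M borel)" by measurable
        then show "{r. fst r < f (snd r)} \<in> sets ((borel :: real measure) \<Otimes>\<^sub>M borel)" by (simp add: space_pair_measure)
      qed
      then have [measurable]: "(\<lambda>r. indicator {y. fst r < f y} (snd r) :: ennreal) \<in> borel_measurable ((borel :: real measure) \<Otimes>\<^sub>M borel)"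
        by (simp add: indicator_def)
      show ?thesis by measurable
    qed
    have "(\<integral>\<^sup>+x. ennreal (u x powr q) \<partial>lborel) \<le> (\<integral>\<^sup>+x. ennreal (J powr q * p) * (\<integral>\<^sup>+s. ?G s x \<partial>lborel) \<partial>lborel)"
      by (rule nn_integral_mono[OF layer])
    also have "\<dots> = ennreal (J powr q * p) * (\<integral>\<^sup>+x. \<integral>\<^sup>+s. ?G s x \<partial>lborel \<partial>lborel)"
    proof (rule nn_integral_cmult)
      have "(\<lambda>x. \<integral>\<^sup>+s. (\<lambda>r. ?G (snd r) (fst r)) (x, s) \<partial>lborel) \<in> borel_measurable borel"
        by (rule lborel.borel_measurable_nn_integral_fst) (use m1 in \<open>simp cong: measurable_cong_sets sets_pair_measure_cong\<close>)
      then show "(\<lambda>x. \<integral>\<^sup>+s. ?G s x \<partial>lborel) \<in> borel_measurable lborel"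
        by simp
    qed
    also have "(\<integral>\<^sup>+x. \<integral>\<^sup>+s. ?G s x \<partial>lborel \<partial>lborel)
      = (\<integral>\<^sup>+s. \<integral>\<^sup>+x. ?G s x \<partial>lborel \<partial>lborel)"
      by (rule lborel_Fubini_nn[OF m1])
    also have "\<dots> \<le> (\<integral>\<^sup>+s. ennreal J * (\<integral>\<^sup>+y. ?H s y \<partial>lborel) \<partial>lborel)"
    proof (rule nn_integral_mono)
      fix s :: real
      have Sm: "{x. J * s powr (1 - p / Qd) < u x} \<in> sets borel" by measurable
      show "(\<integral>\<^sup>+x. ?G s x \<partial>lborel)
         \<le> ennreal J * (\<integral>\<^sup>+y. ?H s y \<partial>lborel)"
      proof (cases "0 < s")
        case s: True
        have fm: "{y. s < f y} \<in> sets borel" by measurable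
        have "(\<integral>\<^sup>+x. ?G s x \<partial>lborel)
           = ennreal (s powr (p - 1)) * emeasure lborel {x. J * s powr (1 - p / Qd) < u x}"
          using s Sm by (simp add: nn_integral_cmult_indicator)
        also have "\<dots> \<le> ennreal (s powr (p - 1)) * (ennreal (J / s) * (\<integral>\<^sup>+y. ennreal (f y) * indicator {y. s < f y} y \<partial>lborel))"
          by (intro mult_left_mono J(2)) (use s f0 uT fp in auto)
        also have "\<dots> = (ennreal (s powr (p - 1)) * ennreal (J / s)) * (\<integral>\<^sup>+y. ennreal (f y) * indicator {y. s < f y} y \<partial>lborel)"
          by (simp add: mult.assoc)
        also have "ennreal (s powr (p - 1)) * ennreal (J / s) = ennreal J * ennreal (s powr (p - 2))"
        proof -
          have "s powr (p - 1) = s powr (p - 2) * s" using s powr_add[of s "p - 2" 1] by simp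
          then have "s powr (p - 1) * (J / s) = J * s powr (p - 2)" using s by simp
          then show ?thesis using J(1) by (simp add: ennreal_mult'[symmetric])
        qed
        also have "(ennreal J * ennreal (s powr (p - 2))) * (\<integral>\<^sup>+y. ennreal (f y) * indicator {y. s < f y} y \<partial>lborel)
          = ennreal J * (\<integral>\<^sup>+y. ?H s y \<partial>lborel)"
          using s fm by (simp add: nn_integral_cmult mult.assoc)
        finally show ?thesis .
      qed simp
    qed
    also have "\<dots> = ennreal J * (\<integral>\<^sup>+s. \<integral>\<^sup>+y. ?H s y \<partial>lborel \<partial>lborel)"
    proof (rule nn_integral_cmult)
      have "(\<lambda>s. \<integral>\<^sup>+y. (\<lambda>r. ?H (fst r) (snd r)) (s, y) \<partial>lborel) \<in> borel_measurable borel"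
        by (rule lborel.borel_measurable_nn_integral_fst) (use m2 in \<open>simp cong: measurable_cong_sets sets_pair_measure_cong\<close>)
      then show "(\<lambda>s. \<integral>\<^sup>+y. ?H s y \<partial>lborel) \<in> borel_measurable lborel"
        by simp
    qed
    also have "(\<integral>\<^sup>+s. \<integral>\<^sup>+y. ?H s y \<partial>lborel \<partial>lborel)
      = (\<integral>\<^sup>+y. \<integral>\<^sup>+s. ?H s y \<partial>lborel \<partial>lborel)"
      by (rule lborel_Fubini_nn[OF m2])
    also have "\<dots> \<le> (\<integral>\<^sup>+y. ennreal (1 / (p - 1)) * ennreal (f y powr p) \<partial>lborel)"
    proof (rule nn_integral_mono)
      fix y
      have "(\<integral>\<^sup>+s. ?H s y \<partial>lborel)
         \<le> (\<integral>\<^sup>+s. ennreal (f y) * (ennreal (s powr (p - 2)) * indicator {0..f y} s) \<partial>lborel)"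
        by (rule nn_integral_mono) (auto simp: indicator_def mult.commute)
      also have "\<dots> = ennreal (f y) * (\<integral>\<^sup>+s. ennreal (s powr (p - 2)) * indicator {0..f y} s \<partial>lborel)"
        by (rule nn_integral_cmult) measurable
      also have "(\<integral>\<^sup>+s. ennreal (s powr (p - 2)) * indicator {0..f y} s \<partial>lborel) = ennreal (f y powr (p - 2 + 1) / (p - 2 + 1))"
        by (rule nn_integral_powr_Icc) (use p f0 in auto)
      also have "ennreal (f y) * ennreal (f y powr (p - 2 + 1) / (p - 2 + 1)) = ennreal (1 / (p - 1)) * ennreal (f y powr p)"
      proof -
        have "f y * f y powr (p - 1) = f y powr p"
          using f0 powr_add[of "f y" 1 "p - 1"] by (cases "f y = 0") auto
        then have "f y * (f y powr (p - 2 + 1) / (p - 2 + 1)) = 1 / (p - 1) * f y powr p" using p by (simp add: field_simps)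
        then show ?thesis using f0 p by (simp add: ennreal_mult'[symmetric])
      qed
      finally show "(\<integral>\<^sup>+s. ?H s y \<partial>lborel) \<le> ennreal (1 / (p - 1)) * ennreal (f y powr p)" .
    qed
    also have "\<dots> = ennreal (1 / (p - 1))" by (simp add: nn_integral_cmult fp)
    finally have "(\<integral>\<^sup>+x. ennreal (u x powr q) \<partial>lborel) \<le> ennreal (J powr q * p) * (ennreal J * ennreal (1 / (p - 1)))"
      by (simp add: mult_left_mono)
    also have "\<dots> = ennreal (J powr q * (p * J / (p - 1)))" using J p by (simp add: ennreal_mult'[symmetric])
    finally show "(\<integral>\<^sup>+x. ennreal (u x powr q) \<partial>lborel) \<le> ennreal (J powr q * (p * J / (p - 1)))" .
  qed
qed


text \<open>As \<open>f\<close> has total mass 1, Jensen's inequality bounds the \<open>q\<close>-th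
  power of the potential by the potential of the \<open>q\<close>-th power of the kernel, which is
  integrable on balls below the critical exponent.\<close>

lemma riesz_L1_estimate:
  assumes q: "1 \<le> q" "(Qd - 1) * q < Qd" and \<rho>: "0 < \<rho>"
  obtains C where "riesz_bounded 1 q {y. N y < 1} {x. N x \<le> \<rho>} C"
proof -
  obtain J where J: "0 \<le> J" "\<And>c. c > 0 \<Longrightarrow>
    (\<integral>\<^sup>+x. ennreal (rk x powr q) * indicator {x. N x \<le> c} x \<partial>lborel) = ennreal (c powr (Qd - (Qd - 1) * q) * J)"
    by (rule rk_powr_inner[OF _ q(2)]) (use q in auto)
  define C where "C = (1 + \<rho>) powr (Qd - (Qd - 1) * q) * J"
  show ?thesis
  proof (rule that[of C], unfold riesz_bounded_def mem_Collect_eq, intro conjI allI impI)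
    show "0 \<le> C" using J by (simp add: C_def)
    fix f u :: "'n point \<Rightarrow> real"
    assume [measurable]: "f \<in> borel_measurable borel" and f0: "\<forall>y. 0 \<le> f y" and f1': "(\<integral>\<^sup>+y. ennreal (f y powr 1) \<partial>lborel) = 1"
      and fs: "\<forall>y. f y \<noteq> 0 \<longrightarrow> N y < 1"
      and [measurable]: "u \<in> borel_measurable borel" and u0: "\<forall>x. 0 \<le> u x" and uT: "\<forall>x. ennreal (u x) \<le> riesz f x"
      and us: "\<forall>x. u x \<noteq> 0 \<longrightarrow> N x \<le> \<rho>"
    have f1: "(\<integral>\<^sup>+y. ennreal (f y) \<partial>lborel) = 1" using f1' f0 by simp
    define K where "K z = ennreal (rk z powr q) * indicator {z. N z \<le> 1 + \<rho>} z" for z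
    have Am: "{z. N z \<le> 1 + \<rho>} \<in> sets borel" by measurable
    have [measurable]: "K \<in> borel_measurable borel" unfolding K_def using Am by measurable
    have pt: "ennreal (u x powr q) \<le> (\<integral>\<^sup>+y. ennreal (f y) * K (gmul (- y) x) \<partial>lborel)" (is "_ \<le> ?V") for x
    proof (cases "u x = 0")
      case False
      define \<tau> where "\<tau> = u x"
      have \<tau>: "\<tau> > 0" and Nx: "N x \<le> \<rho>" using False u0 us by (auto simp: \<tau>_def less_le)
      \<comment> \<open>Convexity: the graph of \<open>k powr q\<close> lies above its tangent at
        \<open>k = \<tau>\<close>. Integrated against \<open>f\<close> this gives Jensen's
        inequality.\<close>
      have young: "q * \<tau> powr (q - 1) * k \<le> k powr q + (q - 1) * \<tau> powr q" if k: "0 \<le> k" for k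
      proof (cases "q = 1")
        case True then show ?thesis using \<tau> k by simp
      next
        case False
        then have q1: "q > 1" using q by simp
        have "k * \<tau> powr (q - 1) \<le> k powr q / q + (\<tau> powr (q - 1)) powr (q / (q - 1)) / (q / (q - 1))"
          using q1 k by (intro Youngs_inequality) (auto simp: field_simps)
        also have "(\<tau> powr (q - 1)) powr (q / (q - 1)) = \<tau> powr q" using q1 by (simp add: powr_powr)
        finally have "q * (k * \<tau> powr (q - 1)) \<le> q * (k powr q / q + \<tau> powr q / (q / (q - 1)))"
          using q1 by (intro mult_left_mono) auto
        moreover have "q * (k powr q / q + \<tau> powr q / (q / (q - 1))) = k powr q + (q - 1) * \<tau> powr q"
          using q1 by (simp add: distrib_left)
        ultimately show ?thesis by (simp add: mult_ac)
      qed
      have "ennreal (q * \<tau> powr q) = ennreal (q * \<tau> powr (q - 1)) * ennreal \<tau>"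
      proof -
        have "\<tau> powr (q - 1) * \<tau> = \<tau> powr q" using \<tau> powr_add[of \<tau> "q - 1" 1] by simp
        then show ?thesis using q \<tau> by (simp add: ennreal_mult'[symmetric] mult.assoc)
      qed
      also have "\<dots> \<le> ennreal (q * \<tau> powr (q - 1)) * riesz f x" using uT by (intro mult_left_mono) (auto simp: \<tau>_def)
      also have "\<dots> = (\<integral>\<^sup>+y. ennreal (q * \<tau> powr (q - 1)) * ennreal (f y * rk (gmul (- y) x)) \<partial>lborel)"
        unfolding riesz_def by (rule nn_integral_cmult[symmetric]) measurable
      also have "\<dots> \<le> (\<integral>\<^sup>+y. ennreal (f y) * K (gmul (- y) x) + ennreal ((q - 1) * \<tau> powr q) * ennreal (f y) \<partial>lborel)"
      proof (rule nn_integral_mono)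
        fix y
        let ?k = "rk (gmul (- y) x)"
        show "ennreal (q * \<tau> powr (q - 1)) * ennreal (f y * ?k) \<le> ennreal (f y) * K (gmul (- y) x) + ennreal ((q - 1) * \<tau> powr q) * ennreal (f y)"
        proof (cases "f y = 0")
          case False
          then have "N (gmul (- y) x) \<le> 1 + \<rho>" using fs Nx N_gmul[of "- y" x] by (auto simp: less_imp_le intro: order_trans add_mono)
          then have K: "K (gmul (- y) x) = ennreal (?k powr q)" by (simp add: K_def)
          have "f y * (q * \<tau> powr (q - 1) * ?k) \<le> f y * (?k powr q + (q - 1) * \<tau> powr q)"
            using young[of ?k] f0 by (intro mult_left_mono) auto
          then have "ennreal (q * \<tau> powr (q - 1) * (f y * ?k)) \<le> ennreal (f y * ?k powr q + (q - 1) * \<tau> powr q * f y)"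
            by (intro ennreal_leI) (simp add: algebra_simps)
          also have "\<dots> = ennreal (f y * ?k powr q) + ennreal ((q - 1) * \<tau> powr q * f y)"
            using f0 q by (intro ennreal_plus) auto
          finally show ?thesis using f0 q by (simp add: K ennreal_mult')
        qed simp
      qed
      also have "\<dots> = ?V + ennreal ((q - 1) * \<tau> powr q)"
        by (simp add: nn_integral_add nn_integral_cmult f1)
      finally have *: "ennreal (q * \<tau> powr q) \<le> ?V + ennreal ((q - 1) * \<tau> powr q)" .
      show ?thesis
      \<comment> \<open>The common term is finite and can be subtracted; for infinite
        \<open>?V\<close> there is nothing to show.\<close>
      proof (cases ?V)
        case (real v)
        have "ennreal (q * \<tau> powr q) \<le> ennreal (v + (q - 1) * \<tau> powr q)" using * real q by (simp add: ennreal_plus)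
        then have "q * \<tau> powr q \<le> v + (q - 1) * \<tau> powr q" using real q by (subst (asm) ennreal_le_iff) auto
        then have "\<tau> powr q \<le> v" by (simp add: algebra_simps)
        then show ?thesis using real by (simp add: \<tau>_def ennreal_leI)
      qed simp
    qed simp
    have "(\<integral>\<^sup>+x. ennreal (u x powr q) \<partial>lborel) \<le> (\<integral>\<^sup>+x. \<integral>\<^sup>+y. ennreal (f y) * K (gmul (- y) x) \<partial>lborel \<partial>lborel)"
      by (rule nn_integral_mono[OF pt])
    also have "\<dots> = (\<integral>\<^sup>+y. \<integral>\<^sup>+x. ennreal (f y) * K (gmul (- y) x) \<partial>lborel \<partial>lborel)"
      by (rule lborel_Fubini_nn) measurable
    also have "\<dots> = (\<integral>\<^sup>+y. ennreal (f y) * ennreal C \<partial>lborel)"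
    proof -
      have "(\<integral>\<^sup>+x. K (gmul (- y) x) \<partial>lborel) = ennreal C" for y
      proof -
        have "(\<integral>\<^sup>+x. K (gmul (- y) x) \<partial>lborel) = (\<integral>\<^sup>+x. K x \<partial>lborel)" by (rule nn_integral_gmul) measurable
        then show ?thesis unfolding K_def C_def using J(2)[of "1 + \<rho>"] \<rho> by simp
      qed
      then show ?thesis by (simp add: nn_integral_cmult)
    qed
    also have "\<dots> = ennreal C" by (simp add: nn_integral_multc f1)
    finally show "(\<integral>\<^sup>+x. ennreal (u x powr q) \<partial>lborel) \<le> ennreal C" .
  qed
qed

text \<open>For \<open>p > 1\<close> the critical exponent \<open>q'\<close> dominates:
  \<open>u powr q\<close> is at most \<open>1 + u powr q'\<close> on the support of
  \<open>u\<close>, which has finite volume. For \<open>p = 1\<close> the bound on \<open>q\<close>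
  is the integrability condition of \<open>riesz_L1_estimate\<close>.\<close>

lemma riesz_local_estimate:
  assumes p: "1 \<le> p" "p < Qd" and q: "1 \<le> q" "1 < p \<Longrightarrow> q \<le> p * Qd / (Qd - p)" "p = 1 \<Longrightarrow> q < Qd / (Qd - 1)" and \<rho>: "0 < \<rho>"
  obtains C where "riesz_bounded p q {y. N y < 1} {x. N x \<le> \<rho>} C"
proof (cases "p = 1")
  case True
  have e: "(Qd - 1) * q < Qd" using q(3)[OF True] p by (simp add: field_simps)
  show ?thesis unfolding True by (rule riesz_L1_estimate[OF q(1) e \<rho>]) (rule that[unfolded True])
next
  case False
  then have p1: "1 < p" using p by simp
  define q' where "q' = p * Qd / (Qd - p)"
  obtain C where C: "riesz_bounded p q' UNIV UNIV C"
    by (rule riesz_strong_estimate[OF p1 p(2) q'_def])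
  have C0: "0 \<le> C" using C by (simp add: riesz_bounded_def)
  show ?thesis
  proof (rule that[of "\<rho> ^ hdim * vol1 + C"], unfold riesz_bounded_def mem_Collect_eq, intro conjI allI impI)
    show "0 \<le> \<rho> ^ hdim * vol1 + C" using C0 \<rho> by (simp add: vol1_def)
    fix f u :: "'n point \<Rightarrow> real"
    assume *: "f \<in> borel_measurable borel" "\<forall>y. 0 \<le> f y" "(\<integral>\<^sup>+y. ennreal (f y powr p) \<partial>lborel) = 1" "\<forall>y. f y \<noteq> 0 \<longrightarrow> N y < 1"
      "u \<in> borel_measurable borel" "\<forall>x. 0 \<le> u x" "\<forall>x. ennreal (u x) \<le> riesz f x" "\<forall>x. u x \<noteq> 0 \<longrightarrow> N x \<le> \<rho>"
    note [measurable] = *(5)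
    have Am: "{x. N x \<le> \<rho>} \<in> sets borel" by measurable
    have "(\<integral>\<^sup>+x. ennreal (u x powr q) \<partial>lborel) \<le> (\<integral>\<^sup>+x. indicator {x. N x \<le> \<rho>} x + ennreal (u x powr q') \<partial>lborel)"
    proof (rule nn_integral_mono)
      fix x
      show "ennreal (u x powr q) \<le> indicator {x. N x \<le> \<rho>} x + ennreal (u x powr q')"
      proof (cases "u x = 0")
        case False
        then have i: "indicator {x. N x \<le> \<rho>} x = (1::ennreal)" using *(8) by simp
        show ?thesis
        proof (cases "u x \<le> 1")
          case True
          then have "u x powr q \<le> 1" using *(6) q by (intro powr_le1) auto
          then have "ennreal (u x powr q) \<le> 1" by (simp add: ennreal_le_1)
          then show ?thesis unfolding i by (simp add: add_increasing2)
        next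
          case False
          then have "u x powr q \<le> u x powr q'" using q(2)[OF p1] by (intro powr_mono) (auto simp: q'_def)
          then show ?thesis by (simp add: add_increasing ennreal_leI)
        qed
      qed simp
    qed
    also have "\<dots> = emeasure lborel {x. N x \<le> \<rho>} + (\<integral>\<^sup>+x. ennreal (u x powr q') \<partial>lborel)"
      by (subst nn_integral_add) (use Am in auto)
    also have "\<dots> \<le> ennreal (\<rho> ^ hdim * vol1) + ennreal C"
      unfolding emeasure_N_le[OF \<rho>] using C * unfolding riesz_bounded_def by (intro add_left_mono) blast
    also have "\<dots> = ennreal (\<rho> ^ hdim * vol1 + C)" using C0 \<rho> by (simp add: vol1_def ennreal_plus)
    finally show "(\<integral>\<^sup>+x. ennreal (u x powr q) \<partial>lborel) \<le> ennreal (\<rho> ^ hdim * vol1 + C)" .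
  qed
qed

text \<open>Removes the normalisation: the factor \<open>F powr (- 1 / p)\<close> brings the norm of
  \<open>f\<close> to 1. The case \<open>F = 0\<close> is separate; there \<open>f\<close> vanishes
  almost everywhere, hence its potential and \<open>u\<close> vanish everywhere.\<close>

lemma riesz_homogeneous_estimate:
  assumes S: "riesz_bounded p q A A' C"
    and p: "p > 0" and q: "q > 0"
    and f: "f \<in> borel_measurable borel" "\<forall>y. 0 \<le> f y" "\<forall>y. f y \<noteq> 0 \<longrightarrow> y \<in> A"
    and F: "(\<integral>\<^sup>+y. ennreal (f y powr p) \<partial>lborel) = ennreal F" "0 \<le> F"
    and u: "u \<in> borel_measurable borel" "\<forall>x. 0 \<le> u x" "\<forall>x. ennreal (u x) \<le> riesz f x" "\<forall>x. u x \<noteq> 0 \<longrightarrow> x \<in> A'"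
  shows "(\<integral>\<^sup>+x. ennreal (u x powr q) \<partial>lborel) \<le> ennreal (C * F powr (q / p))"
proof (cases "F = 0")
  case True
  note [measurable] = f(1)
  have "AE y in lborel. ennreal (f y powr p) = 0" using F(1) True nn_integral_0_iff_AE[of "\<lambda>y. ennreal (f y powr p)" lborel] by simp
  then have ae: "AE y in lborel. f y = 0" by eventually_elim simp
  have "riesz f x = 0" for x
    unfolding riesz_def by (subst nn_integral_0_iff_AE) (measurable, use ae in \<open>eventually_elim, simp\<close>)
  then have "u x = 0" for x using u(2,3) by (metis antisym ennreal_eq_0_iff le_zero_eq)
  then show ?thesis by simp
next
  case False
  then have F0: "F > 0" using F by simp
  have C: "0 \<le> C" using S by (simp add: riesz_bounded_def)
  define t where "t = F powr (- 1 / p)"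
  have t: "t > 0" using F0 by (simp add: t_def)
  have tp: "t powr p * F = 1"
  proof -
    have "t powr p = F powr (- 1)" using p by (simp add: t_def powr_powr)
    then show ?thesis using F0 powr_minus_divide[of F 1] by simp
  qed
  note [measurable] = f(1) u(1)
  have "(\<integral>\<^sup>+x. ennreal ((t * u x) powr q) \<partial>lborel) \<le> ennreal C"
  proof (rule S[unfolded riesz_bounded_def, THEN conjunct2, rule_format, of "\<lambda>y. t * f y" "\<lambda>x. t * u x"])
    have "(\<integral>\<^sup>+y. ennreal ((t * f y) powr p) \<partial>lborel) = (\<integral>\<^sup>+y. ennreal (t powr p) * ennreal (f y powr p) \<partial>lborel)"
      using t f(2) by (simp add: powr_mult ennreal_mult')
    also have "\<dots> = ennreal (t powr p) * ennreal F" by (simp add: nn_integral_cmult F)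
    also have "\<dots> = 1" using tp F by (simp add: ennreal_mult'[symmetric])
    finally show "(\<integral>\<^sup>+y. ennreal ((t * f y) powr p) \<partial>lborel) = 1" .
    have "riesz (\<lambda>y. t * f y) x = ennreal t * riesz f x" for x
    proof -
      have "riesz (\<lambda>y. t * f y) x = (\<integral>\<^sup>+y. ennreal t * ennreal (f y * rk (gmul (- y) x)) \<partial>lborel)"
        unfolding riesz_def using t by (simp add: mult.assoc ennreal_mult')
      also have "\<dots> = ennreal t * riesz f x" unfolding riesz_def by (rule nn_integral_cmult) measurable
      finally show ?thesis .
    qed
    then show "ennreal (t * u x) \<le> riesz (\<lambda>y. t * f y) x" for x
      using u(3) t by (simp add: ennreal_mult' mult_left_mono)
  qed (use f u t in auto)
  then have "ennreal (t powr q) * (\<integral>\<^sup>+x. ennreal (u x powr q) \<partial>lborel) \<le> ennreal C"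
    using t u(2) by (simp add: powr_mult ennreal_mult' nn_integral_cmult)
  then have "ennreal (1 / t powr q) * (ennreal (t powr q) * (\<integral>\<^sup>+x. ennreal (u x powr q) \<partial>lborel)) \<le> ennreal (1 / t powr q) * ennreal C"
    by (rule mult_left_mono) simp
  moreover have "ennreal (1 / t powr q) * (ennreal (t powr q) * (\<integral>\<^sup>+x. ennreal (u x powr q) \<partial>lborel)) = (\<integral>\<^sup>+x. ennreal (u x powr q) \<partial>lborel)"
    using t by (simp add: mult.assoc[symmetric] ennreal_mult'[symmetric])
  moreover have "1 / t powr q * C = C * F powr (q / p)"
  proof -
    have "t powr q = F powr (- (q / p))" by (simp add: t_def powr_powr)
    then show ?thesis using F0 by (simp add: powr_minus_divide)
  qed
  ultimately show ?thesis using C by (simp add: ennreal_mult'[symmetric])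
qed


section \<open>Solving the equation on a ball\<close>

lemma gball_eq: "gball gmul N x0 r = {y. N (gmul (- x0) y) < r}" by (simp add: gball_def)

lemma gball_borel [measurable]: "gball gmul N x0 r \<in> sets borel"
  unfolding gball_eq by measurable

lemma compact_translated_N_le: "compact {x. N (gmul (- x0) x) \<le> c}"
proof -
  have "{x. N (gmul (- x0) x) \<le> c} = gmul x0 ` {x. N x \<le> c}"
    by (auto simp: image_iff) (metis gmul_cancel(2))
  then show ?thesis by (simp add: compact_continuous_image compact_N_le smooth_continuous_on smooth_gmul_left)
qed

lemma integral_lebesgue_lborel: "f \<in> borel_measurable borel \<Longrightarrow> (LINT x|lebesgue. f x) = (LINT x|lborel. f x :: real)"
  by (rule integral_completion) simp

text \<open>The horizontal components of the solution are the integrals of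
  \<open>f y * k a x y\<close> over \<open>y\<close>. Integrating the reproducing formula against
  \<open>f\<close> gives the weak equation, because \<open>m g\<close> is multiplied by the integral
  of \<open>f\<close>, which is 0.\<close>

lemma solve_on_ball:
  fixes k :: "'n \<Rightarrow> 'n point \<Rightarrow> 'n point \<Rightarrow> real"
  assumes p: "1 \<le> p" and q: "1 \<le> q" and r: "0 < r" and M: "0 \<le> M" and \<rho>: "0 < \<rho>" "\<rho> < l"
    and ker: "reproducing_kernel x0 r (\<rho> * r) M k m"
    and est: "riesz_bounded p q {y. N (gmul (- x0) y) < r} {x. N (gmul (- x0) x) \<le> \<rho> * r} C"
    and \<omega>: "\<omega> \<in> Lp_forms gmul p CARD('n) (gball gmul N x0 r)" and zero: "top_integral (gball gmul N x0 r) \<omega> = 0"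
  shows "\<exists>\<phi> \<in> Lp_forms gmul q (CARD('n) - 1) (gball gmul N x0 (l * r)).
          compactly_supported_in \<phi> (gball gmul N x0 (l * r)) \<and>
          weak_rumin_d gmul (CARD('n) - 1) (gball gmul N x0 r) \<phi> \<omega> \<and>
          Lp_norm q (gball gmul N x0 (l * r)) \<phi> \<le> ((real CARD('n) * M + 1) * C powr (1 / q)) * Lp_norm p (gball gmul N x0 r) \<omega>"
proof -
  note K = ker[unfolded reproducing_kernel_def]
  have km: "(\<lambda>q. k a (fst q) (snd q)) \<in> borel_measurable borel" for a using K by blast
  have kb: "N (gmul (- x0) y) < r \<Longrightarrow> x \<noteq> y \<Longrightarrow> \<bar>k a x y\<bar> \<le> M * rk (gmul (- y) x)" for a x y using K by blast
  have ks: "N (gmul (- x0) y) < r \<Longrightarrow> \<rho> * r < N (gmul (- x0) x) \<Longrightarrow> k a x y = 0" for a x y using K by blast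
  have kr: "smooth g \<Longrightarrow> N (gmul (- x0) y) < r \<Longrightarrow>
      g y - m g = (LINT x|lborel. (\<Sum>a | w a = 1. k a x y * lder (axis a 1) g x))" for g y using K by blast
  have C: "0 \<le> C" using est by (simp add: riesz_bounded_def)
  let ?B = "gball gmul N x0 r" and ?B' = "gball gmul N x0 (l * r)"
  have Bm [measurable]: "?B \<in> sets borel" "?B' \<in> sets borel" by (rule gball_borel)+
  define f0 where "f0 x = indicator ?B x * (\<omega> x $ UNIV)" for x
  have \<omega>m: "(\<lambda>x. indicator ?B x *\<^sub>R \<omega> x) \<in> borel_measurable lebesgue"
    and \<omega>E: "AE x in lebesgue. x \<in> ?B \<longrightarrow> \<omega> x \<in> E0 gmul CARD('n)"
    and \<omega>i: "integrable lebesgue (\<lambda>x. indicator ?B x *\<^sub>R norm (\<omega> x) powr p)"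
    using \<omega> by (auto simp: Lp_forms_def set_borel_measurable_def set_integrable_def)
  have f0m: "f0 \<in> borel_measurable lebesgue"
  proof -
    have "(\<lambda>v :: 'n covector. v $ UNIV) \<in> borel_measurable borel"
      by (intro borel_measurable_continuous_onI continuous_intros)
    from measurable_compose[OF \<omega>m this] show ?thesis by (simp add: f0_def[abs_def])
  qed
  \<comment> \<open>A Borel representative of the coefficient; cutting it off to the ball at every
    point makes \<open>f\<close> admissible for the kernel and potential estimates.\<close>
  obtain f1 where f1: "f1 \<in> borel_measurable lborel" "AE x in lborel. f0 x = f1 x"
    using completion_ex_borel_measurable_real[OF f0m] by blast
  define f where "f x = indicator ?B x * f1 x" for x
  have fm [measurable]: "f \<in> borel_measurable borel" unfolding f_def using f1(1) by simp
  have fs: "N (gmul (- x0) y) < r" if "f y \<noteq> 0" for y using that by (auto simp: f_def gball_eq indicator_def split: if_splits)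
  have f0f: "AE x in lebesgue. f0 x = f x"
    using AE_completion[OF f1(2)] by eventually_elim (auto simp: f_def f0_def indicator_def)
  have normf: "AE x in lebesgue. indicator ?B x *\<^sub>R norm (\<omega> x) powr p = \<bar>f x\<bar> powr p"
    using \<omega>E f0f
  proof eventually_elim
    case (elim x)
    show ?case
    proof (cases "x \<in> ?B")
      case True
      then have "\<omega> x = (\<omega> x $ UNIV) *\<^sub>R axis UNIV 1"
        using elim unfolding E0_top by (auto simp: vec_eq_iff axis_def)
      then have "norm (\<omega> x) = \<bar>\<omega> x $ UNIV\<bar>" by (metis norm_axis_1 norm_scaleR mult.right_neutral)
      then show ?thesis using elim True by (simp add: f0_def)
    next
      case False then show ?thesis by (simp add: f_def)
    qed
  qed
  have fpm: "(\<lambda>x. \<bar>f x\<bar> powr p) \<in> borel_measurable borel" by measurable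
  define F where "F = (LINT x|lborel. \<bar>f x\<bar> powr p)"
  have F0: "0 \<le> F" unfolding F_def by (intro Bochner_Integration.integral_nonneg) simp
  have "integrable lebesgue (\<lambda>x. \<bar>f x\<bar> powr p)"
    by (rule integrable_cong_AE_imp[OF \<omega>i]) (use fpm normf in \<open>auto simp: measurable_completion\<close>)
  then have fpi: "integrable lborel (\<lambda>x. \<bar>f x\<bar> powr p)" using fpm by (simp add: integrable_completion)
  have Fnorm: "Lp_norm p ?B \<omega> = F powr (1 / p)"
  proof -
    have "(LINT x:?B|lebesgue. norm (\<omega> x) powr p) = (LINT x|lebesgue. \<bar>f x\<bar> powr p)"
      unfolding set_lebesgue_integral_def
      by (rule integral_cong_AE) (use \<omega>i fpm normf in \<open>auto simp: measurable_completion\<close>)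
    also have "\<dots> = F" unfolding F_def by (rule integral_lebesgue_lborel[OF fpm])
    finally show ?thesis by (simp add: Lp_norm_def)
  qed
  have Fnn: "(\<integral>\<^sup>+y. ennreal (\<bar>f y\<bar> powr p) \<partial>lborel) = ennreal F"
    unfolding F_def by (rule nn_integral_eq_integral[OF fpi]) simp
  have finB: "emeasure lborel ?B < \<infinity>"
  proof -
    have "emeasure lborel ?B \<le> emeasure lborel {x. N (gmul (- x0) x) \<le> r}"
      by (rule emeasure_mono) (auto simp: gball_eq compact_imp_closed[OF compact_translated_N_le] borel_closed)
    also have "\<dots> < \<infinity>" by (rule emeasure_compact_finite[OF compact_translated_N_le])
    finally show ?thesis .
  qed
  \<comment> \<open>On a ball of finite volume \<open>f\<close> is dominated by 1 plus its
    \<open>p\<close>-th power.\<close>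
  have fi: "integrable lborel f"
  proof (rule Bochner_Integration.integrable_bound)
    show "integrable lborel (\<lambda>x. indicator ?B x + \<bar>f x\<bar> powr p)"
      using fpi finB by (intro Bochner_Integration.integrable_add integrable_real_indicator) auto
    show "AE x in lborel. norm (f x) \<le> norm (indicator ?B x + \<bar>f x\<bar> powr p)"
    proof (intro AE_I2)
      fix x
      show "norm (f x) \<le> norm (indicator ?B x + \<bar>f x\<bar> powr p)"
      proof (cases "f x = 0")
        case False
        then have i: "indicator ?B x = (1::real)" using fs by (simp add: gball_eq)
        show ?thesis
        proof (cases "\<bar>f x\<bar> \<le> 1")
          case True then show ?thesis unfolding i by (simp add: add_increasing2)
        next
          case False
          then have "\<bar>f x\<bar> powr 1 \<le> \<bar>f x\<bar> powr p" using p by (intro powr_mono) auto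
          then show ?thesis unfolding i by simp
        qed
      qed simp
    qed
  qed simp
  have f0int: "(LINT x|lborel. f x) = 0"
  proof -
    have "(LINT x|lborel. f x) = (LINT x|lebesgue. f x)" by (rule integral_lebesgue_lborel[OF fm, symmetric])
    also have "\<dots> = (LINT x|lebesgue. f0 x)"
      by (rule integral_cong_AE) (use f0m f0f in \<open>auto simp: measurable_completion\<close>)
    also have "\<dots> = top_integral ?B \<omega>" by (simp add: top_integral_def set_lebesgue_integral_def f0_def)
    finally show ?thesis using zero by simp
  qed
  have kmp: "(\<lambda>z. k a (snd z) (fst z)) \<in> borel_measurable (borel \<Otimes>\<^sub>M borel)" for a
  proof -
    have "(\<lambda>z :: 'n point \<times> 'n point. (snd z, fst z)) \<in> borel \<Otimes>\<^sub>M borel \<rightarrow>\<^sub>M borel" unfolding borel_prod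
      by (intro borel_measurable_continuous_onI continuous_intros)
    from measurable_compose[OF this km[of a]] show ?thesis by simp
  qed
  have kmp': "(\<lambda>z. k a (fst z) (snd z)) \<in> borel_measurable (borel \<Otimes>\<^sub>M borel)" for a
    using km[of a] unfolding borel_prod .
  define u where "u a x = (LINT y|lborel. f y * k a x y)" for a x
  have um [measurable]: "u a \<in> borel_measurable borel" for a
    unfolding u_def[abs_def]
    by (rule lborel.borel_measurable_lebesgue_integral)
       (use kmp'[of a] in \<open>simp add: case_prod_beta' cong: measurable_cong_sets sets_pair_measure_cong\<close>)
  have ub: "ennreal \<bar>u a x\<bar> \<le> ennreal M * riesz (\<lambda>y. \<bar>f y\<bar>) x" for a x
  proof -
    have "ennreal \<bar>u a x\<bar> \<le> (\<integral>\<^sup>+y. ennreal \<bar>f y * k a x y\<bar> \<partial>lborel)" unfolding u_def by (rule abs_integral_le_nn_integral)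
    also have "\<dots> \<le> (\<integral>\<^sup>+y. ennreal M * ennreal (\<bar>f y\<bar> * rk (gmul (- y) x)) \<partial>lborel)"
    proof (rule nn_integral_mono_AE)
      have "AE y in lborel. y \<noteq> x" by (rule AE_lborel_singleton)
      then show "AE y in lborel. ennreal \<bar>f y * k a x y\<bar> \<le> ennreal M * ennreal (\<bar>f y\<bar> * rk (gmul (- y) x))"
      proof eventually_elim
        case (elim y)
        have "\<bar>f y * k a x y\<bar> \<le> M * (\<bar>f y\<bar> * rk (gmul (- y) x))"
        proof (cases "f y = 0")
          case False
          have "\<bar>f y\<bar> * \<bar>k a x y\<bar> \<le> \<bar>f y\<bar> * (M * rk (gmul (- y) x))" using kb[OF fs[OF False], of x a] elim by (intro mult_left_mono) auto
          then show ?thesis by (simp add: abs_mult mult_ac)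
        qed simp
        then show ?case using M by (simp add: ennreal_mult'[symmetric] ennreal_leI)
      qed
    qed
    also have "\<dots> = ennreal M * riesz (\<lambda>y. \<bar>f y\<bar>) x" unfolding riesz_def by (rule nn_integral_cmult) measurable
    finally show ?thesis .
  qed
  have us: "u a x = 0" if "\<rho> * r < N (gmul (- x0) x)" for a x
  proof -
    have z: "f y * k a x y = 0" for y using ks[OF fs that] by (cases "f y = 0") auto
    show ?thesis unfolding u_def z by simp
  qed
  define \<phi> where "\<phi> x = - (\<Sum>a | w a = 1. (sg a * u a x) *\<^sub>R axis (UNIV - {a}) 1 :: 'n covector)" for x
  have \<phi>m [measurable]: "\<phi> \<in> borel_measurable borel" unfolding \<phi>_def by measurable
  have \<phi>E: "\<phi> x \<in> E0 gmul (CARD('n) - 1)" for x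
    unfolding \<phi>_def by (intro subspace_neg[OF subspace_E0] subspace_sum[OF subspace_E0] subspace_scale[OF subspace_E0] horizontal_E0) auto
  have \<phi>s: "\<phi> x = 0" if "\<rho> * r < N (gmul (- x0) x)" for x unfolding \<phi>_def using us[OF that] by simp
  \<comment> \<open>The norm of \<open>\<phi>\<close> is at most the sum of the components, each
    below \<open>M\<close> times the potential; adding 1 keeps \<open>D\<close> positive when
    \<open>M = 0\<close>. Then \<open>v\<close> is a minorant of the potential.\<close>
  define D where "D = real CARD('n) * M + 1"
  have D: "D > 0" using M by (simp add: D_def add_nonneg_pos)
  define v where "v x = norm (\<phi> x) / D" for x
  have vm [measurable]: "v \<in> borel_measurable borel" unfolding v_def by measurable
  have vT: "ennreal (v x) \<le> riesz (\<lambda>y. \<bar>f y\<bar>) x" for x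
  proof -
    have "norm (\<phi> x) \<le> (\<Sum>a | w a = 1. \<bar>u a x\<bar>)"
      unfolding \<phi>_def norm_minus_cancel by (rule order_trans[OF norm_sum]) (simp add: abs_mult sg_sq)
    then have "ennreal (norm (\<phi> x)) \<le> ennreal (\<Sum>a | w a = 1. \<bar>u a x\<bar>)" by (rule ennreal_leI)
    also have "\<dots> = (\<Sum>a | w a = 1. ennreal \<bar>u a x\<bar>)" by (simp add: sum_ennreal)
    also have "\<dots> \<le> (\<Sum>a\<in>{a. w a = 1}. ennreal M * riesz (\<lambda>y. \<bar>f y\<bar>) x)" by (intro sum_mono ub)
    also have "\<dots> \<le> (\<Sum>a\<in>(UNIV::'n set). ennreal M * riesz (\<lambda>y. \<bar>f y\<bar>) x)" by (intro sum_mono2) auto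
    also have "\<dots> = ennreal (real CARD('n) * M) * riesz (\<lambda>y. \<bar>f y\<bar>) x"
      using M by (simp add: ennreal_mult' ennreal_of_nat_eq_real_of_nat mult.assoc)
    finally have "ennreal (1 / D) * ennreal (norm (\<phi> x)) \<le> ennreal (1 / D) * (ennreal (real CARD('n) * M) * riesz (\<lambda>y. \<bar>f y\<bar>) x)"
      by (rule mult_left_mono) simp
    also have "\<dots> = ennreal (real CARD('n) * M / D) * riesz (\<lambda>y. \<bar>f y\<bar>) x"
      using D M by (simp add: mult.assoc[symmetric] ennreal_mult'[symmetric])
    also have "\<dots> \<le> 1 * riesz (\<lambda>y. \<bar>f y\<bar>) x"
      using D by (intro mult_right_mono) (auto simp: D_def)
    finally show ?thesis using D by (simp add: v_def ennreal_mult'[symmetric])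
  qed
  have vq: "(\<integral>\<^sup>+x. ennreal (v x powr q) \<partial>lborel) \<le> ennreal (C * F powr (q / p))"
  proof (rule riesz_homogeneous_estimate[OF est, where f="\<lambda>y. \<bar>f y\<bar>"])
    show "\<forall>x. v x \<noteq> 0 \<longrightarrow> x \<in> {x. N (gmul (- x0) x) \<le> \<rho> * r}" using \<phi>s by (auto simp: v_def not_less[symmetric])
    show "\<forall>y. \<bar>f y\<bar> \<noteq> 0 \<longrightarrow> y \<in> {y. N (gmul (- x0) y) < r}" using fs by auto
    show "\<forall>x. 0 \<le> v x" using D by (simp add: v_def)
  qed (use p q Fnn F0 vT in auto)
  have CF: "0 \<le> C * F powr (q / p)" using C by simp
  have vi: "integrable lborel (\<lambda>x. v x powr q)"
    by (rule integrableI_bounded) (use vq in \<open>auto intro: le_less_trans\<close>)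
  have "ennreal (LINT x|lborel. v x powr q) = (\<integral>\<^sup>+x. ennreal (v x powr q) \<partial>lborel)"
    by (rule nn_integral_eq_integral[OF vi, symmetric]) simp
  then have vI: "(LINT x|lborel. v x powr q) \<le> C * F powr (q / p)" using vq ennreal_le_iff[OF CF] by metis
  have nv: "norm (\<phi> x) powr q = D powr q * v x powr q" for x using D by (simp add: v_def powr_divide)
  have ni: "integrable lborel (\<lambda>x. norm (\<phi> x) powr q)" unfolding nv using vi by simp
  have outB': "\<phi> x = 0" if "x \<notin> ?B'" for x
  proof (rule \<phi>s)
    have "\<rho> * r < l * r" using \<rho> r by simp
    then show "\<rho> * r < N (gmul (- x0) x)" using that by (simp add: gball_eq)
  qed
  have indB': "indicator ?B' x *\<^sub>R norm (\<phi> x) powr q = norm (\<phi> x) powr q" for x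
    using outB'[of x] by (cases "x \<in> ?B'") auto
  show ?thesis
  proof (rule bexI[of _ \<phi>], intro conjI)
    show "\<phi> \<in> Lp_forms gmul q (CARD('n) - 1) ?B'"
    proof -
      have "integrable lebesgue (\<lambda>x. norm (\<phi> x) powr q)" using ni by (subst integrable_completion) auto
      moreover have "(\<lambda>x. indicator ?B' x *\<^sub>R \<phi> x) \<in> borel_measurable lebesgue"
        by (rule measurable_completion) measurable
      ultimately show ?thesis
        unfolding Lp_forms_def mem_Collect_eq set_integrable_def set_borel_measurable_def indB' using \<phi>E by simp
    qed
    show "compactly_supported_in \<phi> ?B'"
      unfolding compactly_supported_in_def
    proof (intro exI conjI)
      show "compact {x. N (gmul (- x0) x) \<le> \<rho> * r}" by (rule compact_translated_N_le)
      have "\<rho> * r < l * r" using \<rho> r by simp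
      then show "{x. N (gmul (- x0) x) \<le> \<rho> * r} \<subseteq> ?B'" by (auto simp: gball_eq)
      show "AE x in lebesgue. x \<in> ?B' - {x. N (gmul (- x0) x) \<le> \<rho> * r} \<longrightarrow> \<phi> x = 0" using \<phi>s by auto
    qed
    show "Lp_norm q ?B' \<phi> \<le> ((real CARD('n) * M + 1) * C powr (1 / q)) * Lp_norm p ?B \<omega>"
    proof -
      have "(LINT x:?B'|lebesgue. norm (\<phi> x) powr q) = (LINT x|lborel. norm (\<phi> x) powr q)"
        unfolding set_lebesgue_integral_def indB' by (rule integral_lebesgue_lborel) measurable
      also have "\<dots> = D powr q * (LINT x|lborel. v x powr q)" unfolding nv by simp
      also have "\<dots> \<le> D powr q * (C * F powr (q / p))" by (intro mult_left_mono vI) simp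
      finally have "Lp_norm q ?B' \<phi> \<le> (D powr q * (C * F powr (q / p))) powr (1 / q)"
        unfolding Lp_norm_def using q
        by (intro powr_mono2) (auto simp: set_lebesgue_integral_def intro!: Bochner_Integration.integral_nonneg)
      also have "\<dots> = D * C powr (1 / q) * F powr (1 / p)"
        using D C q by (simp add: powr_mult powr_powr)
      finally show ?thesis unfolding Fnorm D_def .
    qed
    show "weak_rumin_d gmul (CARD('n) - 1) ?B \<phi> \<omega>"
    proof (rule weak_rumin_d_horizontal[where u=u])
      show "\<phi> x = - (\<Sum>a | w a = 1. (sg a * u a x) *\<^sub>R axis (UNIV - {a}) 1)" for x by (simp add: \<phi>_def)
      fix g :: "'n point \<Rightarrow> real" and K assume g: "smooth g" and K: "compact K" "K \<subseteq> ?B" "\<And>x. x \<notin> K \<Longrightarrow> g x = 0"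
      let ?G = "\<lambda>a. lder (axis a 1) g"
      have [measurable]: "?G a \<in> borel_measurable borel" for a by (rule smooth_measurable[OF smooth_lder[OF g]])
      have [measurable]: "g \<in> borel_measurable borel" by (rule smooth_measurable[OF g])
      have G0: "?G a x = 0" if "x \<notin> K" for a x
        unfolding lder_def by (rule dird_eq_0_outside[OF compact_imp_closed[OF K(1)] K(3) that])
      have LHS: "(LINT x:?B|lebesgue. (\<Sum>a | w a = 1. u a x * ?G a x)) = (LINT x|lborel. (\<Sum>a | w a = 1. u a x * ?G a x))"
      proof -
        have "indicator ?B x *\<^sub>R (\<Sum>a | w a = 1. u a x * ?G a x) = (\<Sum>a | w a = 1. u a x * ?G a x)" for x
        proof (cases "x \<in> ?B")
          case False
          then have "x \<notin> K" using K(2) by auto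
          then show ?thesis using G0 by simp
        qed simp
        then have "(LINT x:?B|lebesgue. (\<Sum>a | w a = 1. u a x * ?G a x)) = (LINT x|lebesgue. (\<Sum>a | w a = 1. u a x * ?G a x))"
          unfolding set_lebesgue_integral_def by (simp only:)
        also have "\<dots> = (LINT x|lborel. (\<Sum>a | w a = 1. u a x * ?G a x))" by (rule integral_lebesgue_lborel) measurable
        finally show ?thesis .
      qed
      have RHS: "(LINT x:?B|lebesgue. \<omega> x $ UNIV * g x) = (LINT x|lborel. f x * g x)"
      proof -
        have gl: "g \<in> borel_measurable lebesgue" by (rule measurable_completion) measurable
        have fl: "f \<in> borel_measurable lebesgue" by (rule measurable_completion) measurable
        have "(LINT x:?B|lebesgue. \<omega> x $ UNIV * g x) = (LINT x|lebesgue. f0 x * g x)"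
          by (simp add: set_lebesgue_integral_def f0_def mult.assoc)
        also have "\<dots> = (LINT x|lebesgue. f x * g x)"
        proof (rule integral_cong_AE)
          show "AE x in lebesgue. f0 x * g x = f x * g x" using f0f by eventually_elim simp
        qed (use f0m gl fl in auto)
        also have "\<dots> = (LINT x|lborel. f x * g x)" by (rule integral_lebesgue_lborel) measurable
        finally show ?thesis .
      qed
      define \<Psi> where "\<Psi> a y x = f y * k a x y * ?G a x" for a y x
      have \<Psi>i: "integrable (lborel \<Otimes>\<^sub>M lborel) (\<lambda>(y, x). \<Psi> a y x)" for a
      proof -
        have "compact (?G a ` K)" by (intro compact_continuous_image K smooth_continuous_on smooth_lder g)
        from compact_imp_bounded[OF this] obtain B where "\<And>x. x \<in> K \<Longrightarrow> \<bar>?G a x\<bar> \<le> B" by (auto simp: bounded_iff)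
        then have B: "\<bar>?G a x\<bar> \<le> \<bar>B\<bar>" for x using G0[of x a] by (cases "x \<in> K") fastforce+
        \<comment> \<open>Where the integrand does not vanish, \<open>y\<close> and \<open>x\<close>
          lie within \<open>r\<close> and \<open>\<rho> * r\<close> of the centre, so
          \<open>N (gmul (- y) x) \<le> R\<close>.\<close>
        define R where "R = (1 + \<rho>) * r"
        have R: "R > 0" using \<rho> r by (simp add: R_def)
        define J where "J = enn2real (\<integral>\<^sup>+x. ennreal (rk x) * indicator {x. N x \<le> R} x \<partial>lborel)"
        have J: "(\<integral>\<^sup>+x. ennreal (rk x) * indicator {x. N x \<le> R} x \<partial>lborel) = ennreal J"
          unfolding J_def using rk_inner_finite[OF R] by simp
        have Am: "{x. N x \<le> R} \<in> sets borel" by measurable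
        have mm: "(\<lambda>(y, x). \<Psi> a y x) \<in> borel_measurable (lborel \<Otimes>\<^sub>M lborel)"
        proof -
          have "(\<lambda>z. f (fst z) * k a (snd z) (fst z) * ?G a (snd z)) \<in> borel_measurable (borel \<Otimes>\<^sub>M borel)"
            by (intro borel_measurable_times kmp) measurable
          then show ?thesis by (simp add: \<Psi>_def case_prod_beta' cong: measurable_cong_sets sets_pair_measure_cong)
        qed
        have "(\<integral>\<^sup>+y. \<integral>\<^sup>+x. ennreal \<bar>\<Psi> a y x\<bar> \<partial>lborel \<partial>lborel) \<le> (\<integral>\<^sup>+y. ennreal (M * \<bar>B\<bar> * J) * ennreal \<bar>f y\<bar> \<partial>lborel)"
        proof (rule nn_integral_mono)
          fix y
          show "(\<integral>\<^sup>+x. ennreal \<bar>\<Psi> a y x\<bar> \<partial>lborel) \<le> ennreal (M * \<bar>B\<bar> * J) * ennreal \<bar>f y\<bar>"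
          proof (cases "f y = 0")
            case False
            note y = fs[OF False]
            have "(\<integral>\<^sup>+x. ennreal \<bar>\<Psi> a y x\<bar> \<partial>lborel) \<le> (\<integral>\<^sup>+x. ennreal (\<bar>f y\<bar> * M * \<bar>B\<bar>) * (ennreal (rk (gmul (- y) x)) * indicator {x. N x \<le> R} (gmul (- y) x)) \<partial>lborel)"
            proof (rule nn_integral_mono_AE)
              have "AE x in lborel. x \<noteq> y" by (rule AE_lborel_singleton)
              then show "AE x in lborel. ennreal \<bar>\<Psi> a y x\<bar> \<le> ennreal (\<bar>f y\<bar> * M * \<bar>B\<bar>) * (ennreal (rk (gmul (- y) x)) * indicator {x. N x \<le> R} (gmul (- y) x))"
              proof eventually_elim
                case (elim x)
                have "\<bar>\<Psi> a y x\<bar> \<le> \<bar>f y\<bar> * M * \<bar>B\<bar> * (rk (gmul (- y) x) * indicator {x. N x \<le> R} (gmul (- y) x))"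
                proof (cases "\<rho> * r < N (gmul (- x0) x)")
                  case True
                  then show ?thesis using ks[OF y True] M by (simp add: \<Psi>_def)
                next
                  case nR: False
                  have "N (gmul (- y) x) \<le> N (gmul (- y) x0) + N (gmul (- x0) x)"
                    using N_gmul[of "gmul (- y) x0" "gmul (- x0) x"] by (simp add: gmul_assoc)
                  also have "N (gmul (- y) x0) = N (gmul (- x0) y)" by (rule N_swap)
                  finally have "N (gmul (- y) x) \<le> R" using y nR by (simp add: R_def algebra_simps)
                  moreover have "\<bar>f y\<bar> * \<bar>k a x y\<bar> * \<bar>?G a x\<bar> \<le> \<bar>f y\<bar> * (M * rk (gmul (- y) x)) * \<bar>B\<bar>"
                    using kb[OF y elim, of a] B M by (intro mult_mono mult_left_mono) auto
                  ultimately show ?thesis by (simp add: \<Psi>_def abs_mult mult_ac)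
                qed
                then have "ennreal \<bar>\<Psi> a y x\<bar> \<le> ennreal (\<bar>f y\<bar> * M * \<bar>B\<bar> * (rk (gmul (- y) x) * indicator {x. N x \<le> R} (gmul (- y) x)))"
                  by (rule ennreal_leI)
                also have "\<dots> = ennreal (\<bar>f y\<bar> * M * \<bar>B\<bar>) * (ennreal (rk (gmul (- y) x)) * indicator {x. N x \<le> R} (gmul (- y) x))"
                  using M by (auto simp: indicator_def ennreal_mult'[symmetric])
                finally show ?case .
              qed
            qed
            also have "\<dots> = ennreal (\<bar>f y\<bar> * M * \<bar>B\<bar>) * (\<integral>\<^sup>+x. ennreal (rk (gmul (- y) x)) * indicator {x. N x \<le> R} (gmul (- y) x) \<partial>lborel)"
              by (rule nn_integral_cmult) (use Am in measurable)
            also have "(\<integral>\<^sup>+x. ennreal (rk (gmul (- y) x)) * indicator {x. N x \<le> R} (gmul (- y) x) \<partial>lborel) = ennreal J"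
              unfolding J[symmetric] by (rule nn_integral_gmul) (use Am in measurable)
            also have "ennreal (\<bar>f y\<bar> * M * \<bar>B\<bar>) * ennreal J = ennreal (M * \<bar>B\<bar> * J) * ennreal \<bar>f y\<bar>"
              using M by (simp add: J_def ennreal_mult'[symmetric] mult_ac)
            finally show ?thesis .
          qed (simp add: \<Psi>_def)
        qed
        also have "\<dots> = ennreal (M * \<bar>B\<bar> * J) * (\<integral>\<^sup>+y. ennreal \<bar>f y\<bar> \<partial>lborel)" by (rule nn_integral_cmult) measurable
        also have "\<dots> < \<infinity>"
          using fi by (simp add: integrable_iff_bounded ennreal_mult_less_top)
        finally have "(\<integral>\<^sup>+z. ennreal \<bar>(\<lambda>(y, x). \<Psi> a y x) z\<bar> \<partial>(lborel \<Otimes>\<^sub>M lborel)) < \<infinity>"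
          by (subst lborel.nn_integral_fst[symmetric]) (use mm in auto)
        then show ?thesis using mm by (intro integrableI_bounded) auto
      qed
      have xint: "(LINT y|lborel. \<Psi> a y x) = u a x * ?G a x" for a x
        unfolding \<Psi>_def u_def by simp
      have ui: "integrable lborel (\<lambda>x. u a x * ?G a x)" for a
        using lborel_pair.integrable_snd[OF \<Psi>i[of a]] unfolding xint .
      have kint: "integrable lborel (\<lambda>x. k a x y * ?G a x)" if "f y \<noteq> 0" "integrable lborel (\<lambda>x. \<Psi> a y x)" for a y
      proof -
        have "integrable lborel (\<lambda>x. (1 / f y) * \<Psi> a y x)" using that(2) by simp
        moreover have "(1 / f y) * \<Psi> a y x = k a x y * ?G a x" for x using that(1) by (simp add: \<Psi>_def)
        ultimately show ?thesis by simp
      qed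
      have fgi: "integrable lborel (\<lambda>y. f y * g y)"
      proof -
        have "bounded (g ` K)" by (intro compact_imp_bounded compact_continuous_image K smooth_continuous_on g)
        then obtain B where "\<And>x. x \<in> K \<Longrightarrow> \<bar>g x\<bar> \<le> B" by (auto simp: bounded_iff)
        then have B: "\<bar>g x\<bar> \<le> \<bar>B\<bar>" for x using K(3)[of x] by (cases "x \<in> K") fastforce+
        show ?thesis
          by (rule Bochner_Integration.integrable_bound[of lborel "\<lambda>y. f y * B"])
             (use fi B in \<open>auto simp: abs_mult intro!: mult_left_mono\<close>)
      qed
      have "(LINT x|lborel. (\<Sum>a | w a = 1. u a x * ?G a x)) = (\<Sum>a | w a = 1. (LINT x|lborel. u a x * ?G a x))"
        using ui by simp
      also have "\<dots> = (\<Sum>a | w a = 1. (LINT x|lborel. LINT y|lborel. \<Psi> a y x))" unfolding xint ..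
      also have "\<dots> = (\<Sum>a | w a = 1. (LINT y|lborel. LINT x|lborel. \<Psi> a y x))"
        by (intro sum.cong refl lborel_pair.Fubini_integral[OF \<Psi>i])
      also have "\<dots> = (LINT y|lborel. (\<Sum>a | w a = 1. (LINT x|lborel. \<Psi> a y x)))"
        using lborel_pair.integrable_fst[OF \<Psi>i] by simp
      also have "\<dots> = (LINT y|lborel. f y * (g y - m g))"
      proof (rule integral_cong_AE)
        show "(\<lambda>y. \<Sum>a | w a = 1. (LINT x|lborel. \<Psi> a y x)) \<in> borel_measurable lborel"
          using lborel_pair.integrable_fst[OF \<Psi>i] by (intro borel_measurable_sum borel_measurable_integrable) auto
        \<comment> \<open>The sections of \<open>\<Psi>\<close> are integrable for almost every
          \<open>y\<close> only, and the sum over \<open>a\<close> is exchanged with the integral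
          there.\<close>
        have "\<forall>a. AE y in lborel. integrable lborel (\<lambda>x. \<Psi> a y x)" using lborel_pair.AE_integrable_fst[OF \<Psi>i] by blast
        then have "AE y in lborel. \<forall>a. integrable lborel (\<lambda>x. \<Psi> a y x)" by (simp add: AE_all_countable)
        then show "AE y in lborel. (\<Sum>a | w a = 1. (LINT x|lborel. \<Psi> a y x)) = f y * (g y - m g)"
        proof eventually_elim
          case (elim y)
          show ?case
          proof (cases "f y = 0")
            case False
            have "(\<Sum>a | w a = 1. (LINT x|lborel. \<Psi> a y x)) = (\<Sum>a | w a = 1. f y * (LINT x|lborel. k a x y * ?G a x))"
              unfolding \<Psi>_def by (simp add: mult.assoc)
            also have "\<dots> = f y * (LINT x|lborel. (\<Sum>a | w a = 1. k a x y * ?G a x))"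
              using kint[OF False] elim by (simp add: sum_distrib_left)
            also have "\<dots> = f y * (g y - m g)" using kr[OF g fs[OF False]] by simp
            finally show ?thesis .
          qed (simp add: \<Psi>_def)
        qed
      qed measurable
      also have "\<dots> = (LINT y|lborel. f y * g y) - m g * (LINT y|lborel. f y)"
        using fi fgi by (simp add: right_diff_distrib mult.commute[of _ "m g"])
      finally show "(LINT x:?B|lebesgue. (\<Sum>a | w a = 1. u a x * lder (axis a 1) g x)) = (LINT x:?B|lebesgue. \<omega> x $ UNIV * g x)"
        unfolding LHS RHS f0int by simp
    qed
  qed
qed

end

theorem theorem3p17:
  fixes gmul :: "('n::{finite,linorder}) group_law"
    and w :: "'n \<Rightarrow> nat" and step :: nat and N :: "'n point \<Rightarrow> real"
    and Q p q l :: real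
  assumes "carnot_group gmul w step"
    and "Q = real (homogeneous_dim w step)"
    and "homogeneous_norm gmul w N"
    and "1 \<le> p" and "p < Q" and "1 < l"
    and "1 \<le> q"
    and "1 < p \<Longrightarrow> q \<le> p * Q / (Q - p)"
    and "p = 1 \<Longrightarrow> q < Q / (Q - 1)"
  shows "\<exists>C::real.
    (\<forall>\<omega> \<in> Lp_forms gmul p CARD('n) (gball gmul N 0 1).
       compactly_supported_in \<omega> (gball gmul N 0 1) \<and> top_integral (gball gmul N 0 1) \<omega> = 0 \<longrightarrow>
       (\<exists>\<phi> \<in> Lp_forms gmul q (CARD('n) - 1) (gball gmul N 0 l).
          compactly_supported_in \<phi> (gball gmul N 0 l) \<and>
          weak_rumin_d gmul (CARD('n) - 1) (gball gmul N 0 1) \<phi> \<omega> \<and>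
          Lp_norm q (gball gmul N 0 l) \<phi> \<le> C * Lp_norm p (gball gmul N 0 1) \<omega>)) \<and>
    (1 < p \<and> q = p * Q / (Q - p) \<longrightarrow>
      (\<forall>x. \<forall>r>0. \<forall>\<omega> \<in> Lp_forms gmul p CARD('n) (gball gmul N x r).
         compactly_supported_in \<omega> (gball gmul N x r) \<and> top_integral (gball gmul N x r) \<omega> = 0 \<longrightarrow>
         (\<exists>\<phi> \<in> Lp_forms gmul q (CARD('n) - 1) (gball gmul N x (l * r)).
            compactly_supported_in \<phi> (gball gmul N x (l * r)) \<and>
            weak_rumin_d gmul (CARD('n) - 1) (gball gmul N x r) \<phi> \<omega> \<and>
            Lp_norm q (gball gmul N x (l * r)) \<phi> \<le> C * Lp_norm p (gball gmul N x r) \<omega>)))"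
proof -
  interpret carnot gmul w step by unfold_locales (rule assms(1))
  have Q: "Q = real hdim" unfolding assms(2) homogeneous_dim_eq ..
  \<comment> \<open>The homogeneous dimension is an integer larger than
    \<open>p \<ge> 1\<close>.\<close>
  have "hdim \<ge> 2" using assms(4,5) Q by simp
  then interpret carnot_norm gmul w step N by unfold_locales (rule assms(3))
  obtain M \<rho> :: real where M: "0 \<le> M" and \<rho>: "0 < \<rho>" "\<rho> < l"
    and ker: "\<And>x0 r. 0 < r \<Longrightarrow> \<exists>k m. reproducing_kernel x0 r (\<rho> * r) M k m"
    by (rule ball_kernel[OF assms(6)], rule that)
  define A where "A C = (real CARD('n) * M + 1) * C powr (1 / q)" for C
  obtain C1 where C1: "riesz_bounded p q {y. N y < 1} {x. N x \<le> \<rho>} C1"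
    by (rule riesz_local_estimate[of p q \<rho>]) (use assms(4,5,7,8,9) \<rho>(1) Q in auto)
  \<comment> \<open>Away from the critical case the second clause is vacuous, and 0 is a
    placeholder.\<close>
  obtain C2 where C2: "1 < p \<and> q = p * Q / (Q - p) \<Longrightarrow> riesz_bounded p q UNIV UNIV C2"
  proof (cases "1 < p \<and> q = p * Q / (Q - p)")
    case True
    show ?thesis
      by (rule riesz_strong_estimate[of p q]) (use True assms(5) Q that in auto)
  next
    case False
    then show ?thesis using that[of 0] by auto
  qed
  have solve: "\<exists>\<phi> \<in> Lp_forms gmul q (CARD('n) - 1) (gball gmul N x0 (l * r)).
          compactly_supported_in \<phi> (gball gmul N x0 (l * r)) \<and>
          weak_rumin_d gmul (CARD('n) - 1) (gball gmul N x0 r) \<phi> \<omega> \<and>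
          Lp_norm q (gball gmul N x0 (l * r)) \<phi> \<le> max (A C1) (A C2) * Lp_norm p (gball gmul N x0 r) \<omega>"
    if r: "0 < r" and C: "C = C1 \<or> C = C2"
      and est: "riesz_bounded p q {y. N (gmul (- x0) y) < r} {x. N (gmul (- x0) x) \<le> \<rho> * r} C"
      and \<omega>: "\<omega> \<in> Lp_forms gmul p CARD('n) (gball gmul N x0 r)" "top_integral (gball gmul N x0 r) \<omega> = 0" for \<omega> x0 r C
  proof -
    obtain k m where k: "reproducing_kernel x0 r (\<rho> * r) M k m" using ker[OF r, of x0] by blast
    have "A C * Lp_norm p (gball gmul N x0 r) \<omega> \<le> max (A C1) (A C2) * Lp_norm p (gball gmul N x0 r) \<omega>"
      using C by (intro mult_right_mono) (auto simp: Lp_norm_def)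
    then show ?thesis
      using solve_on_ball[OF assms(4,7) r M \<rho> k est \<omega>] unfolding A_def by (blast intro: order_trans)
  qed
  show ?thesis
  \<comment> \<open>The maximum serves both clauses: \<open>C1\<close> comes from the estimate on
    the unit ball, \<open>C2\<close> from the one on the whole group, which restricts to every
    ball.\<close>
  proof (rule exI[of _ "max (A C1) (A C2)"], intro conjI ballI impI allI)
    fix \<omega> assume \<omega>: "\<omega> \<in> Lp_forms gmul p CARD('n) (gball gmul N 0 1)"
      "compactly_supported_in \<omega> (gball gmul N 0 1) \<and> top_integral (gball gmul N 0 1) \<omega> = 0"
    show "\<exists>\<phi> \<in> Lp_forms gmul q (CARD('n) - 1) (gball gmul N 0 l).
          compactly_supported_in \<phi> (gball gmul N 0 l) \<and>
          weak_rumin_d gmul (CARD('n) - 1) (gball gmul N 0 1) \<phi> \<omega> \<and>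
          Lp_norm q (gball gmul N 0 l) \<phi> \<le> max (A C1) (A C2) * Lp_norm p (gball gmul N 0 1) \<omega>"
      using solve[of 1 C1 0 \<omega>] C1 \<omega> by simp
  next
    fix x r \<omega> assume cr: "1 < p \<and> q = p * Q / (Q - p)" and r: "0 < r"
      and \<omega>: "\<omega> \<in> Lp_forms gmul p CARD('n) (gball gmul N x r)"
      "compactly_supported_in \<omega> (gball gmul N x r) \<and> top_integral (gball gmul N x r) \<omega> = 0"
    show "\<exists>\<phi> \<in> Lp_forms gmul q (CARD('n) - 1) (gball gmul N x (l * r)).
            compactly_supported_in \<phi> (gball gmul N x (l * r)) \<and>
            weak_rumin_d gmul (CARD('n) - 1) (gball gmul N x r) \<phi> \<omega> \<and>
            Lp_norm q (gball gmul N x (l * r)) \<phi> \<le> max (A C1) (A C2) * Lp_norm p (gball gmul N x r) \<omega>"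
      using solve[of r C2 x \<omega>] riesz_bounded_mono[OF C2[OF cr] subset_UNIV subset_UNIV] r \<omega> by blast
  qed
qed

end
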